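(* Let $A$ be a unital simple separable exact C$^*$-algebra which is approximately divisible and of real rank zero. Let $a \in A$ be a positive element such that $\langle a \rangle$ is not compact in $\mathrm{Cu}(A)$ (if $A$ is stably finite) or $\langle a\rangle$ is nonzero (if $A$ is purely infinite). Let $D_a = \{ b \in A \mid b \geq 0,\ \langle b \rangle = \langle a \rangle\}$ with the norm topology. Then the homotopy groups $\pi_k(D_a)$ vanish for all $k \geq 1$.
   Context: Cuntz semigroup: for a C$^*$-algebra $B$ and positive $a,b\in B_+$, write $a \precsim b$ if there is a sequence $(v_n)$ in $B$ with $v_n b v_n^* \to a$ in norm, and $a\sim b$ (Cuntz equivalence) if $a\precsim b$ and $b\precsim a$. For a C$^*$-algebra $A$, with $\mathcal{K}$ the compact operators on a separable infinite-dimensional Hilbert space, set $\mathrm{Cu}(A) = (A\otimes\mathcal{K})_+/\!\sim$, and let $\langle a\rangle$ be the class of $a$; elements of $A$ are viewed in $A\otimes\mathcal{K}$ via $a\mapsto a\otimes e_{11}$. $\mathrm{Cu}(A)$ is ordered by $\langle a\rangle\le\langle b\rangle \Leftrightarrow a\precsim b$, and suprema of increasing sequences exist in it. Write $\langle a\rangle\ll\langle b\rangle$ if whenever $(\langle b_i\rangle)$ is an increasing sequence with $\sup_i\langle b_i\rangle\ge\langle b\rangle$, there is $i_0$ with $\langle a\rangle\le\langle b_{i_0}\rangle$. An element $\langle a\rangle$ is compact if $\langle a\rangle\ll\langle a\rangle$. Approximately divisible: a unital separable C$^*$-algebra $A$ is approximately divisible if for each $N\in\mathbb{N}$ there is an approximately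 central sequence of unital $*$-homomorphisms $M_N(\mathbb{C})\oplus M_{N+1}(\mathbb{C})\to A$ (i.e. the images of each fixed element asymptotically commute in norm with each element of $A$). Real rank zero: every self-adjoint element is a norm limit of self-adjoint elements with finite spectrum. An algebra $A$ satisfying the hypotheses is either stably finite or purely infinite. *)

theory Defs
  imports "HOL-Analysis.Analysis" "HOL-Algebra.Elementary_Groups" "Jordan_Normal_Form.Matrix"
begin

section \<open>C*-algebras\<close>

class cstar_algebra = banach + real_normed_algebra +
  fixes scaleC :: "complex \<Rightarrow> 'a \<Rightarrow> 'a" (infixr \<open>*\<^sub>C\<close> 75)
    and star :: "'a \<Rightarrow> 'a" (\<open>_\<^sup>\<star>\<close> [1000] 999)
  assumes scaleC_add_right: "c *\<^sub>C (x + y) = c *\<^sub>C x + c *\<^sub>C y"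
    and scaleC_add_left: "(c + d) *\<^sub>C x = c *\<^sub>C x + d *\<^sub>C x"
    and scaleC_scaleC: "c *\<^sub>C d *\<^sub>C x = (c * d) *\<^sub>C x"
    and scaleC_of_real: "complex_of_real r *\<^sub>C x = r *\<^sub>R x"
    and norm_scaleC: "norm (c *\<^sub>C x) = cmod c * norm x"
    and mult_scaleC_left: "(c *\<^sub>C x) * y = c *\<^sub>C (x * y)"
    and mult_scaleC_right: "x * (c *\<^sub>C y) = c *\<^sub>C (x * y)"
    and star_add: "(x + y)\<^sup>\<star> = x\<^sup>\<star> + y\<^sup>\<star>"
    and star_scaleC: "(c *\<^sub>C x)\<^sup>\<star> = cnj c *\<^sub>C x\<^sup>\<star>"
    and star_mult: "(x * y)\<^sup>\<star> = y\<^sup>\<star> * x\<^sup>\<star>"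
    and star_star: "(x\<^sup>\<star>)\<^sup>\<star> = x"
    and cstar_identity: "norm (x\<^sup>\<star> * x) = (norm x)\<^sup>2"

class unital_cstar_algebra = cstar_algebra + real_normed_algebra_1

instantiation complex :: unital_cstar_algebra
begin

definition scaleC_complex :: "complex \<Rightarrow> complex \<Rightarrow> complex"
  where "scaleC_complex c x = c * x"

definition star_complex :: "complex \<Rightarrow> complex"
  where "star_complex = cnj"

instance
  by standard
    (auto simp: scaleC_complex_def star_complex_def algebra_simps norm_mult scaleR_conv_of_real
      power2_eq_square)

end



section \<open>The Hilbert space of square-summable families\<close>

typedef 'i ell2 = "{f :: 'i \<Rightarrow> complex. (\<lambda>i. (cmod (f i))\<^sup>2) summable_on UNIV}"
  morphisms ell2_nth Abs_ell2
  by (rule exI[of _ "\<lambda>_. 0"]) simp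

setup_lifting type_definition_ell2

lemma ell2_eqI: "(\<And>i. ell2_nth x i = ell2_nth y i) \<Longrightarrow> x = y"
  by (metis ell2_nth_inject ext)

lemma summable_ell2_nth: "(\<lambda>i. (cmod (ell2_nth x i))\<^sup>2) summable_on UNIV"
  using ell2_nth[of x] by simp

lemma ell2_sum_closed:
  assumes "(\<lambda>i. (cmod (f i))\<^sup>2) summable_on UNIV" "(\<lambda>i. (cmod (g i))\<^sup>2) summable_on UNIV"
  shows "(\<lambda>i. (cmod (f i + g i))\<^sup>2) summable_on UNIV"
proof (rule summable_on_comparison_test)
  show "(\<lambda>i. 2 * (cmod (f i))\<^sup>2 + 2 * (cmod (g i))\<^sup>2) summable_on UNIV"
    by (intro summable_on_add summable_on_cmult_right assms)
  fix i
  have "(cmod (f i + g i))\<^sup>2 \<le> (cmod (f i) + cmod (g i))\<^sup>2"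
    by (intro power_mono norm_triangle_ineq) auto
  also have "\<dots> \<le> 2 * (cmod (f i))\<^sup>2 + 2 * (cmod (g i))\<^sup>2"
    using zero_le_power2[of "cmod (f i) - cmod (g i)"] by (simp add: power2_eq_square algebra_simps)
  finally show "(cmod (f i + g i))\<^sup>2 \<le> 2 * (cmod (f i))\<^sup>2 + 2 * (cmod (g i))\<^sup>2" .
qed auto

lemma summable_ell2_mult: "(\<lambda>i. cnj (ell2_nth x i) * ell2_nth y i) summable_on UNIV"
proof (rule abs_summable_summable, rule summable_on_comparison_test)
  show "(\<lambda>i. (cmod (ell2_nth x i))\<^sup>2 + (cmod (ell2_nth y i))\<^sup>2) summable_on UNIV"
    by (intro summable_on_add summable_ell2_nth)
  fix i
  show "cmod (cnj (ell2_nth x i) * ell2_nth y i) \<le> (cmod (ell2_nth x i))\<^sup>2 + (cmod (ell2_nth y i))\<^sup>2"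
  proof -
    have "0 \<le> (cmod (ell2_nth x i) - cmod (ell2_nth y i))\<^sup>2"
      "0 \<le> cmod (ell2_nth x i) * cmod (ell2_nth y i)" by auto
    then show ?thesis by (simp only: norm_mult complex_mod_cnj power2_diff)
  qed
qed simp

definition cinner :: "'i ell2 \<Rightarrow> 'i ell2 \<Rightarrow> complex"
  where "cinner x y = (\<Sum>\<^sub>\<infinity>i. cnj (ell2_nth x i) * ell2_nth y i)"

lift_definition scale_ell2 :: "complex \<Rightarrow> 'i ell2 \<Rightarrow> 'i ell2" is "\<lambda>c f i. c * f i"
  by (simp add: norm_mult power_mult_distrib summable_on_cmult_right)

instantiation ell2 :: (type) real_inner
begin

lift_definition zero_ell2 :: "'a ell2" is "\<lambda>_. 0" by simp
lift_definition plus_ell2 :: "'a ell2 \<Rightarrow> 'a ell2 \<Rightarrow> 'a ell2" is "\<lambda>f g i. f i + g i"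
  by (rule ell2_sum_closed)
lift_definition uminus_ell2 :: "'a ell2 \<Rightarrow> 'a ell2" is "\<lambda>f i. - f i" by simp
definition minus_ell2 :: "'a ell2 \<Rightarrow> 'a ell2 \<Rightarrow> 'a ell2" where "minus_ell2 x y = x + - y"
definition scaleR_ell2 :: "real \<Rightarrow> 'a ell2 \<Rightarrow> 'a ell2"
  where "scaleR_ell2 r = scale_ell2 (complex_of_real r)"
definition inner_ell2 :: "'a ell2 \<Rightarrow> 'a ell2 \<Rightarrow> real" where "inner_ell2 x y = Re (cinner x y)"
definition norm_ell2 :: "'a ell2 \<Rightarrow> real" where "norm_ell2 x = sqrt (inner x x)"
definition dist_ell2 :: "'a ell2 \<Rightarrow> 'a ell2 \<Rightarrow> real" where "dist_ell2 x y = norm (x - y)"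
definition sgn_ell2 :: "'a ell2 \<Rightarrow> 'a ell2" where "sgn_ell2 x = scaleR (inverse (norm x)) x"
definition uniformity_ell2 :: "('a ell2 \<times> 'a ell2) filter"
  where "uniformity_ell2 = (INF e\<in>{0 <..}. principal {(x, y). dist x y < e})"
definition open_ell2 :: "'a ell2 set \<Rightarrow> bool"
  where "open_ell2 U = (\<forall>x\<in>U. \<forall>\<^sub>F (x', y) in uniformity. x' = x \<longrightarrow> y \<in> U)"

lemma minus_ell2_nth: "ell2_nth (x - y) i = ell2_nth x i - ell2_nth y i" for x y :: "'a ell2"
  by (simp add: minus_ell2_def plus_ell2.rep_eq uminus_ell2.rep_eq)

lemma inner_ell2_self: "inner x x = (\<Sum>\<^sub>\<infinity>i. (cmod (ell2_nth x i))\<^sup>2)" for x :: "'a ell2"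
proof -
  have "inner x x = (\<Sum>\<^sub>\<infinity>i. Re (cnj (ell2_nth x i) * ell2_nth x i))"
    unfolding inner_ell2_def cinner_def by (rule infsum_Re[symmetric]) (rule summable_ell2_mult)
  also have "\<dots> = (\<Sum>\<^sub>\<infinity>i. (cmod (ell2_nth x i))\<^sup>2)"
    by (intro infsum_cong) (simp add: cmod_power2 flip: power2_eq_square)
  finally show ?thesis .
qed

instance
proof
  fix x y z :: "'a ell2" and r s :: real
  show "x + y + z = x + (y + z)" "x + y = y + x" "0 + x = x" "- x + x = 0"
    by (rule ell2_eqI; simp add: plus_ell2.rep_eq zero_ell2.rep_eq uminus_ell2.rep_eq)+
  show "x - y = x + - y"
    by (rule minus_ell2_def)
  show "r *\<^sub>R (x + y) = r *\<^sub>R x + r *\<^sub>R y" "(r + s) *\<^sub>R x = r *\<^sub>R x + s *\<^sub>R x"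
    "r *\<^sub>R s *\<^sub>R x = (r * s) *\<^sub>R x" "1 *\<^sub>R x = x"
    by (rule ell2_eqI; simp add: scaleR_ell2_def scale_ell2.rep_eq plus_ell2.rep_eq algebra_simps)+
  show "dist x y = norm (x - y)" by (rule dist_ell2_def)
  show "sgn x = scaleR (inverse (norm x)) x" by (rule sgn_ell2_def)
  show "uniformity = (INF e\<in>{0 <..}. principal {(x, y :: 'a ell2). dist x y < e})"
    by (rule uniformity_ell2_def)
  show "open U = (\<forall>x\<in>U. \<forall>\<^sub>F (x', y) in uniformity. x' = x \<longrightarrow> y \<in> U)" for U :: "'a ell2 set"
    by (rule open_ell2_def)
  show "inner x y = inner y x"
  proof -
    have "cinner y x = cnj (cinner x y)"
      unfolding cinner_def by (simp add: mult.commute flip: infsum_cnj)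
    then show ?thesis by (simp add: inner_ell2_def)
  qed
  show "inner (x + y) z = inner x z + inner y z"
    unfolding inner_ell2_def cinner_def
    by (simp add: plus_ell2.rep_eq distrib_right infsum_add summable_ell2_mult)
  show "inner (r *\<^sub>R x) y = r * inner x y"
    unfolding inner_ell2_def cinner_def
    by (simp add: scaleR_ell2_def scale_ell2.rep_eq mult.assoc infsum_cmult_right')
  show "0 \<le> inner x x"
    unfolding inner_ell2_self by (rule infsum_nonneg) simp
  show "inner x x = 0 \<longleftrightarrow> x = 0"
  proof
    assume "inner x x = 0"
    then have "(cmod (ell2_nth x i))\<^sup>2 = 0" for i
      unfolding inner_ell2_self
      by (intro nonneg_infsum_le_0D[of "\<lambda>i. (cmod (ell2_nth x i))\<^sup>2" UNIV]) (auto simp: summable_ell2_nth)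
    then show "x = 0"
      by (intro ell2_eqI) (simp add: zero_ell2.rep_eq)
  qed (simp add: inner_ell2_self zero_ell2.rep_eq)
  show "norm x = sqrt (inner x x)" by (rule norm_ell2_def)
qed

end

lemma norm_ell2_power2: "(norm x)\<^sup>2 = (\<Sum>\<^sub>\<infinity>i. (cmod (ell2_nth x i))\<^sup>2)"
  using inner_ell2_self[of x] by (simp add: power2_norm_eq_inner)

lemma norm_ell2_finite: "finite F \<Longrightarrow> (\<Sum>i\<in>F. (cmod (ell2_nth x i))\<^sup>2) \<le> (norm x)\<^sup>2"
  unfolding norm_ell2_power2 by (rule finite_sum_le_infsum) (auto simp: summable_ell2_nth)

lemma norm_ell2_nth_le: "cmod (ell2_nth x i) \<le> norm x"
  using norm_ell2_finite[of "{i}" x] by (simp add: abs_le_square_iff[symmetric])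

lemma ell2_boundI:
  assumes "\<And>F. finite F \<Longrightarrow> (\<Sum>i\<in>F. (cmod (f i))\<^sup>2) \<le> B\<^sup>2" "B \<ge> 0"
  shows "(\<lambda>i. (cmod (f i))\<^sup>2) summable_on UNIV" "norm (Abs_ell2 f) \<le> B"
proof -
  show s: "(\<lambda>i. (cmod (f i))\<^sup>2) summable_on UNIV"
    by (rule nonneg_bdd_above_summable_on) (auto simp: bdd_above_def intro!: exI[of _ "B\<^sup>2"] assms)
  then have "ell2_nth (Abs_ell2 f) = f" by (simp add: Abs_ell2_inverse)
  then have "(norm (Abs_ell2 f))\<^sup>2 \<le> B\<^sup>2"
    unfolding norm_ell2_power2 using s by (auto intro!: infsum_le_finite_sums assms)
  then show "norm (Abs_ell2 f) \<le> B" using assms(2) by (rule power2_le_imp_le)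
qed

instance ell2 :: (type) banach
proof
  fix X :: "nat \<Rightarrow> 'a ell2"
  assume C: "Cauchy X"
  have "Cauchy (\<lambda>n. ell2_nth (X n) i)" for i
  proof (rule CauchyI)
    fix e :: real assume "0 < e"
    then obtain M where "\<forall>m\<ge>M. \<forall>n\<ge>M. norm (X m - X n) < e" using CauchyD[OF C \<open>0 < e\<close>] by blast
    then show "\<exists>M. \<forall>m\<ge>M. \<forall>n\<ge>M. cmod (ell2_nth (X m) i - ell2_nth (X n) i) < e"
      by (metis norm_ell2_nth_le minus_ell2_nth le_less_trans)
  qed
  then have "\<exists>l. (\<lambda>n. ell2_nth (X n) i) \<longlonglongrightarrow> l" for i
    using Cauchy_convergent convergent_def by blast
  then obtain f where f: "(\<lambda>n. ell2_nth (X n) i) \<longlonglongrightarrow> f i" for i by metis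
  have bd: "\<exists>M. \<forall>n\<ge>M. \<forall>F. finite F \<longrightarrow> (\<Sum>i\<in>F. (cmod (ell2_nth (X n) i - f i))\<^sup>2) \<le> e\<^sup>2" if "e > 0" for e
  proof -
    obtain M where M: "\<forall>m\<ge>M. \<forall>n\<ge>M. norm (X m - X n) < e" using CauchyD[OF C \<open>e > 0\<close>] by metis
    have "(\<Sum>i\<in>F. (cmod (ell2_nth (X n) i - f i))\<^sup>2) \<le> e\<^sup>2" if "n \<ge> M" "finite F" for n F
    proof (rule tendsto_upperbound)
      show "(\<lambda>m. \<Sum>i\<in>F. (cmod (ell2_nth (X n) i - ell2_nth (X m) i))\<^sup>2)
        \<longlonglongrightarrow> (\<Sum>i\<in>F. (cmod (ell2_nth (X n) i - f i))\<^sup>2)"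
        by (intro tendsto_intros f)
      show "\<forall>\<^sub>F m in sequentially. (\<Sum>i\<in>F. (cmod (ell2_nth (X n) i - ell2_nth (X m) i))\<^sup>2) \<le> e\<^sup>2"
      proof (rule eventually_sequentiallyI[of M])
        fix m assume "M \<le> m"
        then have "(norm (X n - X m))\<^sup>2 \<le> e\<^sup>2"
          using M \<open>n \<ge> M\<close> by (intro power_mono) (auto intro: less_imp_le)
        with norm_ell2_finite[OF \<open>finite F\<close>, of "X n - X m"]
        show "(\<Sum>i\<in>F. (cmod (ell2_nth (X n) i - ell2_nth (X m) i))\<^sup>2) \<le> e\<^sup>2"
          by (simp add: minus_ell2_nth)
      qed
    qed simp
    then show ?thesis by blast
  qed
  have sm: "(\<lambda>i. (cmod (f i))\<^sup>2) summable_on UNIV"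
  proof -
    obtain M where "\<forall>n\<ge>M. \<forall>F. finite F \<longrightarrow> (\<Sum>i\<in>F. (cmod (ell2_nth (X n) i - f i))\<^sup>2) \<le> 1\<^sup>2"
      using bd[of 1] by auto
    then obtain n where "\<And>F. finite F \<Longrightarrow> (\<Sum>i\<in>F. (cmod (ell2_nth (X n) i - f i))\<^sup>2) \<le> 1\<^sup>2"
      by blast
    then have "(\<lambda>i. (cmod (ell2_nth (X n) i - f i))\<^sup>2) summable_on UNIV"
      by (rule ell2_boundI) auto
    then have "(\<lambda>i. (cmod (f i - ell2_nth (X n) i))\<^sup>2) summable_on UNIV"
      by (simp add: norm_minus_commute)
    from ell2_sum_closed[OF this summable_ell2_nth[of "X n"]] show ?thesis by simp
  qed
  have "X \<longlonglongrightarrow> Abs_ell2 f"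
  proof (rule LIMSEQ_I)
    fix e :: real assume e: "0 < e"
    obtain M where M: "\<And>n F. n \<ge> M \<Longrightarrow> finite F \<Longrightarrow> (\<Sum>i\<in>F. (cmod (ell2_nth (X n) i - f i))\<^sup>2) \<le> (e/2)\<^sup>2"
      using bd[of "e/2"] e by auto
    have "norm (X n - Abs_ell2 f) \<le> e/2" if "n \<ge> M" for n
    proof -
      have "norm (Abs_ell2 (\<lambda>i. ell2_nth (X n) i - f i)) \<le> e/2"
        by (rule ell2_boundI(2)) (use M[OF that] e in auto)
      moreover have "X n - Abs_ell2 f = Abs_ell2 (\<lambda>i. ell2_nth (X n) i - f i)"
      proof -
        have "ell2_nth (X n - Abs_ell2 f) = (\<lambda>i. ell2_nth (X n) i - f i)"
          by (simp add: fun_eq_iff minus_ell2_nth Abs_ell2_inverse sm)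
        then show ?thesis by (metis ell2_nth_inverse)
      qed
      ultimately show ?thesis by simp
    qed
    then show "\<exists>no. \<forall>n\<ge>no. norm (X n - Abs_ell2 f) < e"
      using e by (intro exI[of _ M]) force
  qed
  then show "convergent X" by (auto simp: convergent_def)
qed

lemma cinner_commute: "cinner y x = cnj (cinner x y)"
  unfolding cinner_def by (simp add: mult.commute flip: infsum_cnj)

lemma cinner_add_right: "cinner x (y + z) = cinner x y + cinner x z"
  unfolding cinner_def
  by (simp add: plus_ell2.rep_eq distrib_left infsum_add summable_ell2_mult)

lemma cinner_scale_right: "cinner x (scale_ell2 c y) = c * cinner x y"
  unfolding cinner_def
  by (simp add: scale_ell2.rep_eq mult.left_commute infsum_cmult_right')

lemma cinner_add_left: "cinner (x + y) z = cinner x z + cinner y z"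
  by (metis cinner_add_right cinner_commute complex_cnj_add)

lemma cinner_scale_left: "cinner (scale_ell2 c x) y = cnj c * cinner x y"
  by (metis cinner_scale_right cinner_commute complex_cnj_mult)

lemma cinner_self: "cinner x x = complex_of_real ((norm x)\<^sup>2)"
proof (rule complex_eqI)
  show "Re (cinner x x) = Re (complex_of_real ((norm x)\<^sup>2))"
    by (simp add: power2_norm_eq_inner inner_ell2_def)
  have "cnj (cinner x x) = cinner x x" by (rule cinner_commute[symmetric])
  then show "Im (cinner x x) = Im (complex_of_real ((norm x)\<^sup>2))"
    by (simp add: complex_eq_iff)
qed

lemma norm_scale_ell2: "norm (scale_ell2 c x) = cmod c * norm x"
proof -
  have "complex_of_real ((norm (scale_ell2 c x))\<^sup>2) = (c * cnj c) * complex_of_real ((norm x)\<^sup>2)"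
    unfolding cinner_self[symmetric] by (simp add: cinner_scale_left cinner_scale_right)
  also have "\<dots> = complex_of_real ((cmod c * norm x)\<^sup>2)"
    by (simp add: power_mult_distrib flip: complex_norm_square)
  finally have "(norm (scale_ell2 c x))\<^sup>2 = (cmod c * norm x)\<^sup>2" by (simp only: of_real_eq_iff)
  then show ?thesis by simp
qed

lemma scale_ell2_0 [simp]: "scale_ell2 c 0 = 0"
  by (rule ell2_eqI) (simp add: scale_ell2.rep_eq zero_ell2.rep_eq)

lemma scale_ell2_add: "scale_ell2 c (x + y) = scale_ell2 c x + scale_ell2 c y"
  by (rule ell2_eqI) (simp add: scale_ell2.rep_eq plus_ell2.rep_eq algebra_simps)

lemma scale_ell2_add_left: "scale_ell2 (c + d) x = scale_ell2 c x + scale_ell2 d x"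
  by (rule ell2_eqI) (simp add: scale_ell2.rep_eq plus_ell2.rep_eq algebra_simps)

lemma scale_ell2_minus: "scale_ell2 c (- x) = - scale_ell2 c x"
  by (rule ell2_eqI) (simp add: scale_ell2.rep_eq uminus_ell2.rep_eq)

lemma scale_ell2_diff: "scale_ell2 c (x - y) = scale_ell2 c x - scale_ell2 c y"
  by (rule ell2_eqI) (simp add: scale_ell2.rep_eq minus_ell2_nth algebra_simps)

lemma scale_ell2_scale: "scale_ell2 c (scale_ell2 d x) = scale_ell2 (c * d) x"
  by (rule ell2_eqI) (simp add: scale_ell2.rep_eq)

lemma bounded_linear_scale_ell2: "bounded_linear (scale_ell2 c)"
  by (rule bounded_linear_intro[where K = "cmod c"])
     (auto simp: scale_ell2_add scaleR_ell2_def scale_ell2_scale norm_scale_ell2 mult.commute)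

lemma cmod_cinner_le: "cmod (cinner x y) \<le> norm x * norm y"
proof (cases "cinner x y = 0")
  case False
  define c where "c = cnj (cinner x y) / cmod (cinner x y)"
  have c: "cmod c = 1" using False by (simp add: c_def norm_divide)
  have "cinner x (scale_ell2 c y) = complex_of_real (cmod (cinner x y))"
    using False by (simp add: cinner_scale_right c_def complex_norm_square[symmetric] mult.commute power2_eq_square)
  then have "cmod (cinner x y) = inner x (scale_ell2 c y)" by (simp add: inner_ell2_def)
  also have "\<dots> \<le> norm x * norm (scale_ell2 c y)" by (rule norm_cauchy_schwarz)
  finally show ?thesis by (simp add: norm_scale_ell2 c)
qed simp

lemma cinner_diff_left: "cinner (x - y) z = cinner x z - cinner y z"
  using cinner_add_left[of "x - y" y z] by simp

lemma cinner_eqI: "(\<And>x. cinner x y = cinner x z) \<Longrightarrow> y = z"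
proof -
  assume "\<And>x. cinner x y = cinner x z"
  then have "cinner (y - z) (y - z) = 0"
    using cinner_add_right[of "y - z" "y - z" z] by simp
  then show ?thesis by (simp add: cinner_self)
qed

lift_definition ket :: "'i \<Rightarrow> 'i ell2" is "\<lambda>i j. if j = i then 1 else 0"
proof -
  fix i :: 'i
  show "(\<lambda>j. (cmod (if j = i then 1 else 0))\<^sup>2) summable_on UNIV"
    by (rule finite_nonzero_values_imp_summable_on) (auto intro: finite_subset[of _ "{i}"])
qed

lemma cinner_ket: "cinner (ket i) w = ell2_nth w i"
proof -
  have "cinner (ket i) w = (\<Sum>\<^sub>\<infinity>j. if j = i then ell2_nth w i else 0)"
    unfolding cinner_def by (intro infsum_cong) (auto simp: ket.rep_eq)
  also have "\<dots> = (\<Sum>\<^sub>\<infinity>j\<in>{i}. ell2_nth w i)"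
    by (rule infsum_cong_neutral) auto
  finally show ?thesis by simp
qed

definition ell2_trunc :: "'i set \<Rightarrow> 'i ell2 \<Rightarrow> 'i ell2"
  where "ell2_trunc F x = (\<Sum>i\<in>F. scale_ell2 (ell2_nth x i) (ket i))"

lemma cinner_trunc: "finite F \<Longrightarrow> cinner (ell2_trunc F x) w = (\<Sum>i\<in>F. cnj (ell2_nth x i) * ell2_nth w i)"
  unfolding ell2_trunc_def
proof (induction F rule: finite_induct)
  case empty
  have "cinner 0 w = 0" using cinner_add_left[of 0 0 w] by simp
  then show ?case by simp
qed (simp add: cinner_add_left cinner_scale_left cinner_ket)

lemma ell2_trunc_tendsto: "((\<lambda>F. ell2_trunc F x) \<longlongrightarrow> x) (finite_subsets_at_top UNIV)"
proof -
  let ?f = "\<lambda>i. (cmod (ell2_nth x i))\<^sup>2"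
  have nsq: "(norm (ell2_trunc F x - x))\<^sup>2 = (norm x)\<^sup>2 - sum ?f F" if "finite F" for F
  proof -
    have 1: "cinner (ell2_trunc F x) x = complex_of_real (sum ?f F)"
      using that by (simp add: cinner_trunc mult.commute flip: complex_norm_square)
    have nth: "ell2_nth (ell2_trunc F x) i = (if i \<in> F then ell2_nth x i else 0)" for i
    proof -
      have "ell2_nth (ell2_trunc F x) i = cnj (cinner (ell2_trunc F x) (ket i))"
        by (metis cinner_commute cinner_ket)
      also have "\<dots> = (\<Sum>j\<in>F. if j = i then ell2_nth x i else 0)"
        unfolding cinner_trunc[OF that] cnj_sum by (rule sum.cong) (auto simp: ket.rep_eq)
      finally show ?thesis using that by simp
    qed
    have 2: "cinner (ell2_trunc F x) (ell2_trunc F x) = complex_of_real (sum ?f F)"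
      using that by (simp add: cinner_trunc nth mult.commute flip: complex_norm_square)
    have "inner (ell2_trunc F x) x = sum ?f F" "inner (ell2_trunc F x) (ell2_trunc F x) = sum ?f F"
      using 1 2 by (simp_all add: inner_ell2_def)
    then show ?thesis
      by (simp add: power2_norm_eq_inner inner_diff_left inner_diff_right inner_commute)
  qed
  have "(sum ?f \<longlongrightarrow> (norm x)\<^sup>2) (finite_subsets_at_top UNIV)"
    unfolding norm_ell2_power2 by (rule infsum_tendsto) (rule summable_ell2_nth)
  from tendsto_diff[OF tendsto_const[of "(norm x)\<^sup>2"] this]
  have "((\<lambda>F. (norm x)\<^sup>2 - sum ?f F) \<longlongrightarrow> 0) (finite_subsets_at_top UNIV)"
    by simp
  then have "((\<lambda>F. (norm (ell2_trunc F x - x))\<^sup>2) \<longlongrightarrow> 0) (finite_subsets_at_top UNIV)"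
    by (rule tendsto_cong[THEN iffD1, rotated])
       (rule eventually_finite_subsets_at_top_weakI, simp add: nsq)
  then have "((\<lambda>F. sqrt ((norm (ell2_trunc F x - x))\<^sup>2)) \<longlongrightarrow> sqrt 0) (finite_subsets_at_top UNIV)"
    by (rule tendsto_real_sqrt)
  then show ?thesis
    by (simp add: tendsto_norm_zero_iff LIM_zero_iff)
qed

lemma bounded_linear_cinner_left: "bounded_linear (\<lambda>x. cnj (cinner x y))"
proof (rule bounded_linear_intro[where K = "norm y"])
  show "cmod (cnj (cinner x y)) \<le> norm x * norm y" for x
    using cmod_cinner_le by simp
  show "cnj (cinner (r *\<^sub>R x) y) = r *\<^sub>R cnj (cinner x y)" for r x
    by (simp add: scaleR_ell2_def cinner_scale_left scaleR_conv_of_real)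
qed (simp add: cinner_add_left)


section \<open>Bounded operators\<close>

typedef 'i bop = "{T :: 'i ell2 \<Rightarrow>\<^sub>L 'i ell2.
    \<forall>c x. blinfun_apply T (scale_ell2 c x) = scale_ell2 c (blinfun_apply T x)}"
  morphisms blinfun_of_bop Abs_bop
  by (rule exI[of _ id_blinfun]) simp

setup_lifting type_definition_bop

definition bop_apply :: "'i bop \<Rightarrow> 'i ell2 \<Rightarrow> 'i ell2"
  where "bop_apply T = blinfun_apply (blinfun_of_bop T)"

lemma bop_apply_scale: "bop_apply T (scale_ell2 c x) = scale_ell2 c (bop_apply T x)"
  using blinfun_of_bop[of T] by (simp add: bop_apply_def)

lemma bounded_linear_bop_apply: "bounded_linear (bop_apply T)"
  unfolding bop_apply_def by (rule blinfun.bounded_linear_right)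

lemma bop_eqI: "(\<And>x. bop_apply S x = bop_apply T x) \<Longrightarrow> S = T"
  by (metis blinfun_eqI blinfun_of_bop_inject bop_apply_def)

lemma bop_cases:
  assumes "bounded_linear f" "\<And>c x. f (scale_ell2 c x) = scale_ell2 c (f x)"
  obtains T where "bop_apply T = f"
proof
  show "bop_apply (Abs_bop (Blinfun f)) = f"
    using assms by (simp add: bop_apply_def Abs_bop_inverse bounded_linear_Blinfun_apply)
qed

lemma adjoint_exists: "\<exists>S. \<forall>x y. cinner (bop_apply T x) y = cinner x (bop_apply S y)"
proof -
  interpret T: bounded_linear "bop_apply T" by (rule bounded_linear_bop_apply)
  obtain K where K: "\<And>x. norm (bop_apply T x) \<le> norm x * K" "K \<ge> 0"
    using T.nonneg_bounded by blast
  have Ttrunc: "cinner (bop_apply T (\<Sum>i\<in>F. scale_ell2 (a i) (ket i))) y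
      = (\<Sum>i\<in>F. cnj (a i) * cinner (bop_apply T (ket i)) y)" if "finite F" for F a y
    using that
  proof (induction F rule: finite_induct)
    case empty
    show ?case using cinner_add_left[of 0 0 y] by simp
  qed (simp add: T.add bop_apply_scale cinner_add_left cinner_scale_left)
  define w where "w y = (\<lambda>i. cinner (bop_apply T (ket i)) y)" for y
  have wb: "(\<Sum>i\<in>F. (cmod (w y i))\<^sup>2) \<le> (K * norm y)\<^sup>2" if F: "finite F" for F y
  proof -
    define z where "z = (\<Sum>i\<in>F. scale_ell2 (w y i) (ket i))"
    let ?s = "\<Sum>i\<in>F. (cmod (w y i))\<^sup>2"
    have "cinner (bop_apply T z) y = complex_of_real ?s"
      unfolding z_def Ttrunc[OF F] by (simp add: w_def mult.commute flip: complex_norm_square)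
    then have "?s \<le> norm (bop_apply T z) * norm y"
      using cmod_cinner_le[of "bop_apply T z" y] by (simp add: sum_nonneg del: of_real_sum)
    also have "\<dots> \<le> norm z * K * norm y"
      using K(1)[of z] by (rule mult_right_mono) simp
    finally have 1: "?s \<le> norm z * (K * norm y)" by simp
    have "cinner z z = complex_of_real ?s"
    proof -
      have *: "cinner (\<Sum>i\<in>F. scale_ell2 (a i) (ket i)) v = (\<Sum>i\<in>F. cnj (a i) * ell2_nth v i)" for a v
        using F
      proof (induction F rule: finite_induct)
        case empty
        show ?case using cinner_add_left[of 0 0 v] by simp
      qed (simp add: cinner_add_left cinner_scale_left cinner_ket)
      have nth: "ell2_nth z i = (if i \<in> F then w y i else 0)" for i
      proof -
        have "ell2_nth z i = cnj (cinner z (ket i))" by (metis cinner_commute cinner_ket)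
        also have "\<dots> = (\<Sum>j\<in>F. if j = i then w y i else 0)"
          unfolding z_def * by (auto simp: ket.rep_eq intro!: sum.cong)
        finally show ?thesis using F by simp
      qed
      show ?thesis
        unfolding z_def[THEN arg_cong, of "\<lambda>u. cinner u z"] *
        by (simp add: nth mult.commute flip: complex_norm_square)
    qed
    then have 2: "(norm z)\<^sup>2 = ?s" using cinner_self[of z] by (metis of_real_eq_iff)
    show ?thesis
    proof (cases "norm z = 0")
      case False
      then have "norm z \<le> K * norm y" 
        by (metis 1 2 mult_le_cancel_left_pos norm_ge_zero order_le_less power2_eq_square)
      then show ?thesis unfolding 2[symmetric] by (rule power_mono) simp
    qed (use 2 in simp)
  qed
  define S where "S y = Abs_ell2 (w y)" for y
  have "K * norm y \<ge> 0" for y :: "'a ell2" using K by simp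
  note sw = ell2_boundI[OF wb this]
  have nth: "ell2_nth (S y) = w y" for y unfolding S_def by (simp add: Abs_ell2_inverse sw)
  have adj: "cinner (bop_apply T x) y = cinner x (S y)" for x y
  proof -
    have "((\<lambda>F. cnj (cinner (ell2_trunc F x) (S y))) \<longlongrightarrow> cnj (cinner x (S y))) (finite_subsets_at_top UNIV)"
      by (rule bounded_linear.tendsto[OF bounded_linear_cinner_left ell2_trunc_tendsto])
    moreover have "((\<lambda>F. cnj (cinner (bop_apply T (ell2_trunc F x)) y)) \<longlongrightarrow> cnj (cinner (bop_apply T x) y))
        (finite_subsets_at_top UNIV)"
      by (intro bounded_linear.tendsto[OF bounded_linear_cinner_left] T.tendsto ell2_trunc_tendsto)
    then have "((\<lambda>F. cnj (cinner (ell2_trunc F x) (S y))) \<longlongrightarrow> cnj (cinner (bop_apply T x) y))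
        (finite_subsets_at_top UNIV)"
    proof (rule tendsto_cong[THEN iffD1, rotated], intro eventually_finite_subsets_at_top_weakI)
      fix F :: "'a set" assume "finite F"
      then show "cnj (cinner (bop_apply T (ell2_trunc F x)) y) = cnj (cinner (ell2_trunc F x) (S y))"
        by (simp add: cinner_trunc nth) (simp add: ell2_trunc_def Ttrunc w_def)
    qed
    ultimately show ?thesis
      using tendsto_unique[OF finite_subsets_at_top_neq_bot] by (metis complex_cnj_cancel_iff)
  qed
  have "bounded_linear S"
  proof (rule bounded_linear_intro[where K = K])
    show "S (x + y) = S x + S y" for x y
      by (rule cinner_eqI) (simp add: cinner_add_right flip: adj)
    show "S (r *\<^sub>R x) = r *\<^sub>R S x" for r x
      by (rule cinner_eqI) (simp add: cinner_scale_right scaleR_ell2_def flip: adj)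
    show "norm (S y) \<le> norm y * K" for y
      unfolding S_def using sw(2)[of y] by (simp add: mult.commute)
  qed
  moreover have "S (scale_ell2 c x) = scale_ell2 c (S x)" for c x
    by (rule cinner_eqI) (simp add: cinner_scale_right flip: adj)
  ultimately obtain S' where "bop_apply S' = S" by (rule bop_cases)
  then show ?thesis using adj by auto
qed


lemma bop_closed:
  assumes "\<And>c x. blinfun_apply S (scale_ell2 c x) = scale_ell2 c (blinfun_apply S x)"
  shows "blinfun_apply (Blinfun (\<lambda>x. scale_ell2 d (blinfun_apply S x))) (scale_ell2 c x) =
    scale_ell2 c (blinfun_apply (Blinfun (\<lambda>x. scale_ell2 d (blinfun_apply S x))) x)"
proof -
  have "bounded_linear (\<lambda>x. scale_ell2 d (blinfun_apply S x))"
    by (rule bounded_linear_compose[OF bounded_linear_scale_ell2 blinfun.bounded_linear_right])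
  then show ?thesis
    by (simp add: bounded_linear_Blinfun_apply assms scale_ell2_scale mult.commute)
qed

instantiation bop :: (type) real_normed_algebra
begin

lift_definition zero_bop :: "'a bop" is 0 by simp
lift_definition plus_bop :: "'a bop \<Rightarrow> 'a bop \<Rightarrow> 'a bop" is "(+)"
  by (simp add: blinfun.add_left scale_ell2_add)
lift_definition uminus_bop :: "'a bop \<Rightarrow> 'a bop" is uminus
  by (simp add: blinfun.minus_left scale_ell2_minus)
lift_definition minus_bop :: "'a bop \<Rightarrow> 'a bop \<Rightarrow> 'a bop" is "(-)"
  by (simp add: blinfun.diff_left scale_ell2_diff)
lift_definition times_bop :: "'a bop \<Rightarrow> 'a bop \<Rightarrow> 'a bop" is "(o\<^sub>L)" by simp
lift_definition scaleR_bop :: "real \<Rightarrow> 'a bop \<Rightarrow> 'a bop" is "(*\<^sub>R)"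
  by (simp add: blinfun.scaleR_left scaleR_ell2_def scale_ell2_scale mult.commute)
lift_definition norm_bop :: "'a bop \<Rightarrow> real" is norm .
definition dist_bop :: "'a bop \<Rightarrow> 'a bop \<Rightarrow> real" where "dist_bop x y = norm (x - y)"
definition sgn_bop :: "'a bop \<Rightarrow> 'a bop" where "sgn_bop x = scaleR (inverse (norm x)) x"
definition uniformity_bop :: "('a bop \<times> 'a bop) filter"
  where "uniformity_bop = (INF e\<in>{0 <..}. principal {(x, y). dist x y < e})"
definition open_bop :: "'a bop set \<Rightarrow> bool"
  where "open_bop U = (\<forall>x\<in>U. \<forall>\<^sub>F (x', y) in uniformity. x' = x \<longrightarrow> y \<in> U)"
lemma bop_apply_simps:
  "bop_apply 0 x = 0"
  "bop_apply (S + T) x = bop_apply S x + bop_apply T x"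
  "bop_apply (- S) x = - bop_apply S x"
  "bop_apply (S - T) x = bop_apply S x - bop_apply T x"
  "bop_apply (S * T) x = bop_apply S (bop_apply T x)"
  "bop_apply (r *\<^sub>R S) x = r *\<^sub>R bop_apply S x"
  by (simp_all add: bop_apply_def zero_bop.rep_eq plus_bop.rep_eq uminus_bop.rep_eq minus_bop.rep_eq
      times_bop.rep_eq scaleR_bop.rep_eq blinfun.bilinear_simps)

instance
proof
  fix S T R :: "'a bop" and r s :: real
  show "S + T + R = S + (T + R)" "S + T = T + S" "0 + S = S" "- S + S = 0" "S - T = S + - T"
    "r *\<^sub>R (S + T) = r *\<^sub>R S + r *\<^sub>R T" "(r + s) *\<^sub>R S = r *\<^sub>R S + s *\<^sub>R S"
    "r *\<^sub>R s *\<^sub>R S = (r * s) *\<^sub>R S" "1 *\<^sub>R S = S"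
    by (rule bop_eqI; simp add: bop_apply_simps algebra_simps)+
  show "S * T * R = S * (T * R)" 
    by (rule bop_eqI; simp add: bop_apply_simps)
  have add: "bop_apply S (x + y) = bop_apply S x + bop_apply S y"
    and scl: "bop_apply S (r *\<^sub>R x) = r *\<^sub>R bop_apply S x" for x y S and r :: real
    using bounded_linear_bop_apply[of S] by (simp_all add: bounded_linear.linear linear_add linear_scale)
  show "(S + T) * R = S * R + T * R" "R * (S + T) = R * S + R * T"
    "(r *\<^sub>R S) * T = r *\<^sub>R (S * T)" "S * (r *\<^sub>R T) = r *\<^sub>R (S * T)"
    by (rule bop_eqI; simp add: bop_apply_simps add scl)+
  show "dist S T = norm (S - T)" by (rule dist_bop_def)
  show "sgn S = scaleR (inverse (norm S)) S" by (rule sgn_bop_def)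
  show "uniformity = (INF e\<in>{0 <..}. principal {(x, y :: 'a bop). dist x y < e})"
    by (rule uniformity_bop_def)
  show "open U = (\<forall>x\<in>U. \<forall>\<^sub>F (x', y) in uniformity. x' = x \<longrightarrow> y \<in> U)" for U :: "'a bop set"
    by (rule open_bop_def)
  show "norm S = 0 \<longleftrightarrow> S = 0" by transfer simp
  show "norm (S + T) \<le> norm S + norm T" by transfer (rule norm_triangle_ineq)
  show "norm (r *\<^sub>R S) = \<bar>r\<bar> * norm S" by transfer simp
  show "norm (S * T) \<le> norm S * norm T" by transfer (rule norm_blinfun_compose)
qed

end

instance bop :: (type) banach
proof
  fix X :: "nat \<Rightarrow> 'a bop"
  assume C: "Cauchy X"
  have d: "dist S T = dist (blinfun_of_bop S) (blinfun_of_bop T)" for S T :: "'a bop"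
    by (simp add: dist_bop_def norm_bop.rep_eq minus_bop.rep_eq dist_norm)
  have "Cauchy (\<lambda>n. blinfun_of_bop (X n))"
    using C by (simp add: Cauchy_def d)
  then obtain L where L: "(\<lambda>n. blinfun_of_bop (X n)) \<longlonglongrightarrow> L"
    using Cauchy_convergent convergent_def by blast
  have "blinfun_apply L (scale_ell2 c x) = scale_ell2 c (blinfun_apply L x)" for c x
  proof (rule LIMSEQ_unique)
    show "(\<lambda>n. blinfun_apply (blinfun_of_bop (X n)) (scale_ell2 c x)) \<longlonglongrightarrow> blinfun_apply L (scale_ell2 c x)"
      by (intro tendsto_intros L)
    have "(\<lambda>n. scale_ell2 c (blinfun_apply (blinfun_of_bop (X n)) x)) \<longlonglongrightarrow> scale_ell2 c (blinfun_apply L x)"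
      by (intro bounded_linear.tendsto[OF bounded_linear_scale_ell2] tendsto_intros L)
    then show "(\<lambda>n. blinfun_apply (blinfun_of_bop (X n)) (scale_ell2 c x)) \<longlonglongrightarrow> scale_ell2 c (blinfun_apply L x)"
      by (simp add: bop_apply_scale[unfolded bop_apply_def])
  qed
  then have "blinfun_of_bop (Abs_bop L) = L" by (simp add: Abs_bop_inverse)
  with L have "X \<longlonglongrightarrow> Abs_bop L"
    by (simp add: lim_sequentially d)
  then show "convergent X" by (auto simp: convergent_def)
qed

lemma norm_bop_apply_le: "norm (bop_apply T x) \<le> norm T * norm x"
  by (simp add: bop_apply_def norm_bop.rep_eq norm_blinfun)

lemma norm_bop_leI: "0 \<le> b \<Longrightarrow> (\<And>x. norm (bop_apply T x) \<le> b * norm x) \<Longrightarrow> norm T \<le> b"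
  unfolding bop_apply_def norm_bop.rep_eq by (rule norm_blinfun_bound)

instantiation bop :: (type) cstar_algebra
begin

lift_definition scaleC_bop :: "complex \<Rightarrow> 'a bop \<Rightarrow> 'a bop"
  is "\<lambda>c T. Blinfun (\<lambda>x. scale_ell2 c (blinfun_apply T x))"
  by (simp add: bop_closed)
definition star_bop :: "'a bop \<Rightarrow> 'a bop"
  where "star_bop T = (THE S. \<forall>x y. cinner (bop_apply T x) y = cinner x (bop_apply S y))"

lemma bop_apply_scaleC: "bop_apply (c *\<^sub>C S) x = scale_ell2 c (bop_apply S x)"
proof -
  have "bounded_linear (\<lambda>x. scale_ell2 c (blinfun_apply (blinfun_of_bop S) x))"
    by (rule bounded_linear_compose[OF bounded_linear_scale_ell2 blinfun.bounded_linear_right])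
  then show ?thesis
    by (simp add: bop_apply_def scaleC_bop.rep_eq bounded_linear_Blinfun_apply)
qed

lemma cinner_star: "cinner (bop_apply T x) y = cinner x (bop_apply (T\<^sup>\<star>) y)"
proof -
  obtain S where S: "\<forall>x y. cinner (bop_apply T x) y = cinner x (bop_apply S y)"
    using adjoint_exists by blast
  have "\<forall>x y. cinner (bop_apply T x) y = cinner x (bop_apply (T\<^sup>\<star>) y)"
    unfolding star_bop_def
  proof (rule theI[of _ S])
    fix R assume "\<forall>x y. cinner (bop_apply T x) y = cinner x (bop_apply R y)"
    with S have "bop_apply R y = bop_apply S y" for y by (intro cinner_eqI) metis
    then show "R = S" by (rule bop_eqI)
  qed (rule S)
  then show ?thesis by blast
qed

lemma cinner_star': "cinner (bop_apply (T\<^sup>\<star>) x) y = cinner x (bop_apply T y)"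
  by (metis cinner_commute cinner_star)

lemma star_bop_eqI: "(\<And>x y. cinner (bop_apply T x) y = cinner x (bop_apply S y)) \<Longrightarrow> T\<^sup>\<star> = S"
  by (intro bop_eqI cinner_eqI) (metis cinner_star)

lemma norm_bop_square_le: "(norm T)\<^sup>2 \<le> norm (T\<^sup>\<star> * T)" for T :: "'a bop"
proof -
  have 0: "0 \<le> norm (T\<^sup>\<star> * T)" by (simp add: norm_bop.rep_eq)
  have "norm T \<le> sqrt (norm (T\<^sup>\<star> * T))"
  proof (rule norm_bop_leI)
    fix x :: "'a ell2"
    have "complex_of_real ((norm (bop_apply T x))\<^sup>2) = cinner x (bop_apply (T\<^sup>\<star> * T) x)"
      by (simp only: cinner_self[symmetric] cinner_star bop_apply_simps)
    then have "(norm (bop_apply T x))\<^sup>2 \<le> norm x * norm (bop_apply (T\<^sup>\<star> * T) x)"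
      using cmod_cinner_le[of x "bop_apply (T\<^sup>\<star> * T) x"]
      by (metis norm_of_real abs_of_nonneg zero_le_power2)
    also have "\<dots> \<le> norm x * (norm (T\<^sup>\<star> * T) * norm x)"
      by (intro mult_left_mono norm_bop_apply_le) simp
    also have "\<dots> = (sqrt (norm (T\<^sup>\<star> * T)) * norm x)\<^sup>2"
      using 0 by (simp add: power_mult_distrib) (simp add: power2_eq_square)
    finally show "norm (bop_apply T x) \<le> sqrt (norm (T\<^sup>\<star> * T)) * norm x"
      by (rule power2_le_imp_le) (simp add: 0)
  qed (simp add: 0)
  moreover have "0 \<le> norm T" by (simp add: norm_bop.rep_eq)
  ultimately have "(norm T)\<^sup>2 \<le> (sqrt (norm (T\<^sup>\<star> * T)))\<^sup>2" by (intro power_mono)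
  with 0 show ?thesis by simp
qed

instance
proof
  fix S T :: "'a bop" and r :: real and c d :: complex
  show "c *\<^sub>C (S + T) = c *\<^sub>C S + c *\<^sub>C T" "(c + d) *\<^sub>C S = c *\<^sub>C S + d *\<^sub>C S"
    "c *\<^sub>C d *\<^sub>C S = (c * d) *\<^sub>C S" "complex_of_real r *\<^sub>C S = r *\<^sub>R S"
    "(c *\<^sub>C S) * T = c *\<^sub>C (S * T)" "S * (c *\<^sub>C T) = c *\<^sub>C (S * T)"
    by (rule bop_eqI; simp add: bop_apply_simps bop_apply_scaleC scale_ell2_add scale_ell2_add_left
        scale_ell2_scale bop_apply_scale scaleR_ell2_def)+
  show "norm (c *\<^sub>C S) = cmod c * norm S"
  proof (cases "c = 0")
    case True
    then have "c *\<^sub>C S = 0"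
      by (intro bop_eqI) (simp add: bop_apply_simps bop_apply_scaleC ell2_eqI scale_ell2.rep_eq zero_ell2.rep_eq)
    with True show ?thesis by (simp add: norm_bop.rep_eq zero_bop.rep_eq)
  next
    case False
    have le: "norm (c *\<^sub>C S) \<le> cmod c * norm S" for c and S :: "'a bop"
    proof (rule norm_bop_leI)
      show "0 \<le> cmod c * norm S" by (simp add: norm_bop.rep_eq)
      show "norm (bop_apply (c *\<^sub>C S) x) \<le> cmod c * norm S * norm x" for x
        by (simp add: bop_apply_scaleC norm_scale_ell2 mult.assoc mult_left_mono norm_bop_apply_le)
    qed
    have "S = inverse c *\<^sub>C c *\<^sub>C S"
      using False by (intro bop_eqI ell2_eqI) (simp add: bop_apply_scaleC scale_ell2.rep_eq)
    then have "norm S \<le> inverse (cmod c) * norm (c *\<^sub>C S)"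
      using le[of "inverse c" "c *\<^sub>C S"] by (simp add: norm_inverse)
    then have "cmod c * norm S \<le> norm (c *\<^sub>C S)"
      using False by (simp add: field_simps)
    with le show ?thesis by (intro antisym)
  qed
  show "(S + T)\<^sup>\<star> = S\<^sup>\<star> + T\<^sup>\<star>"
    by (rule star_bop_eqI) (simp add: bop_apply_simps cinner_add_left cinner_add_right cinner_star)
  show "(c *\<^sub>C S)\<^sup>\<star> = cnj c *\<^sub>C S\<^sup>\<star>"
    by (rule star_bop_eqI) (simp add: bop_apply_scaleC cinner_scale_left cinner_scale_right cinner_star)
  show "(S * T)\<^sup>\<star> = T\<^sup>\<star> * S\<^sup>\<star>"
    by (rule star_bop_eqI) (simp add: bop_apply_simps cinner_star)
  show ss: "(S\<^sup>\<star>)\<^sup>\<star> = S" for S :: "'a bop"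
    by (rule star_bop_eqI) (simp add: cinner_star')
  have le: "norm S \<le> norm (S\<^sup>\<star>)" for S :: "'a bop"
  proof (cases "norm S = 0")
    case False
    then have "0 < norm S" by (simp add: norm_bop.rep_eq)
    moreover have "norm S * norm S \<le> norm (S\<^sup>\<star>) * norm S"
      using norm_bop_square_le[of S] norm_mult_ineq[of "S\<^sup>\<star>" S] by (simp add: power2_eq_square)
    ultimately show ?thesis by simp
  qed (simp add: norm_bop.rep_eq)
  have "norm (S\<^sup>\<star>) = norm S"
    using le[of S] le[of "S\<^sup>\<star>"] ss[of S] by simp
  then show "norm (S\<^sup>\<star> * S) = (norm S)\<^sup>2"
    using norm_bop_square_le[of S] norm_mult_ineq[of "S\<^sup>\<star>" S]
    by (simp add: power2_eq_square)
qed

end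


section \<open>Tensor products of operators\<close>

lift_definition tensor_ell2 :: "'i ell2 \<Rightarrow> 'j ell2 \<Rightarrow> ('i \<times> 'j) ell2"
  is "\<lambda>f g (i, j). f i * g j"
proof -
  fix f :: "'i \<Rightarrow> complex" and g :: "'j \<Rightarrow> complex"
  let ?f = "\<lambda>i. (cmod (f i))\<^sup>2" and ?g = "\<lambda>j. (cmod (g j))\<^sup>2"
  assume f: "?f summable_on UNIV" and g: "?g summable_on UNIV"
  have "(\<Sum>p\<in>F. (cmod (case p of (i, j) \<Rightarrow> f i * g j))\<^sup>2) \<le> infsum ?f UNIV * infsum ?g UNIV"
    if F: "finite F" for F
  proof -
    have "(\<Sum>p\<in>F. (cmod (case p of (i, j) \<Rightarrow> f i * g j))\<^sup>2)
        \<le> (\<Sum>p\<in>fst ` F \<times> snd ` F. (cmod (case p of (i, j) \<Rightarrow> f i * g j))\<^sup>2)"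
      by (rule sum_mono2) (use F in \<open>auto simp: rev_image_eqI\<close>)
    also have "\<dots> = sum ?f (fst ` F) * sum ?g (snd ` F)"
      by (simp add: sum_product sum.cartesian_product norm_mult power_mult_distrib split_def)
    also have "\<dots> \<le> infsum ?f UNIV * infsum ?g UNIV"
      by (intro mult_mono finite_sum_le_infsum f g infsum_nonneg sum_nonneg) (use F in auto)
    finally show ?thesis .
  qed
  then show "(\<lambda>p. (cmod (case p of (i, j) \<Rightarrow> f i * g j))\<^sup>2) summable_on UNIV"
    by (intro nonneg_bdd_above_summable_on) (auto simp: bdd_above_def)
qed

lemma tensor_ell2_nth: "ell2_nth (tensor_ell2 x y) (i, j) = ell2_nth x i * ell2_nth y j"
  by (simp add: tensor_ell2.rep_eq)

lemma slices_bound: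
  fixes z :: "'k ell2" and \<sigma> :: "'j \<Rightarrow> 'i \<Rightarrow> 'k"
  assumes \<sigma>: "inj (\<lambda>(j, i). \<sigma> j i)"
  defines "s j \<equiv> Abs_ell2 (\<lambda>i. ell2_nth z (\<sigma> j i))"
  shows "ell2_nth (s j) = (\<lambda>i. ell2_nth z (\<sigma> j i))"
    and "finite G \<Longrightarrow> (\<Sum>j\<in>G. (norm (s j))\<^sup>2) \<le> (norm z)\<^sup>2"
proof -
  have fin: "(\<Sum>j\<in>G. \<Sum>i\<in>F. (cmod (ell2_nth z (\<sigma> j i)))\<^sup>2) \<le> (norm z)\<^sup>2"
    if "finite F" "finite G" for F G
  proof -
    have "(\<Sum>j\<in>G. \<Sum>i\<in>F. (cmod (ell2_nth z (\<sigma> j i)))\<^sup>2)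
        = (\<Sum>k\<in>(\<lambda>(j, i). \<sigma> j i) ` (G \<times> F). (cmod (ell2_nth z k))\<^sup>2)"
      by (subst sum.reindex) (auto simp: sum.cartesian_product split_def
          intro: inj_on_subset[OF \<sigma>[unfolded split_def]])
    also have "\<dots> \<le> (norm z)\<^sup>2" by (rule norm_ell2_finite) (use that in auto)
    finally show ?thesis .
  qed
  have sm: "(\<lambda>i. (cmod (ell2_nth z (\<sigma> j i)))\<^sup>2) summable_on UNIV" for j
    by (rule ell2_boundI[where B = "norm z"]) (use fin[of _ "{j}"] in auto)
  then show nth: "ell2_nth (s j) = (\<lambda>i. ell2_nth z (\<sigma> j i))" for j
    by (simp add: s_def Abs_ell2_inverse)
  assume G: "finite G"
  then have hs: "((\<lambda>i. \<Sum>j\<in>G. (cmod (ell2_nth z (\<sigma> j i)))\<^sup>2) has_sum (\<Sum>j\<in>G. (norm (s j))\<^sup>2)) UNIV"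
  proof (induction G rule: finite_induct)
    case (insert j G)
    then show ?case
      using has_sum_add[OF has_sum_infsum[OF sm[of j]] insert.IH] by (simp add: norm_ell2_power2 nth)
  qed simp
  have "(\<Sum>i\<in>F. \<Sum>j\<in>G. (cmod (ell2_nth z (\<sigma> j i)))\<^sup>2) \<le> (norm z)\<^sup>2" if "finite F" for F
    using fin[OF that G] by (subst sum.swap)
  then show "(\<Sum>j\<in>G. (norm (s j))\<^sup>2) \<le> (norm z)\<^sup>2"
    unfolding infsumI[OF hs, symmetric]
    by (intro infsum_le_finite_sums has_sum_imp_summable[OF hs])
qed

lemma ampliation_exists:
  fixes \<sigma> :: "'j \<Rightarrow> 'i \<Rightarrow> 'k" and T :: "'i bop"
  assumes \<sigma>: "bij (\<lambda>(j, i). \<sigma> j i)"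
  shows "\<exists>R. \<forall>z j i. ell2_nth (bop_apply R z) (\<sigma> j i)
    = ell2_nth (bop_apply T (Abs_ell2 (\<lambda>i. ell2_nth z (\<sigma> j i)))) i"
proof -
  interpret T: bounded_linear "bop_apply T" by (rule bounded_linear_bop_apply)
  define s where "s z j = Abs_ell2 (\<lambda>i. ell2_nth z (\<sigma> j i))" for z j
  define \<tau> where "\<tau> = inv_into UNIV (\<lambda>(j, i). \<sigma> j i)"
  have \<tau>: "\<tau> (\<sigma> j i) = (j, i)" for j i
    using inv_f_f[OF bij_is_inj[OF \<sigma>], of "(j, i)"] by (simp add: \<tau>_def)
  have \<tau>_surj: "\<sigma> (fst (\<tau> k)) (snd (\<tau> k)) = k" for k
    using surj_f_inv_f[OF bij_is_surj[OF \<sigma>], of k] by (simp add: \<tau>_def split_def)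
  have inj\<tau>: "inj \<tau>" by (metis \<tau>_surj injI)
  note sl = slices_bound[OF bij_is_inj[OF \<sigma>], folded s_def]
  define w where "w z k = ell2_nth (bop_apply T (s z (fst (\<tau> k)))) (snd (\<tau> k))" for z k
  have bd: "(\<Sum>k\<in>F. (cmod (w z k))\<^sup>2) \<le> (norm T * norm z)\<^sup>2" if F: "finite F" for F z
  proof -
    let ?G = "fst ` \<tau> ` F" and ?H = "snd ` \<tau> ` F"
    have "(\<Sum>k\<in>F. (cmod (w z k))\<^sup>2) = (\<Sum>p\<in>\<tau> ` F. (cmod (ell2_nth (bop_apply T (s z (fst p))) (snd p)))\<^sup>2)"
      by (subst sum.reindex) (auto simp: w_def intro: inj_on_subset[OF inj\<tau>])
    also have "\<dots> \<le> (\<Sum>p\<in>?G \<times> ?H. (cmod (ell2_nth (bop_apply T (s z (fst p))) (snd p)))\<^sup>2)"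
      by (rule sum_mono2[OF _ subset_fst_snd]) (use F in auto)
    also have "\<dots> = (\<Sum>j\<in>?G. \<Sum>i\<in>?H. (cmod (ell2_nth (bop_apply T (s z j)) i))\<^sup>2)"
      by (simp add: sum.cartesian_product split_def)
    also have "\<dots> \<le> (\<Sum>j\<in>?G. (norm (bop_apply T (s z j)))\<^sup>2)"
      by (intro sum_mono norm_ell2_finite) (use F in auto)
    also have "\<dots> \<le> (\<Sum>j\<in>?G. (norm T)\<^sup>2 * (norm (s z j))\<^sup>2)"
      by (intro sum_mono) (metis norm_bop_apply_le norm_ge_zero power_mono power_mult_distrib)
    also have "\<dots> \<le> (norm T)\<^sup>2 * (norm z)\<^sup>2"
      unfolding sum_distrib_left[symmetric] by (intro mult_left_mono sl(2)) (use F in auto)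
    finally show ?thesis by (simp add: power_mult_distrib)
  qed
  note sw = ell2_boundI[OF bd mult_nonneg_nonneg[OF norm_ge_zero norm_ge_zero]]
  have nth: "ell2_nth (Abs_ell2 (w z)) (\<sigma> j i) = ell2_nth (bop_apply T (s z j)) i" for z j i
    by (subst Abs_ell2_inverse) (auto simp: sw, simp add: w_def \<tau>)
  have eqI: "x = y" if "\<And>j i. ell2_nth x (\<sigma> j i) = ell2_nth y (\<sigma> j i)" for x y
    by (rule ell2_eqI) (metis that \<tau>_surj)
  have s_add: "s (x + y) j = s x j + s y j" and s_scale: "s (scale_ell2 c x) j = scale_ell2 c (s x j)"
    for x y c j
    by (rule ell2_eqI; simp add: sl(1) plus_ell2.rep_eq scale_ell2.rep_eq)+
  have scale: "Abs_ell2 (w (scale_ell2 c x)) = scale_ell2 c (Abs_ell2 (w x))" for c x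
    by (rule eqI) (simp add: nth s_scale bop_apply_scale scale_ell2.rep_eq)
  have "bounded_linear (\<lambda>z. Abs_ell2 (w z))"
  proof (rule bounded_linear_intro[where K = "norm T"])
    show "Abs_ell2 (w (x + y)) = Abs_ell2 (w x) + Abs_ell2 (w y)" for x y
      by (rule eqI) (simp add: nth s_add T.add plus_ell2.rep_eq)
    show "Abs_ell2 (w (r *\<^sub>R x)) = r *\<^sub>R Abs_ell2 (w x)" for r x
      by (simp add: scaleR_ell2_def scale)
    show "norm (Abs_ell2 (w x)) \<le> norm x * norm T" for x
      using sw(2)[of x] by (simp add: mult.commute)
  qed
  then obtain R where "bop_apply R = (\<lambda>z. Abs_ell2 (w z))" using scale by (rule bop_cases)
  then show ?thesis using nth unfolding s_def by (intro exI[of _ R]) simp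
qed

text \<open>The unique bounded operator with \<open>(S \<otimes> T)(x \<otimes> y) = S x \<otimes> T y\<close>; that it exists is
  proved in \<open>tensor_bop_apply\<close> below.\<close>

definition tensor_bop :: "'i bop \<Rightarrow> 'j bop \<Rightarrow> ('i \<times> 'j) bop"
  where "tensor_bop S T = (THE R. \<forall>x y. bop_apply R (tensor_ell2 x y)
    = tensor_ell2 (bop_apply S x) (bop_apply T y))"

lemma tensor_ell2_unique:
  fixes R R' :: "('i \<times> 'j) bop"
  assumes "\<And>x y. bop_apply R (tensor_ell2 x y) = bop_apply R' (tensor_ell2 x y)"
  shows "R = R'"
proof (rule bop_eqI)
  fix z :: "('i \<times> 'j) ell2"
  interpret R: bounded_linear "bop_apply R" by (rule bounded_linear_bop_apply)
  interpret R': bounded_linear "bop_apply R'" by (rule bounded_linear_bop_apply)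
  have ket: "ket p = tensor_ell2 (ket (fst p)) (ket (snd p))" for p :: "'i \<times> 'j"
    by (rule ell2_eqI) (auto simp: ket.rep_eq tensor_ell2.rep_eq split: prod.splits)
  have "bop_apply R (ell2_trunc F z) = bop_apply R' (ell2_trunc F z)" for F
    unfolding ell2_trunc_def by (simp add: R.sum R'.sum bop_apply_scale ket assms)
  then show "bop_apply R z = bop_apply R' z"
    using tendsto_unique[OF finite_subsets_at_top_neq_bot R.tendsto[OF ell2_trunc_tendsto[of z]]]
      R'.tendsto[OF ell2_trunc_tendsto[of z]] by simp
qed

lemma tensor_bop_apply:
  fixes S :: "'a bop" and T :: "'b bop"
  shows "bop_apply (tensor_bop S T) (tensor_ell2 x y) = tensor_ell2 (bop_apply S x) (bop_apply T y)"
proof -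
  have "bij (\<lambda>(j :: 'b, i :: 'a). (i, j))" by (auto simp: bij_def inj_def surj_def)
  from ampliation_exists[OF this, of S] obtain S1 where
    S1: "\<And>(z :: ('a \<times> 'b) ell2) i j. ell2_nth (bop_apply S1 z) (i, j) = ell2_nth (bop_apply S (Abs_ell2 (\<lambda>i. ell2_nth z (i, j)))) i"
    by blast
  have "bij (\<lambda>(i :: 'a, j :: 'b). (i, j))" by (auto simp: bij_def inj_def surj_def)
  from ampliation_exists[OF this, of T] obtain T1 where
    T1: "\<And>(z :: ('a \<times> 'b) ell2) i j. ell2_nth (bop_apply T1 z) (i, j) = ell2_nth (bop_apply T (Abs_ell2 (\<lambda>j. ell2_nth z (i, j)))) j"
    by blast
  have a: "Abs_ell2 (\<lambda>i. ell2_nth x i * c) = scale_ell2 c x" "Abs_ell2 (\<lambda>i. c * ell2_nth x i) = scale_ell2 c x"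
    for c and x :: "'k ell2"
    by (rule ell2_nth_inject[THEN iffD1];
        simp add: Abs_ell2_inverse norm_mult power_mult_distrib summable_ell2_nth summable_on_cmult_left
          summable_on_cmult_right scale_ell2.rep_eq mult.commute fun_eq_iff)+
  have "bop_apply (S1 * T1) (tensor_ell2 x y) = tensor_ell2 (bop_apply S x) (bop_apply T y)" for x y
  proof -
    have "bop_apply T1 (tensor_ell2 x y) = tensor_ell2 x (bop_apply T y)"
      by (rule ell2_eqI) (auto simp: T1 tensor_ell2_nth a bop_apply_scale scale_ell2.rep_eq)
    moreover have "bop_apply S1 (tensor_ell2 x y) = tensor_ell2 (bop_apply S x) y" for y
      by (rule ell2_eqI) (auto simp: S1 tensor_ell2_nth a bop_apply_scale scale_ell2.rep_eq)
    ultimately show ?thesis by (simp add: bop_apply_simps)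
  qed
  note ST = this
  have "\<forall>x y. bop_apply (tensor_bop S T) (tensor_ell2 x y) = tensor_ell2 (bop_apply S x) (bop_apply T y)"
    unfolding tensor_bop_def
  proof (rule theI[of _ "S1 * T1"])
    fix R assume "\<forall>x y. bop_apply R (tensor_ell2 x y) = tensor_ell2 (bop_apply S x) (bop_apply T y)"
    with ST show "R = S1 * T1" by (intro tensor_ell2_unique) simp
  qed (use ST in blast)
  then show ?thesis by blast
qed


section \<open>C*-subalgebras, homomorphisms and tensor products\<close>

definition cstar_subalgebra :: "'b::cstar_algebra set \<Rightarrow> bool"
  where "cstar_subalgebra B \<longleftrightarrow> subspace B \<and> closed B \<and> (\<forall>c. \<forall>x\<in>B. c *\<^sub>C x \<in> B)
    \<and> (\<forall>x\<in>B. \<forall>y\<in>B. x * y \<in> B) \<and> (\<forall>x\<in>B. x\<^sup>\<star> \<in> B)"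

definition star_hom_on :: "'b::cstar_algebra set \<Rightarrow> ('b \<Rightarrow> 'c::cstar_algebra) \<Rightarrow> bool"
  where "star_hom_on B h \<longleftrightarrow>
    (\<forall>x\<in>B. \<forall>y\<in>B. h (x + y) = h x + h y \<and> h (x * y) = h x * h y)
    \<and> (\<forall>c. \<forall>x\<in>B. h (c *\<^sub>C x) = c *\<^sub>C h x) \<and> (\<forall>x\<in>B. h (x\<^sup>\<star>) = (h x)\<^sup>\<star>)"

text \<open>Every separable C*-algebra has a faithful representation on \<open>\<ell>\<^sup>2(\<nat>)\<close> (Gelfand--Naimark--Segal).
  The constructions below that use the chosen one do not depend on the choice, up to isomorphism.
  They are only meaningful for separable algebras.\<close>

definition faithful_rep :: "'a::cstar_algebra \<Rightarrow> nat bop"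
  where "faithful_rep = (SOME \<pi>. star_hom_on UNIV \<pi> \<and> inj \<pi>)"

text \<open>The minimal (spatial) tensor product of two C*-algebras of operators. The real span of the
  elementary tensors is already a complex subspace, because \<open>M\<close> is one.\<close>

definition min_tensor :: "'i bop set \<Rightarrow> 'j bop set \<Rightarrow> ('i \<times> 'j) bop set"
  where "min_tensor M N = closure (span {tensor_bop S T |S T. S \<in> M \<and> T \<in> N})"

definition compact_operators :: "'i bop set"
  where "compact_operators = {T. compact (closure (bop_apply T ` cball 0 1))}"

definition stabilization :: "'a::cstar_algebra itself \<Rightarrow> (nat \<times> nat) bop set"
  where "stabilization _ = min_tensor (range (faithful_rep :: 'a \<Rightarrow> nat bop)) compact_operators"

text \<open>The matrix unit \<open>e\<^sub>1\<^sub>1\<close>, the basis of \<open>\<ell>\<^sup>2(\<nat>)\<close> being indexed from 0.\<close>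

definition e11 :: "nat bop"
  where "e11 = Abs_bop (Blinfun (\<lambda>x. scale_ell2 (ell2_nth x 0) (ket 0)))"

lemma bop_apply_e11: "bop_apply e11 x = scale_ell2 (ell2_nth x 0) (ket 0)"
proof -
  let ?f = "\<lambda>x :: nat ell2. scale_ell2 (ell2_nth x 0) (ket (0 :: nat))"
  have b: "bounded_linear ?f"
  proof (rule bounded_linear_intro[where K = "norm (ket (0 :: nat))"])
    show "?f (x + y) = ?f x + ?f y" for x y
      by (simp add: plus_ell2.rep_eq scale_ell2_add_left)
    show "?f (r *\<^sub>R x) = r *\<^sub>R ?f x" for r x
      by (simp add: scaleR_ell2_def scale_ell2.rep_eq scale_ell2_scale)
    show "norm (?f x) \<le> norm x * norm (ket (0 :: nat))" for x
      unfolding norm_scale_ell2 by (intro mult_right_mono norm_ell2_nth_le norm_ge_zero)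
  qed
  have "?f (scale_ell2 c x) = scale_ell2 c (?f x)" for c x
    by (simp add: scale_ell2.rep_eq scale_ell2_scale)
  with b show ?thesis
    unfolding e11_def by (simp add: bop_apply_def Abs_bop_inverse bounded_linear_Blinfun_apply)
qed

definition corner :: "'a::cstar_algebra \<Rightarrow> (nat \<times> nat) bop"
  where "corner a = tensor_bop (faithful_rep a) e11"


section \<open>The Cuntz semigroup\<close>

definition positive_elements :: "'b::cstar_algebra set \<Rightarrow> 'b set"
  where "positive_elements B = {x\<^sup>\<star> * x |x. x \<in> B}"

definition cuntz_subequiv :: "'b::cstar_algebra set \<Rightarrow> 'b \<Rightarrow> 'b \<Rightarrow> bool"
  where "cuntz_subequiv B a b \<longleftrightarrow>
    (\<exists>v. (\<forall>n. v n \<in> B) \<and> (\<lambda>n. v n * b * (v n)\<^sup>\<star>) \<longlonglongrightarrow> a)"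

definition cuntz_equiv :: "'b::cstar_algebra set \<Rightarrow> ('b \<times> 'b) set"
  where "cuntz_equiv B = {(a, b). a \<in> positive_elements B \<and> b \<in> positive_elements B
    \<and> cuntz_subequiv B a b \<and> cuntz_subequiv B b a}"

definition Cu :: "'a::cstar_algebra itself \<Rightarrow> (nat \<times> nat) bop set set"
  where "Cu A = positive_elements (stabilization A) // cuntz_equiv (stabilization A)"

definition cu_class :: "'a::cstar_algebra \<Rightarrow> (nat \<times> nat) bop set"
  where "cu_class a = cuntz_equiv (stabilization TYPE('a)) `` {corner a}"

definition cu_le :: "'a::cstar_algebra itself \<Rightarrow> (nat \<times> nat) bop set \<Rightarrow> (nat \<times> nat) bop set \<Rightarrow> bool"
  where "cu_le A X Y \<longleftrightarrow> (\<exists>a\<in>X. \<exists>b\<in>Y. cuntz_subequiv (stabilization A) a b)"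

definition cu_is_sup ::
  "'a::cstar_algebra itself \<Rightarrow> (nat \<Rightarrow> (nat \<times> nat) bop set) \<Rightarrow> (nat \<times> nat) bop set \<Rightarrow> bool"
  where "cu_is_sup A s U \<longleftrightarrow> U \<in> Cu A \<and> (\<forall>i. cu_le A (s i) U)
    \<and> (\<forall>W\<in>Cu A. (\<forall>i. cu_le A (s i) W) \<longrightarrow> cu_le A U W)"

definition cu_way_below ::
  "'a::cstar_algebra itself \<Rightarrow> (nat \<times> nat) bop set \<Rightarrow> (nat \<times> nat) bop set \<Rightarrow> bool"
  where "cu_way_below A X Y \<longleftrightarrow>
    (\<forall>s U. (\<forall>i. s i \<in> Cu A \<and> cu_le A (s i) (s (Suc i))) \<and> cu_is_sup A s U \<and> cu_le A Y U
      \<longrightarrow> (\<exists>i. cu_le A X (s i)))"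

definition cu_compact :: "'a::cstar_algebra itself \<Rightarrow> (nat \<times> nat) bop set \<Rightarrow> bool"
  where "cu_compact A X \<longleftrightarrow> cu_way_below A X X"


section \<open>Properties of C*-algebras\<close>

definition simple_cstar :: "'a::cstar_algebra itself \<Rightarrow> bool"
  where "simple_cstar _ \<longleftrightarrow>
    (\<forall>I :: 'a set. subspace I \<and> closed I \<and> (\<forall>c. \<forall>x\<in>I. c *\<^sub>C x \<in> I) \<and> (\<forall>x\<in>I. \<forall>y. x * y \<in> I \<and> y * x \<in> I)
      \<longrightarrow> I = {0} \<or> I = UNIV)"

text \<open>Exactness of \<open>A \<otimes>\<^sub>m\<^sub>i\<^sub>n _\<close>: for every short exact sequence \<open>0 \<rightarrow> J \<rightarrow> B \<rightarrow> D \<rightarrow> 0\<close>, where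
  \<open>J\<close> is the kernel of \<open>q\<close>, the sequence
  \<open>0 \<rightarrow> A \<otimes> J \<rightarrow> A \<otimes> B \<rightarrow> A \<otimes> D \<rightarrow> 0\<close> is exact (\<open>Q\<close> is \<open>id \<otimes> q\<close>). HOL cannot quantify over the
  C*-algebras of all types; \<open>B\<close> and \<open>D\<close> range over those acting on \<open>\<ell>\<^sup>2(\<nat>)\<close>, hence over all separable
  ones. This loses nothing: an element of \<open>A \<otimes> B\<close> that \<open>id \<otimes> q\<close> kills already lies in \<open>A \<otimes> B\<^sub>0\<close>
  for a separable C*-subalgebra \<open>B\<^sub>0\<close> of \<open>B\<close>, and \<open>A \<otimes> q(B\<^sub>0)\<close> embeds isometrically in \<open>A \<otimes> D\<close>.\<close>

definition exact_cstar :: "'a::cstar_algebra itself \<Rightarrow> bool"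
  where "exact_cstar _ \<longleftrightarrow>
    (let A = range (faithful_rep :: 'a \<Rightarrow> nat bop) in
      \<forall>(B :: nat bop set) (D :: nat bop set) q.
        cstar_subalgebra B \<and> cstar_subalgebra D \<and> star_hom_on B q \<and> q ` B = D \<longrightarrow>
        (\<exists>Q. star_hom_on (min_tensor A B) Q
          \<and> (\<forall>S\<in>A. \<forall>T\<in>B. Q (tensor_bop S T) = tensor_bop S (q T))
          \<and> Q ` min_tensor A B = min_tensor A D
          \<and> {x \<in> min_tensor A B. Q x = 0} = min_tensor A {T \<in> B. q T = 0}))"

text \<open>\<open>M\<^sub>n(A)\<close> is rendered as \<^term>\<open>carrier_mat n n\<close>; the library's matrix adjoint is restricted to
  fields.\<close>

definition mat_star :: "'a::cstar_algebra mat \<Rightarrow> 'a mat"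
  where "mat_star U = mat (dim_col U) (dim_row U) (\<lambda>(i, j). (U $$ (j, i))\<^sup>\<star>)"

text \<open>Unital *-homomorphisms \<open>M\<^sub>N(\<complex>) \<oplus> M\<^sub>N\<^sub>+\<^sub>1(\<complex>) \<rightarrow> A\<close>\<close>

definition unital_hom_from_matrices ::
  "nat \<Rightarrow> (complex mat \<times> complex mat \<Rightarrow> 'a::unital_cstar_algebra) \<Rightarrow> bool"
  where "unital_hom_from_matrices N \<phi> \<longleftrightarrow>
    \<phi> (1\<^sub>m N, 1\<^sub>m (N + 1)) = 1
    \<and> (\<forall>x\<in>carrier_mat N N. \<forall>y\<in>carrier_mat (N + 1) (N + 1).
        \<phi> (mat_star x, mat_star y) = (\<phi> (x, y))\<^sup>\<star>
        \<and> (\<forall>c. \<phi> (c \<cdot>\<^sub>m x, c \<cdot>\<^sub>m y) = c *\<^sub>C \<phi> (x, y))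
        \<and> (\<forall>x'\<in>carrier_mat N N. \<forall>y'\<in>carrier_mat (N + 1) (N + 1).
            \<phi> (x + x', y + y') = \<phi> (x, y) + \<phi> (x', y')
            \<and> \<phi> (x * x', y * y') = \<phi> (x, y) * \<phi> (x', y')))"

definition approximately_divisible :: "'a::unital_cstar_algebra itself \<Rightarrow> bool"
  where "approximately_divisible _ \<longleftrightarrow>
    (\<forall>N. \<exists>\<phi> :: nat \<Rightarrow> complex mat \<times> complex mat \<Rightarrow> 'a.
      (\<forall>n. unital_hom_from_matrices N (\<phi> n))
      \<and> (\<forall>x\<in>carrier_mat N N. \<forall>y\<in>carrier_mat (N + 1) (N + 1). \<forall>a.
          (\<lambda>n. norm (\<phi> n (x, y) * a - a * \<phi> n (x, y))) \<longlonglongrightarrow> 0))"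

definition cstar_spectrum :: "'a::unital_cstar_algebra \<Rightarrow> complex set"
  where "cstar_spectrum x = {c. \<not> (\<exists>y. (x - c *\<^sub>C 1) * y = 1 \<and> y * (x - c *\<^sub>C 1) = 1)}"

definition real_rank_zero :: "'a::unital_cstar_algebra itself \<Rightarrow> bool"
  where "real_rank_zero _ \<longleftrightarrow>
    (\<forall>x :: 'a. x\<^sup>\<star> = x \<longrightarrow> x \<in> closure {y. y\<^sup>\<star> = y \<and> finite (cstar_spectrum y)})"

definition stably_finite :: "'a::unital_cstar_algebra itself \<Rightarrow> bool"
  where "stably_finite _ \<longleftrightarrow>
    (\<forall>n. \<forall>U :: 'a mat. U \<in> carrier_mat n n \<and> mat_star U * U = 1\<^sub>m n \<longrightarrow> U * mat_star U = 1\<^sub>m n)"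

definition hereditary_subalgebra :: "'a::cstar_algebra set \<Rightarrow> bool"
  where "hereditary_subalgebra B \<longleftrightarrow> cstar_subalgebra B \<and>
    (\<forall>x\<in>positive_elements UNIV. \<forall>y\<in>B. y - x \<in> positive_elements UNIV \<longrightarrow> x \<in> B)"

text \<open>A projection is infinite if it is Murray--von Neumann equivalent to a proper subprojection of
  itself.\<close>

definition infinite_projection :: "'a::cstar_algebra \<Rightarrow> bool"
  where "infinite_projection p \<longleftrightarrow> p\<^sup>\<star> = p \<and> p * p = p \<and>
    (\<exists>v. v\<^sup>\<star> * v = p \<and> p * (v * v\<^sup>\<star>) = v * v\<^sup>\<star> \<and> v * v\<^sup>\<star> \<noteq> p)"

text \<open>Cuntz's definition, for simple algebras.\<close>

definition purely_infinite :: "'a::cstar_algebra itself \<Rightarrow> bool"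
  where "purely_infinite _ \<longleftrightarrow>
    (\<forall>B :: 'a set. hereditary_subalgebra B \<and> B \<noteq> {0} \<longrightarrow> (\<exists>p\<in>B. infinite_projection p))"


section \<open>Homotopy groups\<close>

definition unit_cube :: "nat \<Rightarrow> (nat \<Rightarrow> real) topology"
  where "unit_cube k = subtopology (Euclidean_space k) {s. \<forall>i<k. 0 \<le> s i \<and> s i \<le> 1}"

definition based_cube_map :: "nat \<Rightarrow> 'b \<Rightarrow> ((nat \<Rightarrow> real) \<Rightarrow> 'b) \<Rightarrow> bool"
  where "based_cube_map k x f \<longleftrightarrow>
    (\<forall>s\<in>topspace (unit_cube k). (\<exists>i<k. s i = 0 \<or> s i = 1) \<longrightarrow> f s = x)"

definition cube_loops :: "nat \<Rightarrow> 'b topology \<Rightarrow> 'b \<Rightarrow> ((nat \<Rightarrow> real) \<Rightarrow> 'b) set"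
  where "cube_loops k X x = {f. continuous_map (unit_cube k) X f \<and> based_cube_map k x f}"

definition cube_homotopic ::
  "nat \<Rightarrow> 'b topology \<Rightarrow> 'b \<Rightarrow> (((nat \<Rightarrow> real) \<Rightarrow> 'b) \<times> ((nat \<Rightarrow> real) \<Rightarrow> 'b)) set"
  where "cube_homotopic k X x = {(f, g). f \<in> cube_loops k X x \<and> g \<in> cube_loops k X x
    \<and> homotopic_with (based_cube_map k x) (unit_cube k) X f g}"

definition cube_concat :: "((nat \<Rightarrow> real) \<Rightarrow> 'b) \<Rightarrow> ((nat \<Rightarrow> real) \<Rightarrow> 'b) \<Rightarrow> (nat \<Rightarrow> real) \<Rightarrow> 'b"
  where "cube_concat f g s = (if s 0 \<le> 1/2 then f (s(0 := 2 * s 0)) else g (s(0 := 2 * s 0 - 1)))"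

text \<open>\<open>\<pi>\<^sub>k(X, x)\<close> for \<open>k \<ge> 1\<close>\<close>

definition homotopy_group :: "nat \<Rightarrow> 'b topology \<Rightarrow> 'b \<Rightarrow> ((nat \<Rightarrow> real) \<Rightarrow> 'b) set monoid"
  where "homotopy_group k X x =
    \<lparr>carrier = cube_loops k X x // cube_homotopic k X x,
     mult = (\<lambda>F G. {h. \<exists>f\<in>F. \<exists>g\<in>G. (cube_concat f g, h) \<in> cube_homotopic k X x}),
     one = cube_homotopic k X x `` {\<lambda>_. x}\<rparr>"


section \<open>The Cuntz class of an element as a space\<close>

definition cuntz_class_set :: "'a::cstar_algebra \<Rightarrow> 'a set"
  where "cuntz_class_set a = {b \<in> positive_elements UNIV. cu_class b = cu_class a}"

end

theory Submission
  imports Defs "HOL-Computational_Algebra.Computational_Algebra" "HOL-Combinatorics.Combinatorics"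
begin

text \<open>A based loop of class \<open>a\<close> is contracted by splitting off constant projections. Approximate
  divisibility yields approximately central columns of matrix units; glued by a coloured partition of
  unity they carry a projection below every member of a compact family to a fixed one, up to homotopy
  and leaving a remainder family. Repeating this along a sequence of projections exhausting \<open>a\<close> and
  damping the \<open>j\<close>-th stage by a factor \<open>c j\<close> with rapid decay, the infinite concatenation converges to
  the constant \<open>W = \<Sum> c j e j\<close>, which again has class \<open>a\<close>. If \<open>A\<close> is not stably finite, all nonzero
  positive elements are equivalent, so a straight-line homotopy suffices.\<close>

section \<open>C*-algebra arithmetic\<close>

text \<open>A straight segment between two members of a Cuntz class can leave the class, so only two
  kinds of move are used: conjugation by left-invertible elements, and segments between elements
  that dominate each other up to scalars. Splitting off a projection is a composite of the two. What
  limits it is room. With \<open>m\<close> colours and one further direction for the constant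
  projection, \<open>N = m + 1\<close> columns are needed; matrix units come in blocks of sizes
  \<open>N\<close> and \<open>N + 1\<close>, which costs \<open>m + 2\<close> copies of the
  projection below the remainder, and one more is lost in cancelling what was split off before. So
  each projection is cut into pieces of which \<open>m + 3\<close> copies fit into the next one.
  There always is a next one: a noncompact class contains no projection, so the exhausting sequence
  never stops. The remainders need not tend to \<open>0\<close> in norm; rescaling does not change
  the class, and the weights \<open>c j\<close> force convergence. All homotopies are free but
  constant on the boundary of the cube at every time; they are made based only at the end.\<close>

notation star (\<open>_\<star>\<close> [1000] 999)
notation scaleR (infixr \<open>*R\<close> 75)
notation scaleC (infixr \<open>*C\<close> 75)

lemmas diff_distribs = right_diff_distrib left_diff_distrib
lemmas add_distribs = distrib_left distrib_right

lemma bounded_linear_star: "bounded_linear (star :: 'a::cstar_algebra => 'a)"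
proof (rule bounded_linear_intro[where K = 1])
  have le: "norm x <= norm (x\<star>)" for x :: 'a
  proof (cases "norm x = 0")
    case False
    have "norm x * norm x <= norm (x\<star>) * norm x"
      using cstar_identity[of x] norm_mult_ineq[of "x\<star>" x] by (simp add: power2_eq_square)
    then show ?thesis using False by simp
  qed simp
  show "norm (x\<star>) <= norm x * 1" for x :: 'a
    using le[of "x\<star>"] by (simp add: star_star)
  show "(r *R x)\<star> = r *R x\<star>" for r and x :: 'a
    using star_scaleC[of "complex_of_real r" x] by (simp add: scaleC_of_real)
qed (rule star_add)

lemmas star_scaleR [simp] = bounded_linear.linear[OF bounded_linear_star, THEN linear_scale]
lemmas star_minus [simp] = bounded_linear.linear[OF bounded_linear_star, THEN linear_neg]
lemmas star_diff = bounded_linear.linear[OF bounded_linear_star, THEN linear_diff]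
lemmas star_zero [simp] = bounded_linear.linear[OF bounded_linear_star, THEN linear_0]
lemmas star_sum = bounded_linear.linear[OF bounded_linear_star, THEN linear_sum]
lemmas tendsto_star [tendsto_intros] = bounded_linear.tendsto[OF bounded_linear_star]
lemmas continuous_on_star [continuous_intros] = bounded_linear.continuous_on[OF bounded_linear_star]

declare star_star [simp]

lemma norm_star [simp]: "norm (x\<star>) = norm x" for x :: "'a::cstar_algebra"
proof -
  have "norm (x\<star>) <= norm x" for x :: 'a
  proof (cases "norm (x\<star>) = 0")
    case False
    have "norm (x\<star>) * norm (x\<star>) <= norm x * norm (x\<star>)"
      using cstar_identity[of "x\<star>"] norm_mult_ineq[of x "x\<star>"] by (simp add: power2_eq_square)
    then show ?thesis using False by simp
  qed simp
  from this[of x] this[of "x\<star>"] show ?thesis by simp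
qed

lemma star_one [simp]: "(1 :: 'a::unital_cstar_algebra)\<star> = 1"
  by (metis mult.left_neutral star_mult star_star)

lemma star_power: "(x ^ n)\<star> = (x\<star>) ^ n" for x :: "'a::unital_cstar_algebra"
  by (induction n) (auto simp: star_mult power_commutes)

lemma scaleC_one [simp]: "1 *C x = x" for x :: "'a::cstar_algebra"
  using scaleC_of_real[of 1 x] by simp

lemma scaleC_zero_left [simp]: "0 *C x = 0" for x :: "'a::cstar_algebra"
  using scaleC_of_real[of 0 x] by simp

lemma scaleC_zero_right [simp]: "c *C 0 = 0" for c :: complex
  using norm_scaleC[of c 0] by simp

lemma scaleC_minus_right [simp]: "c *C (- x) = - (c *C x)" for x :: "'a::cstar_algebra"
  using scaleC_add_right[of c x "- x"] by (simp add: eq_neg_iff_add_eq_0 add.commute)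

lemma scaleC_minus_left: "(- c) *C x = - (c *C x)" for x :: "'a::cstar_algebra"
  using scaleC_add_left[of c "- c" x] by (simp add: eq_neg_iff_add_eq_0 add.commute)

lemma scaleC_diff_right: "c *C (x - y) = c *C x - c *C y" for x :: "'a::cstar_algebra"
  using scaleC_add_right[of c x "- y"] by simp

lemma scaleC_diff_left: "(c - d) *C x = c *C x - d *C x" for x :: "'a::cstar_algebra"
  using scaleC_add_left[of c "- d" x] by (simp add: scaleC_minus_left)

lemma bounded_linear_scaleC: "bounded_linear (scaleC c :: 'a::cstar_algebra => 'a)"
proof (rule bounded_linear_intro[where K = "cmod c"])
  show "c *C r *R x = r *R c *C x" for r and x :: 'a
    by (simp add: scaleC_scaleC mult.commute flip: scaleC_of_real)
qed (auto simp: scaleC_add_right norm_scaleC mult.commute)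

lemmas tendsto_scaleC [tendsto_intros] = bounded_linear.tendsto[OF bounded_linear_scaleC]

definition real_part :: "'a::cstar_algebra => 'a" where "real_part x = (1/2) *R (x + x\<star>)"
definition imag_part :: "'a::cstar_algebra => 'a" where "imag_part x = (- \<i> / 2) *C (x - x\<star>)"

lemma star_real_part: "(real_part x)\<star> = real_part x"
  by (simp add: real_part_def star_add)

lemma star_imag_part: "(imag_part x)\<star> = imag_part x"
  by (simp add: imag_part_def star_scaleC star_diff scaleC_diff_right scaleC_minus_left)

lemma real_imag_part: "real_part x + \<i> *C imag_part x = x"
proof -
  have "real_part x + \<i> *C imag_part x = (1/2) *R (x + x\<star>) + (1/2) *R (x - x\<star>)"
    using scaleC_of_real[of "1/2" "x - x\<star>"]
    by (simp add: real_part_def imag_part_def scaleC_scaleC)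
  also have "... = x" by (simp add: scaleR_right_diff_distrib scaleR_right_distrib flip: scaleR_left_distrib)
  finally show ?thesis .
qed

lemma norm_selfadjoint_square:
  "k\<star> = k ==> norm (k * k) = (norm k)\<^sup>2" for k :: "'a::cstar_algebra"
  using cstar_identity[of k] by simp

text \<open>Evaluating the norm of \<open>k + \<i> l\<close> through the C*-identity.\<close>

lemma norm_le_sum_squares:
  fixes k l :: "'a::cstar_algebra"
  assumes "k\<star> = k" "l\<star> = l" "k * l = l * k"
  shows "(norm k)\<^sup>2 <= norm (k * k + l * l)" "(norm l)\<^sup>2 <= norm (k * k + l * l)"
proof -
  define x where "x = k + \<i> *C l"
  have xs: "x\<star> = k - \<i> *C l"
    by (simp add: x_def star_add star_scaleC assms scaleC_minus_left)
  have "x\<star> * x = k * k + l * l"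
    unfolding xs unfolding x_def
    by (simp add: distrib_left left_diff_distrib mult_scaleC_left mult_scaleC_right assms(3) scaleC_scaleC
        scaleC_minus_left scaleC_diff_right)
  then have n: "(norm x)\<^sup>2 = norm (k * k + l * l)" by (metis cstar_identity)
  have "k = (1/2) *R (x + x\<star>)" unfolding xs by (simp add: x_def)
  then have "norm k = norm (x + x\<star>) / 2" by simp
  then have "norm k <= norm x"
    using norm_triangle_ineq[of x "x\<star>"] by simp
  then show "(norm k)\<^sup>2 <= norm (k * k + l * l)" unfolding n[symmetric] by (intro power_mono) auto
  have "2 *R (\<i> *C l) = x - x\<star>" unfolding xs by (simp add: x_def scaleR_2)
  then have "2 * norm l = norm (x - x\<star>)" by (metis norm_scaleC norm_scaleR norm_ii mult_1 abs_numeral)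
  then have "norm l <= norm x"
    using norm_triangle_ineq4[of x "x\<star>"] by simp
  then show "(norm l)\<^sup>2 <= norm (k * k + l * l)" unfolding n[symmetric] by (intro power_mono) auto
qed

section \<open>Square roots\<close>

text \<open>The Taylor coefficients of \<open>sqrt (1 - x)\<close>. All but the constant one are
  nonpositive and their absolute values sum to at most 1, so the series converges on the closed unit
  ball of a Banach algebra, boundary included.\<close>

definition sqrt_coeff :: "nat => real"
  where "sqrt_coeff n = ((1/2) gchoose n) * (- 1) ^ n"

lemma sqrt_coeff_0 [simp]: "sqrt_coeff 0 = 1"
  by (simp add: sqrt_coeff_def)

lemma sqrt_coeff_nonpos: "sqrt_coeff (Suc n) <= 0"
proof (induction n)
  case 0
  then show ?case by (simp add: sqrt_coeff_def)
next
  case (Suc n)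
  have "real (Suc (Suc n)) * ((1/2) gchoose Suc (Suc n)) = (1/2 - real (Suc n)) * ((1/2) gchoose Suc n)"
    using gbinomial_mult_1[of "1/2 :: real" "Suc n"] by (simp add: algebra_simps)
  then have e: "((1/2 :: real) gchoose Suc (Suc n)) = (1/2 - real (Suc n)) / real (Suc (Suc n)) * ((1/2) gchoose Suc n)"
    by (simp add: field_simps del: of_nat_Suc)
  have "sqrt_coeff (Suc (Suc n)) = ((real (Suc n) - 1/2) / real (Suc (Suc n))) * sqrt_coeff (Suc n)"
    unfolding sqrt_coeff_def e by (simp add: field_simps del: of_nat_Suc)
  moreover have "0 <= (real (Suc n) - 1/2) / real (Suc (Suc n))" by simp
  ultimately show ?case using Suc by (metis mult_nonneg_nonpos)
qed

text \<open>Abel's argument: for \<open>0 <= x < 1\<close> the partial sums stay below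
  \<open>1 - sqrt (1 - x) <= 1\<close>, because all terms are nonnegative; then \<open>x\<close>
  tends to 1 in a finite sum.\<close>

lemma sum_abs_sqrt_coeff: "(\<Sum>n<N. \<bar>sqrt_coeff (Suc n)\<bar>) <= 1"
proof -
  have "(\<Sum>n<N. - sqrt_coeff (Suc n) * x ^ Suc n) <= 1" if x: "0 <= x" "x < 1" for x :: real
  proof -
    have "(%n. ((1/2) gchoose n) * (- x) ^ n) sums (1 + (- x)) powr (1/2)"
      by (rule gen_binomial_real) (use x in auto)
    then have s: "(%n. sqrt_coeff n * x ^ n) sums (1 - x) powr (1/2)"
      by (simp add: sqrt_coeff_def power_minus[of x] mult.assoc)
    then have "(%n. - sqrt_coeff (Suc n) * x ^ Suc n) sums (1 - (1 - x) powr (1/2))"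
      using sums_minus[OF s[THEN sums_split_initial_segment[where n = 1]]] by simp
    then have "(\<Sum>n<N. - sqrt_coeff (Suc n) * x ^ Suc n) <= 1 - (1 - x) powr (1/2)"
      unfolding sums_iff using x(1)
      by (metis (no_types, lifting) sum_le_suminf finite_lessThan mult_nonneg_nonneg neg_0_le_iff_le
          sqrt_coeff_nonpos zero_le_power)
    then show ?thesis by (smt (verit) powr_ge_zero)
  qed
  then have "\<forall>\<^sub>F x in at_left 1. (\<Sum>n<N. - sqrt_coeff (Suc n) * x ^ Suc n) <= (1 :: real)"
    unfolding eventually_at_left_field by (intro exI[of _ 0]) auto
  moreover have "((%x :: real. \<Sum>n<N. - sqrt_coeff (Suc n) * x ^ Suc n)
      \<longlongrightarrow> (\<Sum>n<N. - sqrt_coeff (Suc n) * 1 ^ Suc n)) (at_left 1)"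
    by (intro tendsto_intros)
  ultimately have "(\<Sum>n<N. - sqrt_coeff (Suc n) * 1 ^ Suc n) <= 1"
    by (intro tendsto_upperbound[of _ _ "at_left (1 :: real)"]) auto
  then show ?thesis by (simp add: sqrt_coeff_nonpos)
qed

lemma summable_abs_sqrt_coeff: "summable (%n. \<bar>sqrt_coeff n\<bar>)"
proof -
  have "summable (%n. \<bar>sqrt_coeff (Suc n)\<bar>)"
    by (rule bounded_imp_summable[of _ 1]) (use sum_abs_sqrt_coeff[of "Suc _"] in \<open>auto simp: lessThan_Suc_atMost\<close>)
  then show ?thesis by (subst summable_Suc_iff[symmetric])
qed

definition sqrt_one_minus :: "'a::unital_cstar_algebra => 'a"
  where "sqrt_one_minus z = (\<Sum>n. sqrt_coeff n *R z ^ n)"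

text \<open>The Cauchy product has coefficients \<open>(1 gchoose k) * (- 1) ^ k\<close> by
  Vandermonde, and these vanish for \<open>k >= 2\<close>.\<close>

lemma sqrt_one_minus:
  fixes z :: "'a::unital_cstar_algebra"
  assumes z: "norm z <= 1"
  shows "sqrt_one_minus z * sqrt_one_minus z = 1 - z"
    and "norm (1 - sqrt_one_minus z) <= 1"
    and "z\<star> = z ==> (sqrt_one_minus z)\<star> = sqrt_one_minus z"
    and "y * z = z * y ==> y * sqrt_one_minus z = sqrt_one_minus z * y"
proof -
  let ?a = "%n. sqrt_coeff n *R z ^ n"
  have nle: "norm (?a n) <= \<bar>sqrt_coeff n\<bar>" for n
    using norm_power_ineq[of z n] z by (simp add: mult_left_le power_le_one order.trans)
  have sn: "summable (%n. norm (?a n))"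
    by (rule summable_comparison_test[OF _ summable_abs_sqrt_coeff]) (use nle in auto)
  have s: "summable ?a" by (rule summable_norm_cancel[OF sn])
  have conv: "(\<Sum>i\<le>k. sqrt_coeff i * sqrt_coeff (k - i)) = (1 gchoose k) * (- 1) ^ k" for k
  proof -
    have "(\<Sum>i\<le>k. sqrt_coeff i * sqrt_coeff (k - i)) =
       (\<Sum>i\<in>{0..k}. ((1/2) gchoose i) * ((1/2) gchoose (k - i))) * (- 1) ^ k"
      unfolding sum_distrib_right atLeast0AtMost
      by (intro sum.cong refl) (auto simp: sqrt_coeff_def simp flip: power_add)
    also have "... = (1 gchoose k) * (- 1) ^ k"
      using gbinomial_Vandermonde[of "1/2 :: real" "1/2" k] by simp
    finally show ?thesis .
  qed
  have "(%k. \<Sum>i\<le>k. ?a i * ?a (k - i)) sums (suminf ?a * suminf ?a)"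
    by (rule Cauchy_product_sums[OF sn sn])
  moreover have "(\<Sum>i\<le>k. ?a i * ?a (k - i)) = ((1 gchoose k) * (- 1) ^ k) *R z ^ k" for k
    unfolding conv[symmetric] scaleR_sum_left
    by (intro sum.cong refl) (auto simp: mult.commute simp flip: power_add)
  moreover have "(%k. ((1 gchoose k) * (- 1) ^ k) *R z ^ k) sums (\<Sum>k<2. ((1 gchoose k) * (- 1) ^ k) *R z ^ k)"
  proof (rule sums_finite)
    fix k :: nat assume "k \<notin> {..<2}"
    then have "(1 :: real) gchoose k = 0" using binomial_gbinomial[of 1 k, where ?'a = real] by (simp add: binomial_eq_0)
    then show "((1 gchoose k) * (- 1) ^ k) *R z ^ k = 0" by simp
  qed simp
  moreover have "(\<Sum>k<2. (((1 :: real) gchoose k) * (- 1) ^ k) *R z ^ k) = 1 - z"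
    by (simp add: numeral_2_eq_2)
  ultimately show "sqrt_one_minus z * sqrt_one_minus z = 1 - z"
    unfolding sqrt_one_minus_def by (metis (no_types, lifting) sums_cong sums_unique2)
  have "(%n. ?a (Suc n)) sums (sqrt_one_minus z - 1)"
    using s[THEN summable_sums, THEN sums_split_initial_segment[where n = 1]] by (simp add: sqrt_one_minus_def)
  moreover have "norm (\<Sum>n<N. ?a (Suc n)) <= 1" for N
    by (rule order.trans[OF norm_sum order.trans[OF sum_mono sum_abs_sqrt_coeff[of N]]]) (rule nle)
  ultimately have "norm (sqrt_one_minus z - 1) <= 1"
    unfolding sums_def by (intro tendsto_upperbound[OF tendsto_norm, of _ _ sequentially]) auto
  then show "norm (1 - sqrt_one_minus z) <= 1" by (simp add: norm_minus_commute)
  show "(sqrt_one_minus z)\<star> = sqrt_one_minus z" if "z\<star> = z"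
    unfolding sqrt_one_minus_def using bounded_linear.suminf[OF bounded_linear_star s]
    by (simp add: star_power that)
  show "y * sqrt_one_minus z = sqrt_one_minus z * y" if yz: "y * z = z * y"
  proof -
    have "y * z ^ n = z ^ n * y" for n
      by (induction n) (simp_all add: yz, metis yz mult.assoc)
    then show ?thesis
      unfolding sqrt_one_minus_def
      by (simp add: suminf_mult[OF s, symmetric] suminf_mult2[OF s])
  qed
qed

section \<open>Positivity\<close>

definition two_sided_unit :: "'a::ring_1 => bool"
  where "two_sided_unit x \<longleftrightarrow> (\<exists>y. x * y = 1 \<and> y * x = 1)"

lemma two_sided_unitI: "x * y = 1 ==> y * x = 1 ==> two_sided_unit x"
  by (auto simp: two_sided_unit_def)

lemma two_sided_unit_mult: "two_sided_unit x ==> two_sided_unit y ==> two_sided_unit (x * y)"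
proof -
  assume "two_sided_unit x" "two_sided_unit y"
  then obtain a b where "x * a = 1" "a * x = 1" "y * b = 1" "b * y = 1"
    by (auto simp: two_sided_unit_def)
  then have "x * y * (b * a) = 1" "b * a * (x * y) = 1"
    by (metis mult.assoc mult.right_neutral)+
  then show ?thesis by (rule two_sided_unitI)
qed

lemma two_sided_unit_factors:
  assumes "two_sided_unit (x * y)" "x * y = y * x"
  shows "two_sided_unit x"
proof -
  obtain z where z: "x * y * z = 1" "z * (x * y) = 1"
    using assms(1) by (auto simp: two_sided_unit_def)
  have "z * y * x = 1" using z(2) assms(2) by (simp add: mult.assoc)
  moreover have "x * (y * z) = 1" using z(1) by (simp add: mult.assoc)
  ultimately have "z * y = y * z" by (metis mult.assoc mult.left_neutral mult.right_neutral)
  with z show ?thesis by (intro two_sided_unitI[of x "y * z"]) (metis mult.assoc assms(2))+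
qed

lemma one_minus_unit:
  fixes u :: "'a::{real_normed_algebra_1,banach}"
  assumes "norm u < 1"
  obtains y where "(1 - u) * y = 1" "y * (1 - u) = 1" "norm y <= 1 / (1 - norm u)"
proof
  have nle: "norm (u ^ n) <= norm u ^ n" for n by (rule norm_power_ineq)
  have sg: "summable (%n. norm u ^ n)" using assms by (intro summable_geometric) simp
  have sn: "summable (%n. norm (u ^ n))"
    by (rule summable_comparison_test[OF _ sg]) (use nle in auto)
  have s: "summable (%n. u ^ n)" by (rule summable_norm_cancel[OF sn])
  have "(%n. u ^ n - u ^ Suc n) sums (u ^ 0 - 0)"
    by (rule telescope_sums'[OF LIMSEQ_power_zero]) (rule assms)
  then have t: "(\<Sum>n. u ^ n - u ^ Suc n) = 1" by (simp add: sums_iff)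
  have "(1 - u) * (\<Sum>n. u ^ n) = (\<Sum>n. u ^ n - u ^ Suc n)"
    by (subst suminf_mult[OF s, symmetric]) (simp add: left_diff_distrib)
  with t show "(1 - u) * (\<Sum>n. u ^ n) = 1" by simp
  have "(\<Sum>n. u ^ n) * (1 - u) = (\<Sum>n. u ^ n - u ^ Suc n)"
    by (subst suminf_mult2[OF s]) (simp add: right_diff_distrib power_commutes)
  with t show "(\<Sum>n. u ^ n) * (1 - u) = 1" by simp
  have "norm (\<Sum>n. u ^ n) <= (\<Sum>n. norm (u ^ n))" by (rule summable_norm[OF sn])
  also have "... <= (\<Sum>n. norm u ^ n)" by (rule suminf_le[OF nle sn sg])
  also have "... = 1 / (1 - norm u)" using assms by (subst suminf_geometric) auto
  finally show "norm (\<Sum>n. u ^ n) <= 1 / (1 - norm u)" .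
qed

text \<open>Commutation with the commutant of \<open>h\<close> is part of the notion, because roots
  are built before any functional calculus that would provide it.\<close>

definition commuting_sqrt :: "'a::unital_cstar_algebra => 'a => bool"
  where "commuting_sqrt h k \<longleftrightarrow> k\<star> = k \<and> k * k = h \<and> (\<forall>y. y * h = h * y --> y * k = k * y)"

lemma commuting_sqrtD:
  assumes "commuting_sqrt h k"
  shows "k\<star> = k" "k * k = h" "y * h = h * y ==> y * k = k * y"
  using assms unfolding commuting_sqrt_def by blast+

text \<open>The condition \<open>norm (t *R 1 - h) <= t\<close> is positivity expressed through the
  norm: \<open>z = 1 - h / t\<close> lies in the unit ball and
  \<open>sqrt t *R sqrt_one_minus z\<close> is the root. The root satisfies the same condition with
  \<open>sqrt t\<close>, so roots can be iterated.\<close>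

lemma norm_bound_imp_sqrt:
  assumes h: "h\<star> = h" "norm (t *R 1 - h) <= t"
  obtains k where "commuting_sqrt h k" "norm (sqrt t *R 1 - k) <= sqrt t"
proof (cases "t = 0")
  case True
  then have "h = 0" using h by simp
  then show ?thesis by (intro that[of 0]) (auto simp: commuting_sqrt_def True)
next
  case False
  then have t: "t > 0" using h(2) norm_ge_zero[of "t *R 1 - h"] by linarith
  define z where "z = 1 - (1/t) *R h"
  have "t *R z = t *R 1 - h" using t by (simp add: z_def scaleR_right_diff_distrib)
  then have "t * norm z <= t" using h(2) t by (metis norm_scaleR abs_of_pos)
  then have z: "norm z <= 1" using t by simp
  have zs: "z\<star> = z" by (simp add: z_def star_diff h)
  define k where "k = sqrt t *R sqrt_one_minus z"
  have "k * k = t *R (1 - z)"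
    using t by (simp add: k_def sqrt_one_minus(1)[OF z])
  also have "... = h" using t by (simp add: z_def)
  finally have kk: "k * k = h" .
  have "y * k = k * y" if "y * h = h * y" for y
  proof -
    have "y * z = z * y" by (simp add: z_def diff_distribs that)
    then show ?thesis by (simp add: k_def sqrt_one_minus(4)[OF z])
  qed
  moreover have "k\<star> = k" using sqrt_one_minus(3)[OF z zs] by (simp add: k_def)
  ultimately have "commuting_sqrt h k"
    unfolding commuting_sqrt_def using kk by blast
  have "norm (sqrt t *R 1 - k) = sqrt t * norm (1 - sqrt_one_minus z)"
    using t unfolding k_def by (simp flip: scaleR_right_diff_distrib)
  then have "norm (sqrt t *R 1 - k) <= sqrt t"
    using mult_left_mono[OF sqrt_one_minus(2)[OF z], of "sqrt t"] t by simp
  with \<open>commuting_sqrt h k\<close> show ?thesis by (rule that)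
qed

text \<open>The converse criterion. After scaling, \<open>m * m\<close> and
  \<open>l * l = 1 - m * m\<close> sum to 1, and \<open>norm_le_sum_squares\<close> bounds
  \<open>norm l\<close> by 1.\<close>

lemma square_norm_bound:
  fixes k :: "'a::unital_cstar_algebra"
  assumes k: "k\<star> = k" and t: "norm (k * k) <= t"
  shows "norm (t *R 1 - k * k) <= t"
proof (cases "t = 0")
  case False
  then have t0: "t > 0" using t norm_ge_zero[of "k * k"] by linarith
  define m where "m = (1 / sqrt t) *R k"
  have m: "m\<star> = m" by (simp add: m_def k)
  have mm: "m * m = (1/t) *R (k * k)" using t0 by (simp add: m_def)
  then have n: "norm (m * m) <= 1" using t t0 by simp
  define l where "l = sqrt_one_minus (m * m)"
  have l: "l * l = 1 - m * m" "l\<star> = l" "m * l = l * m"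
    unfolding l_def using sqrt_one_minus[OF n] m by (simp_all add: star_mult mult.assoc)
  have "(norm l)\<^sup>2 <= norm (m * m + l * l)" by (rule norm_le_sum_squares) (use m l in auto)
  then have "norm (1 - m * m) <= 1"
    using norm_selfadjoint_square[OF l(2)] by (simp add: l(1))
  moreover have "t *R 1 - k * k = t *R (1 - m * m)" using t0 by (simp add: mm scaleR_right_diff_distrib)
  ultimately show ?thesis using t0 by simp
qed (use t in auto)

text \<open>A provisional notion of positivity. It follows from
  \<open>norm (t *R 1 - h) <= t\<close> for some \<open>t\<close> and implies it for every
  \<open>t >= norm h\<close>; in that form sums and limits are accessible. Elements
  \<open>x\<star> * x\<close> are reached only in \<open>star_mult_self_sa_square\<close>.\<close>

definition sa_square :: "'a::unital_cstar_algebra => bool"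
  where "sa_square h \<longleftrightarrow> (\<exists>k. commuting_sqrt h k)"

lemma sa_square_self_adjoint: "sa_square h ==> h\<star> = h"
  unfolding sa_square_def by (metis commuting_sqrtD(1,2) star_mult)

lemma sa_squareI: "h\<star> = h ==> norm (t *R 1 - h) <= t ==> sa_square h"
  using norm_bound_imp_sqrt[of h t] by (auto simp: sa_square_def)

lemma sa_square_normD: "sa_square h ==> norm h <= t ==> norm (t *R 1 - h) <= t"
  unfolding sa_square_def by (metis commuting_sqrtD(1,2) square_norm_bound)

lemma square_sa_square: "k\<star> = k ==> sa_square (k * k)"
  using sa_squareI[of "k * k"] square_norm_bound[of k "norm (k * k)"] by (simp add: star_mult)

lemma sa_square_add:
  assumes "sa_square h" "sa_square k"
  shows "sa_square (h + k)"
proof (rule sa_squareI)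
  show "(h + k)\<star> = h + k" by (simp add: star_add sa_square_self_adjoint assms)
  have "(norm h + norm k) *R 1 - (h + k) = (norm h *R 1 - h) + (norm k *R 1 - k)"
    by (simp add: scaleR_left_distrib)
  moreover have "norm ((norm h *R 1 - h) + (norm k *R 1 - k)) <= norm h + norm k"
    using norm_triangle_ineq[of "norm h *R 1 - h" "norm k *R 1 - k"]
      sa_square_normD[OF assms(1) order_refl] sa_square_normD[OF assms(2) order_refl] by simp
  ultimately show "norm ((norm h + norm k) *R 1 - (h + k)) <= norm h + norm k" by (simp only:)
qed

lemma sa_square_scaleR:
  assumes "sa_square h" "0 <= r"
  shows "sa_square (r *R h)"
proof -
  obtain k where "k\<star> = k" "k * k = h"
    using assms(1) commuting_sqrtD(1,2) unfolding sa_square_def by blast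
  then show ?thesis using square_sa_square[of "sqrt r *R k"] assms(2) by simp
qed

lemma sa_square_real: "0 <= r ==> sa_square (r *R 1)"
  using sa_square_scaleR[OF square_sa_square[of 1]] by simp

lemma sa_square_closed:
  assumes "!!n. sa_square (X n)" "X \<longlonglongrightarrow> h"
  shows "sa_square h"
proof -
  have lim: "(%n. norm (norm (X n) *R 1 - X n)) \<longlonglongrightarrow> norm (norm h *R 1 - h)"
    by (intro tendsto_intros assms)
  have "norm (norm h *R 1 - h) <= norm h"
    by (rule LIMSEQ_le[OF lim tendsto_norm[OF assms(2)]]) (use sa_square_normD[OF assms(1) order_refl] in auto)
  moreover have "h\<star> = h"
    using LIMSEQ_unique[OF tendsto_star[OF assms(2)]] assms(2) by (simp add: sa_square_self_adjoint[OF assms(1)])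
  ultimately show ?thesis by (intro sa_squareI[of h "norm h"])
qed

lemma scaled_unit:
  fixes x :: "'a::real_algebra_1"
  assumes "two_sided_unit x" "r ~= 0"
  shows "two_sided_unit (r *R x)"
proof -
  obtain y where "x * y = 1" "y * x = 1" using assms by (auto simp: two_sided_unit_def)
  then show ?thesis using assms(2) by (intro two_sided_unitI[of _ "(1/r) *R y"]) auto
qed

text \<open>Neumann series: \<open>h + s\<close> is a multiple of \<open>1 - u\<close> with
  \<open>norm u <= norm h / (norm h + s) < 1\<close>.\<close>

lemma sa_square_shift_unit:
  assumes "sa_square h" "0 < s"
  shows "two_sided_unit (h + s *R 1)"
proof -
  let ?t = "norm h"
  define u where "u = (1 / (?t + s)) *R (?t *R 1 - h)"
  have ts: "?t + s > 0" using assms(2) by (simp add: add_nonneg_pos)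
  have "norm u <= ?t / (?t + s)"
    using sa_square_normD[OF assms(1) order_refl] ts by (simp add: u_def divide_right_mono)
  also have "... < 1" using ts assms(2) by simp
  finally have "two_sided_unit (1 - u)" by (metis one_minus_unit two_sided_unitI)
  moreover have "h + s *R 1 = (?t + s) *R (1 - u)"
    using ts by (simp add: u_def scaleR_right_diff_distrib scaleR_left_distrib)
  ultimately show ?thesis using scaled_unit[of "1 - u" "?t + s"] ts by simp
qed

text \<open>One of \<open>\<plusminus>\<parallel>h\<parallel>\<close> lies in the spectrum of a self-adjoint \<open>h\<close>. Otherwise \<open>\<parallel>h\<parallel>\<^sup>2 - h\<^sup>2\<close> is bounded below
  by a positive constant, which contradicts \<open>\<parallel>h\<^sup>2\<parallel> = \<parallel>h\<parallel>\<^sup>2\<close>.\<close>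

lemma norm_in_spectrum:
  fixes h :: "'a::unital_cstar_algebra"
  assumes h: "h\<star> = h" "two_sided_unit (norm h *R 1 - h)" "two_sided_unit (norm h *R 1 + h)"
  shows False
proof -
  define t where "t = norm h"
  define c where "c = t\<^sup>2 *R 1 - h * h"
  have c: "c = (t *R 1 - h) * (t *R 1 + h)"
    by (simp add: c_def left_diff_distrib distrib_left power2_eq_square scaleR_right_diff_distrib)
  have cs: "c\<star> = c" by (simp add: c_def star_diff star_mult h)
  have nc: "norm (t\<^sup>2 *R 1 - c) <= t\<^sup>2"
    by (simp add: c_def norm_selfadjoint_square h t_def)
  then obtain k where k: "commuting_sqrt c k" using sa_squareI[OF cs] unfolding sa_square_def by blast
  have "two_sided_unit c" unfolding c by (rule two_sided_unit_mult) (use h in \<open>auto simp: t_def\<close>)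
  then obtain d where d: "c * d = 1" "d * c = 1" by (auto simp: two_sided_unit_def)
  have hc: "h * c = c * h" by (simp add: c_def diff_distribs mult.assoc)
  have kk: "k * k = c" "k\<star> = k" "h * k = k * h"
    using commuting_sqrtD[OF k] hc by blast+
  have kc: "k * c = c * k" unfolding kk(1)[symmetric] by (simp add: mult.assoc)
  have dcomm: "y * d = d * y" if "y * c = c * y" for y
  proof -
    have "d * (y * c) * d = d * (c * y) * d" using that by simp
    then show ?thesis by (metis d mult.assoc mult.left_neutral mult.right_neutral)
  qed
  define m where "m = k * d"
  have ds: "d\<star> = d"
  proof -
    have "d\<star> * c = 1" using arg_cong[OF d(1), of star] by (simp add: star_mult cs)
    then show ?thesis by (metis d(1) mult.assoc mult.left_neutral mult.right_neutral)
  qed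
  have m: "m\<star> = m" "m * m = d"
  proof -
    show "m\<star> = m" using dcomm[OF kc] by (simp add: m_def star_mult ds kk)
    have "m * m = k * (d * k) * d" by (simp add: m_def mult.assoc)
    also have "d * k = k * d" using dcomm[OF kc] by simp
    also have "k * (k * d) * d = d" using kk(1) d by (metis mult.assoc mult.left_neutral)
    finally show "m * m = d" .
  qed
  define s where "s = norm d"
  have "d ~= 0" using d by auto
  then have s: "s > 0" by (simp add: s_def)
  have nct: "norm c <= t\<^sup>2"
    using square_norm_bound[OF h(1), of "t\<^sup>2"] by (simp add: c_def norm_selfadjoint_square h t_def)
  have e: "1 / s <= t\<^sup>2"
  proof -
    have "1 <= norm c * s" using norm_mult_ineq[of c d] d(1) by (simp add: s_def)
    also have "... <= t\<^sup>2 * s" using nct s by (intro mult_right_mono) auto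
    finally show ?thesis using s by (simp add: divide_simps)
  qed
  have "sa_square (s *R 1 - d)"
    by (rule sa_squareI[where t = s]) (simp_all add: s_def star_diff ds)
  then obtain l where l: "commuting_sqrt (s *R 1 - d) l"
    unfolding sa_square_def by blast
  have ll: "l * l = s *R 1 - d" "l\<star> = l" "y * d = d * y ==> y * l = l * y" for y
    using commuting_sqrtD(1,2)[OF l] commuting_sqrtD(3)[OF l, of y]
    by (simp_all add: diff_distribs)
  have kl: "k * l = l * k" and hl: "h * l = l * h" by (intro ll dcomm kc hc)+
  \<comment> \<open>\<open>c\<close> is at least \<open>1 / s\<close>, and \<open>r\<close> is a
    root of the difference. So \<open>h * h + r * r\<close> is the scalar
    \<open>t\<^sup>2 - 1 / s\<close>, of norm less than \<open>norm (h * h)\<close>, against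
    \<open>norm_le_sum_squares\<close>.\<close>
  define r where "r = (1 / sqrt s) *R (k * l)"
  have r: "r\<star> = r" "h * r = r * h"
    by (simp_all add: r_def star_mult kk ll kl) (metis hl kk(3) kl mult.assoc)
  have "(k * l) * (k * l) = k * k * (l * l)" by (metis kl mult.assoc)
  also have "... = s *R c - 1" by (simp add: kk ll right_diff_distrib d)
  finally have "r * r = c - (1 / s) *R 1" using s by (simp add: r_def scaleR_right_diff_distrib)
  then have "h * h + r * r = (t\<^sup>2 - 1 / s) *R 1" by (simp add: c_def scaleR_left_diff_distrib)
  then have "t\<^sup>2 <= \<bar>t\<^sup>2 - 1 / s\<bar>"
    using norm_le_sum_squares(1)[OF h(1) r] by (simp add: t_def)
  then show False using e s by simp
qed

lemma sa_square_antisym: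
  assumes "!!s. s > 0 ==> two_sided_unit (s *R 1 - h)" "!!s. s > 0 ==> two_sided_unit (s *R 1 + h)" "h\<star> = h"
  shows "h = (0 :: 'a::unital_cstar_algebra)"
  using norm_in_spectrum[OF assms(3)] assms(1,2)[of "norm h"] by auto

text \<open>Uses that \<open>y\<star>y\<close> and \<open>yy\<star>\<close> have the same spectrum away from \<open>0\<close>.\<close>

lemma neg_star_mult_self:
  assumes "sa_square (- (y\<star> * y))"
  shows "y = 0"
proof -
  let ?h = "y\<star> * y"
  define p q where "p = real_part y" and "q = imag_part y"
  have y: "y = p + \<i> *C q" by (simp add: p_def q_def real_imag_part)
  have pq: "p\<star> = p" "q\<star> = q" by (simp_all add: p_def q_def star_real_part star_imag_part)
  have ys: "y\<star> = p - \<i> *C q" by (simp add: y star_add star_scaleC pq scaleC_minus_left)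
  \<comment> \<open>Since \<open>y\<star> * y\<close> is negative, this displays
    \<open>y * y\<star>\<close> as a sum of positive elements.\<close>
  have "y * y\<star> = 2 *R (p * p + q * q) + - ?h"
    unfolding ys unfolding y
    by (simp add: add_distribs diff_distribs mult_scaleC_left
        mult_scaleC_right scaleC_scaleC scaleC_minus_left scaleC_diff_right scaleC_add_right scaleR_2)
  then have "sa_square (y * y\<star>)"
    using assms by (simp only:) (intro sa_square_add sa_square_scaleR square_sa_square pq, auto)
  have 1: "two_sided_unit (s *R 1 + ?h)" if s: "s > 0" for s
  proof -
    obtain z where z: "(y * y\<star> + s *R 1) * z = 1" "z * (y * y\<star> + s *R 1) = 1"
      using sa_square_shift_unit[OF \<open>sa_square (y * y\<star>)\<close> s] by (auto simp: two_sided_unit_def)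
    have z1: "y * y\<star> * z = 1 - s *R z" "z * (y * y\<star>) = 1 - s *R z"
      using z by (simp_all add: add_distribs eq_diff_eq)
    show ?thesis
    \<comment> \<open>The standard formula carrying an inverse \<open>z\<close> of
      \<open>y * y\<star> + s\<close> over to \<open>y\<star> * y + s\<close>.\<close>
    proof (rule two_sided_unitI[where y = "(1/s) *R (1 - y\<star> * z * y)"])
      have "?h * (y\<star> * z * y) = y\<star> * (y * y\<star> * z) * y" by (simp add: mult.assoc)
      also have "... = ?h - s *R (y\<star> * z * y)" unfolding z1 by (simp add: diff_distribs)
      finally show "(s *R 1 + ?h) * ((1/s) *R (1 - y\<star> * z * y)) = 1"
        using s by (simp add: distrib_right right_diff_distrib scaleR_right_distrib)
      have "(y\<star> * z * y) * ?h = y\<star> * (z * (y * y\<star>)) * y" by (simp add: mult.assoc)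
      also have "... = ?h - s *R (y\<star> * z * y)" unfolding z1 by (simp add: diff_distribs)
      finally show "((1/s) *R (1 - y\<star> * z * y)) * (s *R 1 + ?h) = 1"
        using s by (simp add: distrib_left left_diff_distrib scaleR_right_distrib)
    qed
  qed
  have "two_sided_unit (s *R 1 - ?h)" if "s > 0" for s
    using sa_square_shift_unit[OF assms that] by simp
  then have "?h = 0" by (rule sa_square_antisym) (use 1 in \<open>auto simp: star_mult\<close>)
  then show ?thesis using cstar_identity[of y] by simp
qed

text \<open>With \<open>k\<close> the root of \<open>h * h\<close>, the element
  \<open>v = k - h\<close> is twice the negative part of \<open>h\<close>. Then
  \<open>(x * v)\<star> * (x * v) = v * h * v\<close> is \<open>- 1/2\<close> times the positive
  \<open>v * v * v\<close>, so \<open>x * v = 0\<close> by \<open>neg_star_mult_self\<close>; hence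
  \<open>v = 0\<close> and \<open>h = k\<close>.\<close>

lemma star_mult_self_sa_square:
  shows "sa_square (x\<star> * x)"
proof -
  define h where "h = x\<star> * x"
  have h: "h\<star> = h" by (simp add: h_def star_mult)
  have "norm ((norm (h * h)) *R 1 - h * h) <= norm (h * h)" by (rule square_norm_bound[OF h]) simp
  then obtain k where k: "commuting_sqrt (h * h) k" "norm (sqrt (norm (h * h)) *R 1 - k) <= sqrt (norm (h * h))"
    using norm_bound_imp_sqrt[of "h * h"] by (metis h star_mult)
  have ks: "k\<star> = k" "k * k = h * h" "h * k = k * h"
    using commuting_sqrtD(1,2)[OF k(1)] commuting_sqrtD(3)[OF k(1), of h] by (simp_all add: mult.assoc)
  have "sa_square k" by (rule sa_squareI[OF ks(1) k(2)])
  then obtain l where "commuting_sqrt k l" by (auto simp: sa_square_def)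
  then have l: "l\<star> = l" "l * l = k" "y * k = k * y ==> y * l = l * y" for y
    using commuting_sqrtD by blast+
  define v where "v = k - h"
  have v: "v\<star> = v" by (simp add: v_def star_diff ks h)
  have vk: "v * k = k * v" by (simp add: v_def diff_distribs ks)
  have vv: "v * v = 2 *R (k * v)"
    by (simp add: v_def diff_distribs ks scaleR_2)
  have vhv: "v * h * v = - (1/2) *R (v * v * v)"
  proof -
    have "v * h = - (k * v)"
      by (simp add: v_def diff_distribs ks)
    then have "v * h = - (1/2) *R (v * v)" unfolding vv by simp
    then show ?thesis by simp
  qed
  have vl: "v * l = l * v" by (rule l(3)[OF vk])
  have "v * v * v = 2 *R ((l * v) * (l * v))"
  proof -
    have "(l * v) * (l * v) = l * l * v * v" by (metis vl mult.assoc)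
    then show ?thesis using vv by (simp add: l)
  qed
  moreover have "sa_square ((l * v) * (l * v))" by (rule square_sa_square) (simp add: star_mult l v vl)
  moreover have e: "(x * v)\<star> * (x * v) = v * h * v" by (simp add: h_def star_mult v mult.assoc)
  ultimately have "sa_square (- ((x * v)\<star> * (x * v)))" unfolding e vhv by simp
  then have "x * v = 0" by (rule neg_star_mult_self)
  then have "v * v * v = 0" using vhv e by simp
  then have "(v * v) * (v * v) = 0" by (metis mult.assoc mult_zero_left)
  then have "v * v = 0" using norm_selfadjoint_square[of "v * v"] v by (simp add: star_mult)
  then have "v = 0" using norm_selfadjoint_square[of v] v by simp
  then show ?thesis using \<open>sa_square k\<close> by (simp add: v_def flip: h_def)
qed

section \<open>The cone of positive elements\<close>

abbreviation (input) cpos :: "'a::cstar_algebra => bool" where "cpos h \<equiv> h \<in> positive_elements UNIV"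

lemma cpos_iff_sa_square: "cpos h \<longleftrightarrow> sa_square h"
proof
  assume "sa_square h"
  then obtain k where "k\<star> * k = h" unfolding sa_square_def by (metis commuting_sqrtD(1,2))
  then show "cpos h" by (auto simp: positive_elements_def)
qed (auto simp: positive_elements_def star_mult_self_sa_square)

lemma cpos_star_mult [simp]: "cpos (x\<star> * x)"
  by (auto simp: positive_elements_def)

lemma cpos_mult_star [simp]: "cpos (x * x\<star>)"
  using cpos_star_mult[of "x\<star>"] by simp

lemma cpos_self_adjoint: "cpos h ==> h\<star> = h" for h :: "'a::cstar_algebra"
  by (auto simp: positive_elements_def star_mult)

lemma cpos_zero [simp]: "cpos 0"
  using cpos_star_mult[of 0] by simp

lemma cpos_add: "cpos h ==> cpos k ==> cpos (h + k)" for h k :: "'a::unital_cstar_algebra"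
  by (simp add: cpos_iff_sa_square sa_square_add)

lemma cpos_sum: "(!!i. i \<in> I ==> cpos (f i)) ==> cpos (sum f I)" for f :: "_ => 'a::unital_cstar_algebra"
  by (induction I rule: infinite_finite_induct) (auto intro: cpos_add)

lemma cpos_scaleR: "cpos h ==> 0 <= r ==> cpos (r *R h)" for h :: "'a::unital_cstar_algebra"
  by (simp add: cpos_iff_sa_square sa_square_scaleR)

lemma cpos_real: "0 <= r ==> cpos (r *R 1 :: 'a::unital_cstar_algebra)"
  by (simp add: cpos_iff_sa_square sa_square_real)

lemma cpos_conj: "cpos h ==> cpos (x\<star> * h * x)" for h :: "'a::cstar_algebra"
proof -
  assume "cpos h"
  then obtain y where "h = y\<star> * y" by (auto simp: positive_elements_def)
  then have "x\<star> * h * x = (y * x)\<star> * (y * x)" by (simp add: star_mult mult.assoc)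
  then show ?thesis by simp
qed

lemma cpos_conj': "cpos h ==> cpos (x * h * x\<star>)" for h :: "'a::cstar_algebra"
  using cpos_conj[of h "x\<star>"] by simp

lemma cpos_closed: "(!!n. cpos (X n)) ==> X \<longlonglongrightarrow> h ==> cpos h" for h :: "'a::unital_cstar_algebra"
  unfolding cpos_iff_sa_square by (rule sa_square_closed)

lemma cpos_antisym:
  fixes h :: "'a::unital_cstar_algebra"
  assumes "cpos h" "cpos (- h)"
  shows "h = 0"
  by (rule sa_square_antisym)
    (use assms sa_square_shift_unit[of h] sa_square_shift_unit[of "- h"]
      in \<open>auto simp: cpos_iff_sa_square add.commute sa_square_self_adjoint\<close>)

lemma cpos_norm_diff: "h\<star> = h ==> norm h <= r ==> cpos (r *R 1 - h)" for h :: "'a::unital_cstar_algebra"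
  unfolding cpos_iff_sa_square by (rule sa_squareI[where t = r]) (auto simp: star_diff)

text \<open>If \<open>norm h > r\<close>, both \<open>norm h + h\<close> and
  \<open>norm h - h\<close> would be invertible, contrary to \<open>norm_in_spectrum\<close>; for
  \<open>h = 0\<close> it must be seen that \<open>r\<close> is not negative.\<close>

lemma norm_le_cposI:
  fixes h :: "'a::unital_cstar_algebra"
  assumes "cpos h" "cpos (r *R 1 - h)"
  shows "norm h <= r"
proof -
  have hs: "h\<star> = h" using assms(1) by (rule cpos_self_adjoint)
  have "two_sided_unit (norm h *R 1 + h)" if "norm h > 0"
    using sa_square_shift_unit[of h "norm h"] assms(1) that by (simp add: cpos_iff_sa_square add.commute)
  moreover have "two_sided_unit (norm h *R 1 - h)" if "norm h > r"
    using sa_square_shift_unit[of "r *R 1 - h" "norm h - r"] assms(2) that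
    by (simp add: cpos_iff_sa_square scaleR_left_diff_distrib)
  moreover have "norm h >= 0" "norm h = 0 ==> r >= 0"
  proof -
    assume "norm h = 0"
    then have r: "cpos (r *R 1 :: 'a)" using assms(2) by simp
    show "r >= 0"
    proof (rule ccontr)
      assume "\<not> 0 <= r"
      then have "cpos (- (r *R 1 :: 'a))" using cpos_real[of "- r"] by simp
      then have "r *R (1 :: 'a) = 0" using r by (rule cpos_antisym[rotated])
      then show False using \<open>\<not> 0 <= r\<close> by simp
    qed
  qed simp
  ultimately show ?thesis using norm_in_spectrum[OF hs] by (cases "norm h = 0") fastforce+
qed

section \<open>Continuous functional calculus for self-adjoint elements\<close>

text \<open>Only real points are recorded. For self-adjoint \<open>h\<close> this is the whole
  spectrum, by \<open>rspec_real\<close>.\<close>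

definition rspec :: "'a::unital_cstar_algebra => real set"
  where "rspec h = {t. \<not> two_sided_unit (h - t *R 1)}"

definition cpeval :: "complex poly => 'a::unital_cstar_algebra => 'a"
  where "cpeval p h = fold_coeffs (%a v. a *C 1 + h * v) p 0"

lemma cpeval_0 [simp]: "cpeval 0 h = 0"
  by (simp add: cpeval_def)

lemma cpeval_pCons [simp]: "cpeval (pCons a p) h = a *C 1 + h * cpeval p h"
  by (cases "p = 0 \<and> a = 0") (auto simp: cpeval_def)

lemma cpeval_add: "cpeval (p + q) h = cpeval p h + cpeval q h"
proof (induction p arbitrary: q)
  case (pCons a p)
  obtain b r where "q = pCons b r" by (cases q)
  then show ?case by (simp add: pCons.IH scaleC_add_left algebra_simps)
qed simp

lemma cpeval_smult: "cpeval (Polynomial.smult c p) h = c *C cpeval p h"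
  by (induction p) (auto simp: scaleC_add_right scaleC_scaleC mult_scaleC_right)

lemma cpeval_mult: "cpeval (p * q) h = cpeval p h * cpeval q h"
  by (induction p) (auto simp: cpeval_add cpeval_smult distrib_right mult_scaleC_left mult.assoc)

text \<open>Over the complex numbers \<open>q\<close> splits into linear factors, each invertible at
  \<open>h\<close>. Applied to \<open>p - s\<close> this is the spectral mapping theorem; real
  polynomials enter through \<open>cpeval_of_real\<close>.\<close>

lemma cpeval_unit:
  assumes "q ~= 0" "!!R. poly q R = 0 ==> two_sided_unit (h - R *C 1)"
  shows "two_sided_unit (cpeval q h)"
  using assms
proof (induction "degree q" arbitrary: q)
  case 0
  then obtain a where q: "q = [:a:]" "a ~= 0" using degree_eq_zeroE[of q] by (metis pCons_0_0)
  then show ?case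
    by (intro two_sided_unitI[of _ "(1/a) *C 1"]) (auto simp: mult_scaleC_left mult_scaleC_right scaleC_scaleC)
next
  case (Suc n)
  then have "\<not> constant (poly q)" by (metis constant_degree nat.distinct(1))
  then obtain R where R: "poly q R = 0" using fundamental_theorem_of_algebra by blast
  then obtain r where r: "q = [:- R, 1:] * r" by (metis dvdE poly_eq_0_iff_dvd)
  then have r0: "r ~= 0" using Suc by auto
  have "degree q = Suc (degree r)" unfolding r using r0 by (subst degree_mult_eq) auto
  moreover have "two_sided_unit (h - s *C 1)" if "poly r s = 0" for s
    using Suc(4)[of s] that by (simp add: r)
  ultimately have "two_sided_unit (cpeval r h)" using Suc r0 by auto
  moreover have "two_sided_unit (cpeval [:- R, 1:] h)"
    using Suc(4)[OF R] by (simp add: scaleC_minus_left)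
  ultimately show ?case unfolding r cpeval_mult by (intro two_sided_unit_mult)
qed

definition peval :: "real poly => 'a::unital_cstar_algebra => 'a"
  where "peval p h = fold_coeffs (%a v. a *R 1 + h * v) p 0"

lemma peval_0 [simp]: "peval 0 h = 0"
  by (simp add: peval_def)

lemma peval_pCons [simp]: "peval (pCons a p) h = a *R 1 + h * peval p h"
  by (cases "p = 0 \<and> a = 0") (auto simp: peval_def)

lemma cpeval_of_real: "cpeval (map_poly complex_of_real p) h = peval p h"
  by (induction p) (auto simp: map_poly_pCons scaleC_of_real)

lemma peval_add: "peval (p + q) h = peval p h + peval q h"
proof (induction p arbitrary: q)
  case (pCons a p)
  obtain b r where "q = pCons b r" by (cases q)
  then show ?case by (simp add: pCons.IH algebra_simps)
qed simp

lemma peval_smult: "peval (Polynomial.smult c p) h = c *R peval p h"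
  by (induction p) (auto simp: scaleR_add_right)

lemma peval_mult: "peval (p * q) h = peval p h * peval q h"
  by (induction p) (auto simp: peval_add peval_smult distrib_right mult.assoc)

lemma peval_diff: "peval (p - q) h = peval p h - peval q h"
  using peval_add[of "p - q" q h] by simp

lemma peval_commute: "y * h = h * y ==> y * peval p h = peval p h * y"
proof (induction p)
  case (pCons a p)
  have "y * (h * peval p h) = h * peval p h * y"
    using pCons by (metis mult.assoc)
  then show ?case by (simp add: add_distribs)
qed simp

lemma peval_star: "h\<star> = h ==> (peval p h)\<star> = peval p h"
proof (induction p)
  case (pCons a p)
  then show ?case using peval_commute[of h h p] by (simp add: star_add star_mult)
qed simp

text \<open>For nonreal \<open>r\<close>, multiplying \<open>h - r\<close> by its conjugate gives
  \<open>k * k + (Im r)\<^sup>2\<close>, which is invertible as a shifted square.\<close>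

lemma rspec_real:
  fixes h :: "'a::unital_cstar_algebra"
  assumes h: "h\<star> = h" and n: "\<not> two_sided_unit (h - r *C 1)"
  shows "r = complex_of_real (Re r)" "Re r \<in> rspec h"
proof -
  define k where "k = h - Re r *R 1"
  have k: "k\<star> = k" by (simp add: k_def star_diff h)
  have r: "r = complex_of_real (Re r) + \<i> * complex_of_real (Im r)" by (rule complex_eq)
  have "r *C 1 = Re r *R 1 + \<i> *C Im r *R (1 :: 'a)"
    by (subst r) (simp add: scaleC_add_left scaleC_of_real flip: scaleC_scaleC)
  then have hk: "h - r *C 1 = k - \<i> *C Im r *R 1" by (simp add: k_def)
  show im: "r = complex_of_real (Re r)"
  proof (rule ccontr)
    assume "r ~= complex_of_real (Re r)"
    then have im: "Im r ~= 0" by (auto simp: complex_eq_iff)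
    let ?v = "k + \<i> *C Im r *R 1"
    have "(h - r *C 1) * ?v = k * k + (Im r)\<^sup>2 *R 1"
      and "?v * (h - r *C 1) = k * k + (Im r)\<^sup>2 *R 1"
      unfolding hk
      by (simp_all add: algebra_simps mult_scaleC_left mult_scaleC_right scaleC_scaleC power2_eq_square
          scaleC_minus_left scaleC_diff_right scaleC_add_right bounded_linear.linear[OF bounded_linear_scaleC, THEN linear_scale])
    moreover have "two_sided_unit (k * k + (Im r)\<^sup>2 *R 1)"
      by (rule sa_square_shift_unit[OF square_sa_square[OF k]]) (use im in simp)
    ultimately show False using n two_sided_unit_factors[of "h - r *C 1" ?v] by simp
  qed
  show "Re r \<in> rspec h"
    using n unfolding rspec_def by (subst (asm) im) (simp add: scaleC_of_real)
qed

lemma rspec_bounded: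
  assumes "t \<in> rspec h"
  shows "\<bar>t\<bar> <= norm h"
proof (rule ccontr)
  assume "\<not> \<bar>t\<bar> <= norm h"
  moreover from this have "t ~= 0" by auto
  ultimately have t: "norm ((1/t) *R h) < 1" "t ~= 0" by auto
  then have "two_sided_unit (1 - (1/t) *R h)" by (metis one_minus_unit two_sided_unitI)
  from scaled_unit[OF this, of "- t"] t(2) have "two_sided_unit (h - t *R 1)"
    by (simp add: scaleR_right_diff_distrib)
  with assms show False by (simp add: rspec_def)
qed

lemma rspec_norm:
  assumes h: "h\<star> = h"
  obtains t where "t \<in> rspec h" "\<bar>t\<bar> = norm h"
proof -
  have "\<not> two_sided_unit (norm h *R 1 - h) \<or> \<not> two_sided_unit (norm h *R 1 + h)"
    using norm_in_spectrum[OF h] by blast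
  then show thesis
  proof
    assume n: "\<not> two_sided_unit (norm h *R 1 - h)"
    have "norm h \<in> rspec h"
      using scaled_unit[of "h - norm h *R 1" "- 1"] n by (auto simp: rspec_def)
    then show thesis by (rule that) simp
  next
    assume n: "\<not> two_sided_unit (norm h *R 1 + h)"
    then have "- norm h \<in> rspec h" by (simp add: rspec_def add.commute)
    then show thesis by (rule that) simp
  qed
qed

lemma rspec_nonempty: "h\<star> = h ==> rspec h ~= {}"
  using rspec_norm by blast

lemma poly_map_poly_of_real:
  "poly (map_poly complex_of_real p) (complex_of_real x) = complex_of_real (poly p x)"
  by (induction p) (auto simp: map_poly_pCons)

lemma rspec_peval:
  assumes h: "h\<star> = h" and s: "s \<in> rspec (peval p h)"
  obtains t where "t \<in> rspec h" "poly p t = s"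
proof -
  define q where "q = map_poly complex_of_real (p - [:s:])"
  have pq: "cpeval q h = peval p h - s *R 1"
    unfolding q_def cpeval_of_real by (simp add: peval_diff)
  then have n: "\<not> two_sided_unit (cpeval q h)" using s by (simp add: rspec_def)
  show thesis
  proof (cases "q = 0")
    case True
    have "poly p t = s" for t
      using poly_map_poly_of_real[of "p - [:s:]" t] True by (simp flip: q_def del: of_real_diff)
    then show thesis using rspec_nonempty[OF h] that by blast
  next
    case False
    then obtain r where r: "poly q r = 0" "\<not> two_sided_unit (h - r *C 1)"
      using cpeval_unit[OF False] n by blast
    from r(1) have "poly (p - [:s:]) (Re r) = 0"
      unfolding q_def rspec_real(1)[OF h r(2), THEN arg_cong[of _ _ "poly q"], unfolded q_def] poly_map_poly_of_real
      by simp
    then show thesis using that[OF rspec_real(2)[OF h r(2)]] by simp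
  qed
qed

text \<open>A self-adjoint element attains its norm on its spectrum, and the spectral points of
  \<open>peval p h\<close> are values of \<open>p\<close> on \<open>rspec h\<close>.\<close>

lemma peval_norm_le:
  assumes h: "h\<star> = h" and B: "!!t. t \<in> rspec h ==> \<bar>poly p t\<bar> <= B"
  shows "norm (peval p h) <= B"
  using rspec_norm[OF peval_star[OF h]] rspec_peval[OF h] B by metis

lemma polynomial_approximation:
  fixes f :: "real => real"
  assumes "continuous_on UNIV f" "0 < e"
  obtains p where "!!t. \<bar>t\<bar> <= R ==> \<bar>poly p t - f t\<bar> < e"
proof -
  have "continuous_on {-R..R} f" using assms(1) continuous_on_subset by blast
  from Stone_Weierstrass_real_polynomial_function[OF _ this assms(2)]
  obtain g where g: "real_polynomial_function g" "!!t. t \<in> {-R..R} ==> \<bar>f t - g t\<bar> < e" by auto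
  then obtain a n where a: "g = (%x. \<Sum>i\<le>n. a i * x ^ i)" by (auto simp: real_polynomial_function_iff_sum)
  have "poly (\<Sum>i\<le>n. monom (a i) i) t = g t" for t by (simp add: a poly_sum poly_monom)
  then show thesis
    using that[of "\<Sum>i\<le>n. monom (a i) i"] g(2) by (simp add: abs_minus_commute abs_le_iff)
qed

text \<open>Approximation is on the interval of radius \<open>R\<close>, later
  \<open>norm h\<close>, rather than on the spectrum: functions continuous on the whole line then
  need no domain conditions, and the spectrum enters through comparison of values.\<close>

definition cfc_poly :: "(real => real) => real => nat => real poly"
  where "cfc_poly f R n = (SOME p. \<forall>t. \<bar>t\<bar> <= R --> \<bar>poly p t - f t\<bar> < 1 / Suc n)"

lemma cfc_poly: "continuous_on UNIV f ==> \<bar>t\<bar> <= R ==> \<bar>poly (cfc_poly f R n) t - f t\<bar> < 1 / Suc n"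
proof -
  assume f: "continuous_on UNIV f" and t: "\<bar>t\<bar> <= R"
  obtain p where "!!t. \<bar>t\<bar> <= R ==> \<bar>poly p t - f t\<bar> < 1 / Suc n"
    using polynomial_approximation[OF f, of "1 / Suc n" R] by auto
  then have "\<exists>p. \<forall>t. \<bar>t\<bar> <= R --> \<bar>poly p t - f t\<bar> < 1 / Suc n" by blast
  from someI_ex[OF this] t show ?thesis unfolding cfc_poly_def by blast
qed

definition cfc :: "(real => real) => 'a::unital_cstar_algebra => 'a"
  where "cfc f h = lim (%n. peval (cfc_poly f (norm h) n) h)"

lemma cfc_tendsto:
  assumes f: "continuous_on UNIV f" and h: "h\<star> = h"
  shows "(%n. peval (cfc_poly f (norm h) n) h) \<longlonglongrightarrow> cfc f h"
proof -
  let ?p = "%n. cfc_poly f (norm h) n"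
  have "norm (peval (?p m) h - peval (?p n) h) <= 1 / Suc m + 1 / Suc n" for m n
    unfolding peval_diff[symmetric]
  proof (rule peval_norm_le[OF h])
    fix t assume "t \<in> rspec h"
    then have "\<bar>t\<bar> <= norm h" by (rule rspec_bounded)
    from cfc_poly[OF f this, of m] cfc_poly[OF f this, of n]
    show "\<bar>poly (?p m - ?p n) t\<bar> <= 1 / Suc m + 1 / Suc n" unfolding poly_diff by simp
  qed
  then have "Cauchy (%n. peval (?p n) h)"
  proof (intro CauchyI)
    fix e :: real assume "0 < e"
    then obtain N where N: "1 / Suc N < e / 2" using nat_approx_posE[of "e/2"] by auto
    have "norm (peval (?p m) h - peval (?p n) h) < e" if "m >= N" "n >= N" for m n
    proof -
      have "1 / real (Suc m) <= 1 / Suc N" "1 / real (Suc n) <= 1 / Suc N" using that by (auto simp: frac_le)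
      then show ?thesis using \<open>norm (peval (?p m) h - peval (?p n) h) <= 1 / Suc m + 1 / Suc n\<close> N by simp
    qed
    then show "\<exists>M. \<forall>m\<ge>M. \<forall>n\<ge>M. norm (peval (?p m) h - peval (?p n) h) < e" by blast
  qed
  then show ?thesis unfolding cfc_def by (simp add: Cauchy_convergent_iff convergent_LIMSEQ_iff)
qed

lemma cfc_close_peval:
  assumes f: "continuous_on UNIV f" and h: "h\<star> = h" and e: "!!t. t \<in> rspec h ==> \<bar>f t - poly p t\<bar> <= e"
  shows "norm (cfc f h - peval p h) <= e"
proof (rule tendsto_upperbound)
  let ?p = "%n. cfc_poly f (norm h) n"
  show "(%n. norm (peval (?p n) h - peval p h) - 1 / Suc n) \<longlonglongrightarrow> norm (cfc f h - peval p h)"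
    using tendsto_diff[OF tendsto_norm[OF tendsto_diff[OF cfc_tendsto[OF f h] tendsto_const]] LIMSEQ_Suc[OF lim_1_over_n]]
    by simp
  have "norm (peval (?p n) h - peval p h) <= e + 1 / Suc n" for n
    unfolding peval_diff[symmetric]
  proof (rule peval_norm_le[OF h])
    fix t assume t: "t \<in> rspec h"
    from cfc_poly[OF f rspec_bounded[OF this], of n] e[OF t]
    show "\<bar>poly (?p n - p) t\<bar> <= e + 1 / Suc n" unfolding poly_diff by simp
  qed
  then show "\<forall>\<^sub>F n in sequentially. norm (peval (?p n) h - peval p h) - 1 / Suc n <= e"
    by (intro always_eventually) (simp add: algebra_simps)
qed simp

text \<open>The device behind the algebraic rules below: an element approximated by the same
  polynomials as \<open>f\<close> must be \<open>cfc f h\<close>.\<close>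

lemma cfc_eqI:
  assumes f: "continuous_on UNIV f" and h: "h\<star> = h"
    and p: "!!e. e > 0 ==> \<exists>p. (\<forall>t\<in>rspec h. \<bar>f t - poly p t\<bar> <= e) \<and> norm (x - peval p h) <= e"
  shows "cfc f h = x"
proof (rule ccontr)
  assume "cfc f h ~= x"
  then have d: "norm (cfc f h - x) > 0" by simp
  from p[of "norm (cfc f h - x) / 3"] d
  obtain q where q: "\<forall>t\<in>rspec h. \<bar>f t - poly q t\<bar> <= norm (cfc f h - x) / 3"
      "norm (x - peval q h) <= norm (cfc f h - x) / 3" by auto
  have "norm (cfc f h - peval q h) <= norm (cfc f h - x) / 3"
    by (rule cfc_close_peval[OF f h]) (use q in auto)
  with q(2) norm_triangle_ineq4[of "cfc f h - peval q h" "x - peval q h"] d show False by simp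
qed

lemma cfc_approx:
  assumes "continuous_on UNIV f" "h\<star> = h" "e > 0"
  obtains p where "!!t. \<bar>t\<bar> <= norm h ==> \<bar>f t - poly p t\<bar> <= e" "norm (cfc f h - peval p h) <= e"
proof -
  obtain p where p: "!!t. \<bar>t\<bar> <= norm h ==> \<bar>poly p t - f t\<bar> < e" using polynomial_approximation[OF assms(1,3), of "norm h"] by blast
  show thesis
  proof (rule that)
    show *: "\<bar>f t - poly p t\<bar> <= e" if "\<bar>t\<bar> <= norm h" for t using p[OF that] by simp
    show "norm (cfc f h - peval p h) <= e"
      by (rule cfc_close_peval[OF assms(1,2)]) (rule *, rule rspec_bounded)
  qed
qed

context
  fixes h :: "'a::unital_cstar_algebra"
  assumes h: "h\<star> = h"
begin

lemma cfc_poly_eq: "cfc (poly p) h = peval p h"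
  by (rule cfc_eqI[OF _ h]) (auto intro!: continuous_intros exI[of _ p])

lemma cfc_const: "cfc (%_. c) h = c *R 1"
proof -
  have "poly [:c:] = (%_. c)" by auto
  then show ?thesis using cfc_poly_eq[of "[:c:]"] by simp
qed

lemma cfc_id: "cfc (%t. t) h = h"
proof -
  have "poly [:0, 1:] = (%t. t :: real)" by auto
  then show ?thesis using cfc_poly_eq[of "[:0, 1:]"] by simp
qed

lemma cfc_cong:
  assumes "continuous_on UNIV f" "continuous_on UNIV g" "!!t. t \<in> rspec h ==> f t = g t"
  shows "cfc f h = cfc g h"
proof (rule cfc_eqI[OF assms(1) h])
  fix e :: real assume "e > 0"
  obtain p where "!!t. \<bar>t\<bar> <= norm h ==> \<bar>g t - poly p t\<bar> <= e" "norm (cfc g h - peval p h) <= e"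
    using cfc_approx[OF assms(2) h \<open>e > 0\<close>] by blast
  then show "\<exists>p. (\<forall>t\<in>rspec h. \<bar>f t - poly p t\<bar> <= e) \<and> norm (cfc g h - peval p h) <= e"
    using assms(3) rspec_bounded by metis
qed

lemma cfc_add:
  assumes f: "continuous_on UNIV f" and g: "continuous_on UNIV g"
  shows "cfc (%t. f t + g t) h = cfc f h + cfc g h"
proof (rule cfc_eqI[OF _ h])
  fix e :: real assume "e > 0"
  then have e2: "e / 2 > 0" by simp
  obtain p where p: "!!t. \<bar>t\<bar> <= norm h ==> \<bar>f t - poly p t\<bar> <= e/2" "norm (cfc f h - peval p h) <= e/2"
    using cfc_approx[OF f h e2] by blast
  obtain q where q: "!!t. \<bar>t\<bar> <= norm h ==> \<bar>g t - poly q t\<bar> <= e/2" "norm (cfc g h - peval q h) <= e/2"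
    using cfc_approx[OF g h e2] by blast
  show "\<exists>p. (\<forall>t\<in>rspec h. \<bar>f t + g t - poly p t\<bar> <= e) \<and> norm (cfc f h + cfc g h - peval p h) <= e"
  proof (intro exI conjI ballI)
    show "\<bar>f t + g t - poly (p + q) t\<bar> <= e" if "t \<in> rspec h" for t
      using p(1)[OF rspec_bounded[OF that]] q(1)[OF rspec_bounded[OF that]] unfolding poly_add by linarith
    show "norm (cfc f h + cfc g h - peval (p + q) h) <= e"
      using p(2) q(2) norm_triangle_ineq[of "cfc f h - peval p h" "cfc g h - peval q h"]
      by (simp add: peval_add algebra_simps)
  qed
qed (intro continuous_intros f g)

lemma cfc_mult:
  assumes f: "continuous_on UNIV f" and g: "continuous_on UNIV g"
  shows "cfc (%t. f t * g t) h = cfc f h * cfc g h"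
proof (rule cfc_eqI[OF _ h])
  fix e :: real assume e: "e > 0"
  have c: "compact ((%t. \<bar>f t\<bar> + \<bar>g t\<bar>) ` {- norm h..norm h})"
    by (intro compact_continuous_image continuous_intros continuous_on_subset[OF f] continuous_on_subset[OF g]) auto
  obtain M where M': "!!y. y \<in> (%t. \<bar>f t\<bar> + \<bar>g t\<bar>) ` {- norm h..norm h} ==> norm y <= M"
    using compact_imp_bounded[OF c] unfolding bounded_iff by blast
  have M: "\<bar>f t\<bar> + \<bar>g t\<bar> <= M" if "\<bar>t\<bar> <= norm h" for t
    using M'[of "\<bar>f t\<bar> + \<bar>g t\<bar>"] that by (simp add: abs_le_iff image_iff) (metis abs_le_iff abs_minus_cancel that atLeastAtMost_iff minus_le_iff)
  define N where "N = M + norm (cfc f h) + norm (cfc g h) + 2"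
  have "0 <= M" using M[of 0] by simp
  then have N: "N >= 2" "M + 1 <= N" "norm (cfc f h) + 1 <= N" "norm (cfc g h) + 1 <= N" by (auto simp: N_def)
  \<comment> \<open>\<open>d <= 1\<close> keeps the approximants below \<open>N\<close>, so both
    cross terms are at most \<open>N * d\<close>.\<close>
  define d where "d = min 1 (e / (2 * N))"
  have d: "d > 0" "d <= 1" "d * N + N * d <= e" using e N by (auto simp: d_def min_def)
  obtain p where p: "!!t. \<bar>t\<bar> <= norm h ==> \<bar>f t - poly p t\<bar> <= d" "norm (cfc f h - peval p h) <= d"
    using cfc_approx[OF f h d(1)] by blast
  obtain q where q: "!!t. \<bar>t\<bar> <= norm h ==> \<bar>g t - poly q t\<bar> <= d" "norm (cfc g h - peval q h) <= d"
    using cfc_approx[OF g h d(1)] by blast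
  show "\<exists>p. (\<forall>t\<in>rspec h. \<bar>f t * g t - poly p t\<bar> <= e) \<and> norm (cfc f h * cfc g h - peval p h) <= e"
  proof (intro exI conjI ballI)
    show "\<bar>f t * g t - poly (p * q) t\<bar> <= e" if "t \<in> rspec h" for t
    proof -
    have t: "\<bar>t\<bar> <= norm h" using that by (rule rspec_bounded)
    have "\<bar>f t * g t - poly p t * poly q t\<bar> = \<bar>(f t - poly p t) * g t + poly p t * (g t - poly q t)\<bar>"
      by (simp add: algebra_simps)
    also have "... <= \<bar>f t - poly p t\<bar> * \<bar>g t\<bar> + \<bar>poly p t\<bar> * \<bar>g t - poly q t\<bar>"
      unfolding abs_mult[symmetric] by simp
    also have "... <= d * N + N * d"
      by (intro add_mono mult_mono) (use p(1)[OF t] q(1)[OF t] M[OF t] N d in auto)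
    finally show ?thesis using d(3) by simp
    qed
    have "cfc f h * cfc g h - peval p h * peval q h
        = (cfc f h - peval p h) * cfc g h + peval p h * (cfc g h - peval q h)"
      by (simp add: algebra_simps)
    also have "norm ... <= norm (cfc f h - peval p h) * norm (cfc g h) + norm (peval p h) * norm (cfc g h - peval q h)"
      by (intro norm_triangle_le add_mono norm_mult_ineq)
    also have "... <= d * N + N * d"
    proof -
      have "norm (peval p h) <= N"
        using p(2) norm_triangle_sub[of "peval p h" "cfc f h"] N d by (simp add: norm_minus_commute)
      then show ?thesis by (intro add_mono mult_mono) (use p(2) q(2) N d in auto)
    qed
    finally show "norm (cfc f h * cfc g h - peval (p * q) h) <= e" using d(3) by (simp add: peval_mult)
  qed
qed (intro continuous_intros f g)

lemma cfc_star: "continuous_on UNIV f ==> (cfc f h)\<star> = cfc f h"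
  using LIMSEQ_unique[OF tendsto_star[OF cfc_tendsto[OF _ h]]] cfc_tendsto[OF _ h]
  by (simp add: peval_star[OF h])

lemma cfc_scaleR: "continuous_on UNIV f ==> cfc (%t. c * f t) h = c *R cfc f h"
  using cfc_mult[of "%_. c" f] by (simp add: cfc_const)

lemma cfc_diff:
  "continuous_on UNIV f ==> continuous_on UNIV g ==> cfc (%t. f t - g t) h = cfc f h - cfc g h"
  using cfc_add[of f "%t. - 1 * g t"] cfc_scaleR[of g "- 1"] by (simp add: continuous_on_minus)

lemma cfc_commute:
  assumes "continuous_on UNIV f" "y * h = h * y"
  shows "y * cfc f h = cfc f h * y"
  using LIMSEQ_unique[OF tendsto_mult_left[OF cfc_tendsto[OF assms(1) h], of y]]
    tendsto_mult_right[OF cfc_tendsto[OF assms(1) h], of y]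
  by (simp add: peval_commute[OF assms(2)])

lemma cfc_norm_le:
  assumes f: "continuous_on UNIV f" and B: "!!t. t \<in> rspec h ==> \<bar>f t\<bar> <= B"
  shows "norm (cfc f h) <= B"
  using cfc_close_peval[OF f h, of 0 B] B by simp

lemma cfc_cpos:
  assumes f: "continuous_on UNIV f" and pos: "!!t. t \<in> rspec h ==> 0 <= f t"
  shows "cpos (cfc f h)"
proof -
  let ?g = "%t. sqrt \<bar>f t\<bar>"
  have g: "continuous_on UNIV ?g" by (intro continuous_intros f)
  have "cfc f h = cfc (%t. ?g t * ?g t) h"
    by (rule cfc_cong) (use pos in \<open>auto intro!: continuous_intros f\<close>)
  also have "... = cfc ?g h * cfc ?g h" by (rule cfc_mult[OF g g])
  also have "... = (cfc ?g h)\<star> * cfc ?g h" by (simp only: cfc_star[OF g])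
  finally show ?thesis by simp
qed

lemma cfc_mem_closed:
  assumes f: "continuous_on UNIV f" "f 0 = 0"
    and B: "subspace B" "closed B" "!!x y. x \<in> B ==> y \<in> B ==> x * y \<in> B" "h \<in> B"
  shows "cfc f h \<in> B"
proof -
  have pe: "h * peval p h \<in> B" for p
  proof (induction p)
    case (pCons a p)
    then show ?case using B by (simp add: distrib_left subspace_add subspace_scale)
  qed (use B(1) in \<open>simp add: subspace_0\<close>)
  have "\<exists>y\<in>B. dist y (cfc f h) < e" if "e > 0" for e
  proof -
    obtain p where p: "!!t. \<bar>t\<bar> <= norm h ==> \<bar>f t - poly p t\<bar> <= e/4" "norm (cfc f h - peval p h) <= e/4"
      using cfc_approx[OF f(1) h, of "e/4"] \<open>e > 0\<close> by auto
    obtain a q where q: "p = pCons a q" by (cases p)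
    have "\<bar>a\<bar> <= e/4" using p(1)[of 0] by (simp add: q f(2))
    then have "norm ((cfc f h - peval p h) + a *R 1) <= e/4 + e/4"
      using p(2) norm_triangle_ineq[of "cfc f h - peval p h" "a *R 1"] by simp
    moreover have "cfc f h - h * peval q h = (cfc f h - peval p h) + a *R 1" by (simp add: q)
    ultimately have "norm (cfc f h - h * peval q h) <= e/4 + e/4" by (simp only:)
    then show ?thesis using pe[of q] \<open>e > 0\<close> by (intro bexI[of _ "h * peval q h"]) (auto simp: dist_norm norm_minus_commute)
  qed
  then have "cfc f h \<in> closure B" by (simp add: closure_approachable)
  then show ?thesis using B(2) by simp
qed

end

lemma cpos_iff_rspec:
  assumes h: "h\<star> = h"
  shows "cpos h \<longleftrightarrow> rspec h \<subseteq> {0..}"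
proof
  assume c: "cpos h"
  show "rspec h \<subseteq> {0..}"
  proof
    fix t assume t: "t \<in> rspec h"
    show "t \<in> {0..}"
    proof (rule ccontr)
      assume "t \<notin> {0..}"
      then have "two_sided_unit (h + (- t) *R 1)"
        using c by (intro sa_square_shift_unit) (auto simp: cpos_iff_sa_square)
      with t show False by (simp add: rspec_def)
    qed
  qed
next
  assume r: "rspec h \<subseteq> {0..}"
  have "cpos (cfc (%t. t) h)" by (rule cfc_cpos[OF h]) (use r in auto)
  then show "cpos h" by (simp add: cfc_id[OF h])
qed

lemma cpos_rspec: "cpos h ==> t \<in> rspec h ==> 0 <= t"
  using cpos_iff_rspec[of h] cpos_self_adjoint[of h] by auto

section \<open>Cuntz comparison in a C*-subalgebra\<close>

lemma norm_add_less: "norm (y :: 'a::real_normed_vector) <= p ==> norm z < q ==> x = y + z ==> p + q <= e ==> norm x < e"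
  using norm_triangle_ineq[of y z] by simp

lemma cuntz_subequivI:
  assumes "!!e. e > 0 ==> \<exists>v\<in>B. norm (v * b * v\<star> - a) < e"
  shows "cuntz_subequiv B a b"
proof -
  have "\<forall>n. \<exists>v\<in>B. norm (v * b * v\<star> - a) < 1 / Suc n" using assms by simp
  then obtain v where v: "!!n. v n \<in> B" "!!n. norm (v n * b * (v n)\<star> - a) < 1 / Suc n" by metis
  have "(%n. v n * b * (v n)\<star> - a) \<longlonglongrightarrow> 0"
    by (rule LIMSEQ_norm_0) (rule v(2))
  then have "(%n. v n * b * (v n)\<star>) \<longlonglongrightarrow> a" by (simp add: LIM_zero_iff)
  with v(1) show ?thesis unfolding cuntz_subequiv_def by blast
qed

lemma cuntz_subequivD:
  assumes "cuntz_subequiv B a b" "e > 0"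
  obtains v where "v \<in> B" "norm (v * b * v\<star> - a) < e"
proof -
  obtain v where v: "!!n. v n \<in> B" "(%n. v n * b * (v n)\<star>) \<longlonglongrightarrow> a"
    using assms(1) by (auto simp: cuntz_subequiv_def)
  from LIMSEQ_D[OF v(2) assms(2)] v(1) that show thesis by blast
qed

lemma norm_conj_le: "norm (v * x * v\<star>) <= (norm v)\<^sup>2 * norm x" for x :: "'a::cstar_algebra"
proof -
  have "norm (v * x * v\<star>) <= norm v * norm x * norm (v\<star>)"
    by (rule order.trans[OF norm_mult_ineq mult_right_mono[OF norm_mult_ineq]]) simp
  then show ?thesis by (simp add: power2_eq_square mult_ac)
qed

lemma cuntz_subequiv_trans:
  assumes "cuntz_subequiv B a b" "cuntz_subequiv B b c" "!!x y. x \<in> B ==> y \<in> B ==> x * y \<in> B"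
  shows "cuntz_subequiv B a c"
proof (rule cuntz_subequivI)
  fix e :: real assume e: "e > 0"
  obtain v where v: "v \<in> B" "norm (v * b * v\<star> - a) < e/2" using cuntz_subequivD[OF assms(1), of "e/2"] e by auto
  define d where "d = e / (2 * ((norm v)\<^sup>2 + 1))"
  have "(norm v)\<^sup>2 + 1 > 0" by (simp add: add_nonneg_pos)
  then have d: "d > 0" "(norm v)\<^sup>2 * d <= e/2" using e by (auto simp: d_def field_simps)
  obtain w where w: "w \<in> B" "norm (w * c * w\<star> - b) < d" using cuntz_subequivD[OF assms(2) d(1)] by auto
  have "norm (v * (w * c * w\<star> - b) * v\<star>) <= (norm v)\<^sup>2 * d"
    using w(2) by (intro order.trans[OF norm_conj_le] mult_left_mono) auto
  moreover have "(v * w) * c * (v * w)\<star> - a = v * (w * c * w\<star> - b) * v\<star> + (v * b * v\<star> - a)"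
    by (simp add: star_mult algebra_simps)
  ultimately have "norm ((v * w) * c * (v * w)\<star> - a) < e"
    by (rule norm_add_less[OF _ v(2)]) (use d in auto)
  then show "\<exists>v\<in>B. norm (v * c * v\<star> - a) < e" using assms(3) v(1) w(1) by blast
qed

lemma cuntz_subequiv_limit:
  assumes "!!e. e > 0 ==> \<exists>a'. cuntz_subequiv B a' b \<and> norm (a' - a) < e"
  shows "cuntz_subequiv B a b"
proof (rule cuntz_subequivI)
  fix e :: real assume "e > 0"
  then obtain a' where a': "cuntz_subequiv B a' b" "norm (a' - a) < e/2" using assms[of "e/2"] by auto
  obtain v where "v \<in> B" "norm (v * b * v\<star> - a') < e/2" using cuntz_subequivD[OF a'(1), of "e/2"] \<open>e > 0\<close> by auto
  then show "\<exists>v\<in>B. norm (v * b * v\<star> - a) < e"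
    using a'(2) norm_triangle_ineq[of "v * b * v\<star> - a'" "a' - a"] by (intro bexI[of _ v]) auto
qed

lemma cuntz_subequiv_conj:
  assumes "v \<in> B"
  shows "cuntz_subequiv B (v * b * v\<star>) b"
  unfolding cuntz_subequiv_def using assms by (intro exI[of _ "%_. v"]) auto

lemma cstar_subalgebraD:
  assumes "cstar_subalgebra B"
  shows "subspace B" "closed B" "x \<in> B ==> y \<in> B ==> x * y \<in> B" "x \<in> B ==> x\<star> \<in> B"
    "x \<in> B ==> y \<in> B ==> x + y \<in> B" "x \<in> B ==> y \<in> B ==> x - y \<in> B" "x \<in> B ==> r *R x \<in> B" "0 \<in> B"
  using assms unfolding cstar_subalgebra_def
  by (auto intro: subspace_add subspace_scale subspace_diff subspace_0)

lemma cstar_subalgebra_UNIV [simp]: "cstar_subalgebra UNIV"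
  by (auto simp: cstar_subalgebra_def)

text \<open>The cut-down \<open>(a - e)_+\<close> of Cuntz theory.\<close>

definition cutoff :: "real => 'a::unital_cstar_algebra => 'a"
  where "cutoff e = cfc (%t. max (t - e) 0)"

text \<open>The absolute value only makes the function total; on a positive element this is the
  square root.\<close>

definition csqrt_el :: "'a::unital_cstar_algebra => 'a"
  where "csqrt_el = cfc (%t. sqrt \<bar>t\<bar>)"

lemma csqrt_el:
  assumes "cpos a"
  shows "(csqrt_el a)\<star> = csqrt_el a" "csqrt_el a * csqrt_el a = a"
proof -
  note a = cpos_self_adjoint[OF assms]
  have c: "continuous_on UNIV (%t. sqrt \<bar>t\<bar>)" by (intro continuous_intros)
  show "(csqrt_el a)\<star> = csqrt_el a" unfolding csqrt_el_def by (rule cfc_star[OF a c])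
  have "csqrt_el a * csqrt_el a = cfc (%t. sqrt \<bar>t\<bar> * sqrt \<bar>t\<bar>) a"
    unfolding csqrt_el_def by (rule cfc_mult[OF a c c, symmetric])
  also have "... = cfc (%t. t) a"
    by (rule cfc_cong[OF a]) (use cpos_rspec[OF assms] in \<open>auto intro!: continuous_intros\<close>)
  finally show "csqrt_el a * csqrt_el a = a" by (simp add: cfc_id[OF a])
qed

lemma cut_props:
  assumes "cpos a" "e > 0"
  shows "cpos (cutoff e a)" "norm (a - cutoff e a) <= e" "a * cutoff e a = cutoff e a * a"
proof -
  note a = cpos_self_adjoint[OF assms(1)]
  have c: "continuous_on UNIV (%t. max (t - e) (0 :: real))" by (intro continuous_intros)
  show "cpos (cutoff e a)" unfolding cutoff_def by (rule cfc_cpos[OF a c]) simp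
  have "a - cutoff e a = cfc (%t. t - max (t - e) 0) a"
    unfolding cutoff_def by (subst cfc_diff[OF a]) (auto intro!: continuous_intros simp: cfc_id[OF a])
  also have "norm ... <= e"
    by (rule cfc_norm_le[OF a]) (use cpos_rspec[OF assms(1)] assms(2) in \<open>force intro!: continuous_intros\<close>)+
  finally show "norm (a - cutoff e a) <= e" .
  show "a * cutoff e a = cutoff e a * a" unfolding cutoff_def by (rule cfc_commute[OF a c]) simp
qed

context
  fixes B :: "'b::unital_cstar_algebra set"
  assumes B: "cstar_subalgebra B"
begin

lemmas Bs = cstar_subalgebraD[OF B]

lemma sub_trans: "cuntz_subequiv B a b ==> cuntz_subequiv B b c ==> cuntz_subequiv B a c"
  by (rule cuntz_subequiv_trans) (auto intro: Bs)

lemma cfc_mem: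
  assumes "continuous_on UNIV f" "f 0 = 0" "h\<star> = h" "h \<in> B"
  shows "cfc f h \<in> B"
  by (rule cfc_mem_closed[OF assms(3,1,2)]) (use Bs assms in auto)

text \<open>When \<open>f 0\<close> is not \<open>0\<close>, \<open>cfc f h\<close> lies only in
  \<open>B\<close> with a unit adjoined; multiplication by \<open>x\<close> turns the scalar part
  into a multiple of \<open>x\<close>.\<close>

lemma mult_cfc_mem:
  assumes f: "continuous_on UNIV f" and h: "h\<star> = h" "h \<in> B" and x: "x \<in> B"
  shows "x * cfc f h \<in> B"
proof -
  have c: "continuous_on UNIV (%t. f t - f 0)" by (intro continuous_intros f)
  have "cfc f h = cfc (%t. f t - f 0) h + f 0 *R 1"
    using cfc_diff[OF h(1) f, of "%_. f 0"] by (simp add: cfc_const[OF h(1)])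
  then have "x * cfc f h = x * cfc (%t. f t - f 0) h + f 0 *R x" by (simp add: distrib_left)
  moreover have "cfc (%t. f t - f 0) h \<in> B" by (rule cfc_mem[OF c]) (use h in auto)
  ultimately show ?thesis using x Bs by simp
qed

lemma cut_mem: "cpos a ==> a \<in> B ==> e > 0 ==> cutoff e a \<in> B"
  unfolding cutoff_def by (rule cfc_mem) (auto intro!: continuous_intros simp: cpos_self_adjoint)

lemma csqrt_el_mem: "cpos a ==> a \<in> B ==> csqrt_el a \<in> B"
  unfolding csqrt_el_def by (rule cfc_mem) (auto intro!: continuous_intros simp: cpos_self_adjoint)

lemma positive_elements_sub: "positive_elements B = {a \<in> B. cpos a}"
proof (intro equalityI subsetI)
  fix a assume "a \<in> positive_elements B"
  then show "a \<in> {a \<in> B. cpos a}" using Bs by (auto simp: positive_elements_def)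
next
  fix a assume a: "a \<in> {a \<in> B. cpos a}"
  then have "a = (csqrt_el a)\<star> * csqrt_el a" using csqrt_el[of a] by simp
  then show "a \<in> positive_elements B" using csqrt_el_mem[of a] a unfolding positive_elements_def by blast
qed

text \<open>Let \<open>r\<close> be the root of \<open>a\<close> and \<open>x\<close> the power
  \<open>-1/2\<close> of \<open>b + d\<close>. Then \<open>v = r * x\<close> gives
  \<open>v * b * v\<star> = a - d *R (r * x * x * r)\<close>. The error is \<open>d\<close> times
  the norm of \<open>x * a * x\<close>, which is at most \<open>\<bar>C\<bar>\<close> because
  \<open>x * b * x <= 1\<close>.\<close>

lemma dominated_cuntz_subequiv:
  assumes a: "cpos a" "a \<in> B" and b: "cpos b" "b \<in> B" and ab: "cpos (C *R b - a)"
  shows "cuntz_subequiv B a b"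
proof (rule cuntz_subequivI)
  fix e :: real assume e: "e > 0"
  define d where "d = e / (2 * (\<bar>C\<bar> + 1))"
  have d: "d > 0" "d * \<bar>C\<bar> < e" using e add_nonneg_pos[OF mult_nonneg_nonneg[OF less_imp_le[OF e] abs_ge_zero[of C]], of "e * 2"] by (auto simp: d_def field_simps)
  let ?f = "%t. 1 / sqrt (\<bar>t\<bar> + d)"
  have f: "continuous_on UNIV ?f" using d by (intro continuous_intros) (auto simp: add_nonneg_eq_0_iff)
  note bs = cpos_self_adjoint[OF b(1)]
  define r where "r = csqrt_el a"
  have r: "r\<star> = r" "r * r = a" "r \<in> B" using csqrt_el[OF a(1)] csqrt_el_mem[OF a] by (auto simp: r_def)
  define x where "x = cfc ?f b"
  have x: "x\<star> = x" unfolding x_def by (rule cfc_star[OF bs f])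
  have ff: "continuous_on UNIV (%t. ?f t * t * ?f t)" by (intro continuous_on_mult f continuous_on_id)
  have xbx0: "x * b * x = cfc (%t. ?f t * t * ?f t) b"
    unfolding x_def by (subst cfc_mult[OF bs], (intro continuous_on_mult f continuous_on_id)+)+ (simp add: cfc_id[OF bs])
  have fi: "?f t * t * ?f t = 1 - d * (?f t * ?f t)" if "t >= 0" for t
    using that d by (simp add: field_simps)
  have "x * b * x = cfc (%t. 1 - d * (?f t * ?f t)) b"
    unfolding xbx0
  proof (rule cfc_cong[OF bs ff])
    show "continuous_on UNIV (%t. 1 - d * (?f t * ?f t))" by (intro continuous_on_diff continuous_on_mult f continuous_on_const)
    show "?f t * t * ?f t = 1 - d * (?f t * ?f t)" if "t \<in> rspec b" for t
      using fi cpos_rspec[OF b(1) that] by blast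
  qed
  also have "... = 1 - d *R (x * x)"
  proof -
    have "cfc (%t. 1 - d * (?f t * ?f t)) b = cfc (%t. 1) b - cfc (%t. d * (?f t * ?f t)) b"
      by (rule cfc_diff[OF bs]) (intro continuous_intros continuous_on_mult f)+
    also have "cfc (%t. d * (?f t * ?f t)) b = d *R cfc (%t. ?f t * ?f t) b"
      by (rule cfc_scaleR[OF bs]) (intro continuous_on_mult f)
    also have "cfc (%t. ?f t * ?f t) b = x * x" unfolding x_def by (rule cfc_mult[OF bs f f])
    finally show ?thesis by (simp add: cfc_const[OF bs])
  qed
  finally have xbx: "x * b * x = 1 - d *R (x * x)" .
  have "(r * x) * b * (r * x)\<star> = r * (x * b * x) * r" by (simp add: star_mult r x mult.assoc)
  also have "... = a - d *R ((x * r)\<star> * (x * r))"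
    unfolding xbx by (simp add: algebra_simps star_mult r x)
  finally have "norm ((r * x) * b * (r * x)\<star> - a) = d * norm ((x * r)\<star> * (x * r))" using d by simp
  also have "norm ((x * r)\<star> * (x * r)) = norm ((x * r) * (x * r)\<star>)"
    using cstar_identity[of "(x * r)\<star>"] by (simp add: cstar_identity)
  also have "(x * r) * (x * r)\<star> = x * a * x" by (simp add: star_mult r x mult.assoc flip: r(2))
  also have "norm (x * a * x) <= \<bar>C\<bar>"
  proof (rule norm_le_cposI)
    show "cpos (x * a * x)" using cpos_conj[OF a(1), of x] by (simp add: x)
    have p1: "cpos (x * (C *R b - a) * x)" using cpos_conj[OF ab, of x] by (simp add: x)
    have p2: "cpos (x * b * x)" using cpos_conj[OF b(1), of x] by (simp add: x)
    have p3: "cpos (x * x)" using cpos_star_mult[of x] by (simp add: x)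
    have "\<bar>C\<bar> *R 1 - x * a * x = x * (C *R b - a) * x + (\<bar>C\<bar> - C) *R (x * b * x) + (\<bar>C\<bar> * d) *R (x * x)"
    proof -
      have "\<bar>C\<bar> *R 1 = \<bar>C\<bar> *R (x * b * x) + (\<bar>C\<bar> * d) *R (x * x)"
        unfolding xbx by (simp add: scaleR_right_diff_distrib)
      moreover have "x * (C *R b - a) * x = C *R (x * b * x) - x * a * x"
        by (simp add: diff_distribs)
      ultimately show ?thesis by (simp add: scaleR_left_diff_distrib)
    qed
    then show "cpos (\<bar>C\<bar> *R 1 - x * a * x)"
      using d by (simp only:) (intro cpos_add cpos_scaleR p1 p2 p3, auto)
  qed
  finally have "norm ((r * x) * b * (r * x)\<star> - a) <= d * \<bar>C\<bar>" using d by simp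
  moreover have "r * x \<in> B" unfolding x_def by (rule mult_cfc_mem[OF f bs b(2) r(3)])
  ultimately show "\<exists>v\<in>B. norm (v * b * v\<star> - a) < e" using d by (intro bexI[of _ "r * x"]) auto
qed

lemma cuntz_subequiv_refl: "cpos a ==> a \<in> B ==> cuntz_subequiv B a a"
  by (rule dominated_cuntz_subequiv[of _ _ 1]) auto

text \<open>The witness is \<open>v = f(a)\<close> with \<open>f t = sqrt t / (t + d)\<close>: the
  function \<open>t ^ 3 / (t + d)\<^sup>2\<close> differs from \<open>t\<close> by at most
  \<open>2 * d\<close>.\<close>

lemma cuntz_subequiv_square:
  assumes a: "cpos a" "a \<in> B"
  shows "cuntz_subequiv B a (a * a)"
proof (rule cuntz_subequivI)
  fix e :: real assume e: "e > 0"
  note as = cpos_self_adjoint[OF a(1)]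
  define d where "d = e / 3"
  have d: "d > 0" using e by (simp add: d_def)
  let ?f = "%t. sqrt \<bar>t\<bar> / (\<bar>t\<bar> + d)"
  have f: "continuous_on UNIV ?f" using d by (intro continuous_intros) (auto simp: add_nonneg_eq_0_iff)
  define v where "v = cfc ?f a"
  have v: "v\<star> = v" "v \<in> B" unfolding v_def using a
    by (auto intro!: cfc_star[OF as f] cfc_mem[OF f _ as])
  have "v * (a * a) * v = cfc (%t. ?f t * (t * t) * ?f t) a"
    unfolding v_def by (subst cfc_mult[OF as], (intro continuous_on_mult f continuous_on_id)+)+ (simp add: cfc_id[OF as])
  moreover have "cfc (%t. ?f t * (t * t) * ?f t - t) a = cfc (%t. ?f t * (t * t) * ?f t) a - cfc (%t. t) a"
    by (rule cfc_diff[OF as]) (intro continuous_on_mult f continuous_on_id)+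
  ultimately have "v * (a * a) * v - a = cfc (%t. ?f t * (t * t) * ?f t - t) a"
    by (simp only: cfc_id[OF as])
  also have "norm ... <= 2 * d"
  proof (rule cfc_norm_le[OF as])
    show "continuous_on UNIV (%t. ?f t * (t * t) * ?f t - t)"
      by (intro continuous_on_diff continuous_on_mult f continuous_on_id)
    fix t assume "t \<in> rspec a"
    then have t: "t >= 0" by (rule cpos_rspec[OF a(1)])
    have "?f t * (t * t) * ?f t = (sqrt t * sqrt t) * (t * t) / ((t + d) * (t + d))" using t by simp
    also have "... = t ^ 3 / (t + d)\<^sup>2" using t by (simp add: power2_eq_square power3_eq_cube)
    finally have "?f t * (t * t) * ?f t - t = - (t * d * (2 * t + d)) / (t + d)\<^sup>2"
      using t d by (simp add: divide_simps) (simp add: power2_eq_square power3_eq_cube algebra_simps)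
    moreover have "t * d * (2 * t + d) <= 2 * d * (t + d)\<^sup>2"
      using t d mult_nonneg_nonneg[of t d] by (simp add: power2_eq_square algebra_simps)
    then have "(t * d * (2 * t + d)) / (t + d)\<^sup>2 <= 2 * d" using d by (simp add: divide_le_eq)
    moreover have "0 <= (t * d * (2 * t + d)) / (t + d)\<^sup>2" using t d by simp
    ultimately show "\<bar>?f t * (t * t) * ?f t - t\<bar> <= 2 * d" by simp
  qed
  finally show "\<exists>v\<in>B. norm (v * (a * a) * v\<star> - a) < e" using v d by (intro bexI[of _ v]) (auto simp: d_def)
qed

text \<open>The square of \<open>x\<star> * x\<close> is a conjugate of
  \<open>x * x\<star>\<close>.\<close>

lemma cuntz_star_mult_swap:
  assumes "x \<in> B"
  shows "cuntz_subequiv B (x\<star> * x) (x * x\<star>)"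
proof -
  have "cuntz_subequiv B (x\<star> * x) ((x\<star> * x) * (x\<star> * x))"
    by (rule cuntz_subequiv_square) (use assms Bs in auto)
  moreover have "cuntz_subequiv B (x\<star> * (x * x\<star>) * (x\<star>)\<star>) (x * x\<star>)"
    by (rule cuntz_subequiv_conj) (use assms Bs in auto)
  then have "cuntz_subequiv B ((x\<star> * x) * (x\<star> * x)) (x * x\<star>)" by (simp add: mult.assoc)
  ultimately show ?thesis by (rule sub_trans)
qed

text \<open>Rordam's lemma. With \<open>g\<close> the root of the cut-down,
  \<open>g * (a - e) * g\<close> is the square of the cut-down, and \<open>a - e <= b\<close> puts
  it below \<open>g * b * g\<close>; squaring does not change the class.\<close>

lemma cut_cuntz_subequiv:
  assumes a: "cpos a" "a \<in> B" and b: "cpos b" "b \<in> B" and d: "norm (a - b) <= e" "e > 0"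
  shows "cuntz_subequiv B (cutoff e a) b"
proof -
  note as = cpos_self_adjoint[OF a(1)]
  have c: "continuous_on UNIV (%t. max (t - e) (0 :: real))" by (intro continuous_intros)
  define g where "g = csqrt_el (cutoff e a)"
  note cu = cut_props[OF a(1) d(2)] cut_mem[OF a d(2)]
  have g: "g\<star> = g" "g * g = cutoff e a" "g \<in> B" using csqrt_el[OF cu(1)] csqrt_el_mem[OF cu(1,4)] by (auto simp: g_def)
  have ga: "g * a = a * g"
    unfolding g_def csqrt_el_def
    by (rule cfc_commute[symmetric]) (use cu cpos_self_adjoint[OF cu(1)] in \<open>auto intro!: continuous_intros\<close>)
  have sq: "cutoff e a * cutoff e a = g * (a - e *R 1) * g"
  proof -
    have "cutoff e a * cutoff e a = cfc (%t. max (t - e) 0 * max (t - e) 0) a"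
      unfolding cutoff_def by (rule cfc_mult[OF as c c, symmetric])
    also have "... = cfc (%t. max (t - e) 0 * (t - e)) a"
      by (rule cfc_cong[OF as]) (auto intro!: continuous_intros split: split_max)
    also have "... = cutoff e a * cfc (%t. t - e) a"
      unfolding cutoff_def by (rule cfc_mult[OF as c]) (intro continuous_intros)
    also have "cfc (%t. t - e) a = a - e *R 1"
      using cfc_diff[OF as, of "%t. t" "%_. e"] by (simp add: cfc_id[OF as] cfc_const[OF as])
    finally have "cutoff e a * cutoff e a = g * (g * (a - e *R 1))" by (simp add: mult.assoc flip: g(2))
    also have "g * (a - e *R 1) = (a - e *R 1) * g" by (simp add: diff_distribs ga)
    finally show ?thesis by (simp add: mult.assoc)
  qed
  have "cpos (e *R 1 - (a - b))"
    by (rule cpos_norm_diff) (use d as cpos_self_adjoint[OF b(1)] in \<open>auto simp: star_diff\<close>)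
  from cpos_conj[OF this, of g] have "cpos (g * b * g - cutoff e a * cutoff e a)"
    unfolding sq by (simp add: g algebra_simps)
  then have "cuntz_subequiv B (cutoff e a * cutoff e a) (g * b * g\<star>)"
    using cpos_star_mult[of "cutoff e a"] cpos_conj[OF b(1), of g] cpos_self_adjoint[OF cu(1)] g cu(4) b
    by (intro dominated_cuntz_subequiv[of _ _ 1]) (auto intro!: Bs)
  moreover have "cuntz_subequiv B (cutoff e a) (cutoff e a * cutoff e a)" by (rule cuntz_subequiv_square[OF cu(1,4)])
  moreover have "cuntz_subequiv B (g * b * g\<star>) b" by (rule cuntz_subequiv_conj[OF g(3)])
  ultimately show ?thesis using sub_trans by blast
qed

text \<open>\<open>d\<close> is so small that cutting \<open>b\<close> by \<open>d\<close> moves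
  \<open>v * b * v\<star>\<close> by at most \<open>e / 2\<close>; the other half of
  \<open>e\<close> is the error of \<open>v\<close>.\<close>

lemma cuntz_subequiv_cut:
  assumes ab: "cuntz_subequiv B a b" and a: "cpos a" "a \<in> B" and b: "cpos b" "b \<in> B" and e: "e > 0"
  obtains d where "d > 0" "cuntz_subequiv B (cutoff e a) (cutoff d b)"
proof -
  obtain v where v: "v \<in> B" "norm (v * b * v\<star> - a) < e/2" using cuntz_subequivD[OF ab, of "e/2"] e by auto
  define d where "d = e / (2 * ((norm v)\<^sup>2 + 1))"
  have "(norm v)\<^sup>2 + 1 > 0" by (simp add: add_nonneg_pos)
  then have d: "d > 0" "(norm v)\<^sup>2 * d <= e/2" using e by (auto simp: d_def field_simps)
  note cu = cut_props[OF b(1) d(1)] cut_mem[OF b d(1)]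
  have 1: "norm (v * (b - cutoff d b) * v\<star>) <= (norm v)\<^sup>2 * d"
    using cu(2) by (intro order.trans[OF norm_conj_le] mult_left_mono) auto
  have 2: "norm (a - v * b * v\<star>) < e/2" using v(2) by (subst norm_minus_commute)
  have "a - v * cutoff d b * v\<star> = v * (b - cutoff d b) * v\<star> + (a - v * b * v\<star>)" by (simp add: algebra_simps)
  from norm_add_less[OF 1 2 this, of e] d(2) have n: "norm (a - v * cutoff d b * v\<star>) <= e" by simp
  have "cuntz_subequiv B (cutoff e a) (v * cutoff d b * v\<star>)"
    by (rule cut_cuntz_subequiv[OF a _ _ n e]) (use cpos_conj'[OF cu(1)] v(1) cu(4) in \<open>auto intro!: Bs\<close>)
  then have "cuntz_subequiv B (cutoff e a) (cutoff d b)"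
    by (rule sub_trans) (rule cuntz_subequiv_conj[OF v(1)])
  with d(1) show thesis by (rule that)
qed

end

section \<open>Projections\<close>

abbreviation cuntz_le :: "'a::cstar_algebra => 'a => bool" (infix \<open>\<lessapprox>\<close> 50)
  where "a \<lessapprox> b \<equiv> cuntz_subequiv UNIV a b"

lemma cuntz_le_trans [trans]: "a \<lessapprox> b ==> b \<lessapprox> c ==> a \<lessapprox> c"
  by (rule cuntz_subequiv_trans) auto

lemmas dominated_cuntz_le = dominated_cuntz_subequiv[OF cstar_subalgebra_UNIV _ UNIV_I _ UNIV_I]
lemmas cuntz_le_refl = cuntz_subequiv_refl[OF cstar_subalgebra_UNIV _ UNIV_I]
lemmas cuntz_le_square = cuntz_subequiv_square[OF cstar_subalgebra_UNIV _ UNIV_I]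
lemmas cuntz_le_conj = cuntz_subequiv_conj[OF UNIV_I]

definition is_proj :: "'a::cstar_algebra => bool"
  where "is_proj p \<longleftrightarrow> p\<star> = p \<and> p * p = p"

lemma is_projD: "is_proj p ==> p\<star> = p" "is_proj p ==> p * p = p" "is_proj p ==> p * (p * x) = p * x"
  by (auto simp: is_proj_def simp flip: mult.assoc)

lemma is_proj_cpos: "is_proj p ==> cpos p"
  using cpos_star_mult[of p] by (simp add: is_proj_def)

lemma is_proj_complement: "is_proj p ==> is_proj (1 - p)" for p :: "'a::unital_cstar_algebra"
  by (simp add: is_proj_def star_diff algebra_simps)

lemma is_proj_zero [simp]: "is_proj 0" and is_proj_one [simp]: "is_proj (1 :: 'a::unital_cstar_algebra)"
  by (auto simp: is_proj_def)

lemma is_proj_norm: "is_proj p ==> norm p <= 1"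
  using cstar_identity[of p] by (cases "norm p = 0") (auto simp: is_proj_def power2_eq_square)

lemma norm_of_projection_star: "is_proj (u\<star> * u) ==> norm u <= 1"
  using is_proj_norm[of "u\<star> * u"] cstar_identity[of u] by (simp add: abs_square_le_1)

lemma partial_isometry_right:
  fixes w :: "'a::unital_cstar_algebra"
  assumes "w\<star> * w = x" "is_proj x"
  shows "w * x = w"
proof -
  have "(w - w * x)\<star> * (w - w * x) = (1 - x) * (w\<star> * w) * (1 - x)"
    using assms(2) by (simp add: star_diff star_mult is_projD algebra_simps)
  also have "... = 0" unfolding assms(1) using assms(2) by (simp add: is_projD algebra_simps)
  finally show ?thesis using cstar_identity[of "w - w * x"] by simp
qed

text \<open>The function \<open>1 / sqrt (max t r)\<close> is the power \<open>-1/2\<close> on the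
  spectrum of \<open>c\<close>, extended continuously to the line.\<close>

lemma inverse_sqrt_near:
  assumes c: "c\<star> = c" "!!t. t \<in> rspec c ==> r <= t" and r: "r > 0"
  obtains h where "h\<star> = h" "h * c * h = 1" "h * h * c = 1" "!!y. y * c = c * y ==> y * h = h * y"
    "norm h <= 1 / sqrt r"
proof -
  let ?f = "%t. 1 / sqrt (max t r)"
  have f: "continuous_on UNIV ?f" using r by (intro continuous_intros) (auto simp: max_def)
  note m = cfc_mult[OF c(1)]
  have e1: "?f t * t * ?f t = 1" and e2: "?f t * ?f t * t = 1" if "t \<in> rspec c" for t
    using c(2)[OF that] r by auto
  show thesis
  proof (rule that[of "cfc ?f c"])
    show "(cfc ?f c)\<star> = cfc ?f c" by (rule cfc_star[OF c(1) f])
    have "cfc ?f c * c * cfc ?f c = cfc (%t. ?f t * t * ?f t) c"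
      by (subst m, (intro continuous_on_mult f continuous_on_id)+)+ (simp add: cfc_id[OF c(1)])
    also have "... = cfc (%_. 1) c"
      by (rule cfc_cong[OF c(1)]) (intro continuous_on_mult f continuous_on_id continuous_on_const | rule e1)+
    finally show "cfc ?f c * c * cfc ?f c = 1" by (simp add: cfc_const[OF c(1)])
    have "cfc ?f c * cfc ?f c * c = cfc (%t. ?f t * ?f t * t) c"
      by (subst m, (intro continuous_on_mult f continuous_on_id)+)+ (simp add: cfc_id[OF c(1)])
    also have "... = cfc (%_. 1) c"
      by (rule cfc_cong[OF c(1)]) (intro continuous_on_mult f continuous_on_id continuous_on_const | rule e2)+
    finally show "cfc ?f c * cfc ?f c * c = 1" by (simp add: cfc_const[OF c(1)])
    show "y * cfc ?f c = cfc ?f c * y" if "y * c = c * y" for y by (rule cfc_commute[OF c(1) f that])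
    show "norm (cfc ?f c) <= 1 / sqrt r" by (rule cfc_norm_le[OF c(1) f]) (use r in \<open>simp add: frac_le\<close>)
  qed
qed

lemma rspec_near_one:
  assumes "t \<in> rspec c"
  shows "1 - norm (1 - c) <= t"
proof (rule ccontr)
  assume t: "\<not> 1 - norm (1 - c) <= t"
  then have p: "1 - t > 0" using norm_ge_zero[of "1 - c"] by linarith
  define u where "u = (1 / (1 - t)) *R (1 - c)"
  have "norm u < 1" using t p by (simp add: u_def)
  then have "two_sided_unit (1 - u)" by (metis one_minus_unit two_sided_unitI)
  from scaled_unit[OF this, of "1 - t"] p have "two_sided_unit (c - t *R 1)"
    by (simp add: u_def scaleR_right_diff_distrib scaleR_left_diff_distrib)
  with assms show False by (simp add: rspec_def)
qed

text \<open>Polar decomposition. Adding \<open>1 - x\<close> makes \<open>u\<star> * u\<close>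
  invertible in the whole algebra, so that the inverse root exists there and not just in the corner
  of \<open>x\<close>; it commutes with \<open>x\<close>.\<close>

lemma correct_to_partial_isometry:
  fixes u :: "'a::unital_cstar_algebra"
  assumes x: "is_proj x" and u: "u * x = u" "norm (u\<star> * u - x) < 1"
  obtains h where "(u * h)\<star> * (u * h) = x" "u * h * x = u * h" "h * x = x * h"
    "norm h <= 1 / sqrt (1 - norm (u\<star> * u - x))"
proof -
  define c where "c = u\<star> * u + (1 - x)"
  have cs: "c\<star> = c" using x by (simp add: c_def star_add star_diff star_mult is_projD)
  have xu: "x * u\<star> = u\<star>" using arg_cong[OF u(1), of star] x by (simp add: star_mult is_projD)
  have nc: "norm (1 - c) = norm (u\<star> * u - x)" by (simp add: c_def norm_minus_commute)
  then have "1 - norm (1 - c) > 0" using u(2) by simp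
  from inverse_sqrt_near[OF cs rspec_near_one this]
  obtain h where h: "h\<star> = h" "h * c * h = 1" "h * h * c = 1" "!!y. y * c = c * y ==> y * h = h * y"
    "norm h <= 1 / sqrt (1 - norm (1 - c))" by blast
  have xc: "x * c = c * x"
  proof -
    have "x * c = u\<star> * u" by (simp add: c_def algebra_simps is_projD[OF x]) (simp add: xu flip: mult.assoc)
    moreover have "c * x = u\<star> * u" by (simp add: c_def algebra_simps is_projD[OF x] u)
    ultimately show ?thesis by simp
  qed
  have hx: "h * x = x * h" using h(4)[OF xc] by simp
  have hc: "h * c = c * h" using h(4)[of c] by simp
  have "(1 - x) * c = 1 - x"
    by (simp add: c_def algebra_simps is_projD[OF x]) (simp add: xu flip: mult.assoc)
  then have "(1 - x) = h * h * ((1 - x) * c)" if "h * h * (1 - x) = (1 - x) * (h * h)"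
    using h(3) that by (metis mult.assoc mult.right_neutral)
  moreover have comm: "h * h * (1 - x) = (1 - x) * (h * h)"
    by (simp add: algebra_simps) (metis hx mult.assoc)
  ultimately have hh: "h * h * (1 - x) = 1 - x" using \<open>(1 - x) * c = 1 - x\<close> by simp
  have "(u * h)\<star> * (u * h) = h * (c - (1 - x)) * h"
    by (simp add: star_mult h(1) c_def mult.assoc)
  also have "... = h * c * h - h * h * (1 - x)" by (simp add: algebra_simps) (metis hx mult.assoc)
  also have "... = x" by (simp add: h(2) hh)
  finally show thesis
  proof (rule that)
    have "u * h * x = (u * x) * h" unfolding mult.assoc hx ..
    then show "u * h * x = u * h" unfolding u(1) .
    show "norm h <= 1 / sqrt (1 - norm (u\<star> * u - x))" using h(5) unfolding nc .
  qed (rule hx)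
qed

lemma csqrt_conj:
  assumes "cpos b"
  shows "(csqrt_el b * v)\<star> * (csqrt_el b * w) = v\<star> * b * w"
  using csqrt_el[OF assms] by (simp add: star_mult) (metis mult.assoc)

text \<open>An approximation of a projection within distance less than 1 is corrected by polar
  decomposition, so Cuntz comparison of a projection with \<open>b\<close> becomes an algebraic
  identity.\<close>

lemma projection_le_exact:
  fixes q :: "'a::unital_cstar_algebra"
  assumes q: "is_proj q" and b: "cpos b" and v: "norm (v\<star> * b * v - q) < 1"
  obtains w where "w\<star> * b * w = q" "w * q = w"
proof -
  define u where "u = csqrt_el b * v * q"
  have uu: "u\<star> * u = q * (v\<star> * b * v) * q"
    using csqrt_conj[OF b, of "v * q" "v * q"] q by (simp add: u_def mult.assoc star_mult is_projD)
  have "u\<star> * u - q = q * (v\<star> * b * v - q) * q" unfolding uu using q by (simp add: algebra_simps is_projD)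
  then have "norm (u\<star> * u - q) <= norm (q * (v\<star> * b * v - q) * q\<star>)" using q by (simp add: is_projD)
  also have "... <= (norm q)\<^sup>2 * norm (v\<star> * b * v - q)" by (rule norm_conj_le)
  also have "... <= 1 * norm (v\<star> * b * v - q)"
    using is_proj_norm[OF q] by (intro mult_right_mono) (auto simp: abs_square_le_1)
  finally have "norm (u\<star> * u - q) < 1" using v by simp
  moreover have "u * q = u" using q by (simp add: u_def mult.assoc is_projD)
  ultimately obtain h where h: "(u * h)\<star> * (u * h) = q" "u * h * q = u * h" "h * q = q * h"
    using correct_to_partial_isometry[OF q] by blast
  show thesis
  proof (rule that[of "v * q * h"])
    show "(v * q * h)\<star> * b * (v * q * h) = q"
      using h(1) csqrt_conj[OF b, of "v * q * h" "v * q * h"] by (simp add: u_def mult.assoc)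
    show "v * q * h * q = v * q * h" using h(3) is_projD[OF q] by (simp add: mult.assoc)
  qed
qed

lemma projection_cuntz_le_iff:
  fixes q :: "'a::unital_cstar_algebra"
  assumes q: "is_proj q" and b: "cpos b"
  shows "q \<lessapprox> b \<longleftrightarrow> (\<exists>v. v\<star> * b * v = q)"
proof
  assume "q \<lessapprox> b"
  then obtain v where "norm (v * b * v\<star> - q) < 1" using cuntz_subequivD[of UNIV q b 1] by auto
  then show "\<exists>v. v\<star> * b * v = q" using projection_le_exact[OF q b, of "v\<star>"] by auto
next
  assume "\<exists>v. v\<star> * b * v = q"
  then show "q \<lessapprox> b" using cuntz_le_conj[of "_\<star>" b] by auto
qed

lemma unit_conj_cuntz:
  fixes b :: "'a::unital_cstar_algebra"
  assumes "S * T = 1"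
  shows "T * b * T\<star> \<lessapprox> b" "b \<lessapprox> T * b * T\<star>"
proof -
  have "S * (T * b * T\<star>) * S\<star> = (S * T) * b * (S * T)\<star>" by (simp add: star_mult mult.assoc)
  then show "b \<lessapprox> T * b * T\<star>" using cuntz_le_conj[of S "T * b * T\<star>"] by (simp add: assms)
qed (rule cuntz_le_conj)

lemma cpos_le_norm: "cpos b ==> cpos (norm b *R 1 - b)" for b :: "'a::unital_cstar_algebra"
  by (rule cpos_norm_diff) (auto simp: cpos_self_adjoint)

lemma cpos_square: "b\<star> = b ==> cpos (b * b)"
  using cpos_star_mult[of b] by simp

lemma sum_lessThan_add: "(\<Sum>i<m + n. f i) = (\<Sum>i<m. f i) + (\<Sum>i<n. f (m + i))" for f :: "nat => 'a::comm_monoid_add"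
  by (induction n) (auto simp: add.assoc)

text \<open>Expand \<open>(x\<star> - y)\<star> * g * (x\<star> - y)\<close>. This bounds a mixed
  term \<open>x * g * y\<close> by conjugates of \<open>g\<close>.\<close>

lemma conj_le_sum:
  fixes g :: "'a::unital_cstar_algebra"
  assumes "cpos g"
  shows "cpos (x * g * x\<star> + y\<star> * g * y - (x * g * y + (x * g * y)\<star>))"
proof -
  have "(x\<star> - y)\<star> * g * (x\<star> - y) = x * g * x\<star> + y\<star> * g * y - (x * g * y + (x * g * y)\<star>)"
    using cpos_self_adjoint[OF assms] by (simp add: star_diff star_mult algebra_simps)
  then show ?thesis using cpos_conj[OF assms, of "x\<star> - y"] by simp
qed

lemma rspec_shift: "t \<in> rspec h ==> t - r \<in> rspec (h - r *R 1)"
  by (simp add: rspec_def scaleR_left_diff_distrib)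

lemma cpos_inverse_sqrt:
  fixes T :: "'a::unital_cstar_algebra"
  assumes "cpos (T - r *R 1)" "r > 0"
  obtains h where "h\<star> = h" "h * T * h = 1" "!!y. y * T = T * y ==> y * h = h * y"
proof -
  have "T\<star> = T" using cpos_self_adjoint[OF assms(1)] by (simp add: star_diff)
  moreover have "r <= t" if "t \<in> rspec T" for t
    using cpos_rspec[OF assms(1) rspec_shift[OF that]] by simp
  ultimately obtain h where "h\<star> = h" "h * T * h = 1" "!!y. y * T = T * y ==> y * h = h * y"
    using inverse_sqrt_near[of T r] assms(2) by blast
  then show thesis by (rule that)
qed

lemma subspace_closure:
  fixes S :: "'a::real_normed_vector set"
  assumes "subspace S"
  shows "subspace (closure S)"
proof (rule subspaceI)
  show "0 \<in> closure S" using subspace_0[OF assms] closure_subset by blast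
  show "x + y \<in> closure S" if xy: "x \<in> closure S" "y \<in> closure S" for x y
  proof -
    obtain f where f: "!!n. f n \<in> S" "f \<longlonglongrightarrow> x"
      using xy(1) unfolding closure_sequential by blast
    obtain g where g: "!!n. g n \<in> S" "g \<longlonglongrightarrow> y"
      using xy(2) unfolding closure_sequential by blast
    have "!!n. f n + g n \<in> S" "(%n. f n + g n) \<longlonglongrightarrow> x + y"
      using subspace_add[OF assms f(1) g(1)] tendsto_add[OF f(2) g(2)] by auto
    then show ?thesis unfolding closure_sequential by (intro exI[of _ "%n. f n + g n"]) auto
  qed
  show "c *R x \<in> closure S" if x: "x \<in> closure S" for c x
  proof -
    obtain f where "!!n. f n \<in> S" "f \<longlonglongrightarrow> x"
      using x unfolding closure_sequential by blast
    then have "!!n. c *R f n \<in> S" "(%n. c *R f n) \<longlonglongrightarrow> c *R x"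
      using subspace_scale[OF assms] tendsto_scaleR[OF tendsto_const] by auto
    then show ?thesis unfolding closure_sequential by (intro exI[of _ "%n. c *R f n"]) auto
  qed
qed

text \<open>By simplicity 1 is near some sum \<open>j\<close> of terms \<open>x i * g * y i\<close>.
  Twice the real part of \<open>j\<close> is at least 1 and at most a sum \<open>T\<close> of
  conjugates of \<open>g\<close>, so conjugating by the power \<open>-1/2\<close> of
  \<open>T\<close> gives exactly 1.\<close>

lemma simple_full:
  fixes g :: "'a::unital_cstar_algebra"
  assumes simple: "simple_cstar TYPE('a)" and g: "cpos g" "g ~= 0"
  obtains M and z :: "nat => 'a" where "(\<Sum>i<M. (z i)\<star> * g * z i) = 1"
proof -
  define S where "S = {x * g * y |x y. True}"
  define I where "I = closure (span S)"
  have lin: "bounded_linear f ==> (!!s. s \<in> S ==> f s \<in> S) ==> x \<in> I ==> f x \<in> I" for f x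
  proof -
    assume f: "bounded_linear f" and fS: "!!s. s \<in> S ==> f s \<in> S" and x: "x \<in> I"
    have "f ` closure (span S) \<subseteq> closure (f ` span S)"
      by (rule closure_bounded_linear_image_subset[OF f])
    also have "f ` span S = span (f ` S)"
      by (rule linear_span_image[OF bounded_linear.linear[OF f], symmetric])
    also have "closure (span (f ` S)) \<subseteq> I"
      unfolding I_def using fS by (intro closure_mono span_mono) auto
    finally show "f x \<in> I" using x unfolding I_def by blast
  qed
  have 1: "c *C x \<in> I" if "x \<in> I" for c x
  proof (rule lin[OF bounded_linear_scaleC _ that])
    fix s assume "s \<in> S"
    then obtain x y where "s = x * g * y" by (auto simp: S_def)
    then have "c *C s = (c *C x) * g * y" by (simp add: mult_scaleC_left)
    then show "c *C s \<in> S" by (auto simp: S_def)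
  qed
  have 2: "x * y \<in> I" if "x \<in> I" for x y
  proof (rule lin[OF bounded_linear_mult_left _ that])
    fix s assume "s \<in> S"
    then obtain a b where "s = a * g * b" by (auto simp: S_def)
    then have "s * y = a * g * (b * y)" by (simp add: mult.assoc)
    then show "s * y \<in> S" by (auto simp: S_def)
  qed
  have 3: "y * x \<in> I" if "x \<in> I" for x y
  proof (rule lin[OF bounded_linear_mult_right _ that])
    fix s assume "s \<in> S"
    then obtain a b where "s = a * g * b" by (auto simp: S_def)
    then have "y * s = (y * a) * g * b" by (simp add: mult.assoc)
    then show "y * s \<in> S" by (auto simp: S_def)
  qed
  have "subspace I" unfolding I_def by (rule subspace_closure) simp
  moreover have "closed I" by (simp add: I_def)
  ultimately have "I = {0} \<or> I = UNIV" using simple 1 2 3 unfolding simple_cstar_def by blast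
  moreover have "1 * g * 1 \<in> S" unfolding S_def by blast
  then have "g \<in> I" unfolding I_def using closure_subset span_base by auto
  ultimately have "1 \<in> I" using g(2) by auto
  then have "\<forall>e>0. \<exists>j\<in>span S. norm (j - 1) < e"
    unfolding I_def closure_approachable dist_norm .
  then obtain j where j: "j \<in> span S" "norm (j - 1) < 1/2"
    by (elim allE[of _ "1/2"]) auto
  have "\<exists>n x y. j = (\<Sum>i<(n::nat). x i * g * y i)"
    using j(1)
  proof (induction rule: span_induct_alt)
    case base
    show ?case by (rule exI[of _ 0]) simp
  next
    case (step c s t)
    then obtain n x y a b where *: "t = (\<Sum>i<(n::nat). x i * g * y i)" "s = a * g * b" by (auto simp: S_def)
    have "c *R s + t = (\<Sum>i<Suc n. (x(n := c *R a)) i * g * (y(n := b)) i)" by (simp add: *)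
    then show ?case by blast
  qed
  then obtain n x y where jn: "j = (\<Sum>i<(n::nat). x i * g * y i)" by blast
  define T where "T = (\<Sum>i<n. x i * g * (x i)\<star>) + (\<Sum>i<n. (y i)\<star> * g * y i)"
  have "cpos (\<Sum>i<n. x i * g * (x i)\<star> + (y i)\<star> * g * y i - (x i * g * y i + (x i * g * y i)\<star>))"
    by (intro cpos_sum conj_le_sum g)
  then have c1: "cpos (T - (j + j\<star>))"
    by (simp add: T_def jn star_sum sum_subtractf sum.distrib)
  have "norm ((j - 1)\<star>) < 1/2" using j(2) by simp
  then have "norm ((1 - j) + (1 - j\<star>)) <= 1"
    using j(2) norm_triangle_ineq[of "1 - j" "1 - j\<star>"] by (simp add: star_diff norm_minus_commute)
  then have "cpos (1 *R 1 - ((1 - j) + (1 - j\<star>)))" by (intro cpos_norm_diff) (auto simp: star_add star_diff)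
  from cpos_add[OF c1 this] have "cpos (T - 1 *R 1)" by simp
  then obtain h where h: "h\<star> = h" "h * T * h = 1" using cpos_inverse_sqrt[of T 1] by auto
  define z where "z i = (if i < n then (x i)\<star> * h else y (i - n) * h)" for i
  have "(\<Sum>i<n + n. (z i)\<star> * g * z i) = (\<Sum>i<n. (z i)\<star> * g * z i) + (\<Sum>i<n. (z (n + i))\<star> * g * z (n + i))"
    by (rule sum_lessThan_add)
  also have "... = (\<Sum>i<n. h * (x i * g * (x i)\<star>) * h) + (\<Sum>i<n. h * ((y i)\<star> * g * y i) * h)"
    by (intro arg_cong2[of _ _ _ _ "(+)"] sum.cong) (auto simp: z_def star_mult h mult.assoc)
  also have "... = h * T * h" by (simp add: T_def sum_distrib_left sum_distrib_right add_distribs)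
  finally show thesis using h(2) by (intro that[of z "n + n"]) simp
qed

subsection \<open>Real rank zero\<close>

text \<open>\<open>y\<close> is near \<open>a\<close> and has finite spectrum, so some
  \<open>T\<close> between \<open>2 * d\<close> and \<open>3 * d\<close> misses it; \<open>r\<close>
  is the spectral projection of \<open>y\<close> for the part above \<open>T\<close>. There
  \<open>a\<close> is at least \<open>d\<close>, whence \<open>r \<lessapprox> a\<close>, and what
  \<open>r\<close> discards of \<open>y\<close> has norm at most \<open>5 * d\<close>.\<close>

lemma real_rank_zero_projection:
  fixes a :: "'a::unital_cstar_algebra"
  assumes rr0: "real_rank_zero TYPE('a)" and a: "cpos a" and e: "e > 0"
  obtains r v where "is_proj r" "r \<lessapprox> a" "norm (v * r * v\<star> - a) < e"
proof -
  define d where "d = e / 7"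
  have d: "d > 0" "7 * d = e" using e by (auto simp: d_def)
  have as: "a\<star> = a" using a by (rule cpos_self_adjoint)
  then obtain y where y: "y\<star> = y" "finite (cstar_spectrum y)" "norm (y - a) < d"
    using rr0 d unfolding real_rank_zero_def closure_approachable dist_norm by blast
  have "infinite {2 * d<..<3 * d}" using d by simp
  then have "infinite (complex_of_real ` {2 * d<..<3 * d})"
    using finite_imageD[of complex_of_real] by (metis inj_of_real inj_on_subset subset_UNIV)
  then have "\<not> complex_of_real ` {2 * d<..<3 * d} \<subseteq> cstar_spectrum y"
    using y(2) finite_subset by blast
  then obtain T where T: "2 * d < T" "T < 3 * d" "complex_of_real T \<notin> cstar_spectrum y"
    by (auto simp: image_subset_iff)
  define h where "h = y - T *R 1"
  have h: "h\<star> = h" by (simp add: h_def star_diff y)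
  obtain k where k: "h * k = 1" "k * h = 1"
    using T(3) unfolding cstar_spectrum_def h_def by (auto simp: scaleC_of_real)
  have ab: "continuous_on UNIV (%t :: real. \<bar>t\<bar>)" by (intro continuous_intros)
  define m where "m = cfc (%t. \<bar>t\<bar>) h"
  have m: "m\<star> = m" "m * h = h * m" "m * m = h * h"
  proof -
    show "m\<star> = m" unfolding m_def by (rule cfc_star[OF h ab])
    show "m * h = h * m" unfolding m_def by (rule cfc_commute[OF h ab, symmetric]) simp
    have "m * m = cfc (%t. \<bar>t\<bar> * \<bar>t\<bar>) h" unfolding m_def by (rule cfc_mult[OF h ab ab, symmetric])
    also have "... = cfc (%t. t * t) h" by simp
    also have "... = h * h" using cfc_mult[OF h continuous_on_id continuous_on_id] by (simp add: cfc_id[OF h])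
    finally show "m * m = h * h" .
  qed
  have mk: "m * k = k * m" by (metis k m(2) mult.assoc mult.left_neutral mult.right_neutral)
  have ks: "k\<star> = k"
  proof -
    have "k\<star> * h = 1" using arg_cong[OF k(1), of star] by (simp add: star_mult h)
    then show ?thesis by (metis k(1) mult.assoc mult.left_neutral mult.right_neutral)
  qed
  \<comment> \<open>The sign of \<open>h\<close>: absolute value times inverse.\<close>
  define s where "s = m * k"
  have s: "s\<star> = s" "s * s = 1" "s * h = m" "s * h = h * s"
  proof -
    show "s\<star> = s" by (simp add: s_def star_mult m ks mk)
    have "s * s = (m * m) * (k * k)" unfolding s_def by (metis mk mult.assoc)
    also have "... = 1" unfolding m(3) by (metis k mult.assoc mult.right_neutral)
    finally show "s * s = 1" .
    show "s * h = m" by (simp add: s_def mult.assoc k)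
    show "s * h = h * s" unfolding s_def by (metis k m(2) mk mult.assoc mult.left_neutral)
  qed
  define r where "r = (1/2) *R (1 + s)"
  have "(1 + s) * (1 + s) = 2 *R (1 + s)" by (simp add: add_distribs s(2) scaleR_2)
  then have r: "is_proj r" unfolding is_proj_def r_def by (simp add: star_add s(1))
  have rh: "r * h = h * r" by (simp add: r_def add_distribs s(4))
  have rhp: "r * h = (1/2) *R (m + h)" and rhn: "(1 - r) * h = - ((1/2) *R (m - h))"
  proof -
    show "r * h = (1/2) *R (m + h)" by (simp add: r_def distrib_right s(3))
    have hh: "h - (1/2) *R h = (1/2) *R h" using scaleR_left_diff_distrib[of 1 "1/2" h] by simp
    have "(1 - r) * h = h - (1/2) *R (m + h)" by (simp add: left_diff_distrib \<open>r * h = (1/2) *R (m + h)\<close>)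
    also have "... = (h - (1/2) *R h) - (1/2) *R m" by (simp add: scaleR_right_distrib)
    also have "... = - ((1/2) *R (m - h))" unfolding hh by (simp add: scaleR_right_diff_distrib)
    finally show "(1 - r) * h = - ((1/2) *R (m - h))" .
  qed
  have mp: "cpos (m + h)" "cpos (m - h)"
  proof -
    have "m + h = cfc (%t. \<bar>t\<bar> + t) h"
      using cfc_add[OF h ab continuous_on_id] by (simp add: m_def cfc_id[OF h])
    moreover have "cpos (cfc (%t. \<bar>t\<bar> + t) h)" by (rule cfc_cpos[OF h]) (auto intro!: continuous_intros)
    ultimately show "cpos (m + h)" by simp
    have "m - h = cfc (%t. \<bar>t\<bar> - t) h"
      using cfc_diff[OF h ab continuous_on_id] by (simp add: m_def cfc_id[OF h])
    moreover have "cpos (cfc (%t. \<bar>t\<bar> - t) h)" by (rule cfc_cpos[OF h]) (auto intro!: continuous_intros)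
    ultimately show "cpos (m - h)" by simp
  qed
  have yr: "y = h + T *R 1" by (simp add: h_def)
  have ry: "r * y = y * r" by (simp add: yr add_distribs rh)
  note rr = is_projD[OF r]
  have c1: "cpos (r * y * r - T *R r)"
  proof -
    have "r * y * r - T *R r = r * h * r" by (simp add: yr add_distribs rr)
    also have "... = r * h" using rh rr by (metis mult.assoc)
    finally show ?thesis using cpos_scaleR[OF mp(1), of "1/2"] by (simp add: rhp)
  qed
  have yge: "cpos (y + d *R 1)"
  proof -
    have "cpos (d *R 1 - (a - y))"
      by (rule cpos_norm_diff) (use y as in \<open>auto simp: star_diff norm_minus_commute\<close>)
    from cpos_add[OF this a] show ?thesis by (simp add: algebra_simps)
  qed
  have small: "norm ((1 - r) * y) <= 5 * d"
  proof -
    have p: "(1 - r) * y * (1 - r) = (1 - r) * y"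
    proof -
      have "y * (1 - r) = (1 - r) * y" using ry by (simp add: diff_distribs)
      then have "(1 - r) * y * (1 - r) = (1 - r) * (1 - r) * y" by (simp only: mult.assoc)
      then show ?thesis using is_projD(2)[OF is_proj_complement[OF r]] by simp
    qed
    have "norm ((1 - r) * y + d *R (1 - r)) <= 3 * d + d"
    proof (rule norm_le_cposI)
      have e: "(1 - r) * (y + d *R 1) * (1 - r) = (1 - r) * y + d *R (1 - r)"
        using p rr by (simp add: add_distribs) (simp add: algebra_simps)
      show "cpos ((1 - r) * y + d *R (1 - r))"
        using cpos_conj[OF yge, of "1 - r"] rr unfolding e[symmetric] by (simp add: star_diff)
      have "(3 * d + d) *R 1 - ((1 - r) * y + d *R (1 - r))
          = (3 * d - T) *R (1 - r) + (1/2) *R (m - h) + (3 * d + d) *R r"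
      proof -
        have 1: "(1 - r) * y = - ((1/2) *R (m - h)) + T *R (1 - r)" by (simp add: yr distrib_left rhn)
        have 2: "(3 * d + d) *R (1 :: 'a) = (3 * d) *R (1 - r) + d *R (1 - r) + (3 * d + d) *R r"
          unfolding scaleR_left_distrib scaleR_right_diff_distrib by simp
        show ?thesis unfolding 1 2 scaleR_left_diff_distrib by simp
      qed
      moreover have "cpos ..."
        using T d by (intro cpos_add cpos_scaleR mp is_proj_cpos is_proj_complement r) auto
      ultimately show "cpos ((3 * d + d) *R 1 - ((1 - r) * y + d *R (1 - r)))" by simp
    qed
    moreover have "norm (d *R (1 - r)) <= d" using is_proj_norm[OF is_proj_complement[OF r]] d by simp
    ultimately show ?thesis using norm_triangle_ineq4[of "(1 - r) * y + d *R (1 - r)" "d *R (1 - r)"] by simp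
  qed
  show thesis
  proof (rule that[OF r])
    have "cpos (d *R 1 - (y - a))"
      by (rule cpos_norm_diff) (use y as in \<open>auto simp: star_diff\<close>)
    from cpos_conj[OF this, of r] have "cpos (d *R r - (r * y * r - r * a * r))"
      using rr by (simp add: diff_distribs)
    then have "cpos (d *R r - r * y * r + r * a * r)" by (simp add: algebra_simps)
    from cpos_add[OF cpos_add[OF this c1] cpos_scaleR[OF is_proj_cpos[OF r], of "T - 2 * d"]]
    have "cpos (d *R r - r * y * r + r * a * r + (r * y * r - T *R r) + (T - 2 * d) *R r)" using T by simp
    moreover have "(2 * d) *R r = d *R r + d *R r" by (simp flip: scaleR_left_distrib)
    ultimately have "cpos (r * a * r - d *R r)" by (simp add: scaleR_left_diff_distrib)
    from cpos_scaleR[OF this, of "1/d"] have "cpos ((1/d) *R (r * a * r) - r)"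
      using d by (simp add: scaleR_right_diff_distrib)
    then have "r \<lessapprox> r * a * r\<star>"
      using is_proj_cpos[OF r] cpos_conj'[OF a, of r] rr by (intro dominated_cuntz_le[of _ _ "1/d"]) auto
    also have "... \<lessapprox> a" by (rule cuntz_le_conj)
    finally show "r \<lessapprox> a" .
    \<comment> \<open>Conjugating \<open>r\<close> by the root of \<open>r * y * r\<close> returns
      \<open>r * y\<close>, the part of \<open>y\<close> above \<open>T\<close>.\<close>
    define v where "v = csqrt_el (r * y * r)"
    have "cpos ((r * y * r - T *R r) + T *R r)"
      using T d by (intro cpos_add c1 cpos_scaleR is_proj_cpos r) auto
    then have cp: "cpos (r * y * r)" by simp
    have v: "v\<star> = v" "v * v = r * y * r" unfolding v_def using csqrt_el[OF cp] by auto
    have rv: "r * v = v * r"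
      unfolding v_def csqrt_el_def
      by (rule cfc_commute[OF cpos_self_adjoint[OF cp]]) (use rr in \<open>auto intro!: continuous_intros simp: mult.assoc\<close>)
    have "v * r * v\<star> = v * v * r" unfolding v(1) mult.assoc rv ..
    then have vrv: "v * r * v\<star> = r * y" using v(2) ry rr by (simp add: mult.assoc)
    have "v * r * v\<star> - a = - ((1 - r) * y) + (y - a)" unfolding vrv by (simp add: algebra_simps)
    from norm_add_less[OF _ y(3) this, of "5 * d" e]
    show "norm (v * r * v\<star> - a) < e" using small d by simp
  qed
qed

section \<open>Matrix comparison of finite families\<close>

text \<open>For families of projections this is Murray--von Neumann subequivalence of the diagonal matrices.
  Working with the entries avoids norms on matrix algebras.\<close>

definition dom_list :: "'a::unital_cstar_algebra list => 'a list => bool"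
  where "dom_list xs ys \<longleftrightarrow> (\<exists>z. \<forall>i<length xs. \<forall>j<length xs.
    (\<Sum>l<length ys. (z l i)\<star> * ys ! l * z l j) = (if i = j then xs ! i else 0))"

lemma dom_listI:
  assumes "!!i j. i < length xs ==> j < length xs ==>
    (\<Sum>l<length ys. (z l i)\<star> * ys ! l * z l j) = (if i = j then xs ! i else 0)"
  shows "dom_list xs ys"
  unfolding dom_list_def using assms by (intro exI[of _ z]) blast

text \<open>Multisets forget the order of the diagonal, and their sum is the direct sum of diagonal
  matrices.\<close>

definition mdom :: "'a::unital_cstar_algebra multiset => 'a multiset => bool"
  where "mdom X Y \<longleftrightarrow> (\<exists>xs ys. mset xs = X \<and> mset ys = Y \<and> dom_list xs ys)"

lemma dom_list_permute:
  assumes "dom_list xs ys" "mset xs' = mset xs" "mset ys' = mset ys"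
  shows "dom_list xs' ys'"
proof -
  obtain z where z: "!!i j. i < length xs ==> j < length xs ==>
      (\<Sum>l<length ys. (z l i)\<star> * ys ! l * z l j) = (if i = j then xs ! i else 0)"
    using assms(1) by (auto simp: dom_list_def)
  obtain p where p: "p permutes {..<length xs}" "permute_list p xs = xs'"
    using mset_eq_permutation[OF assms(2)] by blast
  obtain q where q: "q permutes {..<length ys}" "permute_list q ys = ys'"
    using mset_eq_permutation[OF assms(3)] by blast
  have len: "length xs' = length xs" "length ys' = length ys" using p q by auto
  have pl: "p i < length xs" if "i < length xs" for i using permutes_in_image[OF p(1)] that by auto
  have "(\<Sum>l<length ys. (z (q l) (p i))\<star> * ys' ! l * z (q l) (p j)) = (if i = j then xs' ! i else 0)"
    if "i < length xs" "j < length xs" for i j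
  proof -
    have "(\<Sum>l<length ys. (z (q l) (p i))\<star> * ys' ! l * z (q l) (p j))
        = (\<Sum>l<length ys. (z (q l) (p i))\<star> * ys ! q l * z (q l) (p j))"
      by (intro sum.cong) (auto simp: permute_list_nth[OF q(1)] simp flip: q(2))
    also have "... = (\<Sum>l<length ys. (z l (p i))\<star> * ys ! l * z l (p j))"
      by (rule sum.permute[OF q(1), symmetric, unfolded o_def])
    also have "... = (if p i = p j then xs ! p i else 0)" using z pl that by simp
    also have "... = (if i = j then xs' ! i else 0)"
      using permutes_inj[OF p(1)] that by (auto simp: inj_eq permute_list_nth[OF p(1)] simp flip: p(2))
    finally show ?thesis .
  qed
  then show ?thesis by (intro dom_listI[where z = "%l i. z (q l) (p i)"]) (simp add: len)
qed

lemma mdom_mset [simp]: "mdom (mset xs) (mset ys) \<longleftrightarrow> dom_list xs ys"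
  unfolding mdom_def using dom_list_permute by metis

lemma mdom_refl: "mdom X X"
proof -
  obtain xs where X: "X = mset xs" by (metis ex_mset)
  have "(\<Sum>l<length xs. (if l = i then 1 else 0)\<star> * xs ! l * (if l = j then 1 else 0))
      = (if i = j then xs ! i else 0)" if "i < length xs" for i j
  proof -
    have "(\<Sum>l<length xs. (if l = i then 1 else 0)\<star> * xs ! l * (if l = j then 1 else 0))
        = (\<Sum>l<length xs. if l = i then (if i = j then xs ! i else 0) else 0)"
      by (intro sum.cong) auto
    then show ?thesis using that by simp
  qed
  then show ?thesis unfolding X mdom_mset by (intro dom_listI[where z = "%l i. if l = i then 1 else 0"]) blast
qed

text \<open>The witness is the product of the two rectangular witnesses.\<close>

lemma dom_list_trans:
  assumes "dom_list xs ys" "dom_list ys ws"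
  shows "dom_list xs ws"
proof -
  obtain z where z: "!!i j. i < length xs ==> j < length xs ==>
      (\<Sum>l<length ys. (z l i)\<star> * ys ! l * z l j) = (if i = j then xs ! i else 0)"
    using assms(1) by (auto simp: dom_list_def)
  obtain y where y: "!!i j. i < length ys ==> j < length ys ==>
      (\<Sum>l<length ws. (y l i)\<star> * ws ! l * y l j) = (if i = j then ys ! i else 0)"
    using assms(2) by (auto simp: dom_list_def)
  define u where "u l i = (\<Sum>m<length ys. y l m * z m i)" for l i
  have "(\<Sum>l<length ws. (u l i)\<star> * ws ! l * u l j) = (if i = j then xs ! i else 0)"
    if "i < length xs" "j < length xs" for i j
  proof -
    have "(u l i)\<star> * ws ! l * u l j
        = (\<Sum>m<length ys. \<Sum>m'<length ys. (z m i)\<star> * ((y l m)\<star> * ws ! l * y l m') * z m' j)" for l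
      unfolding u_def star_sum sum_distrib_left sum_distrib_right
      by (subst sum.swap) (intro sum.cong refl, simp add: star_mult mult.assoc)
    then have "(\<Sum>l<length ws. (u l i)\<star> * ws ! l * u l j)
        = (\<Sum>l<length ws. \<Sum>m<length ys. \<Sum>m'<length ys. (z m i)\<star> * ((y l m)\<star> * ws ! l * y l m') * z m' j)"
      by simp
    also have "... = (\<Sum>m<length ys. \<Sum>m'<length ys. \<Sum>l<length ws. (z m i)\<star> * ((y l m)\<star> * ws ! l * y l m') * z m' j)"
      by (subst sum.swap) (rule sum.cong[OF refl], rule sum.swap)
    also have "... = (\<Sum>m<length ys. \<Sum>m'<length ys. (z m i)\<star> * (\<Sum>l<length ws. (y l m)\<star> * ws ! l * y l m') * z m' j)"
      by (simp add: sum_distrib_left sum_distrib_right)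
    also have "... = (\<Sum>m<length ys. \<Sum>m'<length ys. if m' = m then (z m i)\<star> * ys ! m * z m j else 0)"
      by (intro sum.cong refl) (auto simp: y)
    also have "... = (\<Sum>m<length ys. (z m i)\<star> * ys ! m * z m j)" by simp
    also have "... = (if i = j then xs ! i else 0)" by (rule z[OF that])
    finally show ?thesis .
  qed
  then show ?thesis by (rule dom_listI)
qed

lemma mdom_trans [trans]: "mdom X Y ==> mdom Y W ==> mdom X W"
  by (metis ex_mset mdom_mset dom_list_trans)

lemma dom_list_append:
  assumes "dom_list xs ys" "dom_list xs' ys'"
  shows "dom_list (xs @ xs') (ys @ ys')"
proof -
  let ?n = "length xs" and ?m = "length ys" and ?n' = "length xs'" and ?m' = "length ys'"
  obtain z where z: "!!i j. i < ?n ==> j < ?n ==>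
      (\<Sum>l<?m. (z l i)\<star> * ys ! l * z l j) = (if i = j then xs ! i else 0)"
    using assms(1) by (auto simp: dom_list_def)
  obtain y where y: "!!i j. i < ?n' ==> j < ?n' ==>
      (\<Sum>l<?m'. (y l i)\<star> * ys' ! l * y l j) = (if i = j then xs' ! i else 0)"
    using assms(2) by (auto simp: dom_list_def)
  define u where "u l i = (if i < ?n then if l < ?m then z l i else 0 else if l < ?m then 0 else y (l - ?m) (i - ?n))" for l i
  have "(\<Sum>l<length (ys @ ys'). (u l i)\<star> * (ys @ ys') ! l * u l j) = (if i = j then (xs @ xs') ! i else 0)"
    if ij: "i < length (xs @ xs')" "j < length (xs @ xs')" for i j
  proof -
    have "(\<Sum>l<length (ys @ ys'). (u l i)\<star> * (ys @ ys') ! l * u l j)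
        = (\<Sum>l<?m. (u l i)\<star> * ys ! l * u l j) + (\<Sum>l<?m'. (u (?m + l) i)\<star> * ys' ! l * u (?m + l) j)"
      unfolding length_append sum_lessThan_add
      by (intro arg_cong2[of _ _ _ _ "(+)"] sum.cong) (auto simp: nth_append)
    also have "(\<Sum>l<?m. (u l i)\<star> * ys ! l * u l j) = (if i < ?n \<and> j < ?n then if i = j then xs ! i else 0 else 0)"
      using z[of i j] by (auto simp: u_def)
    also have "(\<Sum>l<?m'. (u (?m + l) i)\<star> * ys' ! l * u (?m + l) j)
        = (if i < ?n \<or> j < ?n then 0 else if i = j then xs' ! (i - ?n) else 0)"
      using y[of "i - ?n" "j - ?n"] ij by (auto simp: u_def)
    finally show ?thesis by (auto simp: nth_append)
  qed
  then show ?thesis by (rule dom_listI)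
qed

lemma mdom_add: "mdom X Y ==> mdom X' Y' ==> mdom (X + X') (Y + Y')"
  by (metis ex_mset mdom_mset mset_append dom_list_append)

lemma mdom_empty [simp]: "mdom {#} Y"
  by (metis ex_mset mdom_mset dom_list_def mset.simps(1) list.size(3) not_less_zero)

lemma mdom_subset: "X \<subseteq># Y ==> mdom X Y"
  using mdom_add[OF mdom_refl[of X] mdom_empty[of "Y - X"]] by simp

lemma mdom_zero: "mdom {#0#} {#}"
  unfolding mset_single_iff[symmetric] using mdom_mset[of "[0]" "[]"] by (auto simp: dom_list_def)

lemma mdom_repeat: "mdom X Y ==> mdom (repeat_mset n X) (repeat_mset n Y)"
  by (induction n) (auto intro: mdom_add)

lemma mdom_replicate_le: "m <= n ==> mdom (replicate_mset m x) (replicate_mset n x)"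
  by (rule mdom_subset) (simp add: mset_subset_eqI)

lemma repeat_replicate_mset: "repeat_mset m (replicate_mset n x) = replicate_mset (m * n) x"
  by (rule multiset_eqI) simp

lemma mdom_single: "mdom {#q#} {#b#} \<longleftrightarrow> (\<exists>v. v\<star> * b * v = q)"
  using mdom_mset[of "[q]" "[b]"] by (auto simp: dom_list_def)

lemma mdom_single_target: "mdom (mset xs) {#b#} \<longleftrightarrow>
  (\<exists>z. \<forall>i<length xs. \<forall>j<length xs. (z i)\<star> * b * z j = (if i = j then xs ! i else 0))"
proof -
  have "dom_list xs [b] \<longleftrightarrow>
    (\<exists>z. \<forall>i<length xs. \<forall>j<length xs. (z i)\<star> * b * z j = (if i = j then xs ! i else 0))"
  proof
    assume "dom_list xs [b]"
    then obtain z where "\<forall>i<length xs. \<forall>j<length xs. (z 0 i)\<star> * b * z 0 j = (if i = j then xs ! i else 0)"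
      by (auto simp: dom_list_def)
    then show "\<exists>z. \<forall>i<length xs. \<forall>j<length xs. (z i)\<star> * b * z j = (if i = j then xs ! i else 0)"
      by blast
  next
    assume "\<exists>z. \<forall>i<length xs. \<forall>j<length xs. (z i)\<star> * b * z j = (if i = j then xs ! i else 0)"
    then obtain z where "\<forall>i<length xs. \<forall>j<length xs. (z i)\<star> * b * z j = (if i = j then xs ! i else 0)" by blast
    then show "dom_list xs [b]" by (intro dom_listI[where z = "%l. z"]) simp
  qed
  then show ?thesis using mdom_mset[of xs "[b]"] by simp
qed

lemma mdom_cuntz_le: "is_proj q ==> cpos b ==> mdom {#q#} {#b#} \<longleftrightarrow> q \<lessapprox> b"
  by (simp add: mdom_single projection_cuntz_le_iff)

text \<open>In both directions the witness is the vector with entries \<open>P\<close> and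
  \<open>1 - P\<close>, as a row or as a column.\<close>

lemma mdom_orthogonal_sum:
  assumes P: "is_proj P" and g: "P * g = 0" "g * P = 0"
  shows "mdom {#P, g#} {#P + g#}" "mdom {#P + g#} {#P, g#}"
proof -
  have "\<forall>i<length [P, g]. \<forall>j<length [P, g]. ([P, 1 - P] ! i)\<star> * (P + g) * ([P, 1 - P] ! j) = (if i = j then [P, g] ! i else 0)"
    using g is_projD[OF P] by (auto simp: less_Suc_eq star_diff algebra_simps)
  then have "mdom (mset [P, g]) {#P + g#}" unfolding mdom_single_target by blast
  then show "mdom {#P, g#} {#P + g#}" by simp
  have "(\<Sum>l<length [P, g]. ([P, 1 - P] ! l)\<star> * [P, g] ! l * ([P, 1 - P] ! l)) = P + g"
    using g is_projD[OF P] by (simp add: star_diff algebra_simps)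
  then have "dom_list [P + g] [P, g]" unfolding dom_list_def
    by (intro exI[of _ "%l i. [P, 1 - P] ! l"]) simp
  then have "mdom (mset [P + g]) (mset [P, g])" unfolding mdom_mset .
  then show "mdom {#P + g#} {#P, g#}" by simp
qed

text \<open>\<open>p\<close> is the sum of the orthogonal range projections of the
  \<open>w i\<close>; these partial isometries and their adjoints are the witnesses.\<close>

lemma proj_of_isometries:
  fixes xs :: "'a::unital_cstar_algebra list"
  assumes ww: "!!i j. i < length xs ==> j < length xs ==> (w i)\<star> * w j = (if i = j then xs ! i else 0)"
    and X: "!!x. x \<in> set xs ==> is_proj x"
  defines "p \<equiv> \<Sum>i<length xs. w i * (w i)\<star>"
  shows "is_proj p" "mdom (mset xs) {#p#}" "mdom {#p#} (mset xs)"
proof -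
  let ?n = "length xs"
  have pr: "is_proj (xs ! i)" if "i < ?n" for i using X that by auto
  have wx: "w i * xs ! i = w i" if "i < ?n" for i
    by (rule partial_isometry_right[OF _ pr[OF that]]) (use ww[OF that that] in simp)
  have xw: "xs ! i * (w i)\<star> = (w i)\<star>" if "i < ?n" for i
    using arg_cong[OF wx[OF that], of star] is_projD[OF pr[OF that]] by (simp add: star_mult)
  have pw: "p * w j = w j" if "j < ?n" for j
  proof -
    have "p * w j = (\<Sum>i<?n. w i * ((w i)\<star> * w j))" by (simp add: p_def sum_distrib_right mult.assoc)
    also have "... = (\<Sum>i<?n. if i = j then w j else 0)" by (intro sum.cong refl) (auto simp: ww that wx)
    finally show ?thesis using that by simp
  qed
  have ps: "p\<star> = p" by (simp add: p_def star_sum star_mult)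
  have "p * p = p * (\<Sum>j<?n. w j * (w j)\<star>)" unfolding p_def ..
  also have "... = (\<Sum>j<?n. p * w j * (w j)\<star>)" by (simp add: sum_distrib_left mult.assoc)
  also have "... = (\<Sum>j<?n. w j * (w j)\<star>)" by (intro sum.cong) (auto simp: pw)
  also have "... = p" by (simp add: p_def)
  finally show "is_proj p" using ps by (simp add: is_proj_def)
  show "mdom (mset xs) {#p#}" unfolding mdom_single_target
    by (intro exI[of _ w]) (auto simp: mult.assoc pw ww)
  have "dom_list [p] xs" unfolding dom_list_def
    by (intro exI[of _ "%l i. (w l)\<star>"]) (simp add: mult.assoc xw, simp add: p_def)
  then have "mdom (mset [p]) (mset xs)" unfolding mdom_mset .
  then show "mdom {#p#} (mset xs)" by simp
qed

text \<open>The elements \<open>csqrt_el b * z i\<close> are partial isometries with orthogonal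
  ranges, and \<open>p\<close> is the sum of their range projections. Results on single projections
  thereby extend to multisets.\<close>

lemma mdom_realize:
  assumes X: "!!x. x \<in># X ==> is_proj x" and b: "cpos b" and d: "mdom X {#b#}"
  obtains p where "is_proj p" "mdom X {#p#}" "mdom {#p#} X" "mdom {#p#} {#b#}"
proof -
  obtain xs where xs: "X = mset xs" by (metis ex_mset)
  let ?n = "length xs"
  obtain z where z: "!!i j. i < ?n ==> j < ?n ==> (z i)\<star> * b * z j = (if i = j then xs ! i else 0)"
    using d unfolding xs mdom_single_target by blast
  define w where "w i = csqrt_el b * z i" for i
  have ww: "(w i)\<star> * w j = (if i = j then xs ! i else 0)" if "i < ?n" "j < ?n" for i j
    unfolding w_def csqrt_conj[OF b] using z[OF that] .
  have pr: "is_proj x" if "x \<in> set xs" for x using X that by (auto simp: xs)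
  define p where "p = (\<Sum>i<?n. w i * (w i)\<star>)"
  note p = proj_of_isometries[OF ww pr, folded p_def]
  define v where "v = (\<Sum>i<?n. z i * (w i)\<star>)"
  have "csqrt_el b * v = (\<Sum>i<?n. w i * (w i)\<star>)" by (simp add: v_def w_def sum_distrib_left mult.assoc)
  then have "v\<star> * b * v = p\<star> * p" using csqrt_conj[OF b, of v v] by (simp add: p_def)
  then have "mdom {#p#} {#b#}" unfolding mdom_single using is_projD[OF p(1)] by auto
  with p show thesis by (intro that[of p]) (simp_all add: xs)
qed

lemma mdom_mono_cuntz:
  assumes X: "!!x. x \<in># X ==> is_proj x" and b: "cpos b" "cpos c" and d: "mdom X {#b#}" "b \<lessapprox> c"
  shows "mdom X {#c#}"
proof -
  obtain p where p: "is_proj p" "mdom X {#p#}" "mdom {#p#} {#b#}" using mdom_realize[OF X b(1) d(1)] by blast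
  then have "p \<lessapprox> b" by (simp add: mdom_cuntz_le b)
  then have "p \<lessapprox> c" using d(2) by (rule cuntz_le_trans)
  then have "mdom {#p#} {#c#}" by (simp add: mdom_cuntz_le b p)
  with p(2) show ?thesis by (rule mdom_trans)
qed

lemma mdom_full:
  fixes g :: "'a::unital_cstar_algebra"
  assumes "simple_cstar TYPE('a)" "cpos g" "g ~= 0"
  obtains M where "mdom {#1#} (replicate_mset M g)"
proof -
  obtain M and z :: "nat => 'a" where "(\<Sum>i<M. (z i)\<star> * g * z i) = 1" using simple_full[OF assms] .
  then have "dom_list [1] (replicate M g)" unfolding dom_list_def by (intro exI[of _ "%l i. z l"]) simp
  then have "mdom (mset [1]) (mset (replicate M g))" unfolding mdom_mset .
  then show thesis by (intro that[of M]) simp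
qed

lemma mdom_proj_one: "is_proj q ==> mdom {#q#} {#1#}"
  unfolding mdom_single by (intro exI[of _ q]) (simp add: is_projD)

section \<open>Approximately central matrix units\<close>

definition block_size :: "nat => bool => nat" where "block_size N s = (if s then Suc N else N)"

text \<open>Matrix units of a unital copy of a quotient of \<open>M\<^sub>N \<oplus> M\<^sub>N\<^sub>+\<^sub>1\<close>; the flag selects the summand.\<close>

definition mat_units :: "nat => (bool => nat => nat => 'a::unital_cstar_algebra) => bool"
  where "mat_units N u \<longleftrightarrow>
    (\<forall>s t i j k l. i < block_size N s --> j < block_size N s --> k < block_size N t --> l < block_size N t -->
      u s i j * u t k l = (if s = t \<and> j = k then u s i l else 0)) \<and>
    (\<forall>s i j. i < block_size N s --> j < block_size N s --> (u s i j)\<star> = u s j i) \<and>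
    (\<Sum>s\<in>UNIV. \<Sum>i<block_size N s. u s i i) = 1"

lemma mat_unitsD:
  assumes "mat_units N u"
  shows "i < block_size N s ==> j < block_size N s ==> k < block_size N t ==> l < block_size N t ==>
      u s i j * u t k l = (if s = t \<and> j = k then u s i l else 0)"
    and "i < block_size N s ==> j < block_size N s ==> (u s i j)\<star> = u s j i"
    and "(\<Sum>s\<in>UNIV. \<Sum>i<block_size N s. u s i i) = 1"
    and "i < block_size N s ==> j < block_size N s ==> norm (u s i j) <= 1"
proof -
  show 1: "i < block_size N s ==> j < block_size N s ==> k < block_size N t ==> l < block_size N t ==>
      u s i j * u t k l = (if s = t \<and> j = k then u s i l else 0)" for i j s k t l
    using assms unfolding mat_units_def by blast
  show 2: "i < block_size N s ==> j < block_size N s ==> (u s i j)\<star> = u s j i" for i j s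
    using assms unfolding mat_units_def by blast
  show "(\<Sum>s\<in>UNIV. \<Sum>i<block_size N s. u s i i) = 1"
    using assms unfolding mat_units_def by blast
  show "i < block_size N s ==> j < block_size N s ==> norm (u s i j) <= 1" for i j s
    by (rule norm_of_projection_star) (simp add: is_proj_def 1 2)
qed

definition unit_mat :: "nat => nat => nat => complex mat"
  where "unit_mat n i j = mat n n (%(a, b). if a = i \<and> b = j then 1 else 0)"

lemma unit_mat_carrier [simp]: "unit_mat n i j \<in> carrier_mat n n"
  by (simp add: unit_mat_def)

lemma unit_mat_mult:
  assumes "i < n" "j < n" "k < n" "l < n"
  shows "unit_mat n i j * unit_mat n k l = (if j = k then unit_mat n i l else 0\<^sub>m n n)"
proof (rule eq_matI)
  fix a b assume "a < dim_row (if j = k then unit_mat n i l else 0\<^sub>m n n)" "b < dim_col (if j = k then unit_mat n i l else 0\<^sub>m n n)"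
  then have ab: "a < n" "b < n" by (auto simp: unit_mat_def split: if_splits)
  have "(unit_mat n i j * unit_mat n k l) $$ (a, b)
      = (\<Sum>c\<in>{0..<n}. (if a = i \<and> c = j then 1 else 0) * (if c = k \<and> b = l then 1 else 0))"
    using ab by (simp add: unit_mat_def scalar_prod_def)
  also have "... = (\<Sum>c\<in>{0..<n}. if c = j then (if a = i \<and> j = k \<and> b = l then 1 else 0) else 0)"
    by (intro sum.cong) auto
  also have "... = (if a = i \<and> j = k \<and> b = l then 1 else 0)" using assms by simp
  finally show "(unit_mat n i j * unit_mat n k l) $$ (a, b) = (if j = k then unit_mat n i l else 0\<^sub>m n n) $$ (a, b)"
    using ab by (auto simp: unit_mat_def)
qed (auto simp: unit_mat_def)

lemma unit_mat_star: "i < n ==> j < n ==> mat_star (unit_mat n i j) = unit_mat n j i"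
  by (rule eq_matI) (auto simp: unit_mat_def mat_star_def star_complex_def)

text \<open>Approximate centrality is pointwise; a finite \<open>e / 4\<close>-net of
  \<open>K\<close> and \<open>norm (u s i j) <= 1\<close> make it uniform on \<open>K\<close>.
  Compact sets arise as the values of whole families.\<close>

lemma approx_central_mat_units:
  fixes K :: "'a::unital_cstar_algebra set"
  assumes ad: "approximately_divisible TYPE('a)" and K: "compact K" and e: "e > 0"
  obtains u :: "bool => nat => nat => 'a" where "mat_units N u"
    "!!s i j x. i < block_size N s ==> j < block_size N s ==> x \<in> K ==> norm (u s i j * x - x * u s i j) <= e"
proof -
  obtain f :: "nat => complex mat \<times> complex mat => 'a" where
    hom: "!!n. unital_hom_from_matrices N (f n)" and
    lim: "!!x y a. x \<in> carrier_mat N N ==> y \<in> carrier_mat (N + 1) (N + 1) ==>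
      (%n. norm (f n (x, y) * a - a * f n (x, y))) \<longlonglongrightarrow> 0"
    using ad unfolding approximately_divisible_def by blast
  define E where "E s i j = (if s then (0\<^sub>m N N, unit_mat (N + 1) i j) else (unit_mat N i j, 0\<^sub>m (N + 1) (N + 1)))" for s i j
  define u where "u n s i j = f n (E s i j)" for n s i j
  have mu: "mat_units N (u n)" for n
  proof -
    have one: "f n (1\<^sub>m N, 1\<^sub>m (N + 1)) = 1" using hom[of n] by (simp add: unital_hom_from_matrices_def)
    have star: "f n (mat_star x, mat_star y) = (f n (x, y))\<star>"
      and scl: "f n (c \<cdot>\<^sub>m x, c \<cdot>\<^sub>m y) = c *C f n (x, y)"
      and add: "x' \<in> carrier_mat N N ==> y' \<in> carrier_mat (N + 1) (N + 1) ==> f n (x + x', y + y') = f n (x, y) + f n (x', y')"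
      and mul: "x' \<in> carrier_mat N N ==> y' \<in> carrier_mat (N + 1) (N + 1) ==> f n (x * x', y * y') = f n (x, y) * f n (x', y')"
      if "x \<in> carrier_mat N N" "y \<in> carrier_mat (N + 1) (N + 1)" for x y x' y' c
      using hom[of n] that unfolding unital_hom_from_matrices_def by blast+
    have z: "f n (0\<^sub>m N N, 0\<^sub>m (N + 1) (N + 1)) = 0"
      using scl[of "0\<^sub>m N N" "0\<^sub>m (N + 1) (N + 1)" 0] by simp
    have p: "u n s i j * u n t k l = (if s = t \<and> j = k then u n s i l else 0)"
      if "i < block_size N s" "j < block_size N s" "k < block_size N t" "l < block_size N t" for s t i j k l
      using that mul[of "fst (E s i j)" "snd (E s i j)" "fst (E t k l)" "snd (E t k l)"]
      by (cases s; cases t) (auto simp: u_def E_def unit_mat_mult block_size_def z z[simplified]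
          left_mult_zero_mat[OF unit_mat_carrier] right_mult_zero_mat[OF unit_mat_carrier] simp flip: mul)
    have zs: "mat_star (0\<^sub>m m m :: complex mat) = 0\<^sub>m m m" for m
      by (rule eq_matI) (auto simp: mat_star_def star_complex_def)
    have st: "(u n s i j)\<star> = u n s j i" if "i < block_size N s" "j < block_size N s" for s i j
      using that star[of "fst (E s i j)" "snd (E s i j)"]
      by (cases s) (auto simp: u_def E_def unit_mat_star block_size_def zs simp flip: star)
    \<comment> \<open>Partial identities: induction on \<open>m\<close> turns additivity of the
      homomorphism into the sum of the diagonal units.\<close>
    define D where "D k m = mat k k (%(a, b). if a = b \<and> a < m then 1 else 0 :: complex)" for k m
    have Dc [simp]: "D k m \<in> carrier_mat k k" for k m by (simp add: D_def)
    have D0: "D k 0 = 0\<^sub>m k k" and DS: "D k (Suc m) = D k m + unit_mat k m m" and D1: "D k k = 1\<^sub>m k" for k m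
      by (rule eq_matI; auto simp: D_def unit_mat_def)+
    have s0: "f n (D N m, 0\<^sub>m (N + 1) (N + 1)) = (\<Sum>i<m. u n False i i)" for m
    proof (induction m)
      case (Suc m)
      show ?case using add[of "D N m" "0\<^sub>m (N + 1) (N + 1)" "unit_mat N m m" "0\<^sub>m (N + 1) (N + 1)"] Suc
        by (simp add: DS u_def E_def)
    qed (simp add: D0 z[simplified])
    have s1: "f n (0\<^sub>m N N, D (N + 1) m) = (\<Sum>i<m. u n True i i)" for m
    proof (induction m)
      case (Suc m)
      show ?case using add[of "0\<^sub>m N N" "D (N + 1) m" "0\<^sub>m N N" "unit_mat (N + 1) m m"] Suc
        by (simp add: DS u_def E_def)
    qed (simp add: D0 z[simplified])
    have "(\<Sum>s\<in>UNIV. \<Sum>i<block_size N s. u n s i i) = f n (D N N, 0\<^sub>m (N + 1) (N + 1)) + f n (0\<^sub>m N N, D (N + 1) (N + 1))"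
      unfolding s0 s1 by (simp add: UNIV_bool block_size_def)
    also have "... = f n (1\<^sub>m N, 1\<^sub>m (N + 1))"
      using add[of "1\<^sub>m N" "0\<^sub>m (N + 1) (N + 1)" "0\<^sub>m N N" "1\<^sub>m (N + 1)"] by (simp add: D1)
    finally show ?thesis using p st one unfolding mat_units_def by simp
  qed
  have cov: "K \<subseteq> (\<Union>x\<in>K. ball x (e / 4))" using e by auto
  obtain F where F0: "F \<subseteq> K" "finite F" "K \<subseteq> (\<Union>x\<in>F. ball x (e / 4))"
    by (rule compactE_image[OF K _ cov]) auto
  note F = F0(2,1,3)
  define I where "I = (SIGMA s:(UNIV :: bool set). {..<block_size N s} \<times> {..<block_size N s})"
  have "\<forall>\<^sub>F n in sequentially. \<forall>x\<in>F. \<forall>(s, i, j)\<in>I. norm (u n s i j * x - x * u n s i j) < e / 2"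
  proof (intro eventually_ball_finite F ballI)
    show "finite I" by (simp add: I_def)
    fix x and sij assume "sij \<in> I"
    obtain s i j where sij: "sij = (s, i, j)" by (cases sij)
    have "(%n. norm (u n s i j * x - x * u n s i j)) \<longlonglongrightarrow> 0"
      unfolding u_def E_def by (cases s) (auto intro: lim)
    then have "\<forall>\<^sub>F n in sequentially. norm (u n s i j * x - x * u n s i j) < e / 2"
      using e by (intro order_tendstoD(2)) auto
    then show "\<forall>\<^sub>F n in sequentially. case sij of (s, i, j) => norm (u n s i j * x - x * u n s i j) < e / 2"
      by (simp add: sij)
  qed
  then obtain n where n: "!!x s i j. x \<in> F ==> (s, i, j) \<in> I ==> norm (u n s i j * x - x * u n s i j) < e / 2"
    by (auto simp: eventually_sequentially) blast
  show thesis
  proof (rule that[of "u n", OF mu])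
    fix s i j x assume ij: "i < block_size N s" "j < block_size N s" and x: "x \<in> K"
    obtain y where y: "y \<in> F" "norm (y - x) < e / 4" using F(3) x by (auto simp: dist_norm)
    have nu: "norm (u n s i j) <= 1" using mat_unitsD(4)[OF mu] ij .
    have "norm (u n s i j * y - y * u n s i j) < e / 2" using n[OF y(1)] ij by (simp add: I_def)
    moreover have "norm (u n s i j * (x - y)) <= 1 * norm (x - y)"
      by (rule order.trans[OF norm_mult_ineq mult_right_mono[OF nu]]) simp
    moreover have "norm ((x - y) * u n s i j) <= norm (x - y) * 1"
      by (rule order.trans[OF norm_mult_ineq mult_left_mono[OF nu]]) simp
    moreover have "u n s i j * x - x * u n s i j
        = (u n s i j * y - y * u n s i j) + (u n s i j * (x - y) - (x - y) * u n s i j)" by (simp add: algebra_simps)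
    ultimately show "norm (u n s i j * x - x * u n s i j) <= e"
      using norm_triangle_ineq[of "u n s i j * y - y * u n s i j" "u n s i j * (x - y) - (x - y) * u n s i j"]
        norm_triangle_ineq4[of "u n s i j * (x - y)" "(x - y) * u n s i j"] y(2)
      by (simp only: norm_minus_commute[of y x])
  qed
qed

text \<open>Each \<open>(F p)\<star>\<close> is moved past the middle factor at cost
  \<open>e\<close>, once for every pair of summands.\<close>

lemma approx_commute_sum:
  fixes F :: "'i => 'a::unital_cstar_algebra" and G :: "'j => 'a"
  assumes P: "finite P" "finite Q" and F: "!!p. p \<in> P ==> norm (F p) <= 1" and G: "!!q. q \<in> Q ==> norm (G q) <= 1"
    and c: "!!p q. p \<in> P ==> q \<in> Q ==> norm ((F p)\<star> * ((Y p)\<star> * b * Z q) - ((Y p)\<star> * b * Z q) * (F p)\<star>) <= e"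
  shows "norm ((\<Sum>p\<in>P. Y p * F p)\<star> * b * (\<Sum>q\<in>Q. Z q * G q) - (\<Sum>p\<in>P. \<Sum>q\<in>Q. ((Y p)\<star> * b * Z q) * ((F p)\<star> * G q)))
    <= real (card P) * real (card Q) * e"
proof -
  have "(\<Sum>p\<in>P. Y p * F p)\<star> * b * (\<Sum>q\<in>Q. Z q * G q) = (\<Sum>p\<in>P. \<Sum>q\<in>Q. (F p)\<star> * ((Y p)\<star> * b * Z q) * G q)"
    unfolding star_sum sum_distrib_left sum_distrib_right
    by (subst sum.swap) (simp add: star_mult mult.assoc)
  then have "(\<Sum>p\<in>P. Y p * F p)\<star> * b * (\<Sum>q\<in>Q. Z q * G q) - (\<Sum>p\<in>P. \<Sum>q\<in>Q. ((Y p)\<star> * b * Z q) * ((F p)\<star> * G q))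
     = (\<Sum>p\<in>P. \<Sum>q\<in>Q. ((F p)\<star> * ((Y p)\<star> * b * Z q) - ((Y p)\<star> * b * Z q) * (F p)\<star>) * G q)"
    by (simp add: sum_subtractf left_diff_distrib mult.assoc)
  also have "norm ... <= (\<Sum>p\<in>P. \<Sum>q\<in>Q. e)"
  proof (intro sum_norm_le)
    fix p q assume pq: "p \<in> P" "q \<in> Q"
    have "0 <= e" using c[OF pq] norm_ge_zero order.trans by blast
    have "norm (((F p)\<star> * ((Y p)\<star> * b * Z q) - ((Y p)\<star> * b * Z q) * (F p)\<star>) * G q) <= e * 1"
      by (rule order.trans[OF norm_mult_ineq mult_mono]) (use c[OF pq] G[OF pq(2)] \<open>0 <= e\<close> in auto)
    then show "norm (((F p)\<star> * ((Y p)\<star> * b * Z q) - ((Y p)\<star> * b * Z q) * (F p)\<star>) * G q) <= e" by simp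
  qed
  also have "... = real (card P) * real (card Q) * e" by simp
  finally show ?thesis .
qed

lemma replicate_repeat_mset: "replicate_mset n x = repeat_mset n {#x#}"
  by (rule multiset_eqI) simp

text \<open>For \<open>N = K * K\<close> with \<open>K > 0\<close> both block sizes \<open>N\<close>
  and \<open>N + 1\<close> lie between \<open>K * K\<close> and \<open>K * Suc K\<close>, so for
  each block size \<open>n\<close>, \<open>n\<close> copies of \<open>q\<close> fit under
  \<open>n\<close> copies of \<open>b\<close>. The matrix witness \<open>x\<close> is folded into
  one element, its entries being multiplied by approximately central matrix units; this reproduces
  \<open>q\<close> up to an error less than 1, which a projection absorbs.\<close>

lemma almost_unperforated:
  fixes q b :: "'a::unital_cstar_algebra"
  assumes ad: "approximately_divisible TYPE('a)" and q: "is_proj q" and b: "cpos b"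
    and d: "mdom (replicate_mset (Suc K) q) (replicate_mset K b)"
  shows "mdom {#q#} {#b#}"
proof (cases "K = 0")
  case True
  then show ?thesis using d mdom_trans[OF _ mdom_empty] by simp
next
  case False
  define N where "N = K * K"
  let ?n = "block_size N"
  have "mdom (repeat_mset K (replicate_mset (Suc K) q)) (repeat_mset K (replicate_mset K b))"
    using d by (rule mdom_repeat)
  then have base: "mdom (replicate_mset (K * Suc K) q) (replicate_mset (K * K) b)"
    by (simp only: repeat_replicate_mset)
  have "mdom (replicate_mset (?n s) q) (replicate_mset (?n s) b)" for s
  proof -
    have "?n s <= K * Suc K" using False by (simp add: block_size_def N_def)
    then have "mdom (replicate_mset (?n s) q) (replicate_mset (K * K) b)"
      using mdom_trans[OF mdom_replicate_le base] by blast
    then show ?thesis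
      using mdom_trans[OF _ mdom_replicate_le, of _ "K * K" b "?n s"] by (simp add: block_size_def N_def)
  qed
  then have "dom_list (replicate (?n s) q) (replicate (?n s) b)" for s
    using mdom_mset[of "replicate (?n s) q" "replicate (?n s) b"] by simp
  then have "\<forall>s. \<exists>z. \<forall>i<?n s. \<forall>j<?n s. (\<Sum>l<?n s. (z l i)\<star> * replicate (?n s) b ! l * z l j)
      = (if i = j then replicate (?n s) q ! i else 0)"
    unfolding dom_list_def length_replicate by blast
  from choice[OF this] obtain x where
    x0: "\<forall>s. \<forall>i<?n s. \<forall>j<?n s. (\<Sum>l<?n s. (x s l i)\<star> * replicate (?n s) b ! l * x s l j)
      = (if i = j then replicate (?n s) q ! i else 0)" by blast
  have x: "(\<Sum>l<?n s. (x s l i)\<star> * b * x s l j) = (if i = j then q else 0)" if "i < ?n s" "j < ?n s" for s i j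
  proof -
    have "(\<Sum>l<?n s. (x s l i)\<star> * b * x s l j) = (\<Sum>l<?n s. (x s l i)\<star> * replicate (?n s) b ! l * x s l j)"
      by (intro sum.cong) auto
    then show ?thesis using x0 that by simp
  qed
  define P where "P = (SIGMA s:(UNIV :: bool set). {..<?n s} \<times> {..<?n s})"
  have fP: "finite P" by (simp add: P_def)
  have sumP: "(\<Sum>p\<in>P. f p) = (\<Sum>s\<in>UNIV. \<Sum>l<?n s. \<Sum>i<?n s. f (s, l, i))" for f :: "_ => 'a"
  proof -
    have "(\<Sum>s\<in>UNIV. \<Sum>l<?n s. \<Sum>i<?n s. f (s, l, i)) = (\<Sum>s\<in>UNIV. \<Sum>x\<in>{..<?n s} \<times> {..<?n s}. f (s, x))"
      by (simp add: sum.cartesian_product)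
    also have "... = (\<Sum>(s, x)\<in>P. f (s, x))" unfolding P_def by (rule sum.Sigma) auto
    finally show ?thesis by simp
  qed
  define Y where "Y = (%(s, l, i). x s l i)"
  define e where "e = 1 / ((real (card P))\<^sup>2 + 1)"
  have e: "e > 0" "(real (card P))\<^sup>2 * e < 1"
    by (simp_all add: e_def add_nonneg_pos)
  define C where "C = (%(p, r). (Y p)\<star> * b * Y r) ` (P \<times> P)"
  have "compact C" unfolding C_def using fP by (intro finite_imp_compact) auto
  from approx_central_mat_units[OF ad this e(1), of N] obtain u where
    u: "mat_units N u" "!!s i j x. i < ?n s ==> j < ?n s ==> x \<in> C ==> norm (u s i j * x - x * u s i j) <= e"
    by blast
  define F where "F = (%(s, l, i). u s l i)"
  note mu = mat_unitsD[OF u(1)]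
  define X where "X = (\<Sum>p\<in>P. Y p * F p)"
  have "norm (X\<star> * b * X - (\<Sum>p\<in>P. \<Sum>r\<in>P. ((Y p)\<star> * b * Y r) * ((F p)\<star> * F r))) <= (real (card P))\<^sup>2 * e"
    unfolding X_def
  proof (rule approx_commute_sum[OF fP fP, folded power2_eq_square])
    show "norm (F p) <= 1" if "p \<in> P" for p using that mu(4) by (auto simp: P_def F_def)
    then show "norm (F p) <= 1" if "p \<in> P" for p using that .
    fix p r assume pr: "p \<in> P" "r \<in> P"
    then have "(Y p)\<star> * b * Y r \<in> C" by (force simp: C_def)
    then show "norm ((F p)\<star> * ((Y p)\<star> * b * Y r) - ((Y p)\<star> * b * Y r) * (F p)\<star>) <= e"
      using pr u(2) mu(2) by (auto simp: P_def F_def)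
  qed
  also have "(\<Sum>p\<in>P. \<Sum>r\<in>P. ((Y p)\<star> * b * Y r) * ((F p)\<star> * F r)) = q"
  proof -
    let ?z = "%s l i t k j. (x s l i)\<star> * b * x t k j"
    have "(\<Sum>r\<in>P. ((Y (s, l, i))\<star> * b * Y r) * ((F (s, l, i))\<star> * F r)) = (\<Sum>j<?n s. ?z s l i s l j * u s i j)"
      if "l < ?n s" "i < ?n s" for s l i
    proof -
      have "(\<Sum>r\<in>P. ((Y (s, l, i))\<star> * b * Y r) * ((F (s, l, i))\<star> * F r))
          = (\<Sum>t\<in>UNIV. if t = s then (\<Sum>k<?n s. if k = l then (\<Sum>j<?n s. ?z s l i s l j * u s i j) else 0) else 0)"
        unfolding sumP
      proof (rule sum.cong[OF refl])
        fix t
        let ?h = "%j. ?z s l i s l j * u s i j"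
        have G: "((Y (s, l, i))\<star> * b * Y (t, k, j)) * ((F (s, l, i))\<star> * F (t, k, j)) = (if t = s \<and> k = l then ?h j else 0)"
          if "k < ?n t" "j < ?n t" for k j
          using that \<open>l < ?n s\<close> \<open>i < ?n s\<close> by (auto simp: Y_def F_def mu)
        have "(\<Sum>k<?n t. \<Sum>j<?n t. ((Y (s, l, i))\<star> * b * Y (t, k, j)) * ((F (s, l, i))\<star> * F (t, k, j)))
            = (\<Sum>k<?n t. \<Sum>j<?n t. if t = s \<and> k = l then ?h j else 0)"
          by (intro sum.cong refl) (simp add: G)
        also have "... = (\<Sum>k<?n t. if t = s \<and> k = l then \<Sum>j<?n t. ?h j else 0)"
          by (rule sum.cong[OF refl]) simp
        also have "... = (if t = s then (\<Sum>k<?n s. if k = l then (\<Sum>j<?n s. ?h j) else 0) else 0)"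
          by simp
        finally show "(\<Sum>k<?n t. \<Sum>j<?n t. ((Y (s, l, i))\<star> * b * Y (t, k, j)) * ((F (s, l, i))\<star> * F (t, k, j)))
            = (if t = s then (\<Sum>k<?n s. if k = l then (\<Sum>j<?n s. ?h j) else 0) else 0)" .
      qed
      then show ?thesis using that by simp
    qed
    then have "(\<Sum>p\<in>P. \<Sum>r\<in>P. ((Y p)\<star> * b * Y r) * ((F p)\<star> * F r))
        = (\<Sum>s\<in>UNIV. \<Sum>l<?n s. \<Sum>i<?n s. \<Sum>j<?n s. ?z s l i s l j * u s i j)"
      unfolding sumP[of "%p. \<Sum>r\<in>P. ((Y p)\<star> * b * Y r) * ((F p)\<star> * F r)"] by (intro sum.cong refl) auto
    also have "... = (\<Sum>s\<in>UNIV. \<Sum>i<?n s. \<Sum>j<?n s. (\<Sum>l<?n s. ?z s l i s l j) * u s i j)"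
      unfolding sum_distrib_right by (rule sum.cong[OF refl], subst sum.swap) (rule sum.cong[OF refl], rule sum.swap)
    also have "... = (\<Sum>s\<in>UNIV. \<Sum>i<?n s. \<Sum>j<?n s. if j = i then q * u s i i else 0)"
      by (intro sum.cong refl) (auto simp: x)
    also have "... = q * (\<Sum>s\<in>UNIV. \<Sum>i<?n s. u s i i)" by (simp add: sum_distrib_left)
    finally show ?thesis using mu(3) by simp
  qed
  finally have "norm (X\<star> * b * X - q) < 1" using e(2) by simp
  then show ?thesis using projection_le_exact[OF q b] unfolding mdom_single by blast
qed

text \<open>\<open>X\<close> is replaced by a single projection \<open>p\<close>; the element
  \<open>b'\<close> is what makes it fit into the algebra.\<close>

lemma almost_unperforated_mset:
  fixes b b' :: "'a::unital_cstar_algebra"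
  assumes ad: "approximately_divisible TYPE('a)" and X: "!!x. x \<in># X ==> is_proj x" and b: "cpos b" "cpos b'"
    and r: "mdom X {#b'#}" and d: "mdom (repeat_mset (Suc K) X) (replicate_mset K b)"
  shows "mdom X {#b#}"
proof -
  obtain p where p: "is_proj p" "mdom X {#p#}" "mdom {#p#} X" using mdom_realize[OF X b(2) r] by blast
  have "mdom (replicate_mset (Suc K) p) (repeat_mset (Suc K) X)"
    unfolding replicate_repeat_mset by (rule mdom_repeat[OF p(3)])
  then have "mdom {#p#} {#b#}" using almost_unperforated[OF ad p(1) b(1)] mdom_trans d by blast
  with p(2) show ?thesis by (rule mdom_trans)
qed

subsection \<open>Stable finiteness and cancellation\<close>

text \<open>Adding \<open>1 - P\<close> on both sides puts 1 and \<open>x\<close> side by side under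
  1. The witness for 1 is an isometry, hence unitary, and leaves no room for
  \<open>x\<close>.\<close>

lemma stably_finite_projection:
  fixes P x :: "'a::unital_cstar_algebra"
  assumes sf: "stably_finite TYPE('a)" and P: "is_proj P" and d: "mdom {#P, x#} {#P#}"
  shows "x = 0"
proof -
  have o: "mdom {#1#} {#P, 1 - P#}" "mdom {#P, 1 - P#} {#1#}"
    using mdom_orthogonal_sum[OF P, of "1 - P"] is_projD[OF P] by (simp_all add: algebra_simps)
  have "mdom ({#1#} + {#x#}) ({#P, 1 - P#} + {#x#})" by (rule mdom_add[OF o(1) mdom_refl])
  also have "{#P, 1 - P#} + {#x#} = {#P, x#} + {#1 - P#}" by simp
  also have "mdom ({#P, x#} + {#1 - P#}) ({#P#} + {#1 - P#})" by (rule mdom_add[OF d mdom_refl])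
  also have "{#P#} + {#1 - P#} = {#P, 1 - P#}" by simp
  also note o(2)
  finally have "mdom (mset [1, x]) {#1#}" by (simp add: add_mset_commute)
  then obtain z where "\<forall>i<length [1, x]. \<forall>j<length [1, x]. (z i)\<star> * 1 * z j = (if i = j then [1, x] ! i else 0)"
    unfolding mdom_single_target by blast
  then have z: "!!i j. i < 2 ==> j < 2 ==> (z i)\<star> * z j = (if i = j then [1, x] ! i else 0)"
    by simp
  define U where "U = mat 1 1 (%_. z (0 :: nat))"
  have Uc: "U \<in> carrier_mat 1 1" by (simp add: U_def)
  have "mat_star U * U = 1\<^sub>m 1"
    by (rule eq_matI) (use z[of 0 0] in \<open>auto simp: U_def mat_star_def scalar_prod_def\<close>)
  then have "U * mat_star U = 1\<^sub>m 1" using sf Uc unfolding stably_finite_def by blast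
  from arg_cong[OF this, of "%M. M $$ (0, 0)"] have "z 0 * (z 0)\<star> = 1"
    by (simp add: U_def mat_star_def scalar_prod_def)
  then have "z 1 = z 0 * ((z 0)\<star> * z 1)" by (simp flip: mult.assoc)
  also have "(z 0)\<star> * z 1 = 0" using z[of 0 1] by simp
  finally show "x = 0" using z[of 1 1] by simp
qed

text \<open>Iterating \<open>k\<close> times puts \<open>P\<close> and \<open>k * Suc n\<close>
  copies of \<open>x\<close> below \<open>P\<close> and \<open>k\<close> copies of \<open>g\<close>;
  as \<open>g\<close> is full, \<open>P\<close> is below \<open>M\<close> copies of
  \<open>g\<close>. So \<open>k * Suc n\<close> copies of \<open>x\<close> lie below
  \<open>k + M\<close> copies of \<open>g\<close>, and almost unperforation does the division. The
  price is one copy of \<open>x\<close>.\<close>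

lemma cancellation:
  fixes P x g :: "'a::unital_cstar_algebra"
  assumes simple: "simple_cstar TYPE('a)" and ad: "approximately_divisible TYPE('a)" and sf: "stably_finite TYPE('a)"
    and P: "is_proj P" and x: "is_proj x" "x ~= 0" and g: "cpos g" "P * g = 0" "g * P = 0"
    and d: "mdom (add_mset P (replicate_mset (Suc n) x)) {#P, g#}"
  shows "mdom (replicate_mset n x) {#g#}"
proof -
  have g0: "g ~= 0"
  proof
    assume "g = 0"
    have "mdom {#P, x#} (add_mset P (replicate_mset (Suc n) x))" by (rule mdom_subset) simp
    also note d
    also have "mdom {#P, g#} {#P#}"
      using mdom_add[OF mdom_refl[of "{#P#}"] mdom_zero] \<open>g = 0\<close> by (simp add: add_mset_commute)
    finally show False using stably_finite_projection[OF sf P] x by blast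
  qed
  obtain M where "mdom {#1#} (replicate_mset M g)" using mdom_full[OF simple g(1) g0] .
  then have PM: "mdom {#P#} (replicate_mset M g)" using mdom_proj_one[OF P] mdom_trans by blast
  let ?X = "replicate_mset (Suc n) x"
  have it: "mdom ({#P#} + repeat_mset k ?X) ({#P#} + replicate_mset k g)" for k
  proof (induction k)
    case 0
    show ?case by (simp add: mdom_refl)
  next
    case (Suc k)
    have "{#P#} + repeat_mset (Suc k) ?X = ({#P#} + repeat_mset k ?X) + ?X" by simp
    also have "mdom ... (({#P#} + replicate_mset k g) + ?X)" by (rule mdom_add[OF Suc mdom_refl])
    also have "({#P#} + replicate_mset k g) + ?X = replicate_mset k g + add_mset P ?X" by simp
    also have "mdom ... (replicate_mset k g + {#P, g#})" by (rule mdom_add[OF mdom_refl d])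
    also have "replicate_mset k g + {#P, g#} = {#P#} + replicate_mset (Suc k) g" by simp
    finally show ?case .
  qed
  \<comment> \<open>Chosen so that \<open>k * Suc n = n * Suc (k + M)\<close>.\<close>
  define k where "k = n * Suc M"
  have "n * Suc (k + M) <= k * Suc n" by (simp add: k_def algebra_simps)
  have "mdom (repeat_mset (Suc (k + M)) (replicate_mset n x)) (replicate_mset (k * Suc n) x)"
    unfolding repeat_replicate_mset by (rule mdom_replicate_le) (simp add: k_def algebra_simps)
  also have "mdom ... ({#P#} + repeat_mset k ?X)"
    unfolding repeat_replicate_mset by (rule mdom_subset) simp
  also note it[of k]
  also have "mdom ({#P#} + replicate_mset k g) (replicate_mset M g + replicate_mset k g)"
    by (rule mdom_add[OF PM mdom_refl])
  also have "replicate_mset M g + replicate_mset k g = replicate_mset (k + M) g"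
    by (rule multiset_eqI) simp
  finally have big: "mdom (repeat_mset (Suc (k + M)) (replicate_mset n x)) (replicate_mset (k + M) g)" .
  have "mdom (replicate_mset n x) (add_mset P (replicate_mset (Suc n) x))" by (rule mdom_subset) (simp add: subset_mset.le_iff_add)
  also note d
  also have "mdom {#P, g#} {#P + g#}" by (rule mdom_orthogonal_sum[OF P g(2,3)])
  finally have "mdom (replicate_mset n x) {#P + g#}" .
  moreover have "cpos (P + g)" by (intro cpos_add is_proj_cpos P g)
  ultimately show ?thesis
    using almost_unperforated_mset[OF ad _ g(1) _ _ big] x(1) by (metis in_replicate_mset)
qed

subsection \<open>The infinite case\<close>

text \<open>A nonunitary isometry \<open>V\<close> of the module of \<open>n\<close>-tuples moves a
  vector \<open>c\<close> orthogonal to its range through mutually orthogonal vectors with the same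
  Gram element \<open>b\<close>. Since \<open>b\<close> is full, \<open>r\<close> consecutive ones
  combine to a vector with Gram element 1, and disjoint blocks give arbitrarily many orthonormal
  \<open>n\<close>-tuples.\<close>

lemma not_stably_finite_absorbs:
  assumes simple: "simple_cstar TYPE('a::unital_cstar_algebra)" and nsf: "\<not> stably_finite TYPE('a)"
  obtains n where "!!M. mdom (replicate_mset M (1 :: 'a)) (replicate_mset n 1)"
proof -
  obtain n and U :: "'a mat" where U: "U \<in> carrier_mat n n" "mat_star U * U = 1\<^sub>m n" "U * mat_star U ~= 1\<^sub>m n"
    using nsf unfolding stably_finite_def by blast
  define V where "V l m = U $$ (l, m)" for l m
  define ip where "ip v w = (\<Sum>l<n. (v l)\<star> * w l)" for v w :: "nat => 'a"
  define act where "act v = (%l. \<Sum>m<n. V l m * v m)" for v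
  have VV: "(\<Sum>l<n. (V l i)\<star> * V l j) = (if i = j then 1 else 0)" if "i < n" "j < n" for i j
  proof -
    have "(mat_star U * U) $$ (i, j) = (\<Sum>l<n. (V l i)\<star> * V l j)"
      using U(1) that by (simp add: mat_star_def scalar_prod_def V_def lessThan_atLeast0)
    then show ?thesis using that by (simp add: U(2))
  qed
  have ip_act: "ip (act v) (act w) = ip v w" for v w
  proof -
    have "ip (act v) (act w) = (\<Sum>l<n. \<Sum>m<n. \<Sum>k<n. (v m)\<star> * ((V l m)\<star> * V l k) * w k)"
      unfolding ip_def act_def star_sum sum_distrib_left sum_distrib_right
      by (subst (2) sum.swap) (simp add: star_mult mult.assoc)
    also have "... = (\<Sum>m<n. \<Sum>k<n. \<Sum>l<n. (v m)\<star> * ((V l m)\<star> * V l k) * w k)"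
      by (subst sum.swap) (rule sum.cong[OF refl], rule sum.swap)
    also have "... = (\<Sum>m<n. \<Sum>k<n. (v m)\<star> * (\<Sum>l<n. (V l m)\<star> * V l k) * w k)"
      by (simp add: sum_distrib_left sum_distrib_right)
    also have "... = (\<Sum>m<n. \<Sum>k<n. if k = m then (v m)\<star> * w m else 0)"
      by (intro sum.cong refl) (auto simp: VV)
    finally show ?thesis by (simp add: ip_def)
  qed
  obtain i0 j where ij: "i0 < n" "j < n" "(\<Sum>m<n. V i0 m * (V j m)\<star>) ~= (if i0 = j then 1 else 0)"
  proof -
    have "\<exists>i<n. \<exists>j<n. (U * mat_star U) $$ (i, j) ~= 1\<^sub>m n $$ (i, j)"
    proof (rule ccontr)
      assume "\<not> ?thesis"
      then have "U * mat_star U = 1\<^sub>m n"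
        using U(1) by (intro eq_matI) (auto simp: mat_star_def)
      with U(3) show False by simp
    qed
    then obtain i j where "i < n" "j < n" "(U * mat_star U) $$ (i, j) ~= 1\<^sub>m n $$ (i, j)" by blast
    then show thesis using U(1) by (intro that[of i j]) (auto simp: mat_star_def scalar_prod_def V_def lessThan_atLeast0)
  qed
  \<comment> \<open>Column \<open>j\<close> of \<open>1 - V V\<star>\<close>; its entry
    \<open>i0\<close> is nonzero.\<close>
  define c where "c l = (if l = j then 1 else 0) - (\<Sum>m<n. V l m * (V j m)\<star>)" for l
  have orth: "ip (act v) c = 0" for v
  proof -
    have col: "(\<Sum>l<n. (V l m)\<star> * c l) = 0" if "m < n" for m
    proof -
      have "(\<Sum>l<n. (V l m)\<star> * c l) = (\<Sum>l<n. if l = j then (V j m)\<star> else 0) - (\<Sum>l<n. \<Sum>k<n. (V l m)\<star> * V l k * (V j k)\<star>)"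
      proof -
        have "(V l m)\<star> * c l = (if l = j then (V j m)\<star> else 0) - (\<Sum>k<n. (V l m)\<star> * V l k * (V j k)\<star>)" for l
          by (simp add: c_def right_diff_distrib sum_distrib_left mult.assoc)
        then show ?thesis by (simp add: sum_subtractf)
      qed
      also have "(\<Sum>l<n. \<Sum>k<n. (V l m)\<star> * V l k * (V j k)\<star>) = (\<Sum>k<n. (\<Sum>l<n. (V l m)\<star> * V l k) * (V j k)\<star>)"
        by (subst sum.swap) (simp add: sum_distrib_right)
      also have "... = (\<Sum>k<n. if k = m then (V j m)\<star> else 0)" using that by (intro sum.cong refl) (auto simp: VV)
      finally show ?thesis using that ij(2) by simp
    qed
    have "ip (act v) c = (\<Sum>m<n. (v m)\<star> * (\<Sum>l<n. (V l m)\<star> * c l))"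
      unfolding ip_def act_def star_sum sum_distrib_left sum_distrib_right
      by (subst sum.swap) (simp add: star_mult mult.assoc)
    then show ?thesis by (simp add: col)
  qed
  have ip_star: "(ip v w)\<star> = ip w v" for v w by (simp add: ip_def star_sum star_mult)
  define b where "b = ip c c"
  have "cpos b" unfolding b_def ip_def by (intro cpos_sum) simp
  moreover have "b ~= 0"
  proof
    assume b0: "b = 0"
    have r: "b = (c i0)\<star> * c i0 + (\<Sum>l\<in>{..<n} - {i0}. (c l)\<star> * c l)"
      unfolding b_def ip_def using ij(1) by (intro sum.remove) auto
    have "cpos (\<Sum>l\<in>{..<n} - {i0}. (c l)\<star> * c l)" by (intro cpos_sum) simp
    then have "cpos (- ((c i0)\<star> * c i0))" using r b0 by (metis add.commute eq_neg_iff_add_eq_0)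
    then have "(c i0)\<star> * c i0 = 0" by (intro cpos_antisym) simp
    then have "c i0 = 0" using cstar_identity[of "c i0"] by simp
    then show False using ij(3) by (simp add: c_def)
  qed
  ultimately obtain r and z :: "nat => 'a" where z: "(\<Sum>i<r. (z i)\<star> * b * z i) = 1" using simple_full[OF simple] by blast
  have act_scale: "act (%l. v l * y) = (%l. act v l * y)" for v y
    by (simp add: act_def sum_distrib_right mult.assoc)
  have pow_scale: "(act ^^ k) (%l. v l * y) = (%l. (act ^^ k) v l * y)" for k v y
    by (induction k) (simp_all add: act_scale)
  have ip_scale: "ip (%l. v l * y) (%l. w l * y') = y\<star> * ip v w * y'" for v w y y'
    by (simp add: ip_def star_mult sum_distrib_left sum_distrib_right mult.assoc)
  have pow: "ip ((act ^^ (k + m)) v) ((act ^^ m) w) = ip ((act ^^ k) v) w" for k m v w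
    by (induction m) (simp_all add: ip_act)
  have powc: "ip ((act ^^ k) c) ((act ^^ m) c) = (if k = m then b else 0)" for k m
  proof -
    have "ip ((act ^^ k) c) ((act ^^ m) c) = 0" if "m < k" for k m
    proof -
      obtain d where "k = Suc (m + d)" using less_imp_Suc_add[OF \<open>m < k\<close>] by blast
      then have "k = Suc d + m" by simp
      then show ?thesis using pow[of "Suc d" m c c] orth by simp
    qed
    moreover from this have "ip ((act ^^ k) c) ((act ^^ m) c) = 0" if "k < m" for k m
      using ip_star[of "(act ^^ m) c" "(act ^^ k) c"] that by simp
    moreover have "ip ((act ^^ k) c) ((act ^^ k) c) = b" using pow[of 0 k c c] by (simp add: b_def)
    ultimately show ?thesis by (metis linorder_neqE_nat)
  qed
  \<comment> \<open>Block \<open>t\<close> uses the powers from \<open>t * r\<close> to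
    \<open>t * r + r - 1\<close>, so distinct blocks are orthogonal.\<close>
  define Y where "Y t l = (\<Sum>i<r. (act ^^ (t * r + i)) c l * z i)" for t l
  have YY: "ip (Y t) (Y s) = (if t = s then 1 else 0)" for t s
  proof -
    have "ip (Y t) (Y s) = (\<Sum>i<r. \<Sum>k<r. (z i)\<star> * ip ((act ^^ (t * r + i)) c) ((act ^^ (s * r + k)) c) * z k)"
    proof -
      have "ip (Y t) (Y s) = (\<Sum>l<n. \<Sum>i<r. \<Sum>k<r. (z i)\<star> * (((act ^^ (t * r + i)) c l)\<star> * (act ^^ (s * r + k)) c l) * z k)"
        unfolding ip_def Y_def star_sum sum_distrib_left sum_distrib_right
        by (subst (2) sum.swap) (simp add: star_mult mult.assoc)
      also have "... = (\<Sum>i<r. \<Sum>k<r. \<Sum>l<n. (z i)\<star> * (((act ^^ (t * r + i)) c l)\<star> * (act ^^ (s * r + k)) c l) * z k)"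
        by (subst sum.swap) (rule sum.cong[OF refl], rule sum.swap)
      finally show ?thesis by (simp add: ip_def sum_distrib_left sum_distrib_right)
    qed
    also have "... = (\<Sum>i<r. \<Sum>k<r. if k = i then (if t = s then (z i)\<star> * b * z i else 0) else 0)"
    proof (intro sum.cong refl)
      fix i k assume ik: "i \<in> {..<r}" "k \<in> {..<r}"
      have "t * r + i = s * r + k \<longleftrightarrow> t = s \<and> i = k"
      proof
        assume e: "t * r + i = s * r + k"
        have "(t * r + i) div r = t" "(s * r + k) div r = s" using ik by auto
        then show "t = s \<and> i = k" using e by auto
      qed auto
      then show "(z i)\<star> * ip ((act ^^ (t * r + i)) c) ((act ^^ (s * r + k)) c) * z k
          = (if k = i then (if t = s then (z i)\<star> * b * z i else 0) else 0)"
        unfolding powc by auto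
    qed
    also have "... = (\<Sum>i<r. if t = s then (z i)\<star> * b * z i else 0)" by simp
    finally show ?thesis using z by simp
  qed
  show thesis
  proof (rule that[of n])
    fix M
    have "dom_list (replicate M (1 :: 'a)) (replicate n 1)"
      by (rule dom_listI[where z = "%l i. Y i l"]) (use YY in \<open>simp add: ip_def\<close>)
    then show "mdom (replicate_mset M (1 :: 'a)) (replicate_mset n 1)"
      using mdom_mset[of "replicate M (1 :: 'a)" "replicate n 1"] by simp
  qed
qed

text \<open>Any number of copies of 1 fit under \<open>n\<close> copies, hence under
  \<open>n * m\<close> copies of \<open>b\<close>; almost unperforation reduces this to 1 below a
  single \<open>b\<close>.\<close>

lemma not_stably_finite_cuntz_le:
  fixes b c :: "'a::unital_cstar_algebra"
  assumes simple: "simple_cstar TYPE('a)" and ad: "approximately_divisible TYPE('a)"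
    and nsf: "\<not> stably_finite TYPE('a)" and b: "cpos b" "b ~= 0" and c: "cpos c"
  shows "c \<lessapprox> b"
proof -
  obtain n where n: "!!M. mdom (replicate_mset M (1 :: 'a)) (replicate_mset n 1)"
    using not_stably_finite_absorbs[OF simple nsf] by blast
  obtain m where m: "mdom {#1#} (replicate_mset m b)" using mdom_full[OF simple b] .
  have "mdom (replicate_mset n 1) (replicate_mset (n * m) b)"
    using mdom_repeat[OF m, of n] by (simp add: repeat_replicate_mset)
  then have "mdom {#1#} {#b#}"
    using almost_unperforated[OF ad _ b(1), of 1 "n * m"] n mdom_trans is_proj_one by blast
  then have "1 \<lessapprox> b" by (simp add: mdom_cuntz_le b)
  moreover have "csqrt_el c * 1 * (csqrt_el c)\<star> \<lessapprox> 1" by (rule cuntz_le_conj)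
  then have "c \<lessapprox> 1" using csqrt_el[OF c] by simp
  ultimately show ?thesis using cuntz_le_trans by blast
qed

subsection \<open>Splitting projections\<close>

text \<open>As \<open>3/16\<close> is the value of \<open>t * (1 - t)\<close> at \<open>1/4\<close>
  and \<open>3/4\<close>, the spectrum of \<open>c\<close> avoids the interval between them, and
  \<open>?f\<close> is 0 below it and 1 above. The last clause keeps the projection in every corner
  that contains \<open>c\<close>.\<close>

lemma near_projection:
  fixes c :: "'a::unital_cstar_algebra"
  assumes c: "c\<star> = c" "norm (c * c - c) <= e" and e: "e < 3/16"
  obtains y where "is_proj y" "norm (y - c) <= 2 * e" "!!a. a * c = c ==> c * a = c ==> a * y = y \<and> y * a = y"
proof -
  let ?f = "%t :: real. max 0 (min 1 (2 * t - 1/2))"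
  have f: "continuous_on UNIV ?f" by (intro continuous_intros)
  have small: "\<bar>t * t - t\<bar> <= e" if "t \<in> rspec c" for t
  proof -
    have "t * t - t \<in> rspec (c * c - c)"
    proof (rule ccontr)
      assume "t * t - t \<notin> rspec (c * c - c)"
      moreover have "c * c - c - (t * t - t) *R 1 = (c - t *R 1) * (c + (t - 1) *R 1)"
        by (simp add: algebra_simps)
      ultimately have "two_sided_unit ((c - t *R 1) * (c + (t - 1) *R 1))" by (simp add: rspec_def)
      then have "two_sided_unit (c - t *R 1)" by (rule two_sided_unit_factors) (simp add: algebra_simps)
      with that show False by (simp add: rspec_def)
    qed
    from rspec_bounded[OF this] show ?thesis using c(2) by simp
  qed
  have cases: "(t < 1/4 \<and> \<bar>t\<bar> <= 2 * e) \<or> (t > 3/4 \<and> \<bar>t - 1\<bar> <= 2 * e)" if "t \<in> rspec c" for t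
  proof -
    have s: "\<bar>t\<bar> * \<bar>t - 1\<bar> <= e" using small[OF that] by (simp add: right_diff_distrib flip: abs_mult)
    show ?thesis
    proof (cases "t < 1/2")
      case True
      then have "\<bar>t\<bar> * (1/2) <= \<bar>t\<bar> * \<bar>t - 1\<bar>" by (intro mult_left_mono) auto
      then have t: "\<bar>t\<bar> <= 2 * e" using s by simp
      have "t < 1/4"
      proof (rule ccontr)
        assume "\<not> t < 1/4"
        then have "(t - 1/4) * (3/4 - t) >= 0" using True by (intro mult_nonneg_nonneg) auto
        then have "t * (1 - t) >= 3/16" by (simp add: field_simps)
        moreover have "\<bar>t\<bar> * \<bar>t - 1\<bar> = t * (1 - t)" using True \<open>\<not> t < 1/4\<close> by simp
        ultimately show False using s e by simp
      qed
      with t show ?thesis by simp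
    next
      case False
      then have "(1/2) * \<bar>t - 1\<bar> <= \<bar>t\<bar> * \<bar>t - 1\<bar>" by (intro mult_right_mono) auto
      then have t: "\<bar>t - 1\<bar> <= 2 * e" using s by simp
      have "t > 3/4"
      proof (rule ccontr)
        assume "\<not> t > 3/4"
        then have "(t - 1/4) * (3/4 - t) >= 0" using False by (intro mult_nonneg_nonneg) auto
        then have "t * (1 - t) >= 3/16" by (simp add: field_simps)
        moreover have "\<bar>t\<bar> * \<bar>t - 1\<bar> = t * (1 - t)" using False \<open>\<not> t > 3/4\<close> by simp
        ultimately show False using s e by simp
      qed
      with t show ?thesis by simp
    qed
  qed
  have f01: "?f t = (if t < 1/4 then 0 else 1)" if "t \<in> rspec c" for t using cases[OF that] by auto
  show thesis
  proof (rule that)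
    have "cfc ?f c * cfc ?f c = cfc (%t. ?f t * ?f t) c" by (rule cfc_mult[OF c(1) f f, symmetric])
    also have "... = cfc ?f c"
      by (rule cfc_cong[OF c(1)]) (intro continuous_on_mult f | simp only: f01 split: if_split, simp)+
    finally show "is_proj (cfc ?f c)" by (simp add: is_proj_def cfc_star[OF c(1) f])
    have "cfc ?f c - c = cfc (%t. ?f t - t) c"
      using cfc_diff[OF c(1) f continuous_on_id] by (simp add: cfc_id[OF c(1)])
    also have "norm ... <= 2 * e"
    proof (rule cfc_norm_le[OF c(1)])
      show "continuous_on UNIV (%t. ?f t - t)" by (intro continuous_on_diff f continuous_on_id)
      show "\<bar>?f t - t\<bar> <= 2 * e" if "t \<in> rspec c" for t
        unfolding f01[OF that] using cases[OF that] by auto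
    qed
    finally show "norm (cfc ?f c - c) <= 2 * e" .
    fix a assume a: "a * c = c" "c * a = c"
    have "cfc ?f c \<in> {x. a * x = x \<and> x * a = x}"
    proof (rule cfc_mem_closed[OF c(1) f])
      show "subspace {x. a * x = x \<and> x * a = x}" by (rule subspaceI) (auto simp: add_distribs)
      have "closed ({x. a * x = x} \<inter> {x. x * a = x})"
        by (intro closed_Int closed_Collect_eq continuous_intros)
      then show "closed {x. a * x = x \<and> x * a = x}" by (simp add: Collect_conj_eq)
      show "x * y \<in> {x. a * x = x \<and> x * a = x}"
        if "x \<in> {x. a * x = x \<and> x * a = x}" "y \<in> {x. a * x = x \<and> x * a = x}" for x y
        using that by (simp add: mult.assoc) (metis mult.assoc)
    qed (use a in simp_all)
    then show "a * cfc ?f c = cfc ?f c \<and> cfc ?f c * a = cfc ?f c" by simp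
  qed
qed

lemma projections_close_mdom:
  assumes "is_proj p" "is_proj q" "norm (p - q) < 1"
  shows "mdom {#p#} {#q#}"
  using projection_le_exact[OF assms(1) is_proj_cpos[OF assms(2)], of 1] assms(3)
  unfolding mdom_single by (auto simp: norm_minus_commute)

text \<open>A projection \<open>d\<close> that almost commutes with matrix units is nearly the sum
  of copies \<open>u s k 0 * y s * u s 0 k\<close> of two projections \<open>y s\<close> near
  \<open>u s 0 0 * d * u s 0 0\<close>. Each occurs at least \<open>N = R * Suc L\<close> times, so
  that many copies lie below \<open>d\<close>, hence below \<open>L\<close> copies of
  \<open>d'\<close>, and almost unperforation puts \<open>R\<close> copies below
  \<open>d'\<close>.\<close>

lemma split_projection:
  fixes d d' :: "'a::unital_cstar_algebra"
  assumes simple: "simple_cstar TYPE('a)" and ad: "approximately_divisible TYPE('a)"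
    and d: "is_proj d" and d': "is_proj d'" "d' ~= 0"
  obtains X where "mdom {#d#} X" "mdom X {#d#}"
    "!!x. x \<in># X ==> is_proj x \<and> x ~= 0 \<and> mdom (replicate_mset R x) {#d'#}"
proof -
  obtain L where L: "mdom {#1#} (replicate_mset L d')" using mdom_full[OF simple is_proj_cpos[OF d'(1)] d'(2)] .
  define N where "N = R * Suc L"
  let ?n = "block_size N"
  \<comment> \<open>Each of the \<open>2 * N + 1\<close> diagonal blocks costs \<open>2 * e\<close>
    for the choice of \<open>y\<close> and \<open>e\<close> for commuting.\<close>
  define e where "e = 1 / (20 * (2 * real N + 1))"
  have e: "e > 0" "e < 3/16" "(2 * real N + 1) * (3 * e) < 1" by (auto simp: e_def field_simps)
  have "compact {d}" by simp
  from approx_central_mat_units[OF ad this e(1), of N] obtain u where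
    u0: "mat_units N u" "!!s i j x. i < ?n s ==> j < ?n s ==> x \<in> {d} ==> norm (u s i j * x - x * u s i j) <= e"
    by blast
  note u = u0(1) u0(2)[OF _ _ singletonI]
  note mu = mat_unitsD[OF u(1)]
  have "\<exists>y. is_proj y \<and> (0 < ?n s --> norm (y - u s 0 0 * d * u s 0 0) <= 2 * e \<and> u s 0 0 * y = y \<and> y * u s 0 0 = y)" for s
  proof (cases "0 < ?n s")
    case True
    define a where "a = u s 0 0"
    have a: "a\<star> = a" "a * a = a" "a * (a * x) = a * x" "norm a <= 1" for x
      using mu(1,2,4)[OF True True] mu(1)[OF True True True True] by (auto simp: a_def simp flip: mult.assoc)
    define c where "c = a * d * a"
    have cs: "c\<star> = c" using is_projD[OF d] by (simp add: c_def star_mult a mult.assoc)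
    have "c * c - c = - (a * (a * d - d * a) * (d * a))"
      by (simp add: c_def algebra_simps a is_projD[OF d])
    then have "norm (c * c - c) = norm (a * (a * d - d * a) * (d * a))" by simp
    also have "... <= (1 * e) * (1 * 1)"
      by (intro order.trans[OF norm_mult_ineq mult_mono] order.trans[OF norm_mult_ineq mult_mono])
        (use a is_proj_norm[OF d] u(2)[OF True True] e in \<open>auto simp: a_def\<close>)
    finally have "norm (c * c - c) <= e" by simp
    then obtain y where "is_proj y" "norm (y - c) <= 2 * e" "!!a. a * c = c ==> c * a = c ==> a * y = y \<and> y * a = y"
      using near_projection[OF cs _ e(2)] by blast
    moreover have "a * c = c" "c * a = c" by (simp_all add: c_def mult.assoc a)
    ultimately show ?thesis unfolding c_def a_def by blast
  next
    case False
    then show ?thesis by (intro exI[of _ 0]) simp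
  qed
  then have "\<forall>s. \<exists>y. is_proj y \<and> (0 < ?n s -->
      norm (y - u s 0 0 * d * u s 0 0) <= 2 * e \<and> u s 0 0 * y = y \<and> y * u s 0 0 = y)" ..
  from choice[OF this] obtain y where y0: "\<forall>s. is_proj (y s) \<and>
      (0 < ?n s --> norm (y s - u s 0 0 * d * u s 0 0) <= 2 * e \<and> u s 0 0 * y s = y s \<and> y s * u s 0 0 = y s)"
    by blast
  have y: "!!s. is_proj (y s)"
    "!!s. 0 < ?n s ==> norm (y s - u s 0 0 * d * u s 0 0) <= 2 * e \<and> u s 0 0 * y s = y s \<and> y s * u s 0 0 = y s"
    using y0 by blast+
  define xs where "xs = replicate N (y False) @ replicate (Suc N) (y True)"
  define sd where "sd i = (if i < N then (False, i) else (True, i - N))" for i :: nat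
  define w where "w i = (case sd i of (s, k) => u s k 0 * y s)" for i
  have len: "length xs = 2 * N + 1" and len2: "length xs = N + Suc N" by (simp_all add: xs_def)
  have sdl: "snd (sd i) < ?n (fst (sd i))" and sdx: "xs ! i = y (fst (sd i))" if "i < length xs" for i
    using that by (auto simp: sd_def block_size_def xs_def nth_append simp del: replicate_Suc)
  have sdi: "sd i = sd j \<longleftrightarrow> i = j" for i j by (auto simp: sd_def)
  have ww: "(w i)\<star> * w j = (if i = j then xs ! i else 0)" if ij: "i < length xs" "j < length xs" for i j
  proof -
    obtain s k t l where st: "sd i = (s, k)" "sd j = (t, l)" by (metis surj_pair)
    have b: "k < ?n s" "l < ?n t" using sdl[OF ij(1)] sdl[OF ij(2)] st by auto
    then have b0: "0 < ?n s" "0 < ?n t" by auto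
    have "(w i)\<star> * w j = y s * (u s 0 k * u t l 0) * y t"
      using is_projD[OF y(1)[of s]] by (simp add: w_def st star_mult mu(2)[OF b(1) b0(1)] mult.assoc)
    also have "u s 0 k * u t l 0 = (if s = t \<and> k = l then u s 0 0 else 0)" by (rule mu(1)[OF b0(1) b b0(2)])
    finally show ?thesis
      using y(2)[OF b0(1)] is_projD[OF y(1)[of s]] sdi[of i j] sdx[OF ij(1)] by (auto simp: st)
  qed
  have xsp: "is_proj x" if "x \<in> set xs" for x using that y(1) by (auto simp: xs_def)
  define p where "p = (\<Sum>i<length xs. w i * (w i)\<star>)"
  note p = proj_of_isometries[OF ww xsp, folded p_def]
  have one: "(\<Sum>i<length xs. case sd i of (s, k) => u s k k) = 1"
  proof -
    have "(\<Sum>i<length xs. case sd i of (s, k) => u s k k) = (\<Sum>i<N + Suc N. case sd i of (s, k) => u s k k)" by (simp only: len2)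
    also have "... = (\<Sum>i<N. u False i i) + (\<Sum>i<Suc N. u True i i)"
      unfolding sum_lessThan_add by (intro arg_cong2[of _ _ _ _ "(+)"] sum.cong) (auto simp: sd_def)
    also have "... = 1" using mu(3) by (simp add: UNIV_bool block_size_def)
    finally show ?thesis .
  qed
  have "norm (p - d) = norm (\<Sum>i<length xs. w i * (w i)\<star> - (case sd i of (s, k) => d * u s k k))"
  proof -
    have "d = d * (\<Sum>i<length xs. case sd i of (s, k) => u s k k)" by (simp add: one)
    also have "... = (\<Sum>i<length xs. case sd i of (s, k) => d * u s k k)"
      unfolding sum_distrib_left by (intro sum.cong) (auto split: prod.split)
    finally show ?thesis unfolding p_def sum_subtractf by simp
  qed
  also have "... <= (\<Sum>i<length xs. 3 * e)"
  proof (intro sum_norm_le)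
    fix i assume "i \<in> {..<length xs}"
    then have i: "i < length xs" by simp
    obtain s k where st: "sd i = (s, k)" by (metis surj_pair)
    have b: "k < ?n s" using sdl[OF i] st by auto
    then have b0: "0 < ?n s" by auto
    have yy: "y s * y s = y s" "(y s)\<star> = y s" using is_projD[OF y(1)[of s]] by auto
    have "w i * (w i)\<star> = u s k 0 * (y s * y s) * u s 0 k"
      by (simp add: w_def st star_mult yy(2) mu(2)[OF b b0] mult.assoc)
    then have wi: "w i * (w i)\<star> = u s k 0 * y s * u s 0 k" by (simp add: yy)
    have uu: "u s k 0 * u s 0 0 = u s k 0" "u s 0 0 * u s 0 k = u s 0 k" "u s k 0 * u s 0 k = u s k k"
      using mu(1) b b0 by auto
    have "w i * (w i)\<star> - d * u s k k = u s k 0 * (y s - u s 0 0 * d * u s 0 0) * u s 0 k + (u s k 0 * d - d * u s k 0) * u s 0 k"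
    proof -
      have "u s k 0 * (u s 0 0 * d * u s 0 0) * u s 0 k = u s k 0 * u s 0 0 * d * (u s 0 0 * u s 0 k)" by (simp add: mult.assoc)
      then have "u s k 0 * (u s 0 0 * d * u s 0 0) * u s 0 k = u s k 0 * d * u s 0 k" by (simp add: uu)
      then show ?thesis unfolding wi by (simp add: diff_distribs mult.assoc uu)
    qed
    also have "norm ... <= (1 * (2 * e)) * 1 + e * 1"
      by (intro norm_triangle_le add_mono order.trans[OF norm_mult_ineq mult_mono] order.trans[OF norm_mult_ineq mult_mono])
        (use mu(4)[OF b b0] mu(4)[OF b0 b] y(2)[OF b0] u(2)[OF b b0] e in auto)
    finally show "norm (w i * (w i)\<star> - (case sd i of (s, k) => d * u s k k)) <= 3 * e" by (simp add: st)
  qed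
  also have "... < 1" using e(3) by (simp add: len add.commute)
  finally have pd: "norm (p - d) < 1" .
  have dX: "mdom {#d#} (mset xs)" "mdom (mset xs) {#d#}"
    using projections_close_mdom[OF d p(1)] projections_close_mdom[OF p(1) d] pd p(2,3) mdom_trans
    by (auto simp: norm_minus_commute)
  have R: "mdom (replicate_mset R (y s)) {#d'#}" for s
  proof (rule almost_unperforated_mset[OF ad _ is_proj_cpos[OF d'(1)] is_proj_cpos[OF d], where K = L])
    have sub: "mdom (replicate_mset N (y s)) {#d#}"
    proof (rule mdom_trans[OF mdom_subset dX(2)])
      show "replicate_mset N (y s) \<subseteq># mset xs" by (cases s) (auto simp: xs_def subset_mset.le_iff_add)
    qed
    show "is_proj x" if "x \<in># replicate_mset R (y s)" for x using that y(1) by (auto split: if_splits)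
    show "mdom (replicate_mset R (y s)) {#d#}"
      by (rule mdom_trans[OF mdom_replicate_le sub]) (simp add: N_def)
    have "mdom {#d#} (replicate_mset L d')" by (rule mdom_trans[OF mdom_proj_one[OF d] L])
    with sub have "mdom (replicate_mset N (y s)) (replicate_mset L d')" by (rule mdom_trans)
    then show "mdom (repeat_mset (Suc L) (replicate_mset R (y s))) (replicate_mset L d')"
      unfolding repeat_replicate_mset by (simp add: N_def mult.commute)
  qed
  \<comment> \<open>A block projection may vanish, whereas cancellation asks for nonzero pieces;
    dropping zeros does not affect comparison.\<close>
  define X where "X = filter_mset (%x. x ~= 0) (mset xs)"
  have "mdom (mset xs) X"
  proof -
    have "mset xs = X + filter_mset (%x. \<not> x ~= 0) (mset xs)" unfolding X_def by simp
    moreover have "filter_mset (%x. \<not> x ~= 0) (mset xs) = repeat_mset (count (mset xs) 0) {#0#}"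
      by (rule multiset_eqI) auto
    moreover have "mdom (X + repeat_mset (count (mset xs) 0) {#0#}) (X + repeat_mset (count (mset xs) 0) {#})"
      by (intro mdom_add mdom_refl mdom_repeat mdom_zero)
    ultimately show ?thesis by simp
  qed
  moreover have "mdom X (mset xs)" unfolding X_def by (rule mdom_subset) simp
  ultimately show thesis
  proof (intro that[of X])
    show "is_proj x \<and> x ~= 0 \<and> mdom (replicate_mset R x) {#d'#}" if "x \<in># X" for x
    proof -
      have "x \<in> set xs" "x ~= 0" using that by (auto simp: X_def)
      moreover from this have "x = y False \<or> x = y True" by (auto simp: xs_def)
      ultimately show ?thesis using R xsp by auto
    qed
  qed (use dX mdom_trans in blast)+
qed

section \<open>Extracting a constant projection from a family\<close>

lemma cpos_dominated_trans:
  fixes a b c :: "'a::unital_cstar_algebra"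
  assumes "cpos (C *R b - a)" "cpos (D *R c - b)" "0 <= C"
  shows "cpos ((C * D) *R c - a)"
  using cpos_add[OF assms(1) cpos_scaleR[OF assms(2,3)]] by (simp add: scaleR_right_diff_distrib)

text \<open>The formula is \<open>1 - A * R * B\<close> with \<open>R\<close> inverse to
  \<open>1 + B * A\<close>. It serves where \<open>B * A\<close> is small although
  \<open>A * B\<close> is not.\<close>

lemma left_inverse_one_plus:
  fixes A B :: "'a::unital_cstar_algebra"
  assumes "norm (B * A) < 1"
  obtains S where "S * (1 + A * B) = 1"
proof -
  obtain R where "(1 - (- (B * A))) * R = 1" "R * (1 - (- (B * A))) = 1"
    using one_minus_unit[of "- (B * A)"] assms by auto
  then have R: "R + R * (B * A) = 1" by (simp add: distrib_left)
  have "(1 - A * R * B) * (1 + A * B) = 1 + A * B - A * (R + R * (B * A)) * B"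
    by (simp add: algebra_simps)
  also have "... = 1" unfolding R by simp
  finally show thesis by (rule that)
qed

text \<open>A function of \<open>M\<close> alone, so that it can be applied along a family. For
  \<open>M\<close> within distance less than 1 of the unit it is the inverse, whatever the
  choice.\<close>

definition near_inverse :: "'a::unital_cstar_algebra => 'a"
  where "near_inverse M = (SOME K. M * K = 1 \<and> K * M = 1 \<and> norm K <= 1 / (1 - norm (1 - M)))"

lemma near_inverse:
  assumes "norm (1 - M) < 1"
  shows "M * near_inverse M = 1" "near_inverse M * M = 1" "norm (near_inverse M) <= 1 / (1 - norm (1 - M))"
proof -
  obtain K where "(1 - (1 - M)) * K = 1" "K * (1 - (1 - M)) = 1" "norm K <= 1 / (1 - norm (1 - M))"
    using one_minus_unit[OF assms] by blast
  then have "\<exists>K. M * K = 1 \<and> K * M = 1 \<and> norm K <= 1 / (1 - norm (1 - M))" by auto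
  from someI_ex[OF this] show "M * near_inverse M = 1" "near_inverse M * M = 1"
    "norm (near_inverse M) <= 1 / (1 - norm (1 - M))" unfolding near_inverse_def by blast+
qed

text \<open>The difference of two inverses is \<open>K s * (M t - M s) * K t\<close>, writing
  \<open>K\<close> for the inverse, and the inverses are uniformly bounded.\<close>

lemma continuous_on_near_inverse:
  fixes M :: "'s::metric_space => 'a::unital_cstar_algebra"
  assumes M: "continuous_on S M" and r: "!!s. s \<in> S ==> norm (1 - M s) <= r" "r < 1"
  shows "continuous_on S (%s. near_inverse (M s))"
proof -
  let ?n = "%s. near_inverse (M s)"
  define B where "B = 1 / (1 - r)"
  have B: "B > 0" using r by (simp add: B_def)
  have ni: "M s * ?n s = 1" "?n s * M s = 1" "norm (?n s) <= B" if "s \<in> S" for s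
  proof -
    have l: "norm (1 - M s) < 1" using r(1)[OF that] r(2) by simp
    show "M s * ?n s = 1" "?n s * M s = 1" using near_inverse[OF l] by blast+
    have "1 / (1 - norm (1 - M s)) <= B" using r(1)[OF that] r(2) by (simp add: B_def frac_le)
    then show "norm (?n s) <= B" using near_inverse(3)[OF l] by simp
  qed
  have d: "dist (?n s) (?n t) <= B * B * dist (M s) (M t)" if "s \<in> S" "t \<in> S" for s t
  proof -
    have "?n s * (M t - M s) * ?n t
        = ?n s * (M t * ?n t) - (?n s * M s) * ?n t"
      by (simp only: diff_distribs mult.assoc)
    also have "... = ?n s - ?n t" by (simp only: ni that mult_1_left mult_1_right)
    finally have "?n s - ?n t = ?n s * (M t - M s) * ?n t" ..
    then have "norm (?n s - ?n t) <= (B * norm (M t - M s)) * B"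
      using ni(3)[OF that(1)] ni(3)[OF that(2)] B
      by (simp only:) (intro order.trans[OF norm_mult_ineq mult_mono] order.trans[OF norm_mult_ineq mult_mono], auto)
    then show ?thesis by (simp add: dist_norm norm_minus_commute mult_ac)
  qed
  show ?thesis unfolding continuous_on_iff
  proof (intro ballI allI impI)
    fix s and e :: real assume s: "s \<in> S" and e: "e > 0"
    then obtain D where D: "D > 0" "!!t. t \<in> S ==> dist t s < D ==> dist (M t) (M s) < e / (B * B)"
      using M B unfolding continuous_on_iff by (metis divide_pos_pos mult_pos_pos)
    have "dist (?n t) (?n s) < e" if "t \<in> S" "dist t s < D" for t
    proof -
      have "B * B * dist (M t) (M s) < B * B * (e / (B * B))"
        using D(2)[OF that] B by (intro mult_strict_left_mono) auto
      then show ?thesis using d[OF that(1) s] B by simp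
    qed
    then show "\<exists>D>0. \<forall>t\<in>S. dist t s < D --> dist (?n t) (?n s) < e"
      using D(1) by blast
  qed
qed

text \<open>Membership of \<open>b\<close> in the class of \<open>a\<close>, stated inside the
  algebra; \<open>cuntz_class_set_eq\<close> connects it with classes in the stabilization.\<close>

definition cuntz_eq :: "'a::cstar_algebra => 'a => bool"
  where "cuntz_eq a b \<longleftrightarrow> cpos b \<and> a \<lessapprox> b \<and> b \<lessapprox> a"

lemma cuntz_eq_trans: "cuntz_eq a b ==> cuntz_eq b c ==> cuntz_eq a c"
  unfolding cuntz_eq_def using cuntz_le_trans by blast

lemma cuntz_eq_dominated:
  fixes b c :: "'a::unital_cstar_algebra"
  assumes "cpos b" "cpos c" "cpos (C *R c - b)" "cpos (D *R b - c)"
  shows "cuntz_eq b c"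
  unfolding cuntz_eq_def using dominated_cuntz_le assms by blast

lemma cuntz_eq_add_proj:
  fixes b c P :: "'a::unital_cstar_algebra"
  assumes "is_proj P" "cpos b" "cpos c" "cpos (C *R c - b)" "cpos (D *R b - c)" "C >= 1" "D >= 1"
  shows "cuntz_eq (P + b) (P + c)"
proof (rule cuntz_eq_dominated)
  have "C *R (P + c) - (P + b) = (C - 1) *R P + (C *R c - b)"
    "D *R (P + b) - (P + c) = (D - 1) *R P + (D *R b - c)" by (simp_all add: algebra_simps)
  then show "cpos (C *R (P + c) - (P + b))" "cpos (D *R (P + b) - (P + c))"
    using assms by (simp_all only:) (intro cpos_add cpos_scaleR is_proj_cpos assms, auto)+
qed (intro cpos_add is_proj_cpos assms)+

text \<open>With \<open>q = 1 - p\<close>, positivity of \<open>(p - q) * b * (p - q)\<close> bounds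
  \<open>b\<close> by twice its diagonal blocks, and positivity of
  \<open>(1 + p) * b * (1 + p)\<close> bounds \<open>q * b * q\<close> by \<open>b\<close> and
  \<open>p * b * p\<close>. The hypothesis that a multiple of \<open>b\<close> dominates
  \<open>p\<close> takes care of the corner of \<open>p\<close>.\<close>

lemma pinching_bounds:
  fixes b p :: "'a::unital_cstar_algebra"
  assumes p: "is_proj p" and b: "cpos b" and C: "cpos (C *R b - p)" "C >= 0"
  defines "y \<equiv> p + (1 - p) * b * (1 - p)"
  shows "cpos y" "cpos ((2 * norm b + 2) *R y - b)" "cpos ((C + 2 + 2 * norm b * C) *R b - y)"
proof -
  let ?q = "1 - p"
  note pp = is_projD[OF p] and q = is_projD[OF is_proj_complement[OF p]]
  have qbq: "cpos (?q * b * ?q)" using cpos_conj[OF b, of ?q] q by simp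
  have pbp: "cpos (norm b *R p - p * b * p)"
    using cpos_conj[OF cpos_le_norm[OF b], of p] pp by (simp add: diff_distribs)
  show cy: "cpos y" unfolding y_def by (intro cpos_add is_proj_cpos p qbq)
  have "cpos (2 *R (p * b * p) + 2 *R (?q * b * ?q) - b)"
  proof -
    have "(p - ?q)\<star> * b * (p - ?q) = 2 *R (p * b * p) + 2 *R (?q * b * ?q) - b"
      by (simp add: star_diff star_add pp algebra_simps scaleR_2)
    then show ?thesis using cpos_conj[OF b, of "p - ?q"] by simp
  qed
  from cpos_add[OF cpos_add[OF this cpos_scaleR[OF pbp, of 2]] cpos_add[OF cpos_scaleR[OF is_proj_cpos[OF p], of 2] cpos_scaleR[OF qbq, of "2 * norm b"]]]
  show "cpos ((2 * norm b + 2) *R y - b)"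
    unfolding y_def scaleR_right_diff_distrib scaleR_left_distrib scaleR_right_distrib by (simp add: algebra_simps)
  have "cpos (2 *R b + 2 *R (p * b * p) - ?q * b * ?q)"
  proof -
    have "(1 + p)\<star> * b * (1 + p) = 2 *R b + 2 *R (p * b * p) - ?q * b * ?q"
      by (simp add: star_add pp algebra_simps scaleR_2)
    then show ?thesis using cpos_conj[OF b, of "1 + p"] by simp
  qed
  from cpos_add[OF cpos_add[OF this cpos_scaleR[OF pbp, of 2]] cpos_add[OF C(1) cpos_scaleR[OF C(1), of "2 * norm b"]]]
  show "cpos ((C + 2 + 2 * norm b * C) *R b - y)"
    unfolding y_def scaleR_right_diff_distrib scaleR_left_distrib scaleR_right_distrib by (simp add: algebra_simps)
qed

text \<open>The constants \<open>1 + C\<close> and \<open>1 + D\<close> work at every time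
  \<open>t\<close>, also at the ends where one summand disappears.\<close>

lemma segment_bounds:
  fixes b y :: "'a::unital_cstar_algebra"
  assumes "cpos b" "cpos y" "cpos (C *R y - b)" "cpos (D *R b - y)" "0 <= C" "0 <= D" "t \<in> {0..1}"
  defines "m \<equiv> (1 - t) *R b + t *R y"
  shows "cpos m" "cpos ((1 + C) *R m - b)" "cpos ((1 + D) *R b - m)"
proof -
  show cm: "cpos m" using assms unfolding m_def by (intro cpos_add cpos_scaleR) auto
  have "(1 + C) *R m - b = t *R (C *R y - b) + (t *R y + (C * (1 - t)) *R b)"
    unfolding m_def scaleR_right_diff_distrib scaleR_left_distrib scaleR_right_distrib by (simp add: algebra_simps)
  then show "cpos ((1 + C) *R m - b)" using assms by (simp only:) (intro cpos_add cpos_scaleR, auto)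
  have "(1 + D) *R b - m = t *R (D *R b - y) + (t *R b + (D * (1 - t)) *R b)"
    unfolding m_def scaleR_right_diff_distrib scaleR_left_distrib scaleR_right_distrib by (simp add: algebra_simps)
  then show "cpos ((1 + D) *R b - m)" using assms by (simp only:) (intro cpos_add cpos_scaleR, auto)
qed

text \<open>Homotopies of families of positive elements of \<open>(1 - P)A(1 - P)\<close> whose sum with \<open>P\<close> stays in
  the Cuntz class of \<open>a\<close>. The families are constant on \<open>D\<close>, at every time.\<close>

definition class_family ::
  "'a::unital_cstar_algebra => 'a => 's::topological_space set => 's set => ('s => 'a) => bool"
  where "class_family a P S D g \<longleftrightarrow> continuous_on S g \<and> (\<forall>s\<in>D. \<forall>t\<in>D. g s = g t) \<and>
    (\<forall>s\<in>S. cpos (g s) \<and> P * g s = 0 \<and> g s * P = 0 \<and> cuntz_eq a (P + g s))"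

lemma class_familyD:
  assumes "class_family a P S D g"
  shows "continuous_on S g" "s \<in> D ==> t \<in> D ==> g s = g t"
    "s \<in> S ==> cpos (g s)" "s \<in> S ==> P * g s = 0" "s \<in> S ==> g s * P = 0" "s \<in> S ==> cuntz_eq a (P + g s)"
  using assms unfolding class_family_def by blast+

definition class_homotopic ::
  "'a::unital_cstar_algebra => 'a => 's::topological_space set => 's set => ('s => 'a) => ('s => 'a) => bool"
  where "class_homotopic a P S D g g' \<longleftrightarrow> (\<exists>H. continuous_on ({0..1 :: real} \<times> S) (%(t, s). H t s) \<and>
    (\<forall>t\<in>{0..1}. class_family a P S D (H t)) \<and> (\<forall>s\<in>S. H 0 s = g s \<and> H 1 s = g' s))"

lemma class_family_cong:
  assumes "class_family a P S D h" "!!s. s \<in> S ==> h s = g s" "D \<subseteq> S"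
  shows "class_family a P S D g"
proof -
  have "continuous_on S g" using assms(1,2) by (auto simp: class_family_def)
  moreover have "g s = g t" if "s \<in> D" "t \<in> D" for s t
    using assms that unfolding class_family_def by (metis subsetD)
  moreover have "cpos (g s) \<and> P * g s = 0 \<and> g s * P = 0 \<and> cuntz_eq a (P + g s)" if "s \<in> S" for s
    using assms(1) assms(2)[OF that, symmetric] that unfolding class_family_def by simp
  ultimately show ?thesis unfolding class_family_def by blast
qed

text \<open>Gluing is taken from \<open>homotopic_with\<close>, whose side condition must depend
  only on values on \<open>S\<close>; this is where \<open>D \<subseteq> S\<close> is used.\<close>

lemma class_homotopic_trans:
  assumes "D \<subseteq> S" "class_homotopic a P S D g g'" "class_homotopic a P S D g' g''"
  shows "class_homotopic a P S D g g''"
proof -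
  have "class_homotopic a P S D p q \<longleftrightarrow> homotopic_with (class_family a P S D) (top_of_set S) euclidean p q" for p q
  proof (subst homotopic_with)
    show "class_family a P S D h = class_family a P S D k" if "!!s. s \<in> topspace (top_of_set S) ==> h s = k s" for h k
      using class_family_cong[of a P S D h k] class_family_cong[of a P S D k h] that assms(1) by auto
    show "class_homotopic a P S D p q \<longleftrightarrow> (\<exists>h. continuous_map (prod_topology (top_of_set {0..1 :: real}) (top_of_set S)) euclidean h \<and>
        (\<forall>s\<in>topspace (top_of_set S). h (0, s) = p s) \<and> (\<forall>s\<in>topspace (top_of_set S). h (1, s) = q s) \<and>
        (\<forall>t\<in>{0..1}. class_family a P S D (%s. h (t, s))))" (is "_ = ?R")
    proof
      assume "class_homotopic a P S D p q"
      then obtain H where "continuous_on ({0..1 :: real} \<times> S) (%(t, s). H t s)" "\<forall>t\<in>{0..1}. class_family a P S D (H t)"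
        "\<forall>s\<in>S. H 0 s = p s \<and> H 1 s = q s" unfolding class_homotopic_def by blast
      then show ?R by (intro exI[of _ "%(t, s). H t s"]) (simp flip: subtopology_Times)
    next
      assume ?R
      then obtain h where "continuous_map (prod_topology (top_of_set {0..1 :: real}) (top_of_set S)) euclidean h"
        "\<forall>s\<in>S. h (0, s) = p s \<and> h (1, s) = q s" "\<forall>t\<in>{0..1}. class_family a P S D (%s. h (t, s))" by auto
      then show "class_homotopic a P S D p q"
        unfolding class_homotopic_def by (intro exI[of _ "%t s. h (t, s)"]) (simp flip: subtopology_Times)
    qed
  qed
  then show ?thesis using assms(2,3) homotopic_with_trans by blast
qed

lemma class_homotopicI:
  assumes "continuous_on ({0..1 :: real} \<times> S) (%(t, s). H t s)"
    "!!t s. t \<in> {0..1} ==> s \<in> S ==> cpos (H t s) \<and> P * H t s = 0 \<and> H t s * P = 0 \<and> cuntz_eq a (P + H t s)"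
    "!!t s s'. t \<in> {0..1} ==> s \<in> D ==> s' \<in> D ==> H t s = H t s'"
    "!!s. s \<in> S ==> H 0 s = g s" "!!s. s \<in> S ==> H 1 s = g' s"
  shows "class_homotopic a P S D g g'"
proof -
  have "continuous_on S (H t)" if "t \<in> {0..1}" for t
  proof -
    have c: "continuous_on S (%s. (t, s))" by (rule continuous_on_Pair[OF continuous_on_const continuous_on_id])
    have "(%s. (t, s)) ` S \<subseteq> {0..1} \<times> S" using that by auto
    from continuous_on_compose2[OF assms(1) c this] show ?thesis by simp
  qed
  then show ?thesis using assms unfolding class_homotopic_def class_family_def by (intro exI[of _ H]) blast
qed

text \<open>The Cuntz class does not see scalars, so the constants may vary with \<open>s\<close>
  without any uniformity.\<close>

lemma segment_homotopic:
  fixes g g' :: "'s::topological_space => 'a::unital_cstar_algebra"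
  assumes P: "is_proj P" and g: "class_family a P S D g"
    and g': "continuous_on S g'" "!!s t. s \<in> D ==> t \<in> D ==> g' s = g' t" "!!s. s \<in> S ==> P * g' s = 0 \<and> g' s * P = 0"
    and b: "!!s. s \<in> S ==> cpos (g' s) \<and> (\<exists>C\<ge>0. \<exists>E\<ge>0. cpos (C *R g' s - g s) \<and> cpos (E *R g s - g' s))"
  shows "class_homotopic a P S D g g'"
proof (rule class_homotopicI[where H = "%t s. (1 - t) *R g s + t *R g' s"])
  have gc: "continuous_on S g" using g by (simp add: class_family_def)
  have "continuous_on ({0..1 :: real} \<times> S) (%p. (1 - fst p) *R g (snd p) + fst p *R g' (snd p))"
    by (intro continuous_intros continuous_on_compose2[OF gc] continuous_on_compose2[OF g'(1)]) auto
  then show "continuous_on ({0..1} \<times> S) (%(t, s). (1 - t) *R g s + t *R g' s)" by (simp add: split_def)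
  fix t :: real assume t: "t \<in> {0..1}"
  fix s assume s: "s \<in> S"
  have gs: "cpos (g s)" "P * g s = 0" "g s * P = 0" "cuntz_eq a (P + g s)" using class_familyD[OF g] s by blast+
  obtain C E where CE: "C >= 0" "E >= 0" "cpos (C *R g' s - g s)" "cpos (E *R g s - g' s)" "cpos (g' s)" using b[OF s] by blast
  note sb = segment_bounds[OF gs(1) CE(5,3,4,1,2) t]
  have ce: "cuntz_eq (P + g s) (P + ((1 - t) *R g s + t *R g' s))"
    by (rule cuntz_eq_add_proj[OF P gs(1) sb]) (use CE in auto)
  have "P * ((1 - t) *R g s + t *R g' s) = 0" "((1 - t) *R g s + t *R g' s) * P = 0"
    using gs(2,3) g'(3)[OF s] by (simp_all add: add_distribs)
  with sb(1) cuntz_eq_trans[OF gs(4) ce]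
  show "cpos ((1 - t) *R g s + t *R g' s) \<and> P * ((1 - t) *R g s + t *R g' s) = 0 \<and>
      ((1 - t) *R g s + t *R g' s) * P = 0 \<and> cuntz_eq a (P + ((1 - t) *R g s + t *R g' s))"
    by blast
next
  show "(1 - t) *R g s + t *R g' s = (1 - t) *R g s' + t *R g' s'" if "s \<in> D" "s' \<in> D" for t s s'
    unfolding g'(2)[OF that] class_familyD(2)[OF g that] ..
qed auto

lemma class_homotopic_end:
  assumes "class_homotopic a P S D g g'" "D \<subseteq> S"
  shows "class_family a P S D g'"
proof -
  obtain H where H: "!!t :: real. t \<in> {0..1} ==> class_family a P S D (H t)" "!!s. s \<in> S ==> H 1 s = g' s"
    using assms(1) unfolding class_homotopic_def by blast
  show ?thesis by (rule class_family_cong[OF H(1)[of 1] H(2) assms(2)]) auto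
qed

text \<open>Two shears, chosen so that the composite carries the approximate isometry \<open>V s\<close> into the fixed
  direction \<open>w\<close>.\<close>

lemma rotate_into_constant:
  fixes g V Z :: "'s::metric_space => 'a::unital_cstar_algebra"
  assumes P: "is_proj P" and g: "class_family a P S D g" and DS: "D \<subseteq> S"
    and x: "is_proj x" and w: "w\<star> * w = x" "P * w = 0"
    and V: "continuous_on S V" "!!s. s \<in> S ==> V s = g s * Z s" "!!s. s \<in> S ==> V s * x = V s"
      "!!s t. s \<in> D ==> t \<in> D ==> V s = V t"
      "!!s. s \<in> S ==> norm ((V s)\<star> * V s - x) <= 1/4" "!!s. s \<in> S ==> norm (w\<star> * V s) <= 1/8"
  defines "p \<equiv> w * w\<star>"
  obtains g' where "is_proj p" "class_homotopic a P S D g (%s. p + g' s)"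
    "!!s. s \<in> S ==> cpos (g' s) \<and> p * g' s = 0 \<and> g' s * p = 0" "continuous_on S g'" "!!s t. s \<in> D ==> t \<in> D ==> g' s = g' t"
proof -
  note xx = is_projD[OF x]
  have wx: "w * x = w" by (rule partial_isometry_right[OF w(1) x])
  have xw: "x * w\<star> = w\<star>" using arg_cong[OF wx, of star] by (simp add: star_mult xx)
  have wP: "w\<star> * P = 0" using arg_cong[OF w(2), of star] is_projD[OF P] by (simp add: star_mult)
  have "p * p = w * (w\<star> * w) * w\<star>" by (simp add: p_def mult.assoc)
  then have p: "is_proj p" by (simp add: is_proj_def w(1) wx) (simp add: p_def star_mult)
  have gs: "cpos (g s)" "P * g s = 0" "g s * P = 0" "cuntz_eq a (P + g s)" if "s \<in> S" for s
    using class_familyD[OF g] that by blast+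
  have gc: "continuous_on S g" and gD: "!!s t. s \<in> D ==> t \<in> D ==> g s = g t"
    using class_familyD[OF g] by blast+
  have PV: "P * V s = 0" "(V s)\<star> * P = 0" if "s \<in> S" for s
  proof -
    show "P * V s = 0" using gs[OF that] V(2)[OF that] by (simp flip: mult.assoc)
    then have "(P * V s)\<star> = 0" by simp
    then show "(V s)\<star> * P = 0" using is_projD(1)[OF P] by (simp add: star_mult)
  qed
  have xV: "x * (V s)\<star> = (V s)\<star>" if "s \<in> S" for s
    using arg_cong[OF V(3)[OF that], of star] by (simp add: star_mult xx)
  \<comment> \<open>The component of \<open>S1 1 s * V s\<close> along \<open>w\<close>, completed
    by \<open>1 - x\<close> to an invertible element near 1.\<close>
  define M where "M s = w\<star> * V s + (V s)\<star> * V s + (1 - x)" for s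
  have nM: "norm (1 - M s) <= 3/8" if "s \<in> S" for s
  proof -
    have "1 - M s = - (w\<star> * V s) - ((V s)\<star> * V s - x)" by (simp add: M_def)
    then show ?thesis using V(5,6)[OF that] norm_triangle_ineq4[of "- (w\<star> * V s)" "(V s)\<star> * V s - x"] by simp
  qed
  have Mc: "continuous_on S M" unfolding M_def by (intro continuous_intros V(1))
  define K where "K s = near_inverse (M s)" for s
  have Kc: "continuous_on S K" unfolding K_def by (rule continuous_on_near_inverse[OF Mc nM]) auto
  have K: "M s * K s = 1" "K s * M s = 1" "norm (K s) <= 8/5" if "s \<in> S" for s
  proof -
    have l: "norm (1 - M s) < 1" using nM[OF that] by simp
    show "M s * K s = 1" "K s * M s = 1" unfolding K_def using near_inverse[OF l] by blast+
    have "1 / (1 - norm (1 - M s)) <= 1 / (1 - 3/8)" using nM[OF that] by (intro divide_left_mono) auto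
    then show "norm (K s) <= 8/5" unfolding K_def using near_inverse(3)[OF l] by simp
  qed
  \<comment> \<open>At \<open>t = 1\<close>, \<open>S1\<close> adds
    \<open>w * (V s)\<star> * V s\<close> to \<open>V s\<close>, and \<open>S2\<close> then removes
    \<open>V s\<close>; the composite sends \<open>V s\<close> to
    \<open>w * (V s)\<star> * V s\<close>.\<close>
  define S1 where "S1 t s = 1 + (t *R w) * (V s)\<star>" for t :: real and s
  define S2 where "S2 t s = 1 + (- t *R V s) * (K s * w\<star>)" for t :: real and s
  define T where "T t s = S2 t s * S1 t s" for t s
  \<comment> \<open>The products in reversed order are small, because \<open>w\<close> and
    \<open>V s\<close> are nearly orthogonal.\<close>
  have inv: "\<exists>L. L * T t s = 1" if t: "t \<in> {0..1}" and s: "s \<in> S" for t s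
  proof -
    have "norm ((V s)\<star> * w) <= 1/8"
      using V(6)[OF s] norm_star[of "w\<star> * V s"] by (simp add: star_mult)
    moreover have "norm ((V s)\<star> * (t *R w)) = t * norm ((V s)\<star> * w)" using t by simp
    moreover have "t * norm ((V s)\<star> * w) <= 1 * norm ((V s)\<star> * w)" using t by (intro mult_right_mono) auto
    ultimately have "norm ((V s)\<star> * (t *R w)) < 1" by auto
    then obtain L1 where L1: "L1 * S1 t s = 1" unfolding S1_def by (rule left_inverse_one_plus)
    have "norm (K s * w\<star> * (- t *R V s)) = t * norm (K s * (w\<star> * V s))" using t by (simp add: mult.assoc)
    moreover have "t * norm (K s * (w\<star> * V s)) <= 1 * (8/5 * (1/8))"
      by (intro mult_mono order.trans[OF norm_mult_ineq mult_mono]) (use t K(3)[OF s] V(6)[OF s] in auto)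
    ultimately have "norm (K s * w\<star> * (- t *R V s)) < 1" by simp
    then obtain L2 where L2: "L2 * S2 t s = 1" unfolding S2_def by (rule left_inverse_one_plus)
    have "(L1 * L2) * T t s = L1 * (L2 * S2 t s) * S1 t s" by (simp add: T_def mult.assoc)
    then show ?thesis using L1 L2 by auto
  qed
  have TP: "T t s * P = P" "P * T t s = P" if "s \<in> S" for t s
  proof -
    have "V s * (K s * w\<star>) * P = 0" "w * (V s)\<star> * P = 0" by (simp_all add: mult.assoc wP PV[OF that])
    moreover have "P * (V s * (K s * w\<star>)) = 0" "P * (w * (V s)\<star>) = 0"
      by (simp_all add: PV[OF that] w(2) flip: mult.assoc)
    ultimately have "S1 t s * P = P" "S2 t s * P = P" "P * S1 t s = P" "P * S2 t s = P"
      by (simp_all add: S1_def S2_def add_distribs diff_distribs)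
    then show "T t s * P = P" "P * T t s = P" unfolding T_def by (metis mult.assoc)+
  qed
  define H where "H t s = T t s * g s * (T t s)\<star>" for t s
  have Tst: "P * (T t s)\<star> = P" "(T t s)\<star> * P = P" if "s \<in> S" for t s
    using arg_cong[OF TP(1)[OF that], of star t] arg_cong[OF TP(2)[OF that], of star t] is_projD[OF P]
    by (simp_all add: star_mult)
  have hom1: "class_homotopic a P S D g (H 1)"
  proof (rule class_homotopicI[where H = H])
    have "continuous_on ({0..1 :: real} \<times> S) (%p. H (fst p) (snd p))"
      unfolding H_def T_def S1_def S2_def
      by (intro continuous_intros continuous_on_compose2[OF gc] continuous_on_compose2[OF V(1)]
          continuous_on_compose2[OF Kc]) auto
    then show "continuous_on ({0..1 :: real} \<times> S) (%(t, s). H t s)" by (simp add: split_def)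
    fix t :: real assume t: "t \<in> {0..1}"
    fix s assume s: "s \<in> S"
    have cH: "cpos (H t s)" unfolding H_def by (rule cpos_conj'[OF gs(1)[OF s]])
    have "T t s * (P + g s) * (T t s)\<star> = T t s * P * (T t s)\<star> + H t s"
      by (simp add: H_def add_distribs)
    also have "T t s * P * (T t s)\<star> = P" using TP(1)[OF s] Tst(1)[OF s] by simp
    finally have e: "T t s * (P + g s) * (T t s)\<star> = P + H t s" .
    obtain L where "L * T t s = 1" using inv[OF t s] by blast
    from unit_conj_cuntz[OF this, of "P + g s"] have "cuntz_eq (P + g s) (P + H t s)"
      unfolding e cuntz_eq_def using cH by (auto intro: cpos_add is_proj_cpos P)
    then have "cuntz_eq a (P + H t s)" using gs(4)[OF s] cuntz_eq_trans by blast
    moreover have "P * H t s = 0"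
    proof -
      have "P * H t s = (P * T t s) * g s * (T t s)\<star>" by (simp add: H_def mult.assoc)
      then show ?thesis using TP(2)[OF s] gs(2)[OF s] by simp
    qed
    moreover have "H t s * P = 0"
    proof -
      have "H t s * P = T t s * (g s * ((T t s)\<star> * P))" by (simp add: H_def mult.assoc)
      then show ?thesis using Tst(2)[OF s] gs(3)[OF s] by simp
    qed
    ultimately show "cpos (H t s) \<and> P * H t s = 0 \<and> H t s * P = 0 \<and> cuntz_eq a (P + H t s)" using cH by blast
  next
    show "H t s = H t s'" if "s \<in> D" "s' \<in> D" for t s s'
      unfolding H_def T_def S1_def S2_def K_def M_def V(4)[OF that] gD[OF that] ..
    show "H 0 s = g s" for s by (simp add: H_def T_def S1_def S2_def)
  qed simp
  define b where "b = H 1"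
  have bf: "class_family a P S D b"
    unfolding b_def by (rule class_homotopic_end[OF hom1 DS])
  \<comment> \<open>\<open>c * c\<close> is the image of \<open>V s * (V s)\<star>\<close> under
    conjugation by \<open>T 1 s\<close>. It dominates \<open>9/16\<close> of \<open>p\<close> since
    \<open>c\<close> dominates \<open>3/4\<close> of \<open>p\<close>, and it lies below a multiple
    of \<open>b s\<close> since \<open>V s = g s * Z s\<close>.\<close>
  have bound: "\<exists>C\<ge>0. cpos (C *R b s - p)" if s: "s \<in> S" for s
  proof -
    define A where "A = (V s)\<star> * V s"
    have A: "x * A = A" "A * x = A" using xV[OF s] V(3)[OF s] by (simp_all add: A_def mult.assoc) (simp flip: mult.assoc)
    have Ms: "M s = w\<star> * V s + A + (1 - x)" by (simp add: M_def A_def)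
    have TV: "T 1 s * V s = w * A"
    proof -
      have S1V: "S1 1 s * V s = V s + w * A" by (simp add: S1_def A_def distrib_right mult.assoc)
      have "w\<star> * (V s + w * A) = w\<star> * V s + A" by (simp add: distrib_left A w(1) flip: mult.assoc)
      also have "... = M s - (1 - x)" by (simp add: Ms)
      finally have wM: "w\<star> * (V s + w * A) = M s - (1 - x)" .
      have "M s * (1 - x) = 1 - x"
        using V(3)[OF s] A xx by (simp add: Ms algebra_simps)
      then have Kx: "K s * (1 - x) = 1 - x" using K(2)[OF s] by (metis mult.assoc mult_1_left)
      have "K s * (w\<star> * (V s + w * A)) = x" unfolding wM right_diff_distrib[of "K s" "M s" "1 - x"] K(2)[OF s] Kx by simp
      then have "V s * (K s * (w\<star> * (V s + w * A))) = V s" using V(3)[OF s] by simp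
      moreover have "S2 1 s * (V s + w * A) = (V s + w * A) - V s * (K s * (w\<star> * (V s + w * A)))"
        by (simp add: S2_def left_diff_distrib mult.assoc)
      ultimately have "S2 1 s * (V s + w * A) = w * A" by simp
      then show ?thesis by (simp add: T_def mult.assoc S1V)
    qed
    define c where "c = w * A * w\<star>"
    have cs: "c\<star> = c" by (simp add: c_def A_def star_mult mult.assoc)
    have cc: "c * c = T 1 s * (V s * (V s)\<star>) * (T 1 s)\<star>"
    proof -
      have "T 1 s * (V s * (V s)\<star>) * (T 1 s)\<star> = (T 1 s * V s) * (T 1 s * V s)\<star>" by (simp add: star_mult mult.assoc)
      also have "... = w * A * (A * w\<star>)" unfolding TV by (simp add: star_mult A_def)
      also have "... = w * A * x * A * w\<star>" using A by (simp add: mult.assoc)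
      also have "... = c * c" by (simp add: c_def mult.assoc flip: w(1))
      finally show ?thesis ..
    qed
    define d where "d = c - (3/4) *R p"
    have cd: "cpos d"
    proof -
      have "cpos ((1/4) *R 1 - (x - A))"
        by (rule cpos_norm_diff) (use V(5)[OF s] in \<open>auto simp: A_def star_diff star_mult xx norm_minus_commute\<close>)
      from cpos_conj'[OF this, of w] have "cpos ((1/4) *R p - (w * x * w\<star> - c))"
        by (simp add: diff_distribs p_def c_def)
      moreover have "(1/4) *R p - (w * x * w\<star> - c) = d"
      proof -
        have "p = (1/4) *R p + (3/4) *R p" by (simp flip: scaleR_left_distrib)
        then show ?thesis unfolding d_def wx p_def[symmetric] by (simp add: algebra_simps)
      qed
      ultimately show ?thesis by simp
    qed
    have pc: "p * c = c" "c * p = c"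
    proof -
      have "p * c = w * (w\<star> * w) * A * w\<star>" by (simp add: p_def c_def mult.assoc)
      then show "p * c = c" by (simp add: w(1) wx c_def)
      have "c * p = w * A * (w\<star> * w) * w\<star>" by (simp add: p_def c_def mult.assoc)
      also have "... = w * (A * x) * w\<star>" by (simp add: w(1) mult.assoc)
      finally show "c * p = c" by (simp add: A c_def)
    qed
    note pp = is_projD[OF p]
    have "c * c - (9/16) *R p = d * d + (3/2) *R d"
    proof -
      have c: "c = d + (3/4) *R p" by (simp add: d_def)
      have pd: "p * d = d" "d * p = d" by (simp_all add: d_def diff_distribs pc pp)
      have "d + d = 2 *R d" by (simp add: scaleR_2)
      have "c * c = d * d + ((3/4) *R d + (3/4) *R d) + (9/16) *R p"
        unfolding c by (simp add: add_distribs scaleR_right_distrib pd pp)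
      also have "(3/4) *R d + (3/4) *R d = (3/2) *R d" by (simp flip: scaleR_left_distrib)
      finally show ?thesis by simp
    qed
    moreover have "cpos (d * d + (3/2) *R d)"
      by (intro cpos_add cpos_scaleR cd cpos_square cpos_self_adjoint) auto
    ultimately have "cpos (c * c - (9/16) *R p)" by simp
    then have 1: "cpos ((16/9) *R (c * c) - p)"
      using cpos_scaleR[of "c * c - (9/16) *R p" "16/9"] by (simp add: scaleR_right_diff_distrib)
    let ?z = "norm (Z s * (Z s)\<star>)"
    have "cpos (?z *R (g s * g s) - V s * (V s)\<star>)"
      using cpos_conj'[OF cpos_le_norm[OF cpos_mult_star[of "Z s"]], of "g s"] cpos_self_adjoint[OF gs(1)[OF s]]
      by (simp add: V(2)[OF s] star_mult diff_distribs mult.assoc)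
    moreover have "cpos (norm (g s) *R g s - g s * g s)"
    proof -
      note sq = csqrt_el[OF gs(1)[OF s]]
      let ?q = "csqrt_el (g s)"
      have "?q * (norm (g s) *R 1 - g s) * ?q\<star>
          = norm (g s) *R (?q * ?q) - ?q * (?q * ?q) * ?q"
        by (simp only: diff_distribs) (simp add: sq)
      also have "?q * (?q * ?q) * ?q
          = (?q * ?q) * (?q * ?q)" by (simp only: mult.assoc)
      also have "norm (g s) *R (?q * ?q) - (?q * ?q) * (?q * ?q)
          = norm (g s) *R g s - g s * g s" by (simp only: sq)
      finally show ?thesis using cpos_conj'[OF cpos_le_norm[OF gs(1)[OF s]], of ?q] by simp
    qed
    ultimately have "cpos ((?z * norm (g s)) *R g s - V s * (V s)\<star>)"
      using cpos_add[OF _ cpos_scaleR[of "norm (g s) *R g s - g s * g s" ?z]] by (fastforce simp: scaleR_right_diff_distrib)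
    from cpos_conj'[OF this, of "T 1 s"] have 2: "cpos ((?z * norm (g s)) *R b s - c * c)"
      unfolding cc by (simp add: diff_distribs b_def H_def)
    show ?thesis
      by (rule exI[of _ "16/9 * (?z * norm (g s))"]) (use cpos_dominated_trans[OF 1 2] in simp)
  qed
  define g' where "g' s = (1 - p) * b s * (1 - p)" for s
  have bs: "cpos (b s)" "P * b s = 0" "b s * P = 0" if "s \<in> S" for s
    using class_familyD[OF bf] that by blast+
  have bc: "continuous_on S b" "!!s t. s \<in> D ==> t \<in> D ==> b s = b t" using class_familyD[OF bf] by blast+
  have Pp: "P * p = 0" "p * P = 0" unfolding p_def using w(2) wP by (simp_all add: mult.assoc) (simp flip: mult.assoc)
  have pq: "p * (1 - p) = 0" "(1 - p) * p = 0" using is_projD[OF p] by (simp_all add: diff_distribs)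
  have g'p: "cpos (g' s) \<and> p * g' s = 0 \<and> g' s * p = 0" if "s \<in> S" for s
  proof -
    have "cpos (g' s)" unfolding g'_def
      using cpos_conj[OF bs(1)[OF that], of "1 - p"] is_projD[OF is_proj_complement[OF p]] by simp
    moreover have "p * g' s = (p * (1 - p)) * b s * (1 - p)" "g' s * p = (1 - p) * b s * ((1 - p) * p)"
      by (simp_all add: g'_def mult.assoc)
    ultimately show ?thesis using pq by simp
  qed
  have g'c: "continuous_on S g'" unfolding g'_def by (intro continuous_intros bc)
  have g'D: "g' s = g' t" if "s \<in> D" "t \<in> D" for s t unfolding g'_def bc(2)[OF that] ..
  \<comment> \<open>Now \<open>p\<close> lies below a multiple of each \<open>b s\<close>, so
    pinching it off is a move along a segment.\<close>
  have "class_homotopic a P S D b (%s. p + g' s)"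
  proof (rule segment_homotopic[OF P bf])
    show "continuous_on S (%s. p + g' s)" by (intro continuous_intros g'c)
    show "p + g' s = p + g' t" if "s \<in> D" "t \<in> D" for s t using g'D[OF that] by simp
    fix s assume s: "s \<in> S"
    have "P * g' s = 0"
    proof -
      have "P * g' s = (P * (1 - p)) * b s * (1 - p)" by (simp add: g'_def mult.assoc)
      also have "P * (1 - p) = P" using Pp by (simp add: right_diff_distrib)
      finally show ?thesis using bs(2)[OF s] by simp
    qed
    moreover have "g' s * P = 0"
    proof -
      have "g' s * P = (1 - p) * (b s * ((1 - p) * P))" by (simp add: g'_def mult.assoc)
      also have "(1 - p) * P = P" using Pp by (simp add: left_diff_distrib)
      finally show ?thesis using bs(3)[OF s] by simp
    qed
    ultimately show "P * (p + g' s) = 0 \<and> (p + g' s) * P = 0" using Pp by (simp add: add_distribs)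
    obtain C where C: "C >= 0" "cpos (C *R b s - p)" using bound[OF s] by blast
    note pb = pinching_bounds[OF p bs(1)[OF s] C(2,1), folded g'_def]
    show "cpos (p + g' s) \<and> (\<exists>C\<ge>0. \<exists>E\<ge>0. cpos (C *R (p + g' s) - b s) \<and> cpos (E *R b s - (p + g' s)))"
      using pb C(1) by (intro conjI exI[of _ "2 * norm (b s) + 2"] exI[of _ "C + 2 + 2 * norm (b s) * C"]) auto
  qed
  with hom1 have "class_homotopic a P S D g (%s. p + g' s)" unfolding b_def by (rule class_homotopic_trans[OF DS])
  then show thesis by (rule that[OF p _ g'p g'c g'D])
qed

section \<open>Columns of matrix units and extraction of one projection\<close>

text \<open>Row \<open>i\<close> of the matrix units of both blocks, weighted by \<open>y\<close>.
  The index \<open>i\<close> must stay below \<open>N\<close> to exist in both blocks, whereas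
  \<open>y\<close> needs \<open>N + 1\<close> entries.\<close>

definition column :: "nat => (bool => nat => nat => 'a::unital_cstar_algebra) => (nat => 'a) => nat => 'a"
  where "column N u y i = (\<Sum>p\<in>(SIGMA t:UNIV. {..<block_size N t}). y (snd p) * u (fst p) i (snd p))"

lemma card_mat_unit_rows: "card (SIGMA t:UNIV. {..<block_size N t}) = 2 * N + 1"
  by (simp add: UNIV_bool block_size_def)

text \<open>Up to commutators, \<open>(column N u y i)\<star> * b * column N u y' j\<close> is the
  sum of the terms \<open>((y l)\<star> * b * y' l') * (u t l i * u t j l')\<close>. For
  \<open>i ~= j\<close> these vanish whatever \<open>y\<close> and \<open>y'\<close> are: columns
  built from unrelated local data are orthogonal as soon as their indices differ. For
  \<open>i = j\<close> and nearly orthogonal \<open>y\<close>, \<open>y'\<close> the diagonal units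
  remain and add up to 1.\<close>

lemma
  fixes u :: "bool => nat => nat => 'a::unital_cstar_algebra"
  assumes u: "mat_units N u" and ij: "i < N" "j < N"
    and c: "!!t l l'. l < block_size N t ==> l' < Suc N ==>
      norm (u t l i * ((y l)\<star> * b * y' l') - ((y l)\<star> * b * y' l') * u t l i) <= h"
  shows column_orthogonal: "i ~= j ==> norm ((column N u y i)\<star> * b * column N u y' j) <= (real (2 * N + 1))\<^sup>2 * h"
    and column_isometric: "i = j ==> (!!l l'. l < Suc N ==> l' < Suc N ==> norm ((y l)\<star> * b * y' l' - (if l = l' then x else 0)) <= E) ==>
      norm ((column N u y i)\<star> * b * column N u y' j - x) <= (real (2 * N + 1))\<^sup>2 * (E + h)"
proof -
  let ?P = "SIGMA t:UNIV :: bool set. {..<block_size N t}"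
  let ?Z = "%p q. ((y (snd p))\<star> * b * y' (snd q)) * ((u (fst p) i (snd p))\<star> * u (fst q) j (snd q))"
  let ?D = "%f. \<Sum>p\<in>?P. \<Sum>q\<in>?P. f p q" and ?M = "(real (2 * N + 1))\<^sup>2"
  let ?y = "(column N u y i)\<star> * b * column N u y' j"
  have bs: "k < N ==> k < block_size N t" "k < block_size N t ==> k < Suc N" for k t by (auto simp: block_size_def split: if_splits)
  have fin: "finite ?P" by simp
  have A: "norm (?y - ?D ?Z) <= ?M * h"
  proof -
    have "norm (?y - ?D ?Z) <= real (card ?P) * real (card ?P) * h"
      unfolding column_def
    proof (rule approx_commute_sum[OF fin fin])
      fix p q assume pq: "p \<in> ?P" "q \<in> ?P"
      then show "norm (u (fst p) i (snd p)) <= 1" by (intro mat_unitsD(4)[OF u] bs(1)[OF ij(1)]) auto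
      have "(u (fst p) i (snd p))\<star> = u (fst p) (snd p) i"
        by (rule mat_unitsD(2)[OF u]) (use pq bs ij in auto)
      then show "norm ((u (fst p) i (snd p))\<star> * ((y (snd p))\<star> * b * y' (snd q)) - ((y (snd p))\<star> * b * y' (snd q)) * (u (fst p) i (snd p))\<star>) <= h"
        using c[of "snd p" "fst p" "snd q"] pq bs by auto
    next
      show "norm (u (fst q) j (snd q)) <= 1" if "q \<in> ?P" for q using that by (intro mat_unitsD(4)[OF u] bs(1)[OF ij(2)]) auto
    qed
    then show ?thesis by (simp only: card_mat_unit_rows) (simp add: power2_eq_square algebra_simps)
  qed
  have Z: "?Z p q = (if fst p = fst q \<and> i = j then ((y (snd p))\<star> * b * y' (snd q)) * u (fst p) (snd p) (snd q) else 0)"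
    if "p \<in> ?P" "q \<in> ?P" for p q
  proof -
    have "(u (fst p) i (snd p))\<star> = u (fst p) (snd p) i"
      by (rule mat_unitsD(2)[OF u]) (use that bs ij in auto)
    moreover have "u (fst p) (snd p) i * u (fst q) j (snd q) = (if fst p = fst q \<and> i = j then u (fst p) (snd p) (snd q) else 0)"
      by (rule mat_unitsD(1)[OF u]) (use that bs ij in auto)
    ultimately show ?thesis by auto
  qed
  show "norm ?y <= ?M * h" if "i ~= j"
  proof -
    have "?D ?Z = 0" using Z that by (intro sum.neutral ballI) auto
    then show ?thesis using A by simp
  qed
  assume ij': "i = j" and e: "!!l l'. l < Suc N ==> l' < Suc N ==> norm ((y l)\<star> * b * y' l' - (if l = l' then x else 0)) <= E"
  let ?W = "%p q. if fst p = fst q then (if snd p = snd q then x else 0) * u (fst p) (snd p) (snd q) else 0"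
  have e0: "0 <= E" using e[of 0 0] norm_ge_zero order.trans by blast
  have "norm (?D ?Z - ?D ?W) <= (\<Sum>p\<in>?P. \<Sum>q\<in>?P. E)"
    unfolding sum_subtractf[symmetric]
  proof (intro sum_norm_le)
    fix p q assume pq: "p \<in> ?P" "q \<in> ?P"
    show "norm (?Z p q - ?W p q) <= E"
    proof (cases "fst p = fst q")
      case True
      let ?d = "(y (snd p))\<star> * b * y' (snd q) - (if snd p = snd q then x else 0)"
      have "?Z p q - ?W p q = ?d * u (fst p) (snd p) (snd q)"
        unfolding Z[OF pq] using True ij' by (simp add: left_diff_distrib)
      also have "norm ... <= norm ?d * norm (u (fst p) (snd p) (snd q))" by (rule norm_mult_ineq)
      also have "... <= E * 1"
        by (intro mult_mono e mat_unitsD(4)[OF u]) (use pq bs e0 True in auto)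
      finally show ?thesis by simp
    next
      case False
      then show ?thesis unfolding Z[OF pq] using e0 by simp
    qed
  qed
  also have "... = ?M * E" by (simp only: sum_constant card_mat_unit_rows) (simp add: power2_eq_square)
  finally have B: "norm (?D ?Z - ?D ?W) <= ?M * E" .
  have "?D ?W = (\<Sum>p\<in>?P. x * u (fst p) (snd p) (snd p))"
  proof (rule sum.cong[OF refl])
    fix p assume p: "p \<in> ?P"
    have "(\<Sum>q\<in>?P. ?W p q) = (\<Sum>q\<in>?P. if q = p then x * u (fst p) (snd p) (snd p) else 0)"
      by (rule sum.cong) (auto simp: prod_eq_iff)
    then show "(\<Sum>q\<in>?P. ?W p q) = x * u (fst p) (snd p) (snd p)" using p fin by simp
  qed
  also have "... = x * (\<Sum>t\<in>UNIV. \<Sum>l<block_size N t. u t l l)"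
    by (simp add: sum.Sigma split_def sum_distrib_left)
  also have "... = x" using mat_unitsD(3)[OF u] by simp
  finally have C: "?D ?W = x" .
  show "norm (?y - x) <= ?M * (E + h)"
    using norm_triangle_mono[OF A B] unfolding C by (simp add: algebra_simps)
qed

text \<open>Coverings of \<open>S\<close> have subordinate partitions of unity in \<open>m\<close> colours, supports of the same
  colour being disjoint; they do not separate the points of \<open>D\<close>.\<close>

definition colored_pou :: "'s::topological_space set => 's set => nat => bool"
  where "colored_pou S D m \<longleftrightarrow> (\<forall>C. (\<forall>U\<in>C. openin (top_of_set S) U) \<and> S \<subseteq> \<Union>C \<and> (\<exists>U\<in>C. D \<subseteq> U) -->
    (\<exists>(J :: (nat => nat) set) l k. finite J \<and> (\<forall>j\<in>J. continuous_on S (l j) \<and> k j < m \<and> (\<forall>s\<in>S. (0::real) <= l j s)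
        \<and> (\<exists>U\<in>C. \<forall>s\<in>S. l j s ~= 0 --> s \<in> U) \<and> (\<forall>s\<in>D. \<forall>t\<in>D. l j s = l j t)) \<and>
      (\<forall>s\<in>S. (\<Sum>j\<in>J. l j s) = 1) \<and>
      (\<forall>i\<in>J. \<forall>j\<in>J. i ~= j --> k i = k j --> (\<forall>s\<in>S. l i s * l j s = 0))))"

text \<open>Over each \<open>U c\<close> the columns of the local vectors \<open>y c\<close> are
  near-isometries. \<open>V s\<close> combines them with weights \<open>sqrt (l j s)\<close>, the
  colour serving as column index: different colours are orthogonal by their indices, equal colours
  by disjoint supports. Index \<open>m\<close> is no colour and is kept for the constant direction,
  hence \<open>N = m + 1\<close> and \<open>m + 2\<close> local vectors.\<close>

lemma extract_projection:
  fixes g :: "'s::metric_space => 'a::unital_cstar_algebra"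
  assumes ad: "approximately_divisible TYPE('a)" and P: "is_proj P"
    and g: "class_family a P S D g" and S: "compact S" "S ~= {}" "D \<subseteq> S" "colored_pou S D m"
    and x: "is_proj x" and d: "!!s. s \<in> S ==> mdom (replicate_mset (m + 2) x) {#g s#}"
  obtains p g' where "is_proj p" "mdom {#x#} {#p#}" "mdom {#p#} {#x#}" "P * p = 0" "p * P = 0"
    "class_family a (P + p) S D g'" "class_homotopic a P S D g (%s. p + g' s)"
proof -
  define N where "N = m + 1"
  note xx = is_projD[OF x]
  have gs: "cpos (g s)" "P * g s = 0" "g s * P = 0" "cuntz_eq a (P + g s)" if "s \<in> S" for s
    using class_familyD[OF g] that by blast+
  have gc: "continuous_on S g" and gD: "!!s t. s \<in> D ==> t \<in> D ==> g s = g t"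
    using class_familyD[OF g] by blast+
  have gst: "(g s)\<star> = g s" if "s \<in> S" for s using cpos_self_adjoint[OF gs(1)[OF that]] .
  \<comment> \<open>Normalizing against \<open>g c * g c\<close> allows
    \<open>V s = g s * Z s\<close>, which is continuous in \<open>s\<close>, orthogonal to
    \<open>P\<close>, and dominated by \<open>g s\<close>.\<close>
  have "\<exists>y. \<forall>i<Suc N. \<forall>j<Suc N. (y i)\<star> * (g c * g c) * y j = (if i = j then x else 0)" if c: "c \<in> S" for c
  proof -
    have "g c \<lessapprox> g c * g c" using cuntz_le_square gs(1)[OF c] by blast
    then have "mdom (replicate_mset (Suc N) x) {#g c * g c#}"
      by (intro mdom_mono_cuntz[OF _ gs(1)[OF c] cpos_square[OF gst[OF c]]])
        (use d[OF c] x in \<open>auto simp: N_def split: if_splits\<close>)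
    then have "mdom (mset (replicate (Suc N) x)) {#g c * g c#}" by simp
    then obtain z where "\<forall>i<length (replicate (Suc N) x). \<forall>j<length (replicate (Suc N) x).
        (z i)\<star> * (g c * g c) * z j = (if i = j then replicate (Suc N) x ! i else 0)"
      unfolding mdom_single_target by blast
    then show ?thesis by (intro exI[of _ z]) (simp del: replicate_Suc)
  qed
  then obtain y where y: "!!c i j. c \<in> S ==> i < Suc N ==> j < Suc N ==> (y c i)\<star> * (g c * g c) * y c j = (if i = j then x else 0)"
    by metis
  \<comment> \<open>There are \<open>(2 * N + 1)\<^sup>2\<close> pairs of column entries; their
    total Gram error is \<open>1/16\<close>.\<close>
  define e :: real where "e = 1 / (16 * (real (2 * N + 1))\<^sup>2)"
  have e: "e > 0" "(real (2 * N + 1))\<^sup>2 * e = 1/16" by (simp_all add: e_def)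
  define r where "r i j = (if i = j then x else 0)" for i j :: nat
  define U where "U c = {s \<in> S. \<forall>i<Suc N. \<forall>j<Suc N. norm ((y c i)\<star> * (g s * g s) * y c j - r i j) < e}" for c
  have U_self: "c \<in> U c" if "c \<in> S" for c using y[OF that] e(1) that by (simp add: U_def r_def)
  have U_open: "openin (top_of_set S) (U c)" for c
  proof -
    let ?F = "%p s. norm ((y c (fst p))\<star> * (g s * g s) * y c (snd p) - r (fst p) (snd p))"
    have "U c = S \<inter> (\<Inter>p\<in>{..<Suc N} \<times> {..<Suc N}. S \<inter> ?F p -` {..<e})"
by (auto simp: U_def)
    also have "openin (top_of_set S) ..."
      by (intro openin_Int openin_INT2 continuous_openin_preimage_gen continuous_intros gc open_lessThan) auto
    finally show ?thesis .
  qed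
  have "\<exists>V\<in>U ` S. D \<subseteq> V"
  proof (cases "D = {}")
    case False
    then obtain d where d: "d \<in> D" by blast
    have "s \<in> U d" if "s \<in> D" for s
      using U_self[of d] gD[OF that d] S(3) that d by (auto simp: U_def)
    then show ?thesis using d S(3) by blast
  qed (use S(2) in auto)
  moreover have "S \<subseteq> \<Union>(U ` S)" using U_self by blast
  ultimately obtain J :: "(nat => nat) set" and l f where J: "finite J"
      "!!j. j \<in> J ==> continuous_on S (l j) \<and> f j < m \<and> (\<forall>s\<in>S. (0::real) <= l j s)
        \<and> (\<exists>V\<in>U ` S. \<forall>s\<in>S. l j s ~= 0 --> s \<in> V) \<and> (\<forall>s\<in>D. \<forall>t\<in>D. l j s = l j t)"
      "!!s. s \<in> S ==> (\<Sum>j\<in>J. l j s) = 1"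
      "!!i j s. i \<in> J ==> j \<in> J ==> i ~= j ==> f i = f j ==> s \<in> S ==> l i s * l j s = 0"
    using S(4)[unfolded colored_pou_def, rule_format, of "U ` S"] U_open by (smt (verit) imageE)
  have "\<exists>c\<in>S. \<forall>s\<in>S. l j s ~= 0 --> s \<in> U c" if "j \<in> J" for j using J(2)[OF that] by blast
  then obtain c where c: "!!j. j \<in> J ==> c j \<in> S" "!!j s. j \<in> J ==> s \<in> S ==> l j s ~= 0 ==> s \<in> U (c j)" by metis
  obtain s0 where s0: "s0 \<in> S" using S(2) by blast
  define C where "C = insert s0 (c ` J)"
  have C: "finite C" "C \<subseteq> S" using J(1) c(1) s0 by (auto simp: C_def)
  let ?J = "(real (card J))\<^sup>2"
  \<comment> \<open>The commutator bound is shared among the \<open>card J\<close> squared pairs of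
    summands of \<open>V s\<close> and one further term.\<close>
  define n where "n = e / (?J + 1)"
  have J1: "?J + 1 > 0" by (simp add: add_nonneg_pos)
  have n: "n > 0" "(?J + 1) * n = e" using e(1) J1 by (simp_all add: n_def)
  \<comment> \<open>Two parameters occur, because the constant direction is formed at
    \<open>s0\<close> and compared with \<open>V s\<close> at all \<open>s\<close>.\<close>
  define K where "K = (\<Union>(b, b', i, j)\<in>C \<times> C \<times> {..<Suc N} \<times> {..<Suc N}. (%(s, t). (y b i)\<star> * (g s * g t) * y b' j) ` (S \<times> S))"
  have "compact K" unfolding K_def
  proof (intro compact_UN)
    show "finite (C \<times> C \<times> {..<Suc N} \<times> {..<Suc N})" using C by simp
    fix q assume "q \<in> C \<times> C \<times> {..<Suc N} \<times> {..<Suc N}"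
    obtain b b' i j where q: "q = (b, b', i, j)" by (cases q)
    have "continuous_on (S \<times> S) (%p. (y b i)\<star> * (g (fst p) * g (snd p)) * y b' j)"
      by (intro continuous_intros continuous_on_compose2[OF gc]) auto
    then show "compact (case q of (b, b', i, j) => (%(s, t). (y b i)\<star> * (g s * g t) * y b' j) ` (S \<times> S))"
      unfolding q split_def prod.case fst_conv snd_conv using S(1) by (intro compact_continuous_image compact_Times)
  qed
  then obtain u :: "bool => nat => nat => 'a" where u: "mat_units N u"
    "!!s i j x. i < block_size N s ==> j < block_size N s ==> x \<in> K ==> norm (u s i j * x - x * u s i j) <= n"
    using approx_central_mat_units[OF ad _ n(1)] by blast
  have comm: "norm (u t i k * ((y b i)\<star> * (g s * g s') * y b' j) - ((y b i)\<star> * (g s * g s') * y b' j) * u t i k) <= n"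
    if "i < block_size N t" "j < Suc N" "k < N" "b \<in> C" "b' \<in> C" "s \<in> S" "s' \<in> S" for t i k b b' j s s'
  proof (rule u(2))
    have "(y b i)\<star> * (g s * g s') * y b' j \<in> (%(s, t). (y b i)\<star> * (g s * g t) * y b' j) ` (S \<times> S)"
      using that by (intro image_eqI[of _ _ "(s, s')"]) auto
    moreover have "i < Suc N" using that(1) by (auto simp: block_size_def split: if_splits)
    ultimately show "(y b i)\<star> * (g s * g s') * y b' j \<in> K"
      using that unfolding K_def by (intro UN_I[of "(b, b', i, j)"]) auto
    show "i < block_size N t" "k < block_size N t" using that(1,3) by (auto simp: block_size_def)
  qed
  define Y where "Y b k = column N u (y b) k" for b k
  have orth: "norm ((Y b i)\<star> * (g s * g s') * Y b' j) <= (real (2 * N + 1))\<^sup>2 * n"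
    if "i < N" "j < N" "i ~= j" "b \<in> C" "b' \<in> C" "s \<in> S" "s' \<in> S" for b b' i j s s'
    unfolding Y_def by (rule column_orthogonal[OF u(1)]) (use that comm in auto)
  have iso: "norm ((Y b i)\<star> * (g s * g s) * Y b i - x) <= (real (2 * N + 1))\<^sup>2 * (e + n)"
    if "i < N" "b \<in> C" "s \<in> U b" for b i s
  proof -
    have s: "s \<in> S" using that by (simp add: U_def)
    have "norm ((y b l)\<star> * (g s * g s) * y b l' - (if l = l' then x else 0)) <= e" if "l < Suc N" "l' < Suc N" for l l'
      using \<open>s \<in> U b\<close> that less_imp_le unfolding U_def r_def by blast
    then show ?thesis unfolding Y_def by (intro column_isometric[OF u(1)]) (use that s comm in auto)
  qed
  define n1 where "n1 = (real (2 * N + 1))\<^sup>2"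
  have n1: "n1 * e = 1/16" "n1 >= 0" using e(2) by (simp_all add: n1_def)
  have n1e: "n1 * n >= 0" "?J * (n1 * n) + n1 * n = 1/16"
  proof -
    have "?J * (n1 * n) + n1 * n = n1 * ((?J + 1) * n)" by (simp add: algebra_simps)
    then show "?J * (n1 * n) + n1 * n = 1/16" unfolding n(2) n1(1) .
    show "n1 * n >= 0" using n1(2) n(1) by simp
  qed
  have n1e': "?J * (n1 * n) <= 1/16" "n1 * (e + n) <= 1/8" "real (card J) * (n1 * n) <= 1/16"
  proof -
    have 0: "?J * (n1 * n) >= 0" using n1e by simp
    show "?J * (n1 * n) <= 1/16" using n1e by simp
    have "n1 * n <= 1/16" using n1e 0 by linarith
    then show "n1 * (e + n) <= 1/8" using n1(1) by (simp add: distrib_left)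
    have "real (card J) <= ?J" by (cases "card J") (auto simp: power2_eq_square)
    then have "real (card J) * (n1 * n) <= ?J * (n1 * n)" using n1e(1) by (rule mult_right_mono)
    then show "real (card J) * (n1 * n) <= 1/16" using \<open>?J * (n1 * n) <= 1/16\<close> by simp
  qed
  have xn: "norm x <= 1" by (rule is_proj_norm[OF x])
  have cut: "norm (x * z * x) <= norm z" for z
  proof -
    have "norm (x * z * x) <= norm x * norm z * norm x"
      by (meson norm_mult_ineq order.trans mult_right_mono norm_ge_zero)
    also have "... <= 1 * norm z * 1" by (intro mult_mono) (use xn in auto)
    finally show ?thesis by simp
  qed
  define Z where "Z s = (\<Sum>j\<in>J. sqrt (l j s) *R (Y (c j) (f j) * x))" for s
  define V where "V s = g s * Z s" for s
  have lJ: "continuous_on S (l j)" "f j < N" "c j \<in> C" if "j \<in> J" for j using J(2)[OF that] that by (auto simp: N_def C_def)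
  have l0: "0 <= l j s" if "j \<in> J" "s \<in> S" for j s using J(2) that by blast
  have lD: "l j s = l j t" if "j \<in> J" "s \<in> D" "t \<in> D" for j s t using J(2) that by blast
  have Zx: "Z s * x = Z s" for s by (simp add: Z_def sum_distrib_right mult.assoc xx)
  have l1: "l j s <= 1" if "j \<in> J" "s \<in> S" for j s
    using member_le_sum[OF that(1), of "%j. l j s"] l0 that J(1,3) by simp
  have V1: "continuous_on S V" unfolding V_def Z_def by (intro continuous_intros gc lJ) auto
  have V4: "V s = V t" if "s \<in> D" "t \<in> D" for s t
  proof -
    have "Z s = Z t" unfolding Z_def by (rule sum.cong) (use lD[OF _ that] in auto)
    then show ?thesis unfolding V_def gD[OF that] by simp
  qed
  have sq1: "0 <= sqrt (l j s)" "sqrt (l j s) <= 1" if "j \<in> J" "s \<in> S" for j s using l0[OF that] l1[OF that] by auto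
  have V5: "norm ((V s)\<star> * V s - x) <= 1/4" if s: "s \<in> S" for s
  proof -
    define E where "E i j = sqrt (l j s) *R sqrt (l i s) *R (x * ((Y (c i) (f i))\<star> * (g s * g s) * Y (c j) (f j)) * x)" for i j
    have "(V s)\<star> * V s = (\<Sum>i\<in>J. \<Sum>j\<in>J. E i j)"
    proof -
      have "V s = (\<Sum>j\<in>J. sqrt (l j s) *R (g s * (Y (c j) (f j) * x)))"
        by (simp add: V_def Z_def sum_distrib_left)
      moreover from this have "(V s)\<star> = (\<Sum>i\<in>J. sqrt (l i s) *R (x * (Y (c i) (f i))\<star> * g s))"
        by (simp add: star_sum star_mult gst[OF s] xx)
      ultimately show ?thesis by (simp add: sum_product E_def mult.assoc)
    qed
    also have "... - x = (\<Sum>i\<in>J. \<Sum>j\<in>J. E i j - (if i = j then l i s *R x else 0))"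
      using J(3)[OF s] J(1) by (simp add: sum_subtractf scaleR_left.sum[symmetric])
    also have "norm ... <= (\<Sum>i\<in>J. \<Sum>j\<in>J. (if i = j then l i s * (n1 * (e + n)) else 0) + n1 * n)"
    proof (intro sum_norm_le)
      fix i j assume ij: "i \<in> J" "j \<in> J"
      show "norm (E i j - (if i = j then l i s *R x else 0)) <= (if i = j then l i s * (n1 * (e + n)) else 0) + n1 * n"
      proof (cases "i = j")
        case True
        have "norm (E i j - l i s *R x) <= l i s * (n1 * (e + n))"
        proof (cases "l i s = 0")
          case False
          let ?T = "(Y (c i) (f i))\<star> * (g s * g s) * Y (c i) (f i)"
          have "E i j - l i s *R x = l i s *R (x * (?T - x) * x)"
            using l0[OF ij(1) s] xx by (simp add: E_def True[symmetric] diff_distribs scaleR_right_diff_distrib)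
          then have "norm (E i j - l i s *R x) = l i s * norm (x * (?T - x) * x)" using l0[OF ij(1) s] by simp
          also have "... <= l i s * (n1 * (e + n))"
            by (intro mult_left_mono order.trans[OF cut] iso[folded n1_def] lJ ij c(2) s False l0)
          finally show ?thesis .
        qed (simp add: E_def)
        then show ?thesis using True n1e(1) by simp
      next
        case False
        have "norm (E i j) <= n1 * n"
        proof (cases "f i = f j")
          case True
          then have "l i s * l j s = 0" using J(4) ij False s by blast
          then have "E i j = 0" by (auto simp: E_def)
          then show ?thesis using n1e(1) by simp
        next
          case k: False
          have "norm (E i j) = sqrt (l j s) * (sqrt (l i s) * norm (x * ((Y (c i) (f i))\<star> * (g s * g s) * Y (c j) (f j)) * x))"
            using sq1 ij s by (simp add: E_def)
          also have "... <= 1 * (1 * (n1 * n))"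
            by (intro mult_mono order.trans[OF cut] orth[folded n1_def] lJ ij k s sq1) (use sq1 ij s in auto)
          finally show ?thesis by simp
        qed
        then show ?thesis using False by simp
      qed
    qed
    also have "... = (\<Sum>i\<in>J. l i s) * (n1 * (e + n)) + ?J * (n1 * n)"
      using J(1) by (simp add: sum.distrib sum_distrib_right power2_eq_square)
    also have "... <= 1/4" unfolding J(3)[OF s] using n1e' by simp
    finally show ?thesis .
  qed
  \<comment> \<open>Built with the free index \<open>m\<close>, hence almost orthogonal to every
    \<open>V s\<close>.\<close>
  define w0 where "w0 = g s0 * (Y s0 m * x)"
  have s0C: "s0 \<in> C" and mN: "m < N" by (simp_all add: C_def N_def)
  have w0: "norm (w0\<star> * w0 - x) <= 1/8"
  proof -
    let ?T = "(Y s0 m)\<star> * (g s0 * g s0) * Y s0 m"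
    have "w0\<star> * w0 - x = x * (?T - x) * x"
      by (simp add: w0_def star_mult gst[OF s0] xx mult.assoc diff_distribs)
    then have "norm (w0\<star> * w0 - x) <= norm (?T - x)" using cut by simp
    also have "... <= n1 * (e + n)" unfolding n1_def by (rule iso[OF mN s0C U_self[OF s0]])
    finally show ?thesis using n1e' by simp
  qed
  have "w0 * x = w0" by (simp add: w0_def mult.assoc xx)
  moreover have "norm (w0\<star> * w0 - x) < 1" using w0 by simp
  ultimately obtain h where h: "(w0 * h)\<star> * (w0 * h) = x" "w0 * h * x = w0 * h" "h * x = x * h"
      "norm h <= 1 / sqrt (1 - norm (w0\<star> * w0 - x))"
    using correct_to_partial_isometry[OF x] by blast
  define w where "w = w0 * h"
  have hn: "norm h <= 2"
  proof -
    have "sqrt (1/4) <= sqrt (1 - norm (w0\<star> * w0 - x))" using w0 by (intro real_sqrt_le_mono) linarith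
    then have "1 / sqrt (1 - norm (w0\<star> * w0 - x)) <= 1 / (1/2)" by (intro frac_le) (auto simp: real_sqrt_divide)
    then show ?thesis using h(4) by simp
  qed
  have V6: "norm (w\<star> * V s) <= 1/8" if s: "s \<in> S" for s
  proof -
    have "w0\<star> * V s = (\<Sum>j\<in>J. sqrt (l j s) *R (x * ((Y s0 m)\<star> * (g s0 * g s) * Y (c j) (f j)) * x))"
      by (simp add: w0_def V_def Z_def star_mult gst[OF s0] xx sum_distrib_left mult.assoc)
    also have "norm ... <= (\<Sum>j\<in>J. n1 * n)"
    proof (rule sum_norm_le)
      fix j assume j: "j \<in> J"
      have "m ~= f j" using J(2)[OF j] by simp
      have "norm (sqrt (l j s) *R (x * ((Y s0 m)\<star> * (g s0 * g s) * Y (c j) (f j)) * x))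
          = sqrt (l j s) * norm (x * ((Y s0 m)\<star> * (g s0 * g s) * Y (c j) (f j)) * x)" using sq1[OF j s] by simp
      also have "... <= 1 * (n1 * n)"
        by (intro mult_mono order.trans[OF cut] orth[folded n1_def] lJ j s s0 sq1 mN s0C \<open>m ~= f j\<close>) auto
      finally show "norm (sqrt (l j s) *R (x * ((Y s0 m)\<star> * (g s0 * g s) * Y (c j) (f j)) * x)) <= n1 * n" by simp
    qed
    also have "... <= 1/16" using n1e' by simp
    finally have "norm (w0\<star> * V s) <= 1/16" .
    then have "norm h * norm (w0\<star> * V s) <= 2 * (1/16)" using hn by (intro mult_mono) auto
    moreover have "norm (w\<star> * V s) <= norm h * norm (w0\<star> * V s)"
      using norm_mult_ineq[of "h\<star>" "w0\<star> * V s"] by (simp add: w_def star_mult mult.assoc)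
    ultimately show ?thesis by simp
  qed
  have ww: "w\<star> * w = x" using h(1) by (simp add: w_def)
  have Pw: "P * w = 0" unfolding w_def w0_def using gs(2)[OF s0] by (simp flip: mult.assoc)
  have wx: "w * x = w" by (rule partial_isometry_right[OF ww x])
  obtain g' where g': "is_proj (w * w\<star>)" "class_homotopic a P S D g (%s. w * w\<star> + g' s)"
    "!!s. s \<in> S ==> cpos (g' s) \<and> w * w\<star> * g' s = 0 \<and> g' s * (w * w\<star>) = 0" "continuous_on S g'" "!!s t. s \<in> D ==> t \<in> D ==> g' s = g' t"
  proof (rule rotate_into_constant[OF P g S(3) x ww Pw V1 _ _ V4 _ V6])
    show "V s = g s * Z s" for s by (rule V_def)
    show "V s * x = V s" for s by (simp add: V_def mult.assoc Zx)
    show "norm ((V s)\<star> * V s - x) <= 1/4" if "s \<in> S" for s by (rule V5[OF that])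
  qed blast+
  have "w\<star> * (w * w\<star>) * w = (w\<star> * w) * (w\<star> * w)" by (simp only: mult.assoc)
  then have "mdom {#x#} {#w * w\<star>#}" unfolding mdom_single ww xx by blast
  moreover have "mdom {#w * w\<star>#} {#x#}"
    unfolding mdom_single by (rule exI[of _ "w\<star>"]) (simp add: wx)
  moreover have Pp: "P * (w * w\<star>) = 0" using Pw by (simp flip: mult.assoc)
  moreover have pP: "w * w\<star> * P = 0"
    using arg_cong[OF Pw, of star] is_projD(1)[OF P] by (simp add: star_mult mult.assoc)
  moreover have "class_family a (P + w * w\<star>) S D g'"
  proof -
    note f' = class_familyD[OF class_homotopic_end[OF g'(2) S(3)]]
    have "(P + w * w\<star>) * g' s = 0 \<and> g' s * (P + w * w\<star>) = 0 \<and> cuntz_eq a (P + w * w\<star> + g' s)" if s: "s \<in> S" for s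
      using f'(4,5,6)[OF s] g'(3)[OF s] Pp pP by (simp add: add_distribs add.assoc)
    then show ?thesis unfolding class_family_def using g' by blast
  qed
  ultimately show thesis using g'(1,2) that by blast
qed

section \<open>Splitting off finitely many projections\<close>

lemma class_homotopic_shift:
  assumes P: "is_proj P" and e: "is_proj e" "P * e = 0" "e * P = 0"
    and h: "class_homotopic a (P + e) S D h h'"
  shows "class_homotopic a P S D (%s. e + h s) (%s. e + h' s)"
proof -
  obtain H where H: "continuous_on ({0..1 :: real} \<times> S) (%(t, s). H t s)"
    "!!t. t \<in> {0..1} ==> class_family a (P + e) S D (H t)" "!!s. s \<in> S ==> H 0 s = h s \<and> H 1 s = h' s"
    using h unfolding class_homotopic_def by blast
  show ?thesis
  proof (rule class_homotopicI[where H = "%t s. e + H t s"])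
    have "continuous_on ({0..1 :: real} \<times> S) (%p. e + H (fst p) (snd p))"
      using H(1) by (intro continuous_intros) (simp add: split_def)
    then show "continuous_on ({0..1 :: real} \<times> S) (%(t, s). e + H t s)" by (simp add: split_def)
    fix t :: real assume t: "t \<in> {0..1}"
    note f = class_familyD[OF H(2)[OF t]]
    show "e + H t s = e + H t s'" if "s \<in> D" "s' \<in> D" for s s' unfolding f(2)[OF that] ..
    fix s assume s: "s \<in> S"
    have "P * H t s = P * ((P + e) * H t s)" "H t s * P = (H t s * (P + e)) * P"
      by (simp_all add: add_distribs is_projD[OF P] e mult.assoc) (simp add: e flip: mult.assoc)
    then have "P * H t s = 0" "H t s * P = 0" using f(4,5)[OF s] by auto
    then show "cpos (e + H t s) \<and> P * (e + H t s) = 0 \<and> (e + H t s) * P = 0 \<and> cuntz_eq a (P + (e + H t s))"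
      using f(3,6)[OF s] e by (auto simp: add_distribs add.assoc intro: cpos_add is_proj_cpos)
  qed (use H(3) in auto)
qed

lemma is_proj_orthogonal_sum:
  assumes "is_proj P" "is_proj e" "P * e = 0" "e * P = 0"
  shows "is_proj (P + e)"
  using assms by (simp add: is_proj_def star_add add_distribs)

text \<open>Of the \<open>m + 3\<close> spare copies of a piece \<open>x\<close>, cancelling
  \<open>P\<close> from \<open>P + g s\<close> loses one, and the remaining \<open>m + 2\<close> are
  what \<open>extract_projection\<close> requires. Each extraction enlarges \<open>P\<close> and
  moves \<open>x\<close> from the multiset into it, so the total to be kept below \<open>a\<close>
  does not change.\<close>

lemma extract_projections:
  fixes g :: "'s::metric_space => 'a::unital_cstar_algebra"
  assumes simple: "simple_cstar TYPE('a)" and ad: "approximately_divisible TYPE('a)" and sf: "stably_finite TYPE('a)"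
    and a: "cpos a" and S: "compact S" "S ~= {}" "D \<subseteq> S" "colored_pou S D m"
  shows "is_proj P ==> class_family a P S D g ==>
    (!!x. x \<in># Y ==> is_proj x \<and> x ~= 0 \<and> mdom (add_mset P Y + replicate_mset (m + 3) x) {#a#}) ==>
    \<exists>e g'. is_proj e \<and> P * e = 0 \<and> e * P = 0 \<and> mdom (add_mset P Y) {#P + e#} \<and> mdom {#P + e#} (add_mset P Y) \<and>
      class_family a (P + e) S D g' \<and> class_homotopic a P S D g (%s. e + g' s)"
proof (induction Y arbitrary: P g)
  case empty
  have gc: "continuous_on S g" using empty(2) by (simp add: class_family_def)
  have "class_homotopic a P S D g (%s. 0 + g s)"
  proof (rule class_homotopicI[where H = "%t s. g s"])
    show "continuous_on ({0..1 :: real} \<times> S) (%(t, s). g s)"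
      unfolding split_def by (intro continuous_on_compose2[OF gc] continuous_intros) auto
    show "cpos (g s) \<and> P * g s = 0 \<and> g s * P = 0 \<and> cuntz_eq a (P + g s)" if "s \<in> S" for s
      using class_familyD[OF empty(2)] that by blast
    show "g s = g s'" if "s \<in> D" "s' \<in> D" for s s' by (rule class_familyD(2)[OF empty(2) that])
  qed simp_all
  then show ?case by (intro exI[of _ 0] exI[of _ g]) (simp add: mdom_refl empty)
next
  case (add x Y)
  have x: "is_proj x" "x ~= 0" "mdom (add_mset P (add_mset x Y) + replicate_mset (m + 3) x) {#a#}" using add.prems(3)[of x] by auto
  note P = add.prems(1) and g = add.prems(2)
  note f = class_familyD[OF g]
  have "mdom (replicate_mset (m + 2) x) {#g s#}" if s: "s \<in> S" for s
  proof (rule cancellation[OF simple ad sf P x(1,2) f(3,4,5)[OF s]])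
    have sub: "add_mset P (replicate_mset (Suc (m + 2)) x) \<subseteq># add_mset P (add_mset x Y) + replicate_mset (m + 3) x"
      by (simp add: numeral_3_eq_3)
    have "mdom (add_mset P (replicate_mset (Suc (m + 2)) x)) {#a#}" by (rule mdom_trans[OF mdom_subset[OF sub] x(3)])
    moreover have "a \<lessapprox> P + g s" "cpos (P + g s)" using f(6)[OF s] unfolding cuntz_eq_def by blast+
    moreover have "is_proj y" if "y \<in># add_mset P (replicate_mset (Suc (m + 2)) x)" for y
    proof -
      have "y = P \<or> y = x" using that by (auto simp del: replicate_mset_Suc split: if_splits)
      then show ?thesis using P x(1) by blast
    qed
    ultimately have "mdom (add_mset P (replicate_mset (Suc (m + 2)) x)) {#P + g s#}"
      using mdom_mono_cuntz a by blast
    then show "mdom (add_mset P (replicate_mset (Suc (m + 2)) x)) {#P, g s#}"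
      using mdom_trans mdom_orthogonal_sum(2)[OF P f(4,5)[OF s]] by blast
  qed
  note dom = this
  obtain p g' where p: "is_proj p" "mdom {#x#} {#p#}" "mdom {#p#} {#x#}" "P * p = 0" "p * P = 0"
    and cf: "class_family a (P + p) S D g'" and hom: "class_homotopic a P S D g (%s. p + g' s)"
    by (rule extract_projection[OF ad P g S x(1) dom])
  have Pp: "is_proj (P + p)" by (rule is_proj_orthogonal_sum[OF P p(1,4,5)])
  have eqv: "mdom {#P + p#} {#P, x#}" "mdom {#P, x#} {#P + p#}"
  proof -
    have "mdom {#P, p#} {#P, x#}" "mdom {#P, x#} {#P, p#}"
      using mdom_add[OF mdom_refl p(3), of "{#P#}"] mdom_add[OF mdom_refl p(2), of "{#P#}"] by (simp_all add: add_mset_commute)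
    then show "mdom {#P + p#} {#P, x#}" "mdom {#P, x#} {#P + p#}"
      using mdom_trans mdom_orthogonal_sum[OF P p(4,5)] by blast+
  qed
  have "\<exists>e g''. is_proj e \<and> (P + p) * e = 0 \<and> e * (P + p) = 0 \<and> mdom (add_mset (P + p) Y) {#P + p + e#} \<and>
      mdom {#P + p + e#} (add_mset (P + p) Y) \<and> class_family a (P + p + e) S D g'' \<and> class_homotopic a (P + p) S D g' (%s. e + g'' s)"
  proof (rule add.IH[OF Pp cf])
    fix y assume y: "y \<in># Y"
    have "mdom (add_mset (P + p) Y + replicate_mset (m + 3) y) ({#P, x#} + (Y + replicate_mset (m + 3) y))"
      using mdom_add[OF eqv(1) mdom_refl, of "Y + replicate_mset (m + 3) y"] by simp
    moreover have "{#P, x#} + (Y + replicate_mset (m + 3) y) = add_mset P (add_mset x Y) + replicate_mset (m + 3) y" by simp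
    ultimately show "is_proj y \<and> y ~= 0 \<and> mdom (add_mset (P + p) Y + replicate_mset (m + 3) y) {#a#}"
      using add.prems(3)[of y] y mdom_trans by auto
  qed
  then obtain e g'' where e: "is_proj e" "(P + p) * e = 0" "e * (P + p) = 0" "mdom (add_mset (P + p) Y) {#P + p + e#}"
      "mdom {#P + p + e#} (add_mset (P + p) Y)" "class_family a (P + p + e) S D g''" "class_homotopic a (P + p) S D g' (%s. e + g'' s)"
    by blast
  have Pe: "P * e = 0" "p * e = 0" "e * P = 0" "e * p = 0"
  proof -
    have "P * e = P * ((P + p) * e)" "p * e = p * ((P + p) * e)" "e * P = (e * (P + p)) * P" "e * p = (e * (P + p)) * p"
      by (simp_all add: add_distribs is_projD[OF P] is_projD[OF p(1)] p mult.assoc) (simp_all add: p flip: mult.assoc)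
    then show "P * e = 0" "p * e = 0" "e * P = 0" "e * p = 0" using e(2,3) by auto
  qed
  have "class_homotopic a P S D (%s. p + g' s) (%s. p + (e + g'' s))"
    by (rule class_homotopic_shift[OF P p(1,4,5) e(7)])
  from class_homotopic_trans[OF S(3) hom this] have "class_homotopic a P S D g (%s. (p + e) + g'' s)" by (simp add: add.assoc)
  moreover have "mdom (add_mset P (add_mset x Y)) (add_mset (P + p) Y)" "mdom (add_mset (P + p) Y) (add_mset P (add_mset x Y))"
    using mdom_add[OF eqv(2) mdom_refl, of Y] mdom_add[OF eqv(1) mdom_refl, of Y] by auto
  then have "mdom (add_mset P (add_mset x Y)) {#P + p + e#}" "mdom {#P + p + e#} (add_mset P (add_mset x Y))"
    using e(4,5) mdom_trans by blast+
  ultimately show ?case using e(6) p(4,5) Pe is_proj_orthogonal_sum[OF p(1) e(1) Pe(2,4)]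
    by (intro exI[of _ "p + e"] exI[of _ g'']) (simp add: add.assoc add_distribs)
qed

section \<open>Exhaustion by projections and the infinite concatenation\<close>

text \<open>The class of \<open>a\<close> contains no projection, so the projections
  \<open>r n\<close> approximating \<open>a\<close> cannot all lie below \<open>q\<close> from some
  point on, whereas eventually all lie above it. The difference \<open>d\<close> is the complement
  of a copy of \<open>q\<close> in a suitable \<open>r n\<close>.\<close>

lemma projection_step:
  fixes a q :: "'a::unital_cstar_algebra"
  assumes rr0: "real_rank_zero TYPE('a)" and a: "cpos a" "!!q. is_proj q ==> q \<lessapprox> a ==> \<not> a \<lessapprox> q"
    and q: "is_proj q" "q \<lessapprox> a" and e: "e > 0"
  obtains q' d v where "is_proj q'" "q' \<lessapprox> a" "is_proj d" "d ~= 0" "mdom {#q'#} {#q, d#}" "mdom {#q, d#} {#q'#}"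
    "norm (v * q' * v\<star> - a) < e"
proof -
  obtain r v where r: "!!n. is_proj (r n)" "!!n. r n \<lessapprox> a" "!!n. norm (v n * r n * (v n)\<star> - a) < 1 / real (Suc n)"
  proof -
    have "\<exists>r v. is_proj r \<and> r \<lessapprox> a \<and> norm (v * r * v\<star> - a) < 1 / real (Suc n)" for n
      using real_rank_zero_projection[OF rr0 a(1), of "1 / real (Suc n)"] by (metis of_nat_0_less_iff zero_less_Suc zero_less_divide_1_iff)
    then show thesis using that by metis
  qed
  obtain w where w: "w\<star> * a * w = q" using projection_cuntz_le_iff[OF q(1) a(1)] q(2) by blast
  have vr: "v n * r n * (v n)\<star> \<lessapprox> r n" for n by (rule cuntz_subequiv_conj) simp
  have "eventually (%n. q \<lessapprox> r n) sequentially"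
  proof -
    define k where "k = (norm w)\<^sup>2 + 1"
    have k: "k > 0" by (simp add: k_def add_nonneg_pos)
    have "eventually (%n. 1 / real (Suc n) < 1 / k) sequentially" using k by real_asymp
    then show ?thesis
    proof eventually_elim
      case (elim n)
      have "w\<star> * (v n * r n * (v n)\<star> - a) * w = ((v n)\<star> * w)\<star> * r n * ((v n)\<star> * w) - q"
        by (simp add: star_mult w diff_distribs) (simp add: mult.assoc flip: w)
      moreover have "norm (w\<star> * (v n * r n * (v n)\<star> - a) * w) < 1"
      proof -
        have "norm (w\<star> * (v n * r n * (v n)\<star> - a) * w) <= (norm w)\<^sup>2 * norm (v n * r n * (v n)\<star> - a)"
          using norm_conj_le[of "w\<star>" "v n * r n * (v n)\<star> - a"] by simp
        also have "... <= (norm w)\<^sup>2 * (1 / k)" using r(3)[of n] elim by (intro mult_left_mono) auto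
        also have "... < 1" using k by (simp add: k_def)
        finally show ?thesis .
      qed
      ultimately show ?case
        using projection_le_exact[OF q(1) is_proj_cpos[OF r(1)]] projection_cuntz_le_iff[OF q(1) is_proj_cpos[OF r(1)]] by metis
    qed
  qed
  moreover have "eventually (%n. 1 / real (Suc n) < e) sequentially" using e by real_asymp
  ultimately obtain n0 where n0: "!!n. n >= n0 ==> q \<lessapprox> r n \<and> 1 / real (Suc n) < e"
    unfolding eventually_sequentially using eventually_conj by (metis le_trans linear)
  have "\<exists>n\<ge>n0. \<not> r n \<lessapprox> q"
  proof (rule ccontr)
    assume "\<not> ?thesis"
    then have c: "r n \<lessapprox> q" if "n >= n0" for n using that by blast
    have "a \<lessapprox> q"
    proof (rule cuntz_subequiv_limit)
      fix D :: real assume "D > 0"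
      then have "eventually (%n. 1 / real (Suc n) < D) sequentially" by real_asymp
      then obtain n where "n >= n0" "1 / real (Suc n) < D" unfolding eventually_sequentially by (metis linear)
      then show "\<exists>a'. a' \<lessapprox> q \<and> norm (a' - a) < D"
        using cuntz_le_trans[OF vr c] r(3)[of n] by (intro exI[of _ "v n * r n * (v n)\<star>"]) auto
    qed
    then show False using a(2)[OF q] by blast
  qed
  then obtain n where n: "q \<lessapprox> r n" "1 / real (Suc n) < e" "\<not> r n \<lessapprox> q" using n0 by blast
  obtain u0 where u0: "u0\<star> * r n * u0 = q" using projection_cuntz_le_iff[OF q(1) is_proj_cpos[OF r(1)]] n(1) by blast
  define u where "u = r n * u0"
  note rr = is_projD[OF r(1)[of n]]
  have u: "u\<star> * u = q" "r n * u = u"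
  proof -
    have "u\<star> * u = u0\<star> * (r n * (r n * u0))" by (simp add: u_def star_mult rr mult.assoc)
    then show "u\<star> * u = q" by (simp add: rr u0[symmetric] mult.assoc)
  qed (simp add: u_def rr)
  have uq: "u * q = u" by (rule partial_isometry_right[OF u(1) q(1)])
  define f where "f = u * u\<star>"
  define d where "d = r n - f"
  have "f * f = u * (u\<star> * u) * u\<star>" by (simp add: f_def mult.assoc)
  then have f: "is_proj f" by (simp add: is_proj_def u(1) uq) (simp add: f_def star_mult)
  have rf: "r n * f = f" "f * r n = f"
  proof -
    show "r n * f = f" by (simp add: f_def u(2) flip: mult.assoc)
    from arg_cong[OF this, of star] show "f * r n = f" using is_projD(1)[OF f] by (simp add: star_mult rr)
  qed
  have d: "is_proj d" "f * d = 0" "d * f = 0" "f + d = r n"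
    using is_projD[OF f] rr rf by (simp_all add: d_def is_proj_def star_diff diff_distribs)
  have fq: "mdom {#f#} {#q#}" "mdom {#q#} {#f#}"
  proof -
    show "mdom {#f#} {#q#}" unfolding mdom_single by (rule exI[of _ "u\<star>"]) (simp add: f_def uq)
    have "u\<star> * f * u = (u\<star> * u) * (u\<star> * u)" by (simp only: f_def mult.assoc)
    then show "mdom {#q#} {#f#}" unfolding mdom_single using u(1) is_projD(2)[OF q(1)] by auto
  qed
  have "mdom {#f, d#} {#q, d#}" "mdom {#q, d#} {#f, d#}"
    using mdom_add[OF fq(1) mdom_refl, of "{#d#}"] mdom_add[OF fq(2) mdom_refl, of "{#d#}"] by (simp_all add: add_mset_commute)
  then have m: "mdom {#r n#} {#q, d#}" "mdom {#q, d#} {#r n#}"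
    using mdom_orthogonal_sum[OF f d(2,3)] d(4) mdom_trans by metis+
  have "d ~= 0"
  proof
    assume "d = 0"
    then have "r n = f" using d(4) by simp
    then have "r n \<lessapprox> q" using fq(1) mdom_cuntz_le[OF f is_proj_cpos[OF q(1)]] by simp
    then show False using n(3) by blast
  qed
  show thesis
    by (rule that[OF r(1,2) d(1) \<open>d ~= 0\<close> m, of "v n"]) (use r(3)[of n] n(2) in linarith)
qed

text \<open>Stage \<open>n\<close> runs on the interval from \<open>n / (n + 1)\<close> to
  \<open>(n + 1) / (n + 2)\<close>. The telescoping sums \<open>a N\<close>, frozen after the first
  \<open>N\<close> stages, are continuous without case distinctions, and they converge uniformly
  because late stages are uniformly near \<open>W\<close>.\<close>

lemma concatenate_homotopies:
  fixes F :: "nat => real => 's::topological_space => 'a::real_normed_vector"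
  assumes F: "!!n. continuous_on ({0..1} \<times> S) (%(t, s). F n t s)" "!!n s. s \<in> S ==> F n 1 s = F (Suc n) 0 s"
    and lim: "!!e. e > 0 ==> \<exists>n0. \<forall>n\<ge>n0. \<forall>t\<in>{0..1}. \<forall>s\<in>S. norm (F n t s - W) < e"
  shows "\<exists>G :: real => 's => 'a. continuous_on ({0..1} \<times> S) (%(t, s). G t s) \<and>
    (\<forall>s\<in>S. G 0 s = F 0 0 s \<and> G 1 s = W) \<and> (\<forall>t\<in>{0..<1}. \<exists>n. \<exists>x\<in>{0..1}. \<forall>s\<in>S. G t s = F n x s)"
proof -
  \<comment> \<open>The reciprocal length of the \<open>n\<close>-th interval.\<close>
  let ?m = "%n. real (Suc n) * real (Suc (Suc n))"
  define b where "b n = real n / real (Suc n)" for n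
  define c where "c n t = max 0 (min 1 ((t - b n) * ?m n))" for n and t :: real
  have c01: "c n t \<in> {0..1}" for n t by (auto simp: c_def)
  have c0: "c n t = 0" if "t <= b n" for n t
  proof -
    have "(t - b n) * ?m n <= 0" using that by (intro mult_nonpos_nonneg) auto
    then show ?thesis unfolding c_def by simp
  qed
  have b_diff: "(b (Suc n) - b n) * ?m n = 1" for n
  proof -
    have "(b (Suc n) - b n) * ?m n
        = (b (Suc n) * real (Suc (Suc n))) * real (Suc n) - (b n * real (Suc n)) * real (Suc (Suc n))" by (simp only: diff_distribs mult_ac)
    also have "... = 1"
    proof -
      have "b k * real (Suc k) = real k" for k by (simp add: b_def)
      then show ?thesis by (simp only:) (simp add: algebra_simps)
    qed
    finally show ?thesis .
  qed
  have c1: "c n t = 1" if "b (Suc n) <= t" for n t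
  proof -
    have "1 <= (t - b n) * ?m n"
      unfolding b_diff[of n, symmetric] using that by (intro mult_right_mono) auto
    then show ?thesis unfolding c_def by simp
  qed
  have b_mono: "b n <= b m" if "n <= m" for n m
    using that by (simp add: b_def le_divide_eq field_simps)
  define a where "a N t s = F 0 0 s + (\<Sum>n<N. F n (c n t) s - F n 0 s)" for N t s
  have a_Suc: "a (Suc N) t s = a N t s + (F N (c N t) s - F N 0 s)" for N t s by (simp add: a_def)
  have hi: "a N t s = F N 0 s" if "b N <= t" "s \<in> S" for N t s
    using that(1)
  proof (induction N)
    case (Suc N)
    then have "b N <= t" using b_mono[of N "Suc N"] by simp
    then show ?case using Suc c1[OF Suc.prems] F(2)[OF that(2)] by (simp add: a_Suc)
  qed (simp add: a_def)
  have lo: "a M t s = a N t s" if "t <= b N" "N <= M" for N M t s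
    using that(2)
  proof (induction M rule: dec_induct)
    case (step M)
    then have "t <= b M" using that b_mono by (meson order.trans)
    then show ?case using step by (simp add: a_Suc c0)
  qed simp
  have ex: "\<exists>n\<ge>N. \<exists>x\<in>{0..1}. \<forall>s\<in>S. a M t s = F n x s" if "b N <= t" "t <= b M" for N M t
  proof -
    have "N <= M \<or> t = b N"
      using b_mono[of M N] that by (cases "N <= M") auto
    then show ?thesis
    proof
      assume "N <= M"
      then show ?thesis using that(2)
      proof (induction M rule: dec_induct)
        case base
        then have "t = b N" using that by simp
        then show ?case using hi by (intro exI[of _ N]) (auto intro!: bexI[of _ 0])
      next
        case (step M)
        show ?case
        proof (cases "t <= b M")
          case True
          then show ?thesis using step lo[OF True, of "Suc M"] by simp
        next
          case False
          then have "a (Suc M) t s = F M (c M t) s" if "s \<in> S" for s using hi[of M t s] that by (simp add: a_Suc)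
          then show ?thesis using c01 step by blast
        qed
      qed
    next
      assume t: "t = b N"
      have "a M t s = F N 0 s" if "s \<in> S" for s
      proof (cases "M <= N")
        case True
        then have "a M t s = a N t s" using lo[of t M N s] \<open>t <= b M\<close> by simp
        then show ?thesis using hi[of N t s] t that by simp
      next
        case False
        then show ?thesis using lo[of t N M s] hi[of N t s] t that by simp
      qed
      then show ?thesis by (intro exI[of _ N]) (auto intro!: bexI[of _ 0])
    qed
  qed
  define n where "n t = (SOME n. t <= b n)" for t
  have n: "t <= b (n t)" if "t < 1" for t
  proof -
    have "b \<longlonglongrightarrow> 1" unfolding b_def by real_asymp
    then have "eventually (%n. t < b n) sequentially" using that by (rule order_tendstoD)
    then have "\<exists>n. t <= b n" by (meson eventually_sequentially less_imp_le order_refl)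
    then show ?thesis unfolding n_def by (rule someI_ex)
  qed
  define G where "G t s = (if t = 1 then W else a (n t) t s)" for t s
  have lo': "G t s = a N t s" if "t < 1" "t <= b N" for t s N
    using lo[OF that(2), of "n t" s] lo[OF n[OF that(1)], of N s] that(1) by (cases "n t <= N") (auto simp: G_def)
  have "uniform_limit ({0..1} \<times> S) (%N (t, s). a N t s) (%(t, s). G t s) sequentially"
  proof (rule uniform_limitI)
    fix e :: real assume e: "e > 0"
    obtain n0 where n0: "!!n t s. n >= n0 ==> t \<in> {0..1} ==> s \<in> S ==> norm (F n t s - W) < e/2"
      using lim[OF half_gt_zero[OF e]] by blast
    have "dist (a N t s) (G t s) < e" if N: "N >= n0" and t: "t \<in> {0..1}" and s: "s \<in> S" for N t s
    proof (cases "t <= b N")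
      case True
      moreover have "b N < 1" by (simp add: b_def)
      ultimately show ?thesis using lo'[of t N s] e by simp
    next
      case False
      have "norm (F N 0 s - W) < e/2" using n0[OF N _ s] by simp
      moreover have "norm (G t s - W) < e/2"
      proof (cases "t = 1")
        case True
        then show ?thesis using e by (simp add: G_def)
      next
        case ne: False
        then obtain m x where "m >= N" "x \<in> {0..1}" "a (n t) t s = F m x s"
          using ex[of N t "n t"] n[of t] False s t by auto
        then show ?thesis using n0[of m x s] N s ne by (simp add: G_def)
      qed
      moreover have "a N t s = F N 0 s" using hi[of N t s] False s by simp
      ultimately show ?thesis using dist_triangle_half_l[of "F N 0 s" W e "G t s"] by (simp add: dist_norm)
    qed
    then show "\<forall>\<^sub>F N in sequentially. \<forall>p\<in>{0..1} \<times> S. dist (case p of (t, s) => a N t s) (case p of (t, s) => G t s) < e"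
      unfolding eventually_sequentially by (intro exI[of _ n0]) auto
  qed
  moreover have "continuous_on ({0..1} \<times> S) (%(t, s). a N t s)" for N
  proof -
    have Fc: "continuous_on ({0..1} \<times> S) (%p. F n (h (fst p)) (snd p))" if "continuous_on UNIV h" "!!t. h t \<in> {0..1}" for n h
      by (rule continuous_on_compose2[OF F(1)[of n], of _ "%p. (h (fst p), snd p)", simplified])
        (use that in \<open>auto intro!: continuous_intros continuous_on_compose2[OF that(1)]\<close>)
    have "continuous_on UNIV (c n)" for n unfolding c_def by (intro continuous_intros)
    then show ?thesis unfolding a_def split_def using c01 by (intro continuous_intros Fc) auto
  qed
  ultimately have "continuous_on ({0..1} \<times> S) (%(t, s). G t s)"
    by (intro uniform_limit_theorem[OF _ _ sequentially_bot]) auto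
  moreover have "G 0 s = F 0 0 s" if "s \<in> S" for s
  proof -
    have "G 0 s = a 0 0 s" by (rule lo') (auto simp: b_def)
    then show ?thesis by (simp add: a_def)
  qed
  moreover have "\<exists>m. \<exists>x\<in>{0..1}. \<forall>s\<in>S. G t s = F m x s" if "t \<in> {0..<1}" for t
    using ex[of 0 t "n t"] n[of t] that by (fastforce simp: G_def b_def)
  moreover have "G 1 s = W" for s by (simp add: G_def)
  ultimately show ?thesis by (intro exI[of _ G]) blast
qed

lemma projection_sequence:
  fixes a :: "'a::unital_cstar_algebra"
  assumes rr0: "real_rank_zero TYPE('a)" and a: "cpos a" "!!q. is_proj q ==> q \<lessapprox> a ==> \<not> a \<lessapprox> q"
  shows "\<exists>q d v. q 0 = 0 \<and> (\<forall>j. is_proj (q j) \<and> q j \<lessapprox> a \<and> is_proj (d j) \<and> d j ~= 0 \<and>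
    mdom {#q (Suc j)#} {#q j, d j#} \<and> mdom {#q j, d j#} {#q (Suc j)#} \<and>
    norm (v j * q (Suc j) * (v j)\<star> - a) < 1 / real (Suc j))"
proof -
  define Q where "Q n q q' \<longleftrightarrow> (\<exists>d v. is_proj d \<and> d ~= 0 \<and> mdom {#q'#} {#q, d#} \<and> mdom {#q, d#} {#q'#} \<and>
    norm (v * q' * v\<star> - a) < 1 / real (Suc n))" for n :: nat and q q' :: 'a
  have "\<exists>q. \<forall>n. (is_proj (q n) \<and> q n \<lessapprox> a \<and> (n = 0 --> q n = 0)) \<and> Q n (q n) (q (Suc n))"
  proof (rule dependent_nat_choice)
    have "0 \<lessapprox> a" using a(1) cpos_zero by (intro dominated_cuntz_le[of 0 a 1]) auto
    then show "\<exists>q. is_proj q \<and> q \<lessapprox> a \<and> (0 = (0 :: nat) --> q = 0)" by (intro exI[of _ 0]) simp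
    fix q and n :: nat
    assume "is_proj q \<and> q \<lessapprox> a \<and> (n = 0 --> q = 0)"
    then have q: "is_proj q" "q \<lessapprox> a" by blast+
    have e: "1 / real (Suc n) > 0" by simp
    obtain q' d v where "is_proj q'" "q' \<lessapprox> a" "is_proj d" "d ~= 0" "mdom {#q'#} {#q, d#}" "mdom {#q, d#} {#q'#}"
      "norm (v * q' * v\<star> - a) < 1 / real (Suc n)"
      by (rule projection_step[OF rr0 a q e])
    then show "\<exists>q'. (is_proj q' \<and> q' \<lessapprox> a \<and> (Suc n = 0 --> q' = 0)) \<and> Q n q q'"
      unfolding Q_def by blast
  qed
  then obtain q where q: "!!n. is_proj (q n)" "!!n. q n \<lessapprox> a" "q 0 = 0" "!!n. Q n (q n) (q (Suc n))" by blast
  have "\<forall>n. \<exists>p. is_proj (fst p) \<and> fst p ~= 0 \<and> mdom {#q (Suc n)#} {#q n, fst p#} \<and> mdom {#q n, fst p#} {#q (Suc n)#} \<and>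
    norm (snd p * q (Suc n) * (snd p)\<star> - a) < 1 / real (Suc n)"
    using q(4) unfolding Q_def by simp
  from choice[OF this] obtain p where "!!n. is_proj (fst (p n)) \<and> fst (p n) ~= 0 \<and> mdom {#q (Suc n)#} {#q n, fst (p n)#} \<and> mdom {#q n, fst (p n)#} {#q (Suc n)#} \<and>
    norm (snd (p n) * q (Suc n) * (snd (p n))\<star> - a) < 1 / real (Suc n)" by blast
  then show ?thesis using q(1-3) by (intro exI[of _ q] exI[of _ "%n. fst (p n)"] exI[of _ "%n. snd (p n)"]) blast
qed

text \<open>\<open>W\<close> lies between \<open>c *R P\<close> and \<open>P\<close>, and positive
  factors on \<open>h\<close> are harmless, so damping stays within scalar multiples in both
  directions.\<close>

lemma weighted_sum_cuntz_eq:
  fixes P W h :: "'a::unital_cstar_algebra"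
  assumes P: "cpos P" "cpos h" and W: "cpos (P - W)" "cpos (W - c *R P)" "c > 0" and r: "r > 0"
    and a: "cuntz_eq a (P + h)"
  shows "cuntz_eq a (W + r *R h)"
proof (rule cuntz_eq_trans[OF a cuntz_eq_dominated])
  show "cpos (P + h)" by (intro cpos_add P)
  have "cpos (W - c *R P + c *R P)" using W P by (intro cpos_add cpos_scaleR) auto
  then have cW: "cpos W" by simp
  then show "cpos (W + r *R h)" using P r by (intro cpos_add cpos_scaleR) auto
  define C where "C = max (1/c) (1/r)"
  have C: "C * c >= 1" "C * r >= 1" "C >= 0" using W(3) r by (auto simp: C_def field_simps max_def)
  have "C *R (W + r *R h) - (P + h) = C *R (W - c *R P) + ((C * c - 1) *R P + (C * r - 1) *R h)"
    by (simp add: algebra_simps)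
  also have "cpos ..." using C P W by (intro cpos_add cpos_scaleR) auto
  finally show "cpos (C *R (W + r *R h) - (P + h))" .
  have "(1 + r) *R (P + h) - (W + r *R h) = (P - W) + (r *R P + h)"
    by (simp add: algebra_simps)
  also have "cpos ..." using r P W by (intro cpos_add cpos_scaleR) auto
  finally show "cpos ((1 + r) *R (P + h) - (W + r *R h))" .
qed

text \<open>The pieces of \<open>d j\<close> are so small that \<open>m + 3\<close> copies of each
  lie below \<open>d (Suc j)\<close>. The room that splitting off \<open>d j\<close> requires is
  therefore found in the next difference, still below \<open>a\<close>.\<close>

lemma projection_stages:
  fixes f :: "'s::metric_space => 'a::unital_cstar_algebra"
  assumes simple: "simple_cstar TYPE('a)" and ad: "approximately_divisible TYPE('a)" and sf: "stably_finite TYPE('a)"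
    and a: "cpos a" and S: "compact S" "S ~= {}" "D \<subseteq> S" "colored_pou S D m" and f: "class_family a 0 S D f"
    and q: "q 0 = 0" "!!j. is_proj (q j)" "!!j. q j \<lessapprox> a" and d: "!!j. is_proj (d j)" "!!j. d j ~= 0"
    and qd: "!!j. mdom {#q (Suc j)#} {#q j, d j#}" "!!j. mdom {#q j, d j#} {#q (Suc j)#}"
  shows "\<exists>P g. P 0 = 0 \<and> g 0 = f \<and> (\<forall>j. is_proj (P j) \<and> is_proj (P (Suc j) - P j) \<and>
    mdom {#q j#} {#P j#} \<and> class_family a (P j) S D (g j) \<and>
    class_homotopic a (P j) S D (g j) (%s. (P (Suc j) - P j) + g (Suc j) s))"
proof -
  have "\<exists>X. mdom {#d j#} X \<and> mdom X {#d j#} \<and>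
    (\<forall>x. x \<in># X --> is_proj x \<and> x ~= 0 \<and> mdom (replicate_mset (m + 3) x){#d (Suc j)#})" for j
    by (rule split_projection[where d = "d j" and d' = "d (Suc j)" and R = "m + 3", OF simple ad d(1) d(1) d(2)]) blast
  then have "\<forall>j. \<exists>X. mdom {#d j#} X \<and> mdom X {#d j#} \<and>
    (\<forall>x. x \<in># X --> is_proj x \<and> x ~= 0 \<and> mdom (replicate_mset (m + 3) x){#d (Suc j)#})" by blast
  from choice[OF this] obtain X where X: "!!j. mdom {#d j#} (X j)" "!!j. mdom (X j) {#d j#}"
    "!!j x. x \<in># X j ==> is_proj x \<and> x ~= 0 \<and> mdom (replicate_mset (m + 3) x){#d (Suc j)#}" by blast
  define T where "T n Z Z' \<longleftrightarrow> is_proj (fst Z' - fst Z) \<and>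
    class_homotopic a (fst Z) S D (snd Z) (%s. (fst Z' - fst Z) + snd Z' s)" for n :: nat and Z Z' :: "'a \<times> ('s => 'a)"
  have "\<exists>Z. \<forall>n. (is_proj (fst (Z n)) \<and> mdom {#q n#} {#fst (Z n)#} \<and> mdom {#fst (Z n)#} {#q n#} \<and> class_family a (fst (Z n)) S D (snd (Z n)) \<and>
      (n = 0 --> Z n = (0, f))) \<and> T n (Z n) (Z (Suc n))"
  proof (rule dependent_nat_choice)
    show "\<exists>Z. is_proj (fst Z) \<and> mdom {#q 0#} {#fst Z#} \<and> mdom {#fst Z#} {#q 0#} \<and> class_family a (fst Z) S D (snd Z) \<and> (0 = (0 :: nat) --> Z = (0, f))"
      using f by (intro exI[of _ "(0, f)"]) (simp add: q(1) mdom_refl)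
    fix Z n
    assume "is_proj (fst Z) \<and> mdom {#q n#} {#fst Z#} \<and> mdom {#fst Z#} {#q n#} \<and> class_family a (fst Z) S D (snd Z) \<and> (n = 0 --> Z = (0, f))"
    then obtain P g where Z: "Z = (P, g)" and P: "is_proj P" "mdom {#q n#} {#P#}" "mdom {#P#} {#q n#}" and g: "class_family a P S D g"
      by (cases Z) auto
    have Pq: "mdom (add_mset P (X n)) {#q (Suc n)#}" "mdom {#q (Suc n)#} (add_mset P (X n))"
    proof -
      have "mdom (add_mset P (X n)) {#q n, d n#}" "mdom {#q n, d n#} (add_mset P (X n))"
        using mdom_add[OF P(3) X(2)[of n]] mdom_add[OF P(2) X(1)[of n]] by (simp_all add: add_mset_commute)
      from mdom_trans[OF this(1) qd(2)] mdom_trans[OF qd(1) this(2)]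
      show "mdom (add_mset P (X n)) {#q (Suc n)#}" "mdom {#q (Suc n)#} (add_mset P (X n))" .
    qed
    have "\<exists>e g'. is_proj e \<and> P * e = 0 \<and> e * P = 0 \<and> mdom (add_mset P (X n)) {#P + e#} \<and> mdom {#P + e#} (add_mset P (X n)) \<and>
      class_family a (P + e) S D g' \<and> class_homotopic a P S D g (%s. e + g' s)"
    proof (rule extract_projections[OF simple ad sf a S P(1) g])
      fix x assume x: "x \<in># X n"
      have "mdom (add_mset P (X n) + replicate_mset (m + 3) x) ({#q (Suc n)#} + {#d (Suc n)#})"
        using X(3)[OF x] by (intro mdom_add Pq) blast
      also have "mdom ... {#q (Suc (Suc n))#}" using qd(2)[of "Suc n"] by (simp add: add_mset_commute)
      also have "mdom ... {#a#}" using mdom_cuntz_le[OF q(2) a] q(3) by blast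
      finally show "is_proj x \<and> x ~= 0 \<and> mdom (add_mset P (X n) + replicate_mset (m + 3) x) {#a#}"
        using X(3)[OF x] by blast
    qed
    then obtain e g' where e: "is_proj e" "P * e = 0" "e * P = 0" "mdom (add_mset P (X n)) {#P + e#}" "mdom {#P + e#} (add_mset P (X n))"
      "class_family a (P + e) S D g'" "class_homotopic a P S D g (%s. e + g' s)" by blast
    show "\<exists>Z'. (is_proj (fst Z') \<and> mdom {#q (Suc n)#} {#fst Z'#} \<and> mdom {#fst Z'#} {#q (Suc n)#} \<and> class_family a (fst Z') S D (snd Z') \<and> (Suc n = 0 --> Z' = (0, f))) \<and> T n Z Z'"
      using is_proj_orthogonal_sum[OF P(1) e(1-3)] mdom_trans[OF Pq(2) e(4)] mdom_trans[OF e(5) Pq(1)] e(1,6,7)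
      by (intro exI[of _ "(P + e, g')"]) (simp add: T_def Z)
  qed
  then obtain Z where Z: "!!n. is_proj (fst (Z n))" "!!n. mdom {#q n#} {#fst (Z n)#}" "!!n. class_family a (fst (Z n)) S D (snd (Z n))"
    "Z 0 = (0, f)" "!!n. T n (Z n) (Z (Suc n))" by blast
  show ?thesis
    by (intro exI[of _ "%n. fst (Z n)"] exI[of _ "%n. snd (Z n)"]) (use Z in \<open>simp add: T_def\<close>)
qed

lemma class_null_homotopic_finite:
  fixes f :: "'s::metric_space => 'a::unital_cstar_algebra"
  assumes simple: "simple_cstar TYPE('a)" and ad: "approximately_divisible TYPE('a)" and sf: "stably_finite TYPE('a)"
    and rr0: "real_rank_zero TYPE('a)" and a: "cpos a" "!!q. is_proj q ==> q \<lessapprox> a ==> \<not> a \<lessapprox> q"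
    and S: "compact S" "S ~= {}" "D \<subseteq> S" "colored_pou S D m" and f: "class_family a 0 S D f"
  obtains W where "class_homotopic a 0 S D f (%_. W)"
proof -
  obtain q d v where q: "q 0 = 0" "!!j. is_proj (q j)" "!!j. q j \<lessapprox> a" "!!j. is_proj (d j)" "!!j. d j ~= 0"
    "!!j. mdom {#q (Suc j)#} {#q j, d j#}" "!!j. mdom {#q j, d j#} {#q (Suc j)#}"
    and v: "!!j. norm (v j * q (Suc j) * (v j)\<star> - a) < 1 / real (Suc j)"
    using projection_sequence[OF rr0 a] by blast
  obtain P g where P: "P 0 = 0" "g 0 = f" "!!j. is_proj (P j)" "!!j. is_proj (P (Suc j) - P j)"
    "!!j. mdom {#q j#} {#P j#}" and g: "!!j. class_family a (P j) S D (g j)"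
    and hom: "!!j. class_homotopic a (P j) S D (g j) (%s. (P (Suc j) - P j) + g (Suc j) s)"
    using projection_stages[OF simple ad sf a(1) S f q] by blast
  define e where "e j = P (Suc j) - P j" for j
  have e: "is_proj (e j)" for j unfolding e_def by (rule P(4))
  have P_sum: "P n = (\<Sum>i<n. e i)" for n by (induction n) (simp_all add: P(1) e_def)
  have "\<forall>j. \<exists>H. continuous_on ({0..1 :: real} \<times> S) (%(t, s). H t s) \<and>
    (\<forall>t\<in>{0..1}. class_family a (P j) S D (H t)) \<and> (\<forall>s\<in>S. H 0 s = g j s \<and> H 1 s = e j + g (Suc j) s)"
    using hom unfolding class_homotopic_def e_def by blast
  from choice[OF this] obtain H where H: "!!j. continuous_on ({0..1 :: real} \<times> S) (%(t, s). H j t s)"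
    "!!j t. t \<in> {0..1} ==> class_family a (P j) S D (H j t)" "!!j s. s \<in> S ==> H j 0 s = g j s"
    "!!j s. s \<in> S ==> H j 1 s = e j + g (Suc j) s" by blast
  have "\<forall>j. \<exists>B\<ge>0. \<forall>t\<in>{0..1}. \<forall>s\<in>S. norm (H j t s) <= B"
  proof
    fix j
    have "bounded ((%(t, s). H j t s) ` ({0..1} \<times> S))"
      by (intro compact_imp_bounded compact_continuous_image H(1) compact_Times S(1) compact_Icc)
    then obtain B where "B > 0" "!!y. y \<in> (%(t, s). H j t s) ` ({0..1} \<times> S) ==> norm y <= B"
      unfolding bounded_pos by blast
    then show "\<exists>B\<ge>0. \<forall>t\<in>{0..1}. \<forall>s\<in>S. norm (H j t s) <= B" by (intro exI[of _ B]) force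
  qed
  from choice[OF this] obtain B where B: "!!j. B j >= 0" "!!j t s. t \<in> {0..1} ==> s \<in> S ==> norm (H j t s) <= B j" by blast
  \<comment> \<open>Halved at each stage and divided by \<open>1 + B i\<close>, so that stage
    \<open>j\<close> weighted by \<open>c j\<close> has norm at most
    \<open>(1/2) ^ j\<close>.\<close>
  define c :: "nat => real" where "c j = (\<Prod>i\<le>j. (1/2) / (1 + B i))" for j
  have c_pos: "c j > 0" for j unfolding c_def by (intro prod_pos ballI divide_pos_pos add_pos_nonneg B) auto
  have c_Suc: "c (Suc j) * (1 + B (Suc j)) = c j / 2" for j
  proof -
    define x where "x = 1 + B (Suc j)"
    have "c (Suc j) = c j * ((1/2) / x)" by (simp only: c_def prod.atMost_Suc x_def)
    moreover have "x ~= 0" using B(1)[of "Suc j"] by (simp add: x_def)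
    ultimately show ?thesis by (simp add: x_def[symmetric])
  qed
  have c_mono: "c (Suc j) <= c j" for j
  proof -
    have "c (Suc j) * 1 <= c (Suc j) * (1 + B (Suc j))" using B(1) c_pos[of "Suc j"] by (intro mult_left_mono) auto
    then show ?thesis using c_Suc[of j] c_pos[of j] by simp
  qed
  have cB: "c j * (1 + B j) <= (1/2) ^ j" for j
  proof (induction j)
    case 0
    then show ?case using B(1)[of 0] by (simp add: c_def)
  next
    case (Suc j)
    have "c j * 1 <= c j * (1 + B j)" using B(1) c_pos[of j] by (intro mult_left_mono) auto
    then show ?case using Suc c_Suc[of j] by simp
  qed
  have c_le: "c j <= (1/2) ^ j" for j
  proof -
    have "c j * 1 <= c j * (1 + B j)" using B(1) c_pos[of j] by (intro mult_left_mono) auto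
    then show ?thesis using cB[of j] by simp
  qed
  have c_anti: "c j <= c i" if "i <= j" for i j using c_mono that by (rule lift_Suc_antimono_le)
  have c1: "c j <= 1" for j using c_le[of j] power_le_one[of "1/2 :: real" j] by simp
  define Wn where "Wn n = (\<Sum>i<n. c i *R e i)" for n
  define W where "W = (\<Sum>i. c i *R e i)"
  have "summable (%i. c i *R e i)"
  proof (rule summable_comparison_test'[of "%i. (1/2 :: real) ^ i" 0])
    show "norm (c i *R e i) <= (1/2) ^ i" for i
    proof -
      have "norm (c i *R e i) = c i * norm (e i)" using c_pos[of i] by simp
      also have "... <= c i * 1" using is_proj_norm[OF e] c_pos[of i] by (intro mult_left_mono) auto
      also have "... <= (1/2) ^ i" using c_le[of i] by simp
      finally show ?thesis .
    qed
  qed (auto intro: summable_geometric)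
  then have W_lim: "Wn \<longlonglongrightarrow> W" unfolding Wn_def W_def by (rule summable_LIMSEQ)
  have PW: "cpos (P n - Wn n)" for n
  proof -
    have "P n - Wn n = (\<Sum>i<n. (1 - c i) *R e i)" by (simp add: P_sum Wn_def sum_subtractf scaleR_left_diff_distrib)
    also have "cpos ..." using c1 by (intro cpos_sum cpos_scaleR is_proj_cpos e) auto
    finally show ?thesis .
  qed
  have WP: "cpos (Wn n - c k *R P k)" if "k <= n" for n k
  proof -
    have "Wn n - c k *R P k = (\<Sum>i<k. (c i - c k) *R e i) + (\<Sum>i\<in>{..<n} - {..<k}. c i *R e i)"
      using sum.subset_diff[of "{..<k}" "{..<n}" "%i. c i *R e i"] that
      by (simp add: P_sum Wn_def sum_subtractf scaleR_left_diff_distrib scaleR_sum_right)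
    also have "cpos ..."
      using c_anti c_pos by (intro cpos_add cpos_sum cpos_scaleR is_proj_cpos e) (auto intro: less_imp_le)
    finally show ?thesis .
  qed
  have mem: "cpos (Wn n + r *R h) \<and> cuntz_eq a (Wn n + r *R h)"
    if "cpos h" "cuntz_eq a (P n + h)" "r > 0" for n h r
  proof -
    have "cuntz_eq a (Wn n + r *R h)"
      by (rule weighted_sum_cuntz_eq[OF is_proj_cpos[OF P(3)] that(1) PW WP[OF order_refl] c_pos that(3,2)])
    then show ?thesis by (simp add: cuntz_eq_def)
  qed
  let ?w = "%t j. (1 - t) * c j + t * c (Suc j)"
  \<comment> \<open>Stages alternate: \<open>A j\<close> runs \<open>H j\<close> with weight
    \<open>c j\<close>; \<open>A' j\<close> keeps \<open>e j\<close> at weight \<open>c j\<close>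
    while lowering the weight of the remainder to \<open>c (Suc j)\<close>.\<close>
  define A where "A j t s = Wn j + c j *R H j t s" for j t s
  define A' where "A' j t s = Wn (Suc j) + (?w t j) *R g (Suc j) s" for j t s
  define F where "F n = (if even n then A (n div 2) else A' (n div 2))" for n
  have gc: "continuous_on S (g j)" for j using class_familyD[OF g] by blast
  have interp: "0 < ?w t j" "?w t j <= c j" if "t \<in> {0..1}" for t j
  proof -
    have "(1 - t) * c (Suc j) + t * c (Suc j) <= ?w t j"
      using that c_mono by (intro add_right_mono mult_left_mono) auto
    then show "0 < ?w t j" using c_pos[of "Suc j"] by (simp add: algebra_simps)
    have "?w t j <= (1 - t) * c j + t * c j"
      using that c_mono by (intro add_left_mono mult_left_mono) auto
    then show "?w t j <= c j" by (simp add: algebra_simps)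
  qed
  have F_cont: "continuous_on ({0..1} \<times> S) (%(t, s). F n t s)" for n
  proof (cases "even n")
    case True
    show ?thesis unfolding F_def A_def using H(1)[of "n div 2"] True
      by (simp add: split_def) (intro continuous_intros)
  next
    case False
    show ?thesis unfolding F_def A'_def using False
      by (simp add: split_def) (intro continuous_intros continuous_on_compose2[OF gc], auto)
  qed
  have F_mem: "cpos (F n t s) \<and> cuntz_eq a (F n t s)" if t: "t \<in> {0..1}" and s: "s \<in> S" for n t s
  proof (cases "even n")
    case True
    then show ?thesis using mem[OF _ _ c_pos] class_familyD(3,6)[OF H(2)[OF t] s] by (simp add: F_def A_def)
  next
    case False
    then show ?thesis using mem[OF _ _ interp(1)[OF t]] class_familyD(3,6)[OF g s] by (simp add: F_def A'_def)
  qed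
  have F_D: "F n t s = F n t s'" if t: "t \<in> {0..1}" and s: "s \<in> D" "s' \<in> D" for n t s s'
    by (simp add: F_def A_def A'_def class_familyD(2)[OF H(2)[OF t] s] class_familyD(2)[OF g s])
  have F_end: "F n 1 s = F (Suc n) 0 s" if s: "s \<in> S" for n s
  proof (cases "even n")
    case True
    then show ?thesis using H(4)[OF s] by (simp add: F_def A_def A'_def Wn_def scaleR_right_distrib)
  next
    case False
    then show ?thesis using H(3)[OF s] by (simp add: F_def A_def A'_def)
  qed
  have lim: "\<exists>n0. \<forall>n\<ge>n0. \<forall>t\<in>{0..1}. \<forall>s\<in>S. norm (F n t s - W) < l" if l: "l > 0" for l
  proof -
    have "eventually (%j. norm (Wn j - W) < l/2) sequentially"
      using tendstoD[OF W_lim, of "l/2"] l by (simp add: dist_norm)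
    moreover have "eventually (%j. (1/2 :: real) ^ j < l/2) sequentially"
      using order_tendstoD(2)[OF LIMSEQ_realpow_zero[of "1/2 :: real"], of "l/2"] l by simp
    ultimately obtain j0 where j0: "!!j. j >= j0 ==> norm (Wn j - W) < l/2 \<and> (1/2 :: real) ^ j < l/2"
      unfolding eventually_sequentially by (metis le_trans linear)
    have "norm (F n t s - W) < l" if n: "n >= 2 * j0" and t: "t \<in> {0..1}" and s: "s \<in> S" for n t s
    proof -
      define j where "j = n div 2"
      have j: "j >= j0" using n by (simp add: j_def)
      show ?thesis
      proof (cases "even n")
        case True
        have "c j * norm (H j t s) <= c j * (1 + B j)" using B(2)[OF t s, of j] c_pos[of j] by (intro mult_left_mono) auto
        with cB[of j] have "c j * norm (H j t s) <= (1/2) ^ j" by simp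
        then have small: "norm (c j *R H j t s) <= (1/2) ^ j" using c_pos[of j] by simp
        have Feq: "F n t s - W = (Wn j - W) + c j *R H j t s" using True by (simp add: F_def A_def j_def)
        show ?thesis
        proof (rule norm_add_less[OF _ conjunct1[OF j0[OF j]]])
          show "norm (c j *R H j t s) <= l/2" using small conjunct2[OF j0[OF j]] by linarith
          show "F n t s - W = c j *R H j t s + (Wn j - W)" unfolding Feq by simp
        qed simp
      next
        case False
        let ?r = "?w t j"
        have "g (Suc j) s = H j 1 s - e j" using H(4)[OF s] by simp
        then have "norm (g (Suc j) s) <= B j + 1"
          using norm_triangle_ineq4[of "H j 1 s" "e j"] B(2)[OF _ s, of 1 j] is_proj_norm[OF e[of j]] by simp
        then have "?r * norm (g (Suc j) s) <= c j * (1 + B j)"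
          using interp[OF t, of j] c_pos[of j] by (intro mult_mono) auto
        with cB[of j] have "?r * norm (g (Suc j) s) <= (1/2) ^ j" by simp
        then have small: "norm (?r *R g (Suc j) s) <= (1/2) ^ j" using interp[OF t, of j] by simp
        have Feq: "F n t s - W = (Wn (Suc j) - W) + ?r *R g (Suc j) s" using False by (simp add: F_def A'_def j_def)
        show ?thesis
        proof (rule norm_add_less[OF _ conjunct1[OF j0[of "Suc j", OF le_SucI[OF j]]]])
          show "norm (?r *R g (Suc j) s) <= l/2" using small conjunct2[OF j0[OF j]] by linarith
          show "F n t s - W = ?r *R g (Suc j) s + (Wn (Suc j) - W)" unfolding Feq by simp
        qed simp
      qed
    qed
    then show ?thesis by blast
  qed
  have W0: "cpos W"
  proof (rule cpos_closed)
    show "cpos (Wn n)" for n using c_pos unfolding Wn_def by (intro cpos_sum cpos_scaleR is_proj_cpos e) (auto intro: less_imp_le)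
  qed (rule W_lim)
  have WW: "cpos (W - c k *R P k)" for k
  proof (rule cpos_closed)
    show "cpos (Wn (n + k) - c k *R P k)" for n using WP by simp
    show "(%n. Wn (n + k) - c k *R P k) \<longlonglongrightarrow> W - c k *R P k"
      by (intro tendsto_intros LIMSEQ_ignore_initial_segment W_lim)
  qed
  \<comment> \<open>\<open>a\<close> is a limit of conjugates of the \<open>q (Suc j)\<close>, each
    of which lies below \<open>P (Suc j)\<close> and so below a multiple of
    \<open>W\<close>.\<close>
  have aW: "a \<lessapprox> W"
  proof (rule cuntz_subequiv_limit)
    fix l :: real assume "l > 0"
    then obtain j where j: "1 / real (Suc j) < l" using nat_approx_posE by blast
    let ?b = "v j * q (Suc j) * (v j)\<star>"
    have "?b \<lessapprox> q (Suc j)" by (rule cuntz_subequiv_conj) simp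
    also have "q (Suc j) \<lessapprox> P (Suc j)" using P(5) mdom_cuntz_le[OF q(2) is_proj_cpos[OF P(3)]] by blast
    also have "P (Suc j) \<lessapprox> W"
    proof (rule dominated_cuntz_le[OF is_proj_cpos[OF P(3)] W0, of "1 / c (Suc j)"])
      have "cpos ((1 / c (Suc j)) *R (W - c (Suc j) *R P (Suc j)))"
        using c_pos[of "Suc j"] by (intro cpos_scaleR WW) simp
      then show "cpos ((1 / c (Suc j)) *R W - P (Suc j))"
        using c_pos[of "Suc j"] by (simp add: scaleR_right_diff_distrib)
    qed
    finally show "\<exists>a'. a' \<lessapprox> W \<and> norm (a' - a) < l" using v[of j] j by (intro exI[of _ ?b]) simp
  qed
  have Wa: "W \<lessapprox> a"
  proof (rule cuntz_subequiv_limit)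
    fix l :: real assume "l > 0"
    then obtain n where n: "norm (Wn n - W) < l" using tendstoD[OF W_lim, of l] by (auto simp: dist_norm eventually_sequentially)
    obtain s where s: "s \<in> S" using S(2) by blast
    note gs = class_familyD(3,6)[OF g[of n] s]
    have "Wn n \<lessapprox> P n + g n s"
    proof (rule dominated_cuntz_le[of _ _ 1])
      show "cpos (Wn n)" using c_pos unfolding Wn_def by (intro cpos_sum cpos_scaleR is_proj_cpos e) (auto intro: less_imp_le)
      show "cpos (P n + g n s)" by (rule cpos_add[OF is_proj_cpos[OF P(3)] gs(1)])
      show "cpos (1 *R (P n + g n s) - Wn n)" using cpos_add[OF PW[of n] gs(1)] by (simp add: algebra_simps)
    qed
    also have "P n + g n s \<lessapprox> a" using gs(2) unfolding cuntz_eq_def by blast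
    finally show "\<exists>a'. a' \<lessapprox> a \<and> norm (a' - W) < l" using n by blast
  qed
  have aWc: "cuntz_eq a W" using aW Wa W0 by (simp add: cuntz_eq_def)
  obtain G :: "real => 's => 'a" where G: "continuous_on ({0..1} \<times> S) (%(t, s). G t s)" "!!s. s \<in> S ==> G 0 s = F 0 0 s" "!!s. s \<in> S ==> G 1 s = W"
    "!!t. t \<in> {0..<1} ==> \<exists>n. \<exists>x\<in>{0..1}. \<forall>s\<in>S. G t s = F n x s"
    using concatenate_homotopies[of S F, OF F_cont F_end lim] by blast
  have Gn: "(cpos (G t s) \<and> cuntz_eq a (G t s)) \<and> (s \<in> D --> s' \<in> D --> G t s = G t s')" if t: "t \<in> {0..1}" and s: "s \<in> S" "s' \<in> S" for t s s'
  proof (cases "t = 1")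
    case True
    then show ?thesis using G(3)[OF s(1)] G(3)[OF s(2)] W0 aWc by simp
  next
    case False
    then have "t \<in> {0..<1}" using t by auto
    then obtain n x where "x \<in> {0..1}" "\<forall>s\<in>S. G t s = F n x s" using G(4) by blast
    then show ?thesis using F_mem[of x s n] F_D[of x s s' n] s by simp
  qed
  have "class_homotopic a 0 S D (%s. c 0 *R f s) (%_. W)"
  proof (rule class_homotopicI[OF G(1)])
    show "cpos (G t s) \<and> 0 * G t s = 0 \<and> G t s * 0 = 0 \<and> cuntz_eq a (0 + G t s)" if "t \<in> {0..1}" "s \<in> S" for t s
      using Gn[OF that that(2)] by simp
    show "G t s = G t s'" if "t \<in> {0..1}" "s \<in> D" "s' \<in> D" for t s s' using Gn[of t s s'] that S(3) by blast
    show "G 0 s = c 0 *R f s" if "s \<in> S" for s using G(2)[OF that] H(3)[OF that, of 0] P(2) by (simp add: F_def A_def Wn_def)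
  qed (rule G(3))
  \<comment> \<open>The concatenation starts at weight \<open>c 0\<close>; rescaling
    \<open>f\<close> to it is a segment.\<close>
  moreover have "class_homotopic a 0 S D f (%s. c 0 *R f s)"
  proof (rule segment_homotopic[OF is_proj_zero f])
    note ff = class_familyD[OF f]
    show "continuous_on S (%s. c 0 *R f s)" by (intro continuous_intros ff(1))
    show "c 0 *R f s = c 0 *R f t" if "s \<in> D" "t \<in> D" for s t unfolding ff(2)[OF that] ..
    fix s assume s: "s \<in> S"
    have "cpos ((1 / c 0) *R (c 0 *R f s) - f s)" using c_pos[of 0] by simp
    moreover have "cpos (c 0 *R f s - c 0 *R f s)" by simp
    moreover have "cpos (c 0 *R f s)" using c_pos[of 0] by (intro cpos_scaleR ff(3)[OF s]) simp
    ultimately show "cpos (c 0 *R f s) \<and> (\<exists>C\<ge>0. \<exists>E\<ge>0. cpos (C *R (c 0 *R f s) - f s) \<and> cpos (E *R f s - c 0 *R f s))"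
      using c_pos[of 0] by (intro conjI exI[of _ "1 / c 0"] exI[of _ "c 0"]) auto
  qed simp
  ultimately show thesis using that class_homotopic_trans[OF S(3)] by blast
qed

lemma cuntz_le_zero: "b \<lessapprox> 0 ==> b = 0"
  unfolding cuntz_subequiv_def using LIMSEQ_unique[OF tendsto_const] by auto

lemma class_null_homotopic:
  fixes f :: "'s::metric_space => 'a::unital_cstar_algebra"
  assumes simple: "simple_cstar TYPE('a)" and ad: "approximately_divisible TYPE('a)"
    and rr0: "real_rank_zero TYPE('a)" and a: "cpos a"
    and nc: "!!q. stably_finite TYPE('a) ==> is_proj q ==> q \<lessapprox> a ==> \<not> a \<lessapprox> q"
    and S: "compact S" "S ~= {}" "D \<subseteq> S" "colored_pou S D m" and f: "class_family a 0 S D f"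
  obtains W where "class_homotopic a 0 S D f (%_. W)"
proof (cases "stably_finite TYPE('a)")
  case True
  show thesis by (rule class_null_homotopic_finite[OF simple ad True rr0 a nc[OF True] S f that])
next
  case nsf: False
  note ff = class_familyD[OF f]
  have "class_homotopic a 0 S D f (%_. a)"
  proof (rule class_homotopicI[where H = "%t s. (1 - t) *R f s + t *R a"])
    have "continuous_on ({0..1 :: real} \<times> S) (%p. (1 - fst p) *R f (snd p) + fst p *R a)"
      by (intro continuous_intros continuous_on_compose2[OF ff(1)]) auto
    then show "continuous_on ({0..1 :: real} \<times> S) (%(t, s). (1 - t) *R f s + t *R a)" by (simp add: split_def)
    show "(1 - t) *R f s + t *R a = (1 - t) *R f s' + t *R a" if "s \<in> D" "s' \<in> D" for t s s'
      unfolding ff(2)[OF that] ..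
    fix t :: real and s assume t: "t \<in> {0..1}" and s: "s \<in> S"
    let ?b = "(1 - t) *R f s + t *R a"
    have fs: "a \<lessapprox> f s" "f s \<lessapprox> a" "cpos (f s)" using ff(6)[OF s] by (auto simp: cuntz_eq_def)
    have b: "cpos ?b" using t fs(3) a by (intro cpos_add cpos_scaleR) auto
    have "cuntz_eq a ?b"
    proof (cases "a = 0")
      case True
      then have "f s = 0" using fs(2) cuntz_le_zero by blast
      then show ?thesis using True cuntz_le_refl[OF cpos_zero] by (simp add: cuntz_eq_def)
    next
      case False
      have f0: "f s ~= 0"
      proof
        assume "f s = 0"
        then have "a \<lessapprox> 0" using fs(1) by simp
        then show False using False cuntz_le_zero by blast
      qed
      have "?b ~= 0"
      proof
        assume b0: "?b = 0"
        then have "cpos (- (t *R a))" using cpos_scaleR[OF fs(3), of "1 - t"] t by (simp add: add_eq_0_iff2)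
        moreover have "cpos (t *R a)" using t a by (intro cpos_scaleR) auto
        ultimately have "t *R a = 0" using cpos_antisym by blast
        then show False using b0 False f0 by auto
      qed
      then show ?thesis
        unfolding cuntz_eq_def using not_stably_finite_cuntz_le[OF simple ad nsf] a b False by blast
    qed
    then show "cpos ?b \<and> 0 * ?b = 0 \<and> ?b * 0 = 0 \<and> cuntz_eq a (0 + ?b)" using b by simp
  qed auto
  then show thesis by (rule that)
qed

section \<open>Cubes and homotopy groups\<close>

definition cube :: "nat => (nat => real) set"
  where "cube k = {s. (\<forall>i<k. s i \<in> {0..1}) \<and> (\<forall>i\<ge>k. s i = 0)}"

definition cube_boundary :: "nat => (nat => real) set"
  where "cube_boundary k = {s \<in> cube k. \<exists>i<k. s i \<in> {0, 1}}"

lemma unit_cube_eq: "unit_cube k = top_of_set (cube k)"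
proof -
  have "{s. \<forall>i\<ge>k. s i = 0} \<inter> {s. \<forall>i<k. 0 <= s i \<and> s i <= 1} = cube k" by (auto simp: cube_def)
  then show ?thesis
    by (simp add: unit_cube_def Euclidean_space_def euclidean_product_topology subtopology_subtopology)
qed

lemma based_cube_map_iff: "based_cube_map k x f \<longleftrightarrow> (\<forall>s\<in>cube_boundary k. f s = x)"
  by (auto simp: based_cube_map_def unit_cube_eq cube_boundary_def)

lemma continuous_coordinate: "continuous_on S (%s. s i)" for S :: "('i => 'a::topological_space) set"
  by (rule continuous_on_product_then_coordinatewise) (rule continuous_on_id)

lemma compact_cube: "compact (cube k)"
proof -
  have "cube k = (\<Pi>\<^sub>E i\<in>UNIV. if i < k then {0..1} else {0})"
  proof (intro equalityI subsetI)
    fix s :: "nat => real" assume "s \<in> (\<Pi>\<^sub>E i\<in>UNIV. if i < k then {0..1} else {0})"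
    then have s: "s i \<in> (if i < k then {0..1} else {0})" for i by (rule PiE_mem) simp
    have "s i \<in> {0..1}" if "i < k" for i using s[of i] that by simp
    moreover have "s i = 0" if "i >= k" for i using s[of i] that by simp
    ultimately show "s \<in> cube k" by (simp add: cube_def)
  qed (auto simp: cube_def)
  then have "compactin (product_topology (%_. euclideanreal) UNIV) (cube k)"
    by (simp add: compactin_PiE)
  then show ?thesis by (simp add: euclidean_product_topology)
qed

lemma compact_cube_boundary: "compact (cube_boundary k)"
proof -
  have "cube_boundary k = cube k \<inter> (\<Union>i<k. (%s. s i) -` {0, 1})" by (auto simp: cube_boundary_def)
  moreover have "closed (\<Union>i<k. (%s :: nat => real. s i) -` {0, 1})"
    by (intro closed_UN ballI closed_vimage[OF _ continuous_coordinate]) auto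
  ultimately show ?thesis using compact_cube by auto
qed

text \<open>The weights of the product metric sum to 2.\<close>

lemma dist_fun_bound:
  fixes s t :: "'i::countable => 'a::metric_space"
  assumes "!!i. dist (s i) (t i) <= r"
  shows "dist s t <= 2 * r"
proof -
  have "dist s t <= (\<Sum>n. (1/2) ^ n * r)" unfolding dist_fun_def
  proof (rule suminf_le)
    fix n
    have "min (dist (s (from_nat n)) (t (from_nat n))) 1 <= r" using assms[of "from_nat n"] by simp
    then show "(1/2) ^ n * min (dist (s (from_nat n)) (t (from_nat n))) 1 <= (1/2) ^ n * r" by (intro mult_left_mono) auto
  next
    show "summable (%n. (1/2) ^ n * min (dist (s (from_nat n)) (t (from_nat n))) 1)"
      by (rule summable_comparison_test'[of "%n. (1/2) ^ n"]) (auto simp: summable_geometric_iff)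
    show "summable (%n. (1/2) ^ n * r)" by (intro summable_mult2 summable_geometric) auto
  qed
  also have "... = 2 * r" by (simp add: suminf_mult2[symmetric] suminf_geometric)
  finally show ?thesis .
qed

section \<open>Coloured partitions of unity on the cube\<close>

definition tent :: "real => real" where "tent y = max 0 (1 - \<bar>y\<bar>)"

lemma tent_nonneg: "0 <= tent y" and tent_nonzero: "tent y ~= 0 \<longleftrightarrow> \<bar>y\<bar> < 1"
  by (auto simp: tent_def)

lemma sum_tent:
  assumes "0 <= y" "y <= real n"
  shows "(\<Sum>j\<le>n. tent (y - real j)) = 1"
  using assms
proof (induction n)
  case (Suc n)
  show ?case
  proof (cases "y <= real n")
    case True
    then have "tent (y - real (Suc n)) = 0" by (simp add: tent_def)
    then show ?thesis using Suc True by simp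
  next
    case False
    have "(\<Sum>j<n. tent (y - real j)) = 0"
    proof (rule sum.neutral, rule ballI)
      fix j assume "j \<in> {..<n}"
      then have "real j + 1 <= real n" by simp
      then show "tent (y - real j) = 0" using False by (simp add: tent_def)
    qed
    moreover have "tent (y - real n) + tent (y - real (Suc n)) = 1" using False Suc.prems by (simp add: tent_def)
    ultimately show ?thesis by (simp add: lessThan_Suc_atMost[symmetric])
  qed
qed (simp add: tent_def)

text \<open>Products of tents over a grid of mesh \<open>1 / n\<close>, coloured by the parities of
  the grid point: distinct grid points of equal parity differ by at least 2 in some coordinate, so
  their supports are disjoint. All boundary grid points are merged into one function with a colour
  of its own; it equals 1 on the boundary, where the others vanish.\<close>

lemma colored_pou_cube:
  assumes k: "k >= 1"
  obtains m where "colored_pou (cube k) (cube_boundary k) m"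
proof -
  define par where "par p = (\<lambda>i\<in>{..<k}. p i mod 2)" for p :: "nat => nat"
  define Q :: "(nat => nat) set" where "Q = (\<Pi>\<^sub>E i\<in>{..<k}. {0, 1})"
  have "finite Q" unfolding Q_def by (intro finite_PiE) auto
  then obtain h where h: "bij_betw h Q {0..<card Q}" using ex_bij_betw_finite_nat by blast
  have parQ: "par p \<in> Q" for p by (auto simp: par_def Q_def)
  have "colored_pou (cube k) (cube_boundary k) (card Q + 1)"
    unfolding colored_pou_def
  proof (intro allI impI)
    fix C assume C: "(\<forall>U\<in>C. openin (top_of_set (cube k)) U) \<and> cube k \<subseteq> \<Union>C \<and> (\<exists>U\<in>C. cube_boundary k \<subseteq> U)"
    then obtain Ub where Ub: "Ub \<in> C" "cube_boundary k \<subseteq> Ub" by blast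
    define a where "a = {T. open T \<and> cube k \<inter> T \<in> C}"
    have a: "\<exists>T\<in>a. U = cube k \<inter> T" if "U \<in> C" for U
    proof -
      have "openin (top_of_set (cube k)) U" using C that by blast
      then obtain T where "open T" "U = cube k \<inter> T" unfolding openin_open by blast
      then show ?thesis using that by (auto simp: a_def)
    qed
    have sub: "cube k \<subseteq> \<Union>a" using C a by blast
    then obtain e1 where e1: "e1 > 0" "!!x. x \<in> cube k ==> \<exists>G\<in>a. ball x e1 \<subseteq> G"
      using Heine_Borel_lemma[OF compact_cube sub] unfolding a_def by (metis (no_types, lifting) mem_Collect_eq)
    obtain T where T: "open T" "Ub = cube k \<inter> T" using a[OF Ub(1)] by (auto simp: a_def)
    have sub2: "cube_boundary k \<subseteq> \<Union>{T}" using Ub(2) T(2) by auto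
    then obtain e2 where e2: "e2 > 0" "!!x. x \<in> cube_boundary k ==> ball x e2 \<subseteq> T"
      using Heine_Borel_lemma[OF compact_cube_boundary sub2] T(1) by auto
    \<comment> \<open>Half of the Lebesgue numbers, to compensate for the factor 2 between
      coordinatewise and product distance.\<close>
    define e where "e = min e1 e2 / 2"
    have "e > 0" using e1 e2 by (simp add: e_def)
    then obtain n0 where n0: "1 / real (Suc n0) < e" using nat_approx_posE by blast
    define n where "n = Suc n0"
    have n: "n > 0" "2 * (1 / real n) < e1" "2 * (1 / real n) < e2" using n0 by (auto simp: e_def n_def)
    define J where "J = (\<Pi>\<^sub>E i\<in>{..<k}. {..n})"
    define l where "l p s = (\<Prod>i<k. tent (real n * s i - real (p i)))" for p :: "nat => nat" and s :: "nat => real"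
    define B where "B = {p \<in> J. \<exists>i<k. p i = 0 \<or> p i = n}"
    \<comment> \<open>The zero function, never in \<open>J - B\<close>, serves as index of the
      merged boundary function.\<close>
    define L where "L p s = (if p = (%_. 0) then \<Sum>p\<in>B. l p s else l p s)" for p s
    define K where "K p = (if p = (%_. 0) then card Q else h (par p))" for p
    have fJ: "finite J" unfolding J_def by (intro finite_PiE) auto
    have fB: "finite B" "B \<subseteq> J" using fJ by (auto simp: B_def)
    have z: "(%_. 0) \<notin> J - B" using k by (auto simp: B_def intro!: exI[of _ 0])
    have l_nonneg: "0 <= l p s" for p s unfolding l_def by (intro prod_nonneg ballI tent_nonneg)
    have l_nz: "\<bar>s i - real (p i) / real n\<bar> <= 1 / real n" "\<bar>real n * s i - real (p i)\<bar> < 1" if "l p s ~= 0" "i < k" for p s i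
    proof -
      show 1: "\<bar>real n * s i - real (p i)\<bar> < 1" using that tent_nonzero unfolding l_def by auto
      have "s i - real (p i) / real n = (real n * s i - real (p i)) / real n" using n(1) by (simp add: field_simps)
      then show "\<bar>s i - real (p i) / real n\<bar> <= 1 / real n" using 1 n(1) by (simp add: divide_right_mono)
    qed
    have l_cont: "continuous_on S (l p)" for p S
      unfolding l_def tent_def by (intro continuous_intros continuous_coordinate)
    have l_sum: "(\<Sum>p\<in>J. l p s) = 1" if s: "s \<in> cube k" for s
    proof -
      have "(\<Sum>p\<in>J. l p s) = (\<Prod>i<k. \<Sum>j\<le>n. tent (real n * s i - real j))"
        unfolding J_def l_def by (rule prod_sum_PiE[symmetric]) auto
      also have "... = (\<Prod>i<k. 1)"
        using s n(1) by (intro prod.cong refl sum_tent) (auto simp: cube_def mult_left_le)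
      finally show ?thesis by simp
    qed
    have l_bd: "l p s = 0" if p: "p \<in> J - B" and s: "s \<in> cube_boundary k" for p s
    proof (rule ccontr)
      assume nz: "l p s ~= 0"
      obtain i where i: "i < k" "s i \<in> {0, 1}" using s by (auto simp: cube_boundary_def)
      have "p i ~= 0" "p i ~= n" "p i <= n" using p i(1) by (auto simp: B_def J_def)
      then have "1 <= real (p i)" "real (p i) + 1 <= real n" by auto
      then show False using l_nz(2)[OF nz i(1)] i(2) by auto
    qed
    have s1: "(\<Sum>p\<in>insert (%_. 0) (J - B). L p s) = (\<Sum>p\<in>J. l p s)" for s
    proof -
      have "(\<Sum>p\<in>insert (%_. 0) (J - B). L p s) = (\<Sum>p\<in>B. l p s) + (\<Sum>p\<in>J - B. L p s)"
        using fJ z by (simp add: L_def)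
      also have "(\<Sum>p\<in>J - B. L p s) = (\<Sum>p\<in>J - B. l p s)" using z by (intro sum.cong refl) (auto simp: L_def)
      also have "(\<Sum>p\<in>B. l p s) + (\<Sum>p\<in>J - B. l p s) = (\<Sum>p\<in>J. l p s)"
        using sum.subset_diff[OF fB(2) fJ, of "%p. l p s"] by simp
      finally show ?thesis .
    qed
    show "\<exists>(J :: (nat => nat) set) l K. finite J \<and> (\<forall>j\<in>J. continuous_on (cube k) (l j) \<and> K j < card Q + 1 \<and> (\<forall>s\<in>cube k. (0::real) <= l j s)
        \<and> (\<exists>U\<in>C. \<forall>s\<in>cube k. l j s ~= 0 --> s \<in> U) \<and> (\<forall>s\<in>cube_boundary k. \<forall>t\<in>cube_boundary k. l j s = l j t)) \<and>
      (\<forall>s\<in>cube k. (\<Sum>j\<in>J. l j s) = 1) \<and>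
      (\<forall>i\<in>J. \<forall>j\<in>J. i ~= j --> K i = K j --> (\<forall>s\<in>cube k. l i s * l j s = 0))"
    proof (rule exI[of _ "insert (%_. 0) (J - B)"], rule exI[of _ L], rule exI[of _ K], intro conjI ballI impI)
      show "finite (insert (%_. 0) (J - B))" using fJ by simp
      fix p assume p: "p \<in> insert (%_. 0) (J - B)"
      show "continuous_on (cube k) (L p)"
        unfolding L_def by (cases "p = (%_. 0)") (auto intro!: continuous_intros l_cont)
      have hQ: "h (par p) < card Q" for p using bij_betwE[OF h] parQ[of p] by auto
      show "K p < card Q + 1" using hQ[of p] by (simp add: K_def)
      show "0 <= L p s" for s unfolding L_def using l_nonneg by (simp add: sum_nonneg)
      show "L p s = L p t" if s: "s \<in> cube_boundary k" "t \<in> cube_boundary k" for s t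
      proof (cases "p = (%_. 0)")
        case True
        have "(\<Sum>p\<in>B. l p s) = 1" if "s \<in> cube_boundary k" for s
        proof -
          have "s \<in> cube k" using that by (simp add: cube_boundary_def)
          moreover have "(\<Sum>p\<in>J - B. l p s) = 0" using l_bd[OF _ that] by (intro sum.neutral) blast
          ultimately show ?thesis using l_sum[of s] sum.subset_diff[OF fB(2) fJ, of "%p. l p s"] by simp
        qed
        then show ?thesis using s True by (simp add: L_def)
      next
        case False
        then have "p \<in> J - B" using p by simp
        then show ?thesis using l_bd s False by (simp add: L_def)
      qed
      show "\<exists>U\<in>C. \<forall>s\<in>cube k. L p s ~= 0 --> s \<in> U"
      proof (cases "p = (%_. 0)")
        case True
        have "s \<in> Ub" if s: "s \<in> cube k" and nz: "L p s ~= 0" for s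
        proof -
          obtain q where q: "q \<in> B" "l q s ~= 0" using nz True by (auto simp: L_def elim: sum.not_neutral_contains_not_neutral)
          then obtain i where i: "i < k" "q i = 0 \<or> q i = n" by (auto simp: B_def)
          define r where "r = real (q i) / real n"
          have r: "r \<in> {0, 1}" using i(2) by (auto simp: r_def)
          have "s(i := r) \<in> cube_boundary k" using s r i(1) by (auto simp: cube_boundary_def cube_def)
          moreover have "dist (s(i := r)) s <= 2 * (1 / real n)"
            by (rule dist_fun_bound) (use l_nz(1)[OF q(2) i(1)] n(1) in \<open>auto simp: dist_real_def r_def abs_minus_commute\<close>)
          ultimately have "s \<in> T" using e2(2) n(3) by (meson mem_ball order.strict_trans1 subsetD)
          then show ?thesis using T(2) s by blast
        qed
        then show ?thesis using Ub(1) by blast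
      next
        case False
        then have pJ: "p \<in> J" using p by simp
        define c where "c i = (if i < k then real (p i) / real n else 0)" for i
        have "c \<in> cube k" using pJ n(1) by (auto simp: cube_def c_def J_def PiE_iff)
        then obtain G where G: "G \<in> a" "ball c e1 \<subseteq> G" using e1(2) by blast
        have "s \<in> cube k \<inter> G" if s: "s \<in> cube k" and nz: "L p s ~= 0" for s
        proof -
          have "dist c s <= 2 * (1 / real n)"
          proof (rule dist_fun_bound)
            fix i
            show "dist (c i) (s i) <= 1 / real n"
              using l_nz(1)[of p s i] nz False s by (cases "i < k") (auto simp: c_def L_def dist_real_def cube_def abs_minus_commute)
          qed
          then have "s \<in> ball c e1" using n(2) by simp
          then show ?thesis using G(2) s by blast
        qed
        moreover have "cube k \<inter> G \<in> C" using G(1) by (simp add: a_def)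
        ultimately show ?thesis by blast
      qed
      fix q s assume q: "q \<in> insert (%_. 0) (J - B)" and pq: "p ~= q" "K p = K q"
      show "L p s * L q s = 0"
      proof (rule ccontr)
        assume nz: "L p s * L q s ~= 0"
        have ne: "p ~= (%_. 0)" "q ~= (%_. 0)" using pq hQ[of p] hQ[of q] by (auto simp: K_def split: if_splits)
        then have pqJ: "p \<in> J" "q \<in> J" using p q by auto
        have "h (par p) = h (par q)" using pq(2) ne by (simp add: K_def)
        then have par: "par p = par q" using bij_betw_imp_inj_on[OF h] parQ by (meson inj_onD)
        obtain i where i: "i < k" "p i ~= q i" using pq(1) PiE_ext[OF pqJ[unfolded J_def]] by blast
        have "p i mod 2 = q i mod 2" using par i(1) by (auto simp: par_def dest: fun_cong[of _ _ i])
        then have "p i + 2 <= q i \<or> q i + 2 <= p i" using i(2) by presburger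
        then have "real (p i) + 2 <= real (q i) \<or> real (q i) + 2 <= real (p i)" by auto
        moreover have "\<bar>real n * s i - real (p i)\<bar> < 1" "\<bar>real n * s i - real (q i)\<bar> < 1"
          using l_nz(2)[OF _ i(1)] nz ne by (auto simp: L_def)
        ultimately show False by auto
      qed
    next
      show "(\<Sum>p\<in>insert (%_. 0) (J - B). L p s) = 1" if "s \<in> cube k" for s
        unfolding s1 by (rule l_sum[OF that])
    qed
  qed
  then show thesis by (rule that)
qed

section \<open>Based homotopies of cube maps and triviality of the group\<close>

lemma homotopic_cube_mapsI:
  fixes h :: "real => (nat => real) => 'b::topological_space"
  assumes h: "continuous_on ({0..1} \<times> cube k) (%(t, s). h t s)" "!!t s. t \<in> {0..1} ==> s \<in> cube k ==> h t s \<in> X"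
    and "!!s. s \<in> cube k ==> h 0 s = f s" "!!s. s \<in> cube k ==> h 1 s = g s"
    and "!!t s. t \<in> {0..1} ==> s \<in> cube_boundary k ==> h t s = x"
  shows "homotopic_with (based_cube_map k x) (unit_cube k) (top_of_set X) f g"
proof (subst homotopic_with)
  show "based_cube_map k x p \<longleftrightarrow> based_cube_map k x q" if "!!s. s \<in> topspace (unit_cube k) ==> p s = q s" for p q
    using that by (auto simp: based_cube_map_def)
  have "continuous_map (prod_topology (top_of_set {0..1 :: real}) (unit_cube k)) (top_of_set X) (%(t, s). h t s)"
    using h by (auto simp: unit_cube_eq)
  then show "\<exists>h. continuous_map (prod_topology (top_of_set {0..1 :: real}) (unit_cube k)) (top_of_set X) h \<and>
      (\<forall>s\<in>topspace (unit_cube k). h (0, s) = f s) \<and> (\<forall>s\<in>topspace (unit_cube k). h (1, s) = g s) \<and>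
      (\<forall>t\<in>{0..1}. based_cube_map k x (%s. h (t, s)))"
    using assms(3-5) by (intro exI[of _ "%(t, s). h t s"]) (auto simp: unit_cube_eq based_cube_map_iff)
qed

text \<open>A free null-homotopy that is constant on the boundary at every time is made based by pushing it
  into the middle cube and running its trace on the boundary backwards on the collar.\<close>

lemma null_homotopic_based:
  fixes H :: "real => (nat => real) => 'b::topological_space"
  assumes k: "k >= 1" and f: "!!s. s \<in> cube_boundary k ==> f s = x"
    and H: "continuous_on ({0..1} \<times> cube k) (%(t, s). H t s)" "!!t s. t \<in> {0..1} ==> s \<in> cube k ==> H t s \<in> X"
      "!!s. s \<in> cube k ==> H 0 s = f s" "!!s. s \<in> cube k ==> H 1 s = W"
      "!!t s s'. t \<in> {0..1} ==> s \<in> cube_boundary k ==> s' \<in> cube_boundary k ==> H t s = H t s'"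
  shows "homotopic_with (based_cube_map k x) (unit_cube k) (top_of_set X) f (%_. x)"
proof -
  let ?h = "homotopic_with (based_cube_map k x) (unit_cube k) (top_of_set X)" and ?D = "{0..1 :: real} \<times> cube k"
  \<comment> \<open>At \<open>u = 1\<close> the middle cube, with coordinates from
    \<open>1/4\<close> to \<open>3/4\<close>, is stretched over the whole cube and the collar goes
    to the boundary.\<close>
  define r where "r u s = (%i. if i < k then max 0 (min 1 ((1 + u) * s i - u / 2)) else 0)" for u :: real and s :: "nat => real"
  \<comment> \<open>The time at which \<open>H\<close> is evaluated: 1 on the middle cube, 0 on the
    boundary.\<close>
  define T where "T s = (\<Prod>i<k. min 1 (4 * min (s i) (1 - s i)))" for s :: "nat => real"
  have r_cube: "r u s \<in> cube k" for u s by (auto simp: r_def cube_def)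
  have r_bd: "r u s \<in> cube_boundary k" if s: "s \<in> cube_boundary k" and u: "u \<in> {0..1}" for u s
  proof -
    obtain i where "i < k" "s i \<in> {0, 1}" using s by (auto simp: cube_boundary_def)
    then have "r u s i \<in> {0, 1}" using u by (auto simp: r_def)
    then show ?thesis using r_cube \<open>i < k\<close> by (auto simp: cube_boundary_def)
  qed
  have r0: "r 0 s = s" if "s \<in> cube k" for s
    using that by (auto simp: r_def cube_def)
  have T01: "T s \<in> {0..1}" if "s \<in> cube k" for s
    using that unfolding T_def by (auto simp: cube_def intro!: prod_nonneg prod_le_1)
  have T_bd: "T s = 0" if s: "s \<in> cube_boundary k" for s
  proof -
    obtain i where i: "i < k" "s i \<in> {0, 1}" using s by (auto simp: cube_boundary_def)
    then have "min 1 (4 * min (s i) (1 - s i)) = 0" by auto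
    then show ?thesis unfolding T_def using i(1) by (intro prod_zero bexI[of _ i]) auto
  qed
  have T_1: "T s = 1 \<or> r 1 s \<in> cube_boundary k" if s: "s \<in> cube k" for s
  proof (cases "\<forall>i<k. s i \<in> {1/4..3/4}")
    case True
    then have "T s = (\<Prod>i<k. 1)" unfolding T_def by (intro prod.cong refl) (auto simp: min_def)
    then show ?thesis by simp
  next
    case False
    then obtain i where "i < k" "s i < 1/4 \<or> 3/4 < s i" by auto
    then have "r 1 s i \<in> {0, 1}" by (auto simp: r_def)
    then show ?thesis using r_cube \<open>i < k\<close> by (auto simp: cube_boundary_def)
  qed
  have z: "(%_. 0) \<in> cube_boundary k" using k by (auto simp: cube_boundary_def cube_def intro!: exI[of _ 0])
  have bc: "s \<in> cube k" if "s \<in> cube_boundary k" for s using that by (simp add: cube_boundary_def)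
  have r_cont: "continuous_on Z (%p. r (u p) (v p))" if "continuous_on Z u" "continuous_on Z v" for Z :: "(real \<times> (nat => real)) set" and u v
  proof (rule continuous_on_coordinatewise_then_product)
    fix i
    have "continuous_on Z (%p. v p i)" by (rule continuous_on_product_then_coordinatewise[OF that(2)])
    then show "continuous_on Z (%p. r (u p) (v p) i)" unfolding r_def
      by (cases "i < k") (use that(1) in \<open>auto intro!: continuous_intros\<close>)
  qed
  have T_cont: "continuous_on Z (%p. T (snd p))" for Z :: "(real \<times> (nat => real)) set"
  proof -
    have "continuous_on Z (%p. snd p i)" for i
      by (rule continuous_on_product_then_coordinatewise) (intro continuous_intros)
    then show ?thesis unfolding T_def by (intro continuous_intros)
  qed
  have H_comp: "continuous_on Z (%p. H (u p) (v p))"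
    if "continuous_on Z u" "continuous_on Z v" "!!p. p \<in> Z ==> u p \<in> {0..1} \<and> v p \<in> cube k" for Z :: "(real \<times> (nat => real)) set" and u v
    by (rule continuous_on_compose2[OF H(1) continuous_on_Pair[OF that(1,2)], simplified]) (use that(3) in auto)
  have prod01: "t * T s \<in> {0..1}" if "t \<in> {0..1}" "s \<in> cube k" for t s
    using that T01[OF that(2)] by (auto intro: mult_le_one)
  have "?h f (%s. H 0 (r 1 s))"
  proof (rule homotopic_cube_mapsI[where h = "%u s. H 0 (r u s)"])
    have "continuous_on ?D (%p. H 0 (r (fst p) (snd p)))"
      by (intro H_comp r_cont continuous_intros) (use r_cube in auto)
    then show "continuous_on ?D (%(u, s). H 0 (r u s))" by (simp add: split_def)
    show "H 0 (r u s) \<in> X" for u s using H(2)[OF _ r_cube] by simp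
    show "H 0 (r 0 s) = f s" if "s \<in> cube k" for s using H(3)[OF that] r0[OF that] by simp
    show "H 0 (r u s) = x" if "u \<in> {0..1}" "s \<in> cube_boundary k" for u s
      using H(3)[OF r_cube] f[OF r_bd[OF that(2,1)]] by simp
  qed simp
  also have "?h (%s. H 0 (r 1 s)) (%s. H (T s) (%_. 0))"
  proof (rule homotopic_cube_mapsI[where h = "%t s. H (t * T s) (r 1 s)"])
    have "continuous_on ?D (%p. H (fst p * T (snd p)) (r 1 (snd p)))"
      by (intro H_comp r_cont T_cont continuous_intros) (use r_cube prod01 in auto)
    then show "continuous_on ?D (%(t, s). H (t * T s) (r 1 s))" by (simp add: split_def)
    show "H (t * T s) (r 1 s) \<in> X" if "t \<in> {0..1}" "s \<in> cube k" for t s using H(2)[OF prod01[OF that] r_cube] .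
    show "H (t * T s) (r 1 s) = x" if "t \<in> {0..1}" "s \<in> cube_boundary k" for t s
      using T_bd[OF that(2)] H(3)[OF r_cube] f[OF r_bd[OF that(2), of 1]] by simp
    \<comment> \<open>Either \<open>T s = 1\<close>, where \<open>H\<close> has reached
      \<open>W\<close>, or \<open>r 1 s\<close> is on the boundary, where \<open>H\<close> takes a
      single value at each time.\<close>
    show "H (1 * T s) (r 1 s) = H (T s) (%_. 0)" if "s \<in> cube k" for s
      using T_1[OF that] H(5)[OF T01[OF that] _ z] H(4)[OF r_cube] H(4)[OF bc[OF z]] by auto
  qed simp
  also (homotopic_with_trans) have "?h (%s. H (T s) (%_. 0)) (%_. x)"
  proof (rule homotopic_cube_mapsI[where h = "%t s. H ((1 - t) * T s) (%_. 0)"])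
    have p1: "(1 - t) * T s \<in> {0..1}" if "t \<in> {0..1}" "s \<in> cube k" for t s using prod01[of "1 - t" s] that by auto
    have "continuous_on ?D (%p. H ((1 - fst p) * T (snd p)) (%_. 0))"
      by (intro H_comp T_cont continuous_intros) (use bc[OF z] p1 in auto)
    then show "continuous_on ?D (%(t, s). H ((1 - t) * T s) (%_. 0))" by (simp add: split_def)
    show "H ((1 - t) * T s) (%_. 0) \<in> X" if "t \<in> {0..1}" "s \<in> cube k" for t s using H(2)[OF p1[OF that] bc[OF z]] .
    show "H ((1 - t) * T s) (%_. 0) = x" if "t \<in> {0..1}" "s \<in> cube_boundary k" for t s
      using T_bd[OF that(2)] H(3)[OF bc[OF z]] f[OF z] by simp
    show "H ((1 - 1) * T s) (%_. 0) = x" for s using H(3)[OF bc[OF z]] f[OF z] by simp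
  qed simp
  finally (homotopic_with_trans) show ?thesis .
qed

text \<open>All loops are homotopic to the constant one, so the quotient is a single class, on which
  the group laws are checked.\<close>

lemma trivial_homotopy_group:
  assumes x: "x \<in> X" and null: "!!f. f \<in> cube_loops k (top_of_set X) x ==>
    homotopic_with (based_cube_map k x) (unit_cube k) (top_of_set X) f (%_. x)"
  shows "trivial_group (homotopy_group k (top_of_set X) x)"
proof -
  let ?L = "cube_loops k (top_of_set X) x" and ?R = "cube_homotopic k (top_of_set X) x"
  have c: "(%_. x) \<in> ?L" using x by (auto simp: cube_loops_def based_cube_map_def)
  have R: "(f, g) \<in> ?R \<longleftrightarrow> f \<in> ?L \<and> g \<in> ?L" for f g
    using null homotopic_with_trans homotopic_with_symD unfolding cube_homotopic_def by blast
  have cl: "?R `` {f} = ?L" if "f \<in> ?L" for f using that by (auto simp: R)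
  have carrier: "carrier (homotopy_group k (top_of_set X) x) = {?L}"
    using cl c by (auto simp: homotopy_group_def quotient_def)
  have one: "one (homotopy_group k (top_of_set X) x) = ?L" by (simp add: homotopy_group_def cl[OF c])
  have cc: "cube_concat (%_. x) (%_. x) = (%_. x)" by (simp add: cube_concat_def fun_eq_iff)
  have "(\<exists>f\<in>?L. \<exists>g\<in>?L. (cube_concat f g, h) \<in> ?R) \<longleftrightarrow> h \<in> ?L" for h
  proof
    assume "h \<in> ?L"
    then have "(cube_concat (%_. x) (%_. x), h) \<in> ?R" unfolding cc R using c by blast
    then show "\<exists>f\<in>?L. \<exists>g\<in>?L. (cube_concat f g, h) \<in> ?R" using c by blast
  qed (use R in blast)
  then have "{h. \<exists>f\<in>?L. \<exists>g\<in>?L. (cube_concat f g, h) \<in> ?R} = ?L" by blast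
  then have mult: "mult (homotopy_group k (top_of_set X) x) ?L ?L = ?L"
    unfolding homotopy_group_def by simp
  have "group (homotopy_group k (top_of_set X) x)"
    by (rule groupI) (auto simp: carrier one mult)
  then show ?thesis unfolding trivial_group_def carrier one by simp
qed

section \<open>States and the faithful representation\<close>

text \<open>The stabilization has no unit; its functional calculus is carried out among all bounded
  operators on its Hilbert space.\<close>

instantiation bop :: (type) unital_cstar_algebra
begin

lift_definition one_bop :: "'a bop" is id_blinfun by simp

lemma bop_apply_one [simp]: "bop_apply 1 x = x"
  by (simp add: bop_apply_def one_bop.rep_eq)

instance
proof
  fix S :: "'a bop"
  show "1 * S = S" "S * 1 = S" by (rule bop_eqI; simp add: bop_apply_simps)+
  have k: "norm (ket i :: 'a ell2) = 1" for i
  proof -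
    have "complex_of_real ((norm (ket i :: 'a ell2))\<^sup>2) = 1"
      unfolding cinner_self[symmetric] cinner_ket by (simp add: ket.rep_eq)
    then show ?thesis by (metis norm_ge_zero of_real_eq_1_iff one_power2 power2_eq_iff_nonneg zero_le_one)
  qed
  show "(0 :: 'a bop) ~= 1"
  proof
    assume "(0 :: 'a bop) = 1"
    then have "bop_apply (0 :: 'a bop) (ket i) = bop_apply 1 (ket i)" for i by simp
    then have "ket i = (0 :: 'a ell2)" for i by (simp add: bop_apply_simps)
    then show False using k by simp
  qed
  show "norm (1 :: 'a bop) = 1"
  proof (rule antisym)
    show "norm (1 :: 'a bop) <= 1" by (rule norm_bop_leI) auto
    show "1 <= norm (1 :: 'a bop)" using norm_bop_apply_le[of 1 "ket (undefined :: 'a)"] k by simp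
  qed
qed

end

section \<open>The Hahn-Banach theorem and states\<close>

definition sublinear :: "('a::real_normed_vector => real) => bool"
  where "sublinear q \<longleftrightarrow> (\<forall>x y. q (x + y) <= q x + q y) \<and> (\<forall>r\<ge>0. \<forall>x. q (r *R x) = r * q x)"

lemma sublinearD:
  assumes "sublinear q"
  shows "q (x + y) <= q x + q y" "0 <= r ==> q (r *R x) = r * q x" "q 0 = 0" "- q (- x) <= q x"
proof -
  show 1: "q (x + y) <= q x + q y" and 2: "0 <= r ==> q (r *R x) = r * q x" for x y r
    using assms unfolding sublinear_def by blast+
  show 0: "q 0 = 0" using 2[of 0 0] by simp
  show "- q (- x) <= q x" using 1[of x "- x"] 0 by simp
qed

text \<open>The auxiliary functional of the Hahn-Banach proof by minimality: for sublinear
  \<open>q\<close> it lies below \<open>q\<close>, and its value at \<open>- y\<close> is at most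
  \<open>- q y\<close>.\<close>

definition shift_sublinear :: "('a::real_normed_vector => real) => 'a => 'a => real"
  where "shift_sublinear q y x = (INF t\<in>{0..}. q (x + t *R y) - t * q y)"

lemma shift_sublinear:
  assumes q: "sublinear q"
  shows "sublinear (shift_sublinear q y)" "t >= 0 ==> shift_sublinear q y x <= q (x + t *R y) - t * q y"
proof -
  let ?s = "shift_sublinear q y"
  have bb: "- q (- x) <= q (x + t *R y) - t * q y" if "t >= 0" for t x
    using sublinearD(1)[OF q, of "x + t *R y" "- x"] sublinearD(2)[OF q that, of y] by simp
  have bdd: "bdd_below ((%t. q (x + t *R y) - t * q y) ` {0..})" for x
    using bb by (intro bdd_belowI[of _ "- q (- x)"]) auto
  show le: "?s x <= q (x + t *R y) - t * q y" if "t >= 0" for x t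
    unfolding shift_sublinear_def by (rule cINF_lower[OF bdd]) (use that in simp)
  have ge: "m <= ?s x" if "!!t. t >= 0 ==> m <= q (x + t *R y) - t * q y" for m x
    unfolding shift_sublinear_def by (rule cINF_greatest) (use that in auto)
  have hom: "r * ?s x <= ?s (r *R x)" if r: "r > 0" for r x
  proof (rule ge)
    fix t :: real assume t: "t >= 0"
    have "r * ?s x <= r * (q (x + (t / r) *R y) - (t / r) * q y)" using r t by (intro mult_left_mono le) auto
    also have "... = q (r *R (x + (t / r) *R y)) - t * q y" using r sublinearD(2)[OF q] by (simp add: right_diff_distrib)
    also have "r *R (x + (t / r) *R y) = r *R x + t *R y" using r by (simp add: scaleR_right_distrib)
    finally show "r * ?s x <= q (r *R x + t *R y) - t * q y" .
  qed
  show "sublinear ?s" unfolding sublinear_def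
  proof (intro conjI allI impI)
    fix x z
    have "?s (x + z) - (q (z + u *R y) - u * q y) <= q (x + t *R y) - t * q y" if "t >= 0" "u >= 0" for t u
    proof -
      have "?s (x + z) <= q (x + z + (t + u) *R y) - (t + u) * q y" using that by (intro le) simp
      moreover have "x + z + (t + u) *R y = (x + t *R y) + (z + u *R y)" by (simp add: algebra_simps)
      ultimately show ?thesis using sublinearD(1)[OF q, of "x + t *R y" "z + u *R y"] by (simp add: algebra_simps)
    qed
    then have "?s (x + z) - (q (z + u *R y) - u * q y) <= ?s x" if "u >= 0" for u using that by (intro ge) auto
    then have "?s (x + z) - ?s x <= ?s z" by (intro ge) (simp add: algebra_simps)
    then show "?s (x + z) <= ?s x + ?s z" by simp
  next
    fix r :: real and x assume r: "0 <= r"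
    show "?s (r *R x) = r * ?s x"
    proof (cases "r = 0")
      case True
      have "q (t *R y) - t * q y = 0" if "t >= 0" for t using sublinearD(2)[OF q that] by simp
      then have "?s 0 = 0" using le[of 0 0] ge[of 0 0] sublinearD(3)[OF q] by (intro antisym) auto
      then show ?thesis using True by simp
    next
      case False
      with r have r': "r > 0" by simp
      have "inverse r * ?s (r *R x) <= ?s (inverse r *R (r *R x))" using r' by (intro hom) simp
      then have "?s (r *R x) <= r * ?s x" using r' by (simp add: field_simps)
      then show ?thesis using hom[OF r', of x] by simp
    qed
  qed
qed

text \<open>Zorn gives a minimal sublinear functional below \<open>p\<close>. Minimality forces it
  to agree with all its shifts, which makes it superadditive, hence linear.\<close>

lemma linear_below_sublinear:
  fixes p :: "'a::real_normed_vector => real"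
  assumes p: "sublinear p"
  shows "\<exists>f. linear f \<and> (\<forall>x. f x <= p x)"
proof -
  define A where "A = {q. sublinear q \<and> q <= p}"
  have "\<exists>m\<in>A. \<forall>a\<in>A. a <= m --> a = m"
  proof (rule predicate_Zorn)
    show "partial_order_on A (relation_of (%q r. r <= q) A)"
      by (rule partial_order_on_relation_ofI) auto
    fix C assume C: "C \<in> Chains (relation_of (%q r. r <= q) A)"
    have CA: "q \<in> A" if "q \<in> C" for q using C that unfolding Chains_def relation_of_def by blast
    have ch: "q <= r \<or> r <= q" if "q \<in> C" "r \<in> C" for q r using C that unfolding Chains_def relation_of_def by blast
    show "\<exists>u\<in>A. \<forall>q\<in>C. u <= q"
    proof (cases "C = {}")
      case True
      then show ?thesis using p by (auto simp: A_def)
    next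
      case ne: False
      define u where "u x = (INF q\<in>C. q x)" for x
      have "- p (- x) <= q x" if "q \<in> C" for q x
      proof -
        have "sublinear q" "q <= p" using CA[OF that] by (auto simp: A_def)
        then show ?thesis using sublinearD(4)[of q x] le_funD[of q p "- x"] by auto
      qed
      then have bdd: "bdd_below ((%q. q x) ` C)" for x by (intro bdd_belowI[of _ "- p (- x)"]) auto
      have le: "u x <= q x" if "q \<in> C" for q x unfolding u_def by (rule cINF_lower[OF bdd that])
      have ge: "m <= u x" if "!!q. q \<in> C ==> m <= q x" for m x
        unfolding u_def by (rule cINF_greatest) (use ne that in auto)
      have "sublinear u" unfolding sublinear_def
      proof (intro conjI allI impI)
        fix x y
        have "u (x + y) - r y <= q x" if qr: "q \<in> C" "r \<in> C" for q r
        proof -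
          obtain s where s: "s \<in> C" "s <= q" "s <= r" using ch[OF qr] qr by blast
          have "u (x + y) <= s x + s y" using le[OF s(1), of "x + y"] CA[OF s(1)] sublinearD(1)[of s x y] by (simp add: A_def)
          also have "... <= q x + r y" using s by (intro add_mono) (auto dest: le_funD)
          finally show ?thesis by simp
        qed
        then have "u (x + y) - r y <= u x" if "r \<in> C" for r using that by (intro ge) auto
        then have "u (x + y) - u x <= u y" by (intro ge) (simp add: algebra_simps)
        then show "u (x + y) <= u x + u y" by simp
      next
        fix r :: real and x assume r: "0 <= r"
        have hom: "q (r *R x) = r * q x" if "q \<in> C" "0 <= r" for q r x
          using CA[OF that(1)] sublinearD(2)[of q] that(2) by (simp add: A_def)
        have 1: "r * u x <= u (r *R x)" if "0 <= r" for r x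
          using that le by (intro ge) (simp add: hom mult_left_mono)
        show "u (r *R x) = r * u x"
        proof (cases "r = 0")
          case True
          obtain q where "q \<in> C" using ne by blast
          then have "u 0 <= 0" using le[of q 0] hom[of q 0 0] by simp
          then show ?thesis using 1[of 0 0] True by simp
        next
          case False
          with r have r': "r > 0" by simp
          have "inverse r * u (r *R x) <= u (inverse r *R (r *R x))" using r' by (intro 1) simp
          then have "u (r *R x) <= r * u x" using r' by (simp add: field_simps)
          then show ?thesis using 1[OF r, of x] by simp
        qed
      qed
      moreover have "u <= p"
      proof -
        obtain q where "q \<in> C" using ne by blast
        then show ?thesis using le[of q] CA[of q] by (auto simp: A_def le_fun_def intro: order.trans)
      qed
      ultimately show ?thesis using le by (intro bexI[of _ u]) (auto simp: A_def le_fun_def)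
    qed
  qed
  then obtain f where f: "f \<in> A" "!!q. q \<in> A ==> q <= f ==> q = f" by blast
  have fs: "sublinear f" "f <= p" using f(1) by (auto simp: A_def)
  have super: "f x + f y <= f (x + y)" for x y
  proof -
    note s = shift_sublinear[OF fs(1), where y = y]
    have "shift_sublinear f y <= f" using s(2)[of 0] by (simp add: le_fun_def)
    moreover from this have "shift_sublinear f y \<in> A" using s(1) fs(2) by (simp add: A_def)
    ultimately have "shift_sublinear f y = f" using f(2) by blast
    then show ?thesis using s(2)[of 1 x] by simp
  qed
  have add: "f (x + y) = f x + f y" for x y using super sublinearD(1)[OF fs(1)] by (intro antisym) auto
  have neg: "f (- x) = - f x" for x using add[of x "- x"] sublinearD(3)[OF fs(1)] by simp
  have "f (r *R x) = r * f x" for r x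
  proof (cases "r >= 0")
    case False
    then have "f ((- r) *R x) = (- r) * f x" by (intro sublinearD(2)[OF fs(1)]) simp
    then show ?thesis using neg[of "r *R x"] by simp
  qed (rule sublinearD(2)[OF fs(1)])
  with add have "linear f" by (intro linearI) simp_all
  then show ?thesis using fs(2) by (auto simp: le_fun_def)
qed

definition state :: "('a::unital_cstar_algebra => complex) => bool"
  where "state f \<longleftrightarrow> (\<forall>x y. f (x + y) = f x + f y) \<and> (\<forall>c x. f (c *C x) = c * f x) \<and>
    (\<forall>x. f (x\<star>) = cnj (f x)) \<and> (\<forall>h. cpos h --> 0 <= Re (f h)) \<and> f 1 = 1"

lemma stateD:
  assumes "state f"
  shows "f (x + y) = f x + f y" "f (c *C x) = c * f x" "f (x\<star>) = cnj (f x)" "cpos h ==> 0 <= Re (f h)" "f 1 = 1"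
  using assms unfolding state_def by blast+

text \<open>Shifting the norm at 1 yields a real-linear \<open>f\<close> below the norm with
  \<open>f 1 = 1\<close>, and such a functional is positive. Averaging over the involution gives
  \<open>g\<close>, and \<open>g x - \<i> * g (\<i> *C x)\<close> is its complex-linear
  extension.\<close>

lemma state_exists: obtains F :: "'a::unital_cstar_algebra => complex" where "state F"
proof -
  have nrm: "sublinear (norm :: 'a => real)" by (simp add: sublinear_def norm_triangle_ineq)
  note s = shift_sublinear[OF nrm, where y = "1 :: 'a"]
  obtain f :: "'a => real" where f: "linear f" "!!x. f x <= shift_sublinear norm 1 x" using linear_below_sublinear[OF s(1)] by blast
  note lin = linear_add[OF f(1)] linear_scale[OF f(1)] linear_neg[OF f(1)] linear_diff[OF f(1)]
  have fn: "f x <= norm x" for x using f(2)[of x] s(2)[of 0 x] by simp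
  have f1: "f 1 = 1"
  proof (rule antisym)
    show "f 1 <= 1" using fn[of 1] by simp
    show "1 <= f 1" using f(2)[of "- 1"] s(2)[of 1 "- 1"] by (simp add: lin)
  qed
  have fpos: "0 <= f h" if h: "cpos h" for h
  proof -
    have "cpos (norm h *R 1 - h)" by (rule cpos_le_norm[OF h])
    moreover have "norm h *R 1 - (norm h *R 1 - h) = h" by simp
    ultimately have "norm (norm h *R 1 - h) <= norm h" using h by (intro norm_le_cposI) simp_all
    then show ?thesis using fn[of "norm h *R 1 - h"] f1 by (simp add: lin)
  qed
  define g where "g x = (f x + f (x\<star>)) / 2" for x
  have g: "g (x + y) = g x + g y" "g (r *R x) = r * g x" "g (- x) = - g x" "g (x\<star>) = g x" for x y r
    by (simp_all add: g_def star_add lin field_simps)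
  have g_diff: "g (x - y) = g x - g y" for x y using g(1)[of x "- y"] g(3) by simp
  define F where "F x = Complex (g x) (- g (\<i> *C x))" for x
  have sc: "c *C x = Re c *R x + Im c *R (\<i> *C x)" for c and x :: 'a
  proof -
    have "c *C x = (complex_of_real (Re c) + complex_of_real (Im c) * \<i>) *C x"
      by (metis complex_eq mult.commute)
    then show ?thesis by (simp only: scaleC_add_left scaleC_scaleC[symmetric] scaleC_of_real)
  qed
  have ii: "\<i> *C \<i> *C x = - x" for x :: 'a using scaleC_minus_left[of 1 x] by (simp add: scaleC_scaleC)
  have ic: "\<i> *C r *R x = r *R \<i> *C x" for x :: 'a and r by (simp add: scaleC_scaleC mult.commute flip: scaleC_of_real)
  have "state F" unfolding state_def
  proof (intro conjI allI impI)
    show "F (x + y) = F x + F y" for x y by (simp add: F_def g scaleC_add_right complex_eq_iff)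
    show "F (c *C x) = c * F x" for c x
      unfolding sc[of c x] F_def by (simp add: g g_diff scaleC_add_right ii ic complex_eq_iff)
    show "F (x\<star>) = cnj (F x)" for x
    proof -
      have "\<i> *C x\<star> = (- (\<i> *C x))\<star>" by (simp add: star_scaleC scaleC_minus_left)
      then have "g (\<i> *C x\<star>) = - g (\<i> *C x)" by (metis g(3,4))
      then show ?thesis by (simp add: F_def g complex_eq_iff)
    qed
    show "0 <= Re (F h)" if "cpos h" for h
      using fpos[OF that] cpos_self_adjoint[OF that] by (simp add: F_def g_def)
    have "g (\<i> *C 1) = 0"
    proof -
      have "(\<i> *C (1 :: 'a))\<star> = - (\<i> *C 1)" by (simp add: star_scaleC scaleC_minus_left)
      then have "g (\<i> *C 1) = - g (\<i> *C 1)" by (metis g(3,4))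
      then show ?thesis by simp
    qed
    then show "F 1 = 1" by (simp add: F_def g_def f1 complex_eq_iff)
  qed
  then show thesis by (rule that)
qed

section \<open>The GNS construction on square-summable sequences\<close>

definition ip :: "('a::unital_cstar_algebra => complex) => 'a => 'a => complex"
  where "ip f x y = f (x\<star> * y)"

lemma state_zero: "state f ==> f 0 = 0" using stateD(2)[of f 0 0] by simp

lemma
  assumes s: "state f"
  shows ip_add_right: "ip f x (y + z) = ip f x y + ip f x z"
    and ip_add_left: "ip f (x + y) z = ip f x z + ip f y z"
    and ip_scale_right: "ip f x (c *C y) = c * ip f x y"
    and ip_scale_left: "ip f (c *C x) y = cnj c * ip f x y"
    and ip_commute: "ip f y x = cnj (ip f x y)"
    and ip_zero_right: "ip f x 0 = 0" and ip_zero_left: "ip f 0 x = 0"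
  by (simp_all add: ip_def add_distribs stateD[OF s] star_add star_scaleC star_mult mult_scaleC_left mult_scaleC_right state_zero[OF s] flip: stateD(3)[OF s])

lemma ip_diff:
  assumes s: "state f"
  shows "ip f x (y - z) = ip f x y - ip f x z" "ip f (x - y) z = ip f x z - ip f y z"
  using ip_add_right[OF s, of x "y - z" z] ip_add_left[OF s, of "x - y" y z] by auto

lemma ip_sum:
  assumes s: "state h"
  shows "ip h x (sum f F) = (\<Sum>i\<in>F. ip h x (f i))" "ip h (sum f F) x = (\<Sum>i\<in>F. ip h (f i) x)"
  by (induction F rule: infinite_finite_induct)
    (simp_all add: ip_add_left[OF s] ip_add_right[OF s] ip_zero_left[OF s] ip_zero_right[OF s])

definition ip_norm2 :: "('a::unital_cstar_algebra => complex) => 'a => real"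
  where "ip_norm2 f x = Re (ip f x x)"

lemma ip_norm2:
  assumes s: "state f"
  shows "ip f x x = complex_of_real (ip_norm2 f x)" "0 <= ip_norm2 f x"
    "ip_norm2 f (b * x) <= (norm b)\<^sup>2 * ip_norm2 f x" "ip_norm2 f x <= (norm x)\<^sup>2"
    "ip_norm2 f (x + y) <= 2 * ip_norm2 f x + 2 * ip_norm2 f y"
proof -
  have "Im (ip f x x) = 0" using ip_commute[OF s, of x x] by (simp add: complex_eq_iff)
  then show "ip f x x = complex_of_real (ip_norm2 f x)" by (simp add: ip_norm2_def complex_eq_iff)
  show nn: "0 <= ip_norm2 f x" for x unfolding ip_norm2_def ip_def by (intro stateD(4)[OF s]) simp
  show le: "ip_norm2 f (b * x) <= (norm b)\<^sup>2 * ip_norm2 f x" for x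
  proof -
    have "cpos (x\<star> * ((norm b)\<^sup>2 *R 1 - b\<star> * b) * x)"
      by (intro cpos_conj cpos_norm_diff) (simp_all add: cstar_identity star_mult star_star)
    from stateD(4)[OF s this] have "0 <= Re (f (complex_of_real ((norm b)\<^sup>2) *C (x\<star> * x) - (b * x)\<star> * (b * x)))"
      by (simp add: diff_distribs star_mult mult.assoc scaleC_of_real del: of_real_power)
    moreover have "f (y - z) = f y - f z" for y z using stateD(1)[OF s, of "y - z" z] by simp
    ultimately show ?thesis by (simp add: stateD(2)[OF s] ip_norm2_def ip_def)
  qed
  show "ip_norm2 f x <= (norm x)\<^sup>2"
  proof -
    have "cpos ((norm x)\<^sup>2 *R 1 - x\<star> * x)"
        by (intro cpos_norm_diff) (simp_all add: cstar_identity star_mult star_star)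
      from stateD(4)[OF s this] have "0 <= Re (f (complex_of_real ((norm x)\<^sup>2) *C 1 - x\<star> * x))" by (simp add: scaleC_of_real del: of_real_power)
      moreover have "f (y - z) = f y - f z" for y z using stateD(1)[OF s, of "y - z" z] by simp
      ultimately show ?thesis by (simp add: stateD(2,5)[OF s] ip_norm2_def ip_def)
  qed
  show "ip_norm2 f (x + y) <= 2 * ip_norm2 f x + 2 * ip_norm2 f y"
    using nn[of "x - y"] by (simp add: ip_norm2_def ip_add_left[OF s] ip_add_right[OF s] ip_diff[OF s])
qed

text \<open>Gram--Schmidt with respect to a possibly degenerate form; null residuals give the vector 0.\<close>

function gram_schmidt :: "('a::unital_cstar_algebra => complex) => (nat => 'a) => nat => 'a"
  where "gram_schmidt f x n =
    (let y = x n - (\<Sum>i<n. ip f (gram_schmidt f x i) (x n) *C gram_schmidt f x i)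
     in if ip_norm2 f y = 0 then 0 else complex_of_real (1 / sqrt (ip_norm2 f y)) *C y)"
  by pat_completeness auto
termination by (relation "Wellfounded.measure (%(f, x, n). n)") auto

declare gram_schmidt.simps [simp del]

lemma gram_schmidt_orthonormal:
  fixes x :: "nat => 'a::unital_cstar_algebra"
  assumes s: "state f"
  defines "e \<equiv> gram_schmidt f x"
  shows "ip f (e i) (e j) = (if i = j \<and> e i ~= 0 then 1 else 0)"
proof -
  have unit: "ip f (e j) (e j) = (if e j ~= 0 then 1 else 0)" for j
  proof -
    define y where "y = x j - (\<Sum>i<j. ip f (e i) (x j) *C e i)"
    have ej: "e j = (if ip_norm2 f y = 0 then 0 else complex_of_real (1 / sqrt (ip_norm2 f y)) *C y)"
      unfolding e_def y_def by (subst gram_schmidt.simps) (simp add: Let_def)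
    show ?thesis
    proof (cases "ip_norm2 f y = 0")
      case False
      then have p: "ip_norm2 f y > 0" using ip_norm2(2)[OF s, of y] by simp
      have "ip f (e j) (e j) = complex_of_real ((1 / sqrt (ip_norm2 f y)) * (1 / sqrt (ip_norm2 f y)) * ip_norm2 f y)"
        using False by (simp only: ej if_False ip_scale_left[OF s] ip_scale_right[OF s] ip_norm2(1)[OF s, of y]
            complex_cnj_complex_of_real of_real_mult mult.assoc)
      also have "(1 / sqrt (ip_norm2 f y)) * (1 / sqrt (ip_norm2 f y)) * ip_norm2 f y = 1"
        using p by simp
      finally have "ip f (e j) (e j) = 1" by simp
      moreover from this have "e j ~= 0" using ip_zero_left[OF s] by auto
      ultimately show ?thesis by simp
    qed (simp add: ej ip_zero_left[OF s])
  qed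
  have orth: "ip f (e i) (e j) = 0" if "i < j" for i j
    using that
  proof (induction j arbitrary: i rule: less_induct)
    case (less j)
    define y where "y = x j - (\<Sum>i<j. ip f (e i) (x j) *C e i)"
    have o: "ip f (e i) (e k) = (if i = k \<and> e i ~= 0 then 1 else 0)" if "k < j" for k
    proof -
      consider "i < k" | "k < i" | "i = k" by linarith
      then show ?thesis
      proof cases
        case 1 then show ?thesis using less.IH[OF that] by simp
      next
        case 2 then show ?thesis using less.IH[OF less.prems, of k] ip_commute[OF s, of "e i" "e k"] by simp
      qed (simp add: unit)
    qed
    have "ip f (e i) y = ip f (e i) (x j) - (\<Sum>k<j. ip f (e k) (x j) * ip f (e i) (e k))"
      by (simp add: y_def ip_diff[OF s] ip_sum[OF s] ip_scale_right[OF s])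
    also have "(\<Sum>k<j. ip f (e k) (x j) * ip f (e i) (e k)) = (\<Sum>k<j. if k = i then ip f (e i) (x j) else 0)"
      using o ip_zero_left[OF s] by (intro sum.cong refl) auto
    also have "... = ip f (e i) (x j)" using less.prems by simp
    finally have "ip f (e i) y = 0" by simp
    moreover have "e j = (if ip_norm2 f y = 0 then 0 else complex_of_real (1 / sqrt (ip_norm2 f y)) *C y)"
      unfolding e_def y_def by (subst gram_schmidt.simps) (simp add: Let_def)
    ultimately show ?case by (simp add: ip_zero_right[OF s] ip_scale_right[OF s])
  qed
  show ?thesis using orth[of i j] orth[of j i] ip_commute[OF s, of "e i" "e j"] unit[of i] by (cases i j rule: linorder_cases) auto
qed

definition ip_proj :: "('a::unital_cstar_algebra => complex) => (nat => 'a) => nat set => 'a => 'a"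
  where "ip_proj f e F x = (\<Sum>n\<in>F. ip f (e n) x *C e n)"

lemma ip_norm2_combination:
  assumes s: "state f" and e: "!!i j. ip f (e i) (e j) = (if i = j \<and> e i ~= 0 then 1 else 0)" and F: "finite F"
  shows "ip_norm2 f (\<Sum>n\<in>F. c n *C e n) <= (\<Sum>n\<in>F. (cmod (c n))\<^sup>2)"
proof -
  have "ip f (\<Sum>n\<in>F. c n *C e n) (\<Sum>n\<in>F. c n *C e n) = (\<Sum>i\<in>F. \<Sum>j\<in>F. if j = i then cnj (c i) * c i * ip f (e i) (e i) else 0)"
    unfolding ip_sum[OF s] by (subst sum.swap, intro sum.cong refl) (auto simp: ip_scale_left[OF s] ip_scale_right[OF s] e)
  also have "... = (\<Sum>i\<in>F. cnj (c i) * c i * ip f (e i) (e i))" using F by simp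
  also have "... = complex_of_real (\<Sum>i\<in>F. if e i ~= 0 then (cmod (c i))\<^sup>2 else 0)"
    unfolding of_real_sum
    by (intro sum.cong refl) (auto simp: e complex_norm_square mult.commute simp del: of_real_power)
  finally have "ip_norm2 f (\<Sum>n\<in>F. c n *C e n) = (\<Sum>i\<in>F. if e i ~= 0 then (cmod (c i))\<^sup>2 else 0)"
    by (simp only: ip_norm2_def Re_complex_of_real)
  also have "... <= (\<Sum>n\<in>F. (cmod (c n))\<^sup>2)" by (intro sum_mono) simp
  finally show ?thesis .
qed

lemma ip_norm2_residual:
  assumes s: "state h" and e: "!!i j. ip h (e i) (e j) = (if i = j \<and> e i ~= 0 then 1 else 0)" and F: "finite F"
  shows "ip_norm2 h (x - ip_proj h e F x) = ip_norm2 h x - (\<Sum>n\<in>F. (cmod (ip h (e n) x))\<^sup>2)"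
proof -
  let ?c = "%n. ip h (e n) x"
  have sq: "cnj z * z = complex_of_real ((cmod z)\<^sup>2)" for z by (simp add: complex_norm_square del: of_real_power)
  have 1: "ip h (ip_proj h e F x) x = complex_of_real (\<Sum>n\<in>F. (cmod (?c n))\<^sup>2)"
    by (simp add: ip_proj_def ip_sum[OF s] ip_scale_left[OF s] sq del: of_real_power)
  have 2: "ip h x (ip_proj h e F x) = complex_of_real (\<Sum>n\<in>F. (cmod (?c n))\<^sup>2)"
    using ip_commute[OF s, of x "ip_proj h e F x"] unfolding 1 by simp
  have "ip h (ip_proj h e F x) (ip_proj h e F x) = (\<Sum>i\<in>F. cnj (?c i) * ip h (e i) (ip_proj h e F x))"
    by (subst (1) ip_proj_def) (simp add: ip_sum[OF s] ip_scale_left[OF s])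
  also have "... = (\<Sum>i\<in>F. cnj (?c i) * ?c i)"
  proof (intro sum.cong refl arg_cong2[where f = "(*)"])
    fix i assume i: "i \<in> F"
    have "ip h (e i) (ip_proj h e F x) = (\<Sum>n\<in>F. if n = i then ?c i else 0)"
      unfolding ip_proj_def ip_sum[OF s] by (intro sum.cong refl) (auto simp: ip_scale_right[OF s] e ip_zero_left[OF s])
    then show "ip h (e i) (ip_proj h e F x) = ?c i" using F i by simp
  qed
  also have "... = complex_of_real (\<Sum>n\<in>F. (cmod (?c n))\<^sup>2)" by (simp add: sq del: of_real_power)
  finally show ?thesis unfolding ip_norm2_def ip_diff[OF s] 1 2 by simp
qed

lemma gram_schmidt_residual:
  fixes x :: "nat => 'a::unital_cstar_algebra"
  assumes s: "state f"
  defines "e \<equiv> gram_schmidt f x"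
  shows "ip_norm2 f (x m - ip_proj f e {..m} (x m)) = 0"
proof -
  note o = gram_schmidt_orthonormal[OF s, of x, folded e_def]
  define y where "y = x m - (\<Sum>i<m. ip f (e i) (x m) *C e i)"
  have em: "e m = (if ip_norm2 f y = 0 then 0 else complex_of_real (1 / sqrt (ip_norm2 f y)) *C y)"
    unfolding e_def y_def by (subst gram_schmidt.simps) (simp add: Let_def)
  have r: "x m - ip_proj f e {..m} (x m) = y - ip f (e m) (x m) *C e m"
    by (simp add: ip_proj_def y_def lessThan_Suc_atMost[symmetric])
  show ?thesis
  proof (cases "ip_norm2 f y = 0")
    case False
    define r where "r = sqrt (ip_norm2 f y)"
    have r0: "r > 0" "r * r = ip_norm2 f y" using False ip_norm2(2)[OF s, of y] by (simp_all add: r_def)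
    have "ip f (e m) y = complex_of_real (1 / r * ip_norm2 f y)"
      using False by (simp add: em r_def ip_scale_left[OF s] ip_norm2(1)[OF s, of y])
    also have "1 / r * ip_norm2 f y = r" by (simp flip: r0(2))
    finally have "ip f (e m) y = complex_of_real r" .
    moreover have "ip f (e m) y = ip f (e m) (x m)"
      by (simp add: y_def ip_diff[OF s] ip_sum[OF s] ip_scale_right[OF s] o)
    ultimately have "ip f (e m) (x m) *C e m = y"
      using False r0 by (simp add: em r_def[symmetric] scaleC_scaleC)
    then show ?thesis unfolding r by (simp add: ip_norm2_def ip_zero_left[OF s])
  qed (simp add: r em)
qed

text \<open>Fourier coefficients with respect to the orthonormalized dense sequence. They realize
  the GNS space inside \<open>nat ell2\<close>, null vectors going to 0, without quotient or
  completion.\<close>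

definition gns_vec :: "('a::unital_cstar_algebra => complex) => (nat => 'a) => 'a => nat ell2"
  where "gns_vec f e x = Abs_ell2 (%n. ip f (e n) x)"

text \<open>Bessel's inequality gives one direction. For Parseval's identity, each
  \<open>x m\<close> of the dense sequence agrees, up to a null vector, with its projection to the
  first \<open>m + 1\<close> directions, and the form is bounded by the norm.\<close>

lemma
  fixes x :: "nat => 'a::unital_cstar_algebra"
  assumes s: "state f" and x: "closure (range x) = UNIV"
  defines "e \<equiv> gram_schmidt f x"
  shows gns_vec_nth: "ell2_nth (gns_vec f e y) n = ip f (e n) y"
    and norm_gns_vec: "(norm (gns_vec f e y))\<^sup>2 = ip_norm2 f y"
proof -
  note o = gram_schmidt_orthonormal[OF s, of x, folded e_def]
  have bessel: "(\<Sum>n\<in>F. (cmod (ip f (e n) y))\<^sup>2) <= ip_norm2 f y" if "finite F" for F y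
    using ip_norm2_residual[OF s o that, of y] ip_norm2(2)[OF s, of "y - ip_proj f e F y"] by simp
  have b: "(\<Sum>n\<in>F. (cmod (ip f (e n) y))\<^sup>2) <= (sqrt (ip_norm2 f y))\<^sup>2" if "finite F" for F y
    using bessel[OF that] ip_norm2(2)[OF s, of y] by simp
  note sw = ell2_boundI[OF b real_sqrt_ge_zero[OF ip_norm2(2)[OF s]]]
  show nth: "ell2_nth (gns_vec f e y) n = ip f (e n) y" for y n
    unfolding gns_vec_def by (subst Abs_ell2_inverse) (use sw in auto)
  show "(norm (gns_vec f e y))\<^sup>2 = ip_norm2 f y"
  proof (rule antisym)
    have "(norm (gns_vec f e y))\<^sup>2 <= (sqrt (ip_norm2 f y))\<^sup>2"
      unfolding gns_vec_def by (intro power_mono sw) auto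
    then show "(norm (gns_vec f e y))\<^sup>2 <= ip_norm2 f y" using ip_norm2(2)[OF s, of y] by simp
    show "ip_norm2 f y <= (norm (gns_vec f e y))\<^sup>2"
    proof (rule field_le_epsilon)
      fix E :: real assume E: "E > 0"
      have "y \<in> closure (range x)" using x by simp
      then obtain m where m: "dist (x m) y < sqrt (E / 2)"
        using E unfolding closure_approachable by (metis rangeE half_gt_zero real_sqrt_gt_0_iff)
      let ?T = "ip_proj f e {..m}"
      have Td: "?T (y - x m) = ?T y - ?T (x m)"
        by (simp add: ip_proj_def ip_diff[OF s] scaleC_diff_left sum_subtractf)
      have "ip_norm2 f (y - ?T y) = ip_norm2 f ((y - x m - ?T (y - x m)) + (x m - ?T (x m)))" by (simp add: Td)
      also have "... <= 2 * ip_norm2 f (y - x m - ?T (y - x m)) + 2 * 0"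
        using ip_norm2(5)[OF s] gram_schmidt_residual[OF s, of x m, folded e_def] by metis
      also have "ip_norm2 f (y - x m - ?T (y - x m)) <= ip_norm2 f (y - x m)"
        using ip_norm2_residual[OF s o, of "{..m}" "y - x m"] by (simp add: sum_nonneg)
      also have "... <= (norm (y - x m))\<^sup>2" by (rule ip_norm2(4)[OF s])
      also have "... <= (sqrt (E / 2))\<^sup>2" using m by (intro power_mono) (auto simp: dist_norm norm_minus_commute)
      also have "... = E / 2" using E by simp
      finally have "ip_norm2 f y - (\<Sum>n\<le>m. (cmod (ip f (e n) y))\<^sup>2) <= E"
        using ip_norm2_residual[OF s o, of "{..m}" y] by simp
      moreover have "(\<Sum>n\<le>m. (cmod (ip f (e n) y))\<^sup>2) <= (norm (gns_vec f e y))\<^sup>2"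
        using norm_ell2_finite[of "{..m}" "gns_vec f e y"] by (simp add: nth)
      ultimately show "ip_norm2 f y <= (norm (gns_vec f e y))\<^sup>2 + E" by simp
    qed
  qed
qed

text \<open>The map sending \<open>y\<close> to the coefficients \<open>cinner (w n) y\<close> is
  bounded, as is seen by pairing \<open>y\<close> with the combination of the \<open>w n\<close>
  that has these coefficients. The operator wanted is its adjoint.\<close>

lemma column_operator:
  fixes w :: "'j => 'j ell2"
  assumes K: "K >= 0" and w: "!!F c. finite F ==> (norm (\<Sum>n\<in>F. scale_ell2 (c n) (w n)))\<^sup>2 <= K\<^sup>2 * (\<Sum>n\<in>F. (cmod (c n))\<^sup>2)"
  shows "\<exists>T. \<forall>n. bop_apply T (ket n) = w n"
proof -
  have b: "(\<Sum>n\<in>F. (cmod (cinner (w n) y))\<^sup>2) <= (K * norm y)\<^sup>2" if F: "finite F" for F y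
  proof -
    define z where "z = (\<Sum>n\<in>F. scale_ell2 (cinner (w n) y) (w n))"
    let ?s = "\<Sum>n\<in>F. (cmod (cinner (w n) y))\<^sup>2"
    have "cinner (\<Sum>n\<in>F. scale_ell2 (c n) (w n)) y = (\<Sum>n\<in>F. cnj (c n) * cinner (w n) y)" for c
      using F
    proof (induction F rule: finite_induct)
      case empty
      show ?case using cinner_add_left[of 0 0 y] by simp
    qed (simp add: cinner_add_left cinner_scale_left)
    then have "cinner z y = complex_of_real ?s"
      unfolding z_def by (simp add: mult.commute flip: complex_norm_square)
    then have "?s <= norm z * norm y"
      using cmod_cinner_le[of z y] by (simp del: of_real_sum)
    then have "?s\<^sup>2 <= (norm z * norm y)\<^sup>2" by (intro power_mono) (auto intro: sum_nonneg)
    also have "... = (norm z)\<^sup>2 * (norm y)\<^sup>2" by (rule power_mult_distrib)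
    also have "... <= (K\<^sup>2 * ?s) * (norm y)\<^sup>2" unfolding z_def by (intro mult_right_mono w F) simp
    finally have le: "?s * ?s <= ?s * (K * norm y)\<^sup>2" by (simp add: power2_eq_square mult_ac)
    show ?thesis
    proof (cases "?s = 0")
      case False
      then have "?s > 0" by (simp add: sum_nonneg less_le)
      then show ?thesis using le by simp
    qed simp
  qed
  have K': "0 <= K * norm y" for y :: "'j ell2" using K by simp
  define S where "S y = Abs_ell2 (%n. cinner (w n) y)" for y
  note sw = ell2_boundI[OF b K']
  have nth: "ell2_nth (S y) n = cinner (w n) y" for y n unfolding S_def by (subst Abs_ell2_inverse) (use sw in auto)
  have sc: "S (scale_ell2 c y) = scale_ell2 c (S y)" for c y
    by (rule ell2_eqI) (simp add: nth scale_ell2.rep_eq cinner_scale_right)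
  have "bounded_linear S"
  proof (rule bounded_linear_intro[where K = K])
    show "S (x + y) = S x + S y" for x y by (rule ell2_eqI) (simp add: nth plus_ell2.rep_eq cinner_add_right)
    show "S (r *R x) = r *R S x" for r x by (simp add: scaleR_ell2_def sc)
    show "norm (S y) <= norm y * K" for y unfolding S_def using sw(2)[of y] by (simp add: mult.commute)
  qed
  then obtain S' where S': "bop_apply S' = S" using sc by (rule bop_cases)
  have "bop_apply (S'\<star>) (ket n) = w n" for n
  proof (rule cinner_eqI)
    fix y
    have "cinner y (bop_apply (S'\<star>) (ket n)) = cnj (cinner (ket n) (S y))"
      unfolding S'[symmetric] by (metis cinner_commute cinner_star)
    also have "... = cinner y (w n)" unfolding cinner_ket nth by (rule cinner_commute[symmetric])
    finally show "cinner y (bop_apply (S'\<star>) (ket n)) = cinner y (w n)" .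
  qed
  then show ?thesis by blast
qed

lemma bop_ket_eqI:
  assumes "!!n. bop_apply S (ket n) = bop_apply T (ket n)"
  shows "S = T"
proof (rule bop_eqI)
  fix z
  interpret S: bounded_linear "bop_apply S" by (rule bounded_linear_bop_apply)
  interpret T: bounded_linear "bop_apply T" by (rule bounded_linear_bop_apply)
  have "bop_apply S (ell2_trunc F z) = bop_apply T (ell2_trunc F z)" for F
    unfolding ell2_trunc_def by (simp add: S.sum T.sum bop_apply_scale assms)
  then show "bop_apply S z = bop_apply T z"
    using tendsto_unique[OF finite_subsets_at_top_neq_bot S.tendsto[OF ell2_trunc_tendsto[of z]]]
      T.tendsto[OF ell2_trunc_tendsto[of z]] by simp
qed

lemma bop_entry_eqI:
  assumes "!!m n. cinner (ket m) (bop_apply S (ket n)) = cinner (ket m) (bop_apply T (ket n))"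
  shows "S = T"
  by (rule bop_ket_eqI, rule ell2_eqI) (use assms in \<open>simp add: cinner_ket\<close>)

text \<open>The GNS representation of some state. Its kernel is a closed ideal that does not contain
  1, so simplicity gives injectivity.\<close>

lemma faithful_representation_exists:
  assumes simple: "simple_cstar TYPE('a::unital_cstar_algebra)" and sep: "separable_space (euclidean :: 'a topology)"
  shows "\<exists>p :: 'a => nat bop. star_hom_on UNIV p \<and> inj p"
proof -
  obtain f :: "'a => complex" where s: "state f" by (rule state_exists)
  obtain C :: "'a set" where C: "countable C" "closure C = UNIV"
    using sep by (auto simp: separable_space_def)
  then have "C ~= {}" by auto
  define x where "x = from_nat_into C"
  have x: "closure (range x) = UNIV" using range_from_nat_into[OF \<open>C ~= {}\<close> C(1)] C(2) by (simp add: x_def)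
  define e where "e = gram_schmidt f x"
  note o = gram_schmidt_orthonormal[OF s, of x, folded e_def]
  define V where "V = gns_vec f e"
  note nth = gns_vec_nth[OF s x, folded e_def, folded V_def] and nV = norm_gns_vec[OF s x, folded e_def, folded V_def]
  have V_add: "V (y + z) = V y + V z" and V_scale: "V (c *C y) = scale_ell2 c (V y)" for y z c
    by (rule ell2_eqI; simp add: nth plus_ell2.rep_eq scale_ell2.rep_eq ip_add_right[OF s] ip_scale_right[OF s])+
  have V_zero: "V 0 = 0" using V_add[of 0 0] by simp
  have V_sum: "V (sum h F) = (\<Sum>n\<in>F. V (h n))" for h and F :: "nat set"
    by (induction F rule: infinite_finite_induct) (simp_all add: V_add V_zero)
  have inner: "cinner (V y) (V z) = ip f y z" for y z
  proof -
    \<comment> \<open>Polarization: a sesquilinear form that vanishes on the diagonal is 0.\<close>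
    define d where "d y z = cinner (V y) (V z) - ip f y z" for y z
    have d0: "d y y = 0" for y by (simp add: d_def cinner_self nV ip_norm2(1)[OF s] del: of_real_power)
    have d_lin: "d (y + y') z = d y z + d y' z" "d z (y + y') = d z y + d z y'"
      "d (c *C y) z = cnj c * d y z" "d z (c *C y) = c * d z y" for y y' z c
      by (simp_all add: d_def V_add V_scale cinner_add_left cinner_add_right cinner_scale_left cinner_scale_right
          ip_add_left[OF s] ip_add_right[OF s] ip_scale_left[OF s] ip_scale_right[OF s] algebra_simps)
    have 1: "d y z + d z y = 0" using d0[of "y + z"] unfolding d_lin by (simp add: d0 add.commute)
    have "\<i> * d y z - \<i> * d z y = 0" using d0[of "y + \<i> *C z"] unfolding d_lin by (simp add: d0)
    then have "d y z = d z y" by simp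
    with 1 have "d y z = 0" by simp
    then show ?thesis by (simp add: d_def)
  qed
  have "\<exists>T. \<forall>n. bop_apply T (ket n) = V (b * e n)" for b
  proof (rule column_operator[of "norm b"])
    fix F :: "nat set" and c assume F: "finite F"
    have "(\<Sum>n\<in>F. scale_ell2 (c n) (V (b * e n))) = V (b * (\<Sum>n\<in>F. c n *C e n))"
      by (simp add: V_sum V_scale sum_distrib_left mult_scaleC_right)
    also have "(norm ...)\<^sup>2 <= (norm b)\<^sup>2 * ip_norm2 f (\<Sum>n\<in>F. c n *C e n)" unfolding nV by (rule ip_norm2(3)[OF s])
    also have "... <= (norm b)\<^sup>2 * (\<Sum>n\<in>F. (cmod (c n))\<^sup>2)" by (intro mult_left_mono ip_norm2_combination[OF s o F]) simp
    finally show "(norm (\<Sum>n\<in>F. scale_ell2 (c n) (V (b * e n))))\<^sup>2 <= (norm b)\<^sup>2 * (\<Sum>n\<in>F. (cmod (c n))\<^sup>2)" .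
  qed simp
  then have "\<forall>b. \<exists>T. \<forall>n. bop_apply T (ket n) = V (b * e n)" by blast
  from choice[OF this] obtain p where p: "!!b n. bop_apply (p b) (ket n) = V (b * e n)" by blast
  have entry: "cinner (ket m) (bop_apply (p b) (ket n)) = ip f (e m) (b * e n)" for b m n
    unfolding p cinner_ket nth ..
  have ent_star: "cinner (ket m) (bop_apply ((p b)\<star>) (ket n)) = ip f (b * e m) (e n)" for b m n
  proof -
    have "cinner (ket m) (bop_apply ((p b)\<star>) (ket n)) = cnj (cinner (ket n) (bop_apply (p b) (ket m)))"
      by (metis cinner_commute cinner_star)
    then show ?thesis unfolding entry using ip_commute[OF s] by metis
  qed
  have h_add: "p (b + c) = p b + p c" for b c
    by (rule bop_ket_eqI) (simp add: p bop_apply_simps distrib_right V_add)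
  have h_scale: "p (z *C b) = z *C p b" for z b
    by (rule bop_ket_eqI) (simp add: p bop_apply_scaleC mult_scaleC_left V_scale)
  have h_star: "p (b\<star>) = (p b)\<star>" for b
    by (rule bop_entry_eqI) (simp add: entry ent_star, simp add: ip_def star_mult star_star mult.assoc)
  have h_mult: "p (b * c) = p b * p c" for b c
  proof (rule bop_entry_eqI)
    fix m n
    \<comment> \<open>\<open>p c\<close> need not map \<open>ket n\<close> to a basis vector, so
      \<open>p b\<close> is moved to the left as \<open>p (b\<star>)\<close>, where
      \<open>inner\<close> applies.\<close>
    have "cinner (ket m) (bop_apply (p b * p c) (ket n)) = cinner (bop_apply (p (b\<star>)) (ket m)) (bop_apply (p c) (ket n))"
      by (simp add: bop_apply_simps h_star cinner_star')
    also have "... = ip f (b\<star> * e m) (c * e n)" unfolding p inner ..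
    also have "... = ip f (e m) (b * c * e n)" by (simp add: ip_def star_mult mult.assoc)
    finally show "cinner (ket m) (bop_apply (p (b * c)) (ket n)) = cinner (ket m) (bop_apply (p b * p c) (ket n))"
      unfolding entry ..
  qed
  have hom: "star_hom_on UNIV p" unfolding star_hom_on_def using h_add h_scale h_star h_mult by blast
  define I where "I = {b. p b = 0}"
  have pi0: "p 0 = 0" using h_add[of 0 0] by simp
  have I_iff: "b \<in> I \<longleftrightarrow> (\<forall>m n. ip f (e m) (b * e n) = 0)" for b
  proof -
    have "p b = 0 \<longleftrightarrow> (\<forall>m n. cinner (ket m) (bop_apply (p b) (ket n)) = cinner (ket m) (bop_apply 0 (ket n)))"
      using bop_entry_eqI by metis
    then show ?thesis unfolding entry by (simp add: I_def bop_apply_simps cinner_ket zero_ell2.rep_eq)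
  qed
  have f_cont: "continuous_on UNIV f"
  proof -
    have "bounded_linear f"
    proof (rule bounded_linear_intro[where K = 1])
      show "f (y + z) = f y + f z" for y z by (rule stateD(1)[OF s])
      show "f (r *R y) = r *R f y" for r y using stateD(2)[OF s, of "complex_of_real r" y] by (simp add: scaleC_of_real scaleR_conv_of_real)
      show "norm (f y) <= norm y * 1" for y
      proof -
        have "cmod (ip f 1 y) <= norm (V 1) * norm (V y)" unfolding inner[symmetric] by (rule cmod_cinner_le)
        moreover have "(norm (V y))\<^sup>2 <= (norm y)\<^sup>2" for y unfolding nV by (rule ip_norm2(4)[OF s])
        then have VN: "norm (V y) <= norm y" for y by (rule power2_le_imp_le) simp
        have "norm (V 1) * norm (V y) <= 1 * norm y" by (intro mult_mono VN) (use VN[of 1] in auto)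
        ultimately show ?thesis by (simp add: ip_def)
      qed
    qed
    then show ?thesis by (rule linear_continuous_on)
  qed
  have "closed I"
  proof -
    have "I = (\<Inter>m. \<Inter>n. (%b. ip f (e m) (b * e n)) -` {0})" using I_iff by auto
    moreover have "closed ..." unfolding ip_def
      by (intro closed_INT ballI closed_vimage closed_singleton continuous_on_compose2[OF f_cont] continuous_intros) auto
    ultimately show ?thesis by simp
  qed
  moreover have "subspace I"
  proof -
    have "p (r *R b) = r *R p b" for r b using h_scale[of "complex_of_real r" b] by (simp add: scaleC_of_real)
    then show ?thesis by (auto simp: subspace_def I_def pi0 h_add)
  qed
  moreover have "\<forall>c. \<forall>x\<in>I. c *C x \<in> I" "\<forall>x\<in>I. \<forall>y. x * y \<in> I \<and> y * x \<in> I"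
    by (auto simp: I_def h_scale h_mult)
  ultimately have "I = {0} \<or> I = UNIV" using simple unfolding simple_cstar_def by blast
  moreover have "I ~= UNIV"
  proof
    assume "I = UNIV"
    then have "1 \<in> I" by simp
    then have "ip f (e n) (1 * e n) = 0" for n using I_iff by blast
    then have "e n = 0" for n using o[of n n] by (auto split: if_splits)
    then have "V 1 = 0" by (intro ell2_eqI) (simp add: nth zero_ell2.rep_eq ip_zero_left[OF s])
    then have "ip_norm2 f 1 = 0" using nV[of 1] by simp
    then show False by (simp add: ip_norm2_def ip_def stateD(5)[OF s])
  qed
  ultimately have I: "I = {0}" by blast
  have "inj p"
  proof (rule injI)
    fix b c assume bc: "p b = p c"
    have "p (b - c) + p c = p b" using h_add[of "b - c" c] by simp
    then have "b - c \<in> I" using bc by (simp add: I_def)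
    then show "b = c" using I by simp
  qed
  then show ?thesis using hom by blast
qed

section \<open>The stabilization\<close>

lemma star_hom_onD:
  assumes "star_hom_on UNIV h"
  shows "h (x + y) = h x + h y" "h (x * y) = h x * h y" "h (c *C x) = c *C h x" "h (x\<star>) = (h x)\<star>"
    "h (r *R x) = r *R h x" "h 0 = 0" "h (x - y) = h x - h y"
proof -
  show a: "h (x + y) = h x + h y" "h (x * y) = h x * h y" "h (c *C x) = c *C h x" "h (x\<star>) = (h x)\<star>" for x y c
    using assms unfolding star_hom_on_def by blast+
  show "h (r *R x) = r *R h x" using a(3)[of "complex_of_real r" x] by (simp add: scaleC_of_real)
  show "h 0 = 0" using a(1)[of 0 0] by simp
  show "h (x - y) = h x - h y" using a(1)[of "x - y" y] by simp
qed

lemma star_hom_cpos: "star_hom_on UNIV h ==> cpos b ==> cpos (h b)"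
  unfolding positive_elements_def by (auto simp: star_hom_onD)

text \<open>\<open>h\<close> may send 1 to a proper projection; the gap is filled by a multiple of
  the positive \<open>1 - h 1\<close>.\<close>

lemma star_hom_contractive:
  fixes h :: "'a::unital_cstar_algebra => 'b::unital_cstar_algebra"
  assumes h: "star_hom_on UNIV h"
  shows "norm (h x) <= norm x"
proof -
  note hh = star_hom_onD[OF h]
  let ?r = "(norm x)\<^sup>2"
  have p: "is_proj (h 1)" using hh(2)[of 1 1] hh(4)[of 1] by (simp add: is_proj_def)
  have "cpos (h (?r *R 1 - x\<star> * x))"
    by (intro star_hom_cpos[OF h] cpos_norm_diff) (simp_all add: cstar_identity star_mult star_star)
  then have "cpos ((?r *R h 1 - (h x)\<star> * h x) + ?r *R (1 - h 1))"
    using cpos_add[OF _ cpos_scaleR[OF is_proj_cpos[OF is_proj_complement[OF p]]]] by (simp add: hh)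
  then have "cpos (?r *R 1 - (h x)\<star> * h x)" by (simp add: scaleR_right_diff_distrib)
  then have "norm ((h x)\<star> * h x) <= ?r" by (intro norm_le_cposI) auto
  then have "(norm (h x))\<^sup>2 <= ?r" by (simp add: cstar_identity)
  then show ?thesis by (rule power2_le_imp_le) simp
qed

text \<open>Let \<open>s\<close> be the norm of \<open>h b\<close>. The function
  \<open>max (t - s) 0\<close> vanishes on the spectrum of \<open>h b\<close>, so \<open>h\<close>
  kills the corresponding cut-down of \<open>b\<close>; by injectivity this cut-down is 0, and
  \<open>norm b <= s\<close>. Approximating polynomials are stripped of their constant terms,
  because \<open>h\<close> may fail to preserve 1.\<close>

lemma star_hom_isometric:
  fixes h :: "'a::unital_cstar_algebra => 'b::unital_cstar_algebra"
  assumes h: "star_hom_on UNIV h" and inj: "inj h"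
  shows "norm (h x) = norm x"
proof -
  note hh = star_hom_onD[OF h]
  have poly: "h (b * peval p b) = h b * peval p (h b)" for b and p
    by (induction p) (simp_all add: hh distrib_left)
  have main: "norm b <= norm (h b)" if b: "cpos b" for b
  proof -
    define s where "s = norm (h b)"
    have s: "s >= 0" "s <= norm b" using star_hom_contractive[OF h, of b] by (simp_all add: s_def)
    have bs: "b\<star> = b" "(h b)\<star> = h b" using cpos_self_adjoint[OF b] hh(4)[of b] by auto
    define f where "f t = max (t - s) 0" for t :: real
    have fc: "continuous_on UNIV f" unfolding f_def by (intro continuous_intros)
    have sp: "0 <= t \<and> t <= s" if "t \<in> rspec (h b)" for t
      using cpos_rspec[OF star_hom_cpos[OF h b] that] rspec_bounded[OF that] by (simp add: s_def)
    have "norm (h (cfc f b)) <= 4 * e" if e: "e > 0" for e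
    proof -
      obtain p where p: "!!t. \<bar>t\<bar> <= norm b ==> \<bar>f t - poly p t\<bar> <= e" "norm (cfc f b - peval p b) <= e"
        using cfc_approx[OF fc bs(1) e] by blast
      obtain c q where pq: "p = pCons c q" by (cases p) auto
      have c: "\<bar>c\<bar> <= e" using p(1)[of 0] s by (simp add: pq f_def)
      have 1: "norm (cfc f b - b * peval q b) <= 2 * e"
        using norm_triangle_ineq[of "cfc f b - peval p b" "c *R 1"] p(2) c by (simp add: pq)
      have "norm (h (cfc f b) - h b * peval q (h b)) <= 2 * e"
        using star_hom_contractive[OF h, of "cfc f b - b * peval q b"] 1 by (simp add: hh(7) poly)
      moreover have "norm (peval (pCons 0 q) (h b)) <= 2 * e"
      proof (rule peval_norm_le[OF bs(2)])
        fix t assume "t \<in> rspec (h b)"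
        then have t: "0 <= t" "t <= s" using sp by blast+
        then have "\<bar>f t - poly p t\<bar> <= e" using s by (intro p(1)) simp
        moreover have "f t = 0" using t by (simp add: f_def)
        ultimately show "\<bar>poly (pCons 0 q) t\<bar> <= 2 * e" using c by (simp add: pq)
      qed
      moreover have "h (cfc f b) = (h (cfc f b) - h b * peval q (h b)) + peval (pCons 0 q) (h b)" by simp
      ultimately show ?thesis
        using norm_triangle_ineq[of "h (cfc f b) - h b * peval q (h b)" "peval (pCons 0 q) (h b)"] by simp
    qed
    then have "norm (h (cfc f b)) <= 0 + d" if "d > 0" for d
      using that by (metis (no_types) add_0 divide_pos_pos nonzero_mult_div_cancel_left times_divide_eq_right zero_less_numeral zero_neq_numeral)
    then have "norm (h (cfc f b)) <= 0" by (rule field_le_epsilon)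
    then have "h (cfc f b) = h 0" by (simp add: hh(6))
    then have z: "cfc f b = 0" using inj by (simp add: inj_eq)
    have "norm (cfc (%t. t - f t) b) <= s"
    proof (rule cfc_norm_le[OF bs(1)])
      show "continuous_on UNIV (%t. t - f t)" by (intro continuous_intros fc)
      show "\<bar>t - f t\<bar> <= s" if "t \<in> rspec b" for t using cpos_rspec[OF b that] s by (auto simp: f_def)
    qed
    moreover have "cfc (%t. t - f t) b = b" using cfc_diff[OF bs(1) continuous_on_id fc] cfc_id[OF bs(1)] z by simp
    ultimately show ?thesis by (simp add: s_def)
  qed
  have "(norm x)\<^sup>2 <= norm (h (x\<star> * x))" using main[of "x\<star> * x"] by (simp add: cstar_identity)
  also have "... = (norm (h x))\<^sup>2" by (simp add: hh cstar_identity)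
  finally have "norm x <= norm (h x)" by (rule power2_le_imp_le) simp
  then show ?thesis using star_hom_contractive[OF h, of x] by simp
qed

section \<open>Tensor products of operators and the compact operators\<close>

lemma tensor_bop_mult: "tensor_bop S T * tensor_bop S' T' = tensor_bop (S * S') (T * T')"
  by (rule tensor_ell2_unique) (simp add: bop_apply_simps tensor_bop_apply)

lemma tensor_ell2_add: "tensor_ell2 (x + x') y = tensor_ell2 x y + tensor_ell2 x' y" "tensor_ell2 x (y + y') = tensor_ell2 x y + tensor_ell2 x y'"
  by (rule ell2_eqI; auto simp: tensor_ell2.rep_eq plus_ell2.rep_eq algebra_simps)+

lemma tensor_ell2_scale: "tensor_ell2 (scale_ell2 c x) y = scale_ell2 c (tensor_ell2 x y)" "tensor_ell2 x (scale_ell2 c y) = scale_ell2 c (tensor_ell2 x y)"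
  by (rule ell2_eqI; auto simp: tensor_ell2.rep_eq scale_ell2.rep_eq algebra_simps)+

lemma tensor_bop_add: "tensor_bop (S + S') T = tensor_bop S T + tensor_bop S' T"
  by (rule tensor_ell2_unique) (simp add: bop_apply_simps tensor_bop_apply tensor_ell2_add)

lemma tensor_bop_scale: "tensor_bop (c *C S) T = c *C tensor_bop S T" "tensor_bop S (c *C T) = c *C tensor_bop S T"
  by (rule tensor_ell2_unique; simp add: bop_apply_scaleC tensor_bop_apply tensor_ell2_scale)+

lemma tensor_bop_one: "tensor_bop 1 1 = 1"
  by (rule tensor_ell2_unique) (simp add: tensor_bop_apply)

lemma ket_pair: "ket (i, j) = tensor_ell2 (ket i) (ket j)"
  by (rule ell2_eqI) (auto simp: ket.rep_eq tensor_ell2.rep_eq split: prod.splits)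

lemma tensor_bop_star: "(tensor_bop S T)\<star> = tensor_bop (S\<star>) (T\<star>)"
proof (rule bop_entry_eqI)
  fix m n :: "'a \<times> 'b"
  obtain i j k l where mn: "m = (i, j)" "n = (k, l)" by (metis surj_pair)
  have st: "ell2_nth (bop_apply (R\<star>) (ket p)) r = cnj (ell2_nth (bop_apply R (ket r)) p)" for R :: "'c bop" and p r
    unfolding cinner_ket[symmetric] by (metis cinner_commute cinner_star)
  have st': "ell2_nth (bop_apply (R\<star>) (ket p)) r = cnj (ell2_nth (bop_apply R (ket r)) p)" for R :: "'a bop" and p r
    unfolding cinner_ket[symmetric] by (metis cinner_commute cinner_star)
  have st'': "ell2_nth (bop_apply (R\<star>) (ket p)) r = cnj (ell2_nth (bop_apply R (ket r)) p)" for R :: "'b bop" and p r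
    unfolding cinner_ket[symmetric] by (metis cinner_commute cinner_star)
  have st3: "ell2_nth (bop_apply (R\<star>) (ket p)) r = cnj (ell2_nth (bop_apply R (ket r)) p)" for R :: "('a \<times> 'b) bop" and p r
    unfolding cinner_ket[symmetric] by (metis cinner_commute cinner_star)
  show "cinner (ket m) (bop_apply ((tensor_bop S T)\<star>) (ket n)) = cinner (ket m) (bop_apply (tensor_bop (S\<star>) (T\<star>)) (ket n))"
    unfolding cinner_ket st3 by (simp add: mn ket_pair tensor_bop_apply tensor_ell2_nth st' st'')
qed

definition totally_bounded :: "'a::metric_space set => bool"
  where "totally_bounded X \<longleftrightarrow> (\<forall>e>0. \<exists>k. finite k \<and> X \<subseteq> (\<Union>x\<in>k. ball x e))"

lemma compact_closure_iff: "compact (closure X) \<longleftrightarrow> totally_bounded X" for X :: "'a::complete_space set"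
proof
  assume "compact (closure X)"
  then have *: "\<forall>e>0. \<exists>k. finite k \<and> closure X \<subseteq> (\<Union>x\<in>k. ball x e)"
    unfolding compact_eq_totally_bounded by blast
  show "totally_bounded X" unfolding totally_bounded_def
  proof (intro allI impI)
    fix e :: real assume "e > 0"
    then obtain k where "finite k" "closure X \<subseteq> (\<Union>x\<in>k. ball x e)" using * by blast
    then show "\<exists>k. finite k \<and> X \<subseteq> (\<Union>x\<in>k. ball x e)" using closure_subset by (intro exI[of _ k]) blast
  qed
next
  assume X: "totally_bounded X"
  have "\<exists>k. finite k \<and> closure X \<subseteq> (\<Union>x\<in>k. ball x e)" if e: "e > 0" for e
  proof -
    obtain k where k: "finite k" "X \<subseteq> (\<Union>x\<in>k. ball x (e/2))" using X half_gt_zero[OF e] unfolding totally_bounded_def by blast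
    have "(\<Union>x\<in>k. ball x (e/2)) \<subseteq> (\<Union>x\<in>k. cball x (e/2))" by auto
    then have "X \<subseteq> (\<Union>x\<in>k. cball x (e/2))" by (rule order.trans[OF k(2)])
    then have "closure X \<subseteq> (\<Union>x\<in>k. cball x (e/2))"
      by (rule closure_minimal) (intro closed_UN ballI closed_cball k(1))
    also have "... \<subseteq> (\<Union>x\<in>k. ball x e)" using e by (intro UN_mono) auto
    finally show ?thesis using k(1) by blast
  qed
  then show "compact (closure X)"
    unfolding compact_eq_totally_bounded by (simp add: complete_eq_closed)
qed

lemma totally_bounded_subset:
  assumes X: "totally_bounded X" and YX: "Y \<subseteq> X"
  shows "totally_bounded Y"
  unfolding totally_bounded_def
proof (intro allI impI)
  fix e :: real assume "e > 0"
  then obtain k where k: "finite k" "X \<subseteq> (\<Union>x\<in>k. ball x e)" using X unfolding totally_bounded_def by blast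
  show "\<exists>k. finite k \<and> Y \<subseteq> (\<Union>x\<in>k. ball x e)" using k(1) order.trans[OF YX k(2)] by auto
qed

lemma totally_bounded_lipschitz:
  assumes X: "totally_bounded X" and f: "!!x y. dist (f x) (f y) <= L * dist x y"
  shows "totally_bounded (f ` X)"
  unfolding totally_bounded_def
proof (intro allI impI)
  fix e :: real assume e: "e > 0"
  define L' where "L' = max L 1"
  have "e / L' > 0" using e by (simp add: L'_def)
  then obtain k where k: "finite k" "X \<subseteq> (\<Union>x\<in>k. ball x (e / L'))" using X unfolding totally_bounded_def by blast
  have "dist (f x) (f y) < e" if "dist x y < e / L'" for x y
  proof -
    have "dist (f x) (f y) <= L' * dist x y" using f[of x y] mult_right_mono[of L L' "dist x y"] by (simp add: L'_def)
    also have "... < L' * (e / L')" using that by (intro mult_strict_left_mono) (auto simp: L'_def)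
    finally show ?thesis by (simp add: L'_def)
  qed
  note lt = this
  have "f ` X \<subseteq> (\<Union>y\<in>f ` k. ball y e)"
  proof
    fix z assume "z \<in> f ` X"
    then obtain x where x: "x \<in> X" "z = f x" by blast
    then obtain c where "c \<in> k" "x \<in> ball c (e / L')" using k(2) by blast
    then show "z \<in> (\<Union>y\<in>f ` k. ball y e)" using lt[of c x] x(2) by auto
  qed
  then show "\<exists>k. finite k \<and> f ` X \<subseteq> (\<Union>x\<in>k. ball x e)" using k(1) by blast
qed

lemma compact_operators_iff: "T \<in> compact_operators \<longleftrightarrow> totally_bounded (bop_apply T ` cball 0 1)"
  by (simp add: compact_operators_def compact_closure_iff)

lemma bop_apply_diff: "bop_apply T (x - y) = bop_apply T x - bop_apply T y"
  using bounded_linear.linear[OF bounded_linear_bop_apply[of T]] by (rule linear_diff)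

lemma compact_operators_mult_left: "T \<in> compact_operators ==> S * T \<in> compact_operators"
proof -
  assume "T \<in> compact_operators"
  then have "totally_bounded (bop_apply S ` (bop_apply T ` cball 0 1))"
    unfolding compact_operators_iff
    by (rule totally_bounded_lipschitz[where L = "norm S"]) (simp add: dist_norm norm_bop_apply_le flip: bop_apply_diff)
  then show ?thesis by (simp add: compact_operators_iff image_image bop_apply_simps)
qed

lemma compact_operators_mult_right:
  assumes T: "T \<in> compact_operators"
  shows "T * S \<in> compact_operators"
proof -
  let ?r = "norm S + 1"
  have r: "?r > 0" by (simp add: add_nonneg_pos)
  have "totally_bounded ((%z. ?r *R z) ` (bop_apply T ` cball 0 1))"
    using T unfolding compact_operators_iff
    by (rule totally_bounded_lipschitz[where L = ?r]) (use r in \<open>simp add: dist_norm flip: scaleR_right_diff_distrib\<close>)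
  moreover have "bop_apply (T * S) ` cball 0 1 \<subseteq> (%z. ?r *R z) ` (bop_apply T ` cball 0 1)"
  proof
    fix z assume "z \<in> bop_apply (T * S) ` cball 0 1"
    then obtain y where y: "norm y <= 1" "z = bop_apply T (bop_apply S y)" by (auto simp: bop_apply_simps)
    have "norm (bop_apply S y) <= norm S * 1" using norm_bop_apply_le[of S y] y(1) by (meson mult_left_mono norm_ge_zero order.trans)
    then have "norm ((1 / ?r) *R bop_apply S y) <= 1" using r by simp
    moreover have "z = ?r *R bop_apply T ((1 / ?r) *R bop_apply S y)"
      using r bounded_linear.linear[OF bounded_linear_bop_apply[of T]] by (simp add: y(2) linear_scale)
    ultimately show "z \<in> (%z. ?r *R z) ` (bop_apply T ` cball 0 1)" by auto
  qed
  ultimately show ?thesis unfolding compact_operators_iff by (rule totally_bounded_subset)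
qed

text \<open>The square of the norm of \<open>T\<star> z\<close> is at most \<open>norm z\<close>
  times the norm of \<open>T T\<star> z\<close>, so a finite net for the image of the ball under
  \<open>T * T\<star>\<close> yields one for \<open>T\<star>\<close>.\<close>

lemma compact_operators_star:
  assumes T: "T \<in> compact_operators"
  shows "T\<star> \<in> compact_operators"
  unfolding compact_operators_iff totally_bounded_def
proof (intro allI impI)
  let ?S = "bop_apply (T * T\<star>)" and ?A = "bop_apply (T\<star>)"
  fix e :: real assume e: "e > 0"
  have "totally_bounded (?S ` cball 0 1)"
    using compact_operators_mult_right[OF T, of "T\<star>"] by (simp add: compact_operators_iff)
  moreover have "e\<^sup>2 / 8 > 0" using e by simp
  ultimately obtain k where k: "finite k" "?S ` cball 0 1 \<subseteq> (\<Union>x\<in>k. ball x (e\<^sup>2 / 8))"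
    unfolding totally_bounded_def by blast
  define c where "c x = (SOME y. y \<in> cball 0 1 \<and> ?S y \<in> ball x (e\<^sup>2 / 8))" for x
  have "?A y \<in> (\<Union>x\<in>(%x. ?A (c x)) ` k. ball x e)" if y: "y \<in> cball 0 1" for y
  proof -
    obtain x where x: "x \<in> k" "?S y \<in> ball x (e\<^sup>2 / 8)" using k(2) y by blast
    then have c: "c x \<in> cball 0 1" "?S (c x) \<in> ball x (e\<^sup>2 / 8)"
      using someI[of "%y. y \<in> cball 0 1 \<and> ?S y \<in> ball x (e\<^sup>2 / 8)" y] y unfolding c_def by blast+
    let ?z = "c x - y"
    have "complex_of_real ((norm (?A ?z))\<^sup>2) = cinner ?z (?S ?z)"
      unfolding cinner_self[symmetric] by (simp add: cinner_star' bop_apply_simps)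
    then have "(norm (?A ?z))\<^sup>2 <= norm ?z * norm (?S ?z)"
      using cmod_cinner_le[of ?z "?S ?z"] by (metis abs_of_nonneg norm_of_real zero_le_power2)
    also have "norm ?z <= 2" using c(1) y norm_triangle_ineq4[of "c x" y] by simp
    also have "norm (?S ?z) <= e\<^sup>2 / 4"
      using dist_triangle3[of "?S (c x)" "?S y" x] c(2) x(2)
      by (simp add: bop_apply_diff dist_norm[of "bop_apply _ _" "bop_apply _ _"])
    finally have "(norm (?A ?z))\<^sup>2 <= e\<^sup>2 / 2" by (simp add: mult_right_mono)
    also have "... < e\<^sup>2" using e by simp
    finally have "(norm (?A ?z))\<^sup>2 < e\<^sup>2" .
    then have "norm (?A ?z) < e" by (rule power_less_imp_less_base) (use e in simp)
    then have "?A y \<in> ball (?A (c x)) e" by (simp add: bop_apply_diff dist_norm)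
    then show ?thesis using x(1) by auto
  qed
  then show "\<exists>k. finite k \<and> ?A ` cball 0 1 \<subseteq> (\<Union>x\<in>k. ball x e)"
    using k(1) by (intro exI[of _ "(%x. ?A (c x)) ` k"]) blast
qed

lemma compact_operators_e11: "e11 \<in> compact_operators"
proof -
  have "bounded_linear (%z. scale_ell2 z (ket (0 :: nat)))"
    by (rule bounded_linear_intro[where K = "norm (ket (0 :: nat))"])
      (auto simp: scale_ell2_add_left norm_scale_ell2 scaleR_ell2_def scale_ell2_scale scaleR_conv_of_real)
  then have "compact ((%z. scale_ell2 z (ket (0 :: nat))) ` cball 0 1)"
    by (intro compact_continuous_image linear_continuous_on compact_cball)
  then have "totally_bounded ((%z. scale_ell2 z (ket (0 :: nat))) ` cball 0 1)"
    by (simp add: compact_imp_closed flip: compact_closure_iff)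
  moreover have "bop_apply e11 ` cball 0 1 \<subseteq> (%z. scale_ell2 z (ket 0)) ` cball 0 1"
    by (auto simp: bop_apply_e11 intro!: order.trans[OF norm_ell2_nth_le])
  ultimately show ?thesis unfolding compact_operators_iff by (rule totally_bounded_subset)
qed

lemma closure_span_image:
  assumes f: "bounded_linear f" and C: "subspace C" "closed C" and G: "!!x. x \<in> G ==> f x \<in> C" and x: "x \<in> closure (span G)"
  shows "f x \<in> C"
proof -
  have "closed (f -` C)" by (rule closed_vimage[OF C(2) linear_continuous_on[OF f]])
  moreover have "span G \<subseteq> f -` C"
    by (rule span_minimal) (use G C(1) bounded_linear.linear[OF f] in \<open>auto intro: linear_subspace_vimage\<close>)
  ultimately have "closure (span G) \<subseteq> f -` C" by (rule closure_minimal[rotated])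
  then show ?thesis using x by blast
qed

lemma min_tensor_subalgebra:
  assumes M: "!!S S'. S \<in> M ==> S' \<in> M ==> S * S' \<in> M" "!!S. S \<in> M ==> S\<star> \<in> M" "!!c S. S \<in> M ==> c *C S \<in> M"
    and N: "!!T T'. T \<in> N ==> T' \<in> N ==> T * T' \<in> N" "!!T. T \<in> N ==> T\<star> \<in> N"
  shows "cstar_subalgebra (min_tensor M N)"
proof -
  define G where "G = {tensor_bop S T |S T. S \<in> M \<and> T \<in> N}"
  have B: "min_tensor M N = closure (span G)" by (simp add: min_tensor_def G_def)
  have sub: "subspace (min_tensor M N)" unfolding B by (rule subspace_closure) simp
  have cl: "closed (min_tensor M N)" by (simp add: B)
  have GB: "G \<subseteq> min_tensor M N" unfolding B by (rule order.trans[OF span_superset closure_subset])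
  have GG: "x * y \<in> min_tensor M N" if "x \<in> G" "y \<in> G" for x y
  proof -
    have "x * y \<in> G" using that M(1) N(1) unfolding G_def by (force simp: tensor_bop_mult)
    then show ?thesis using GB by blast
  qed
  have GBm: "x * y \<in> min_tensor M N" if "x \<in> G" "y \<in> min_tensor M N" for x y
    using closure_span_image[OF bounded_linear_mult_right[of x] sub cl GG[OF that(1)]] that(2) unfolding B by blast
  have "x * y \<in> min_tensor M N" if "x \<in> min_tensor M N" "y \<in> min_tensor M N" for x y
    using closure_span_image[OF bounded_linear_mult_left[of y] sub cl GBm[OF _ that(2)]] that(1) unfolding B by blast
  moreover have "x\<star> \<in> min_tensor M N" if "x \<in> min_tensor M N" for x
  proof -
    have "y\<star> \<in> min_tensor M N" if "y \<in> G" for y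
    proof -
      have "y\<star> \<in> G" using that M(2) N(2) unfolding G_def by (force simp: tensor_bop_star)
      then show ?thesis using GB by blast
    qed
    then show ?thesis using closure_span_image[OF bounded_linear_star sub cl] that unfolding B by blast
  qed
  moreover have "c *C x \<in> min_tensor M N" if "x \<in> min_tensor M N" for c x
  proof -
    have "c *C y \<in> min_tensor M N" if "y \<in> G" for y
    proof -
      have "c *C y \<in> G" using that M(3) unfolding G_def by (force simp flip: tensor_bop_scale(1))
      then show ?thesis using GB by blast
    qed
    then show ?thesis using closure_span_image[OF bounded_linear_scaleC sub cl] that unfolding B by blast
  qed
  ultimately show ?thesis unfolding cstar_subalgebra_def using sub cl by blast
qed

lemma e11_compress: "e11 * T * e11 = ell2_nth (bop_apply T (ket 0)) 0 *C e11"
  by (rule bop_eqI)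
    (simp add: bop_apply_simps bop_apply_e11 bop_apply_scale bop_apply_scaleC scale_ell2.rep_eq scale_ell2_scale mult.commute)

lemma e11_proj: "is_proj e11"
proof -
  have "e11 * 1 * e11 = e11"
    unfolding e11_compress by (rule bop_eqI) (simp add: bop_apply_scaleC ket.rep_eq)
  moreover have "cinner x (ket 0) = cnj (ell2_nth x 0)" for x :: "nat ell2" by (metis cinner_commute cinner_ket)
  then have "e11\<star> = e11"
    by (intro star_bop_eqI) (simp add: bop_apply_e11 cinner_scale_left cinner_scale_right cinner_ket mult.commute)
  ultimately show ?thesis by (simp add: is_proj_def)
qed

section \<open>Increasing sequences of classes and their limits\<close>

lemma cutoff_antimono:
  assumes B: "cstar_subalgebra B" and a: "cpos a" "a \<in> B" and d: "0 < e" "e <= d"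
  shows "cuntz_subequiv B (cutoff d a) (cutoff e a)"
proof (rule dominated_cuntz_subequiv[OF B])
  show "cpos (cutoff d a)" "cpos (cutoff e a)" using cut_props(1)[OF a(1)] d by auto
  show "cutoff d a \<in> B" "cutoff e a \<in> B" using cut_mem[OF B a] d by auto
  have c: "continuous_on UNIV (%t. max (t - d) 0)" "continuous_on UNIV (%t. max (t - e) 0)" for d e :: real
    by (intro continuous_intros)+
  note as = cpos_self_adjoint[OF a(1)]
  have "cutoff e a - cutoff d a = cfc (%t. max (t - e) 0 - max (t - d) 0) a"
    unfolding cutoff_def by (rule cfc_diff[OF as c(1) c(1), symmetric])
  also have "cpos ..." using d by (intro cfc_cpos[OF as] continuous_intros) auto
  finally show "cpos (1 *R cutoff e a - cutoff d a)" by simp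
qed

lemma rspec_projection:
  assumes p: "is_proj p" and t: "t \<in> rspec p"
  shows "t = 0 \<or> t = 1"
proof (rule ccontr)
  assume n: "\<not> ?thesis"
  let ?y = "(1 / (1 - t)) *R p - (1 / t) *R (1 - p)"
  have pp: "(p - t *R 1) * p = (1 - t) *R p" "p * (p - t *R 1) = (1 - t) *R p"
    "(p - t *R 1) * (1 - p) = - t *R (1 - p)" "(1 - p) * (p - t *R 1) = - t *R (1 - p)"
    by (simp_all add: diff_distribs scaleR_left_diff_distrib scaleR_right_diff_distrib is_projD[OF p])
  have "(p - t *R 1) * ?y = (1 / (1 - t)) *R ((p - t *R 1) * p) - (1 / t) *R ((p - t *R 1) * (1 - p))"
    by (simp only: right_diff_distrib mult_scaleR_right)
  also have "... = 1" unfolding pp using n by simp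
  finally have 1: "(p - t *R 1) * ?y = 1" .
  have "?y * (p - t *R 1) = (1 / (1 - t)) *R (p * (p - t *R 1)) - (1 / t) *R ((1 - p) * (p - t *R 1))"
    by (simp only: left_diff_distrib mult_scaleR_left)
  also have "... = 1" unfolding pp using n by simp
  finally have "two_sided_unit (p - t *R 1)" using 1 by (rule two_sided_unitI[rotated])
  then show False using t by (simp add: rspec_def)
qed

text \<open>A projection is not diminished by a cut-down: \<open>cutoff (1/2) p\<close> is half of
  \<open>p\<close>. So an approximation of \<open>p\<close> by a conjugate of \<open>w n\<close>
  within \<open>1/2\<close> already puts \<open>p\<close> below \<open>w n\<close>.\<close>

lemma projection_below_limit:
  fixes p W :: "'b::unital_cstar_algebra"
  assumes B: "cstar_subalgebra B" and p: "is_proj p" "p \<in> B" "cuntz_subequiv B p W"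
    and w: "!!n. w n \<in> B" "!!n. cpos (w n)" "w \<longlonglongrightarrow> W"
  obtains n where "cuntz_subequiv B p (w n)"
proof -
  obtain v where v: "v \<in> B" "norm (v * W * v\<star> - p) < 1/2" using cuntz_subequivD[OF p(3), of "1/2"] by auto
  have "(%n. norm (v * w n * v\<star> - p)) \<longlonglongrightarrow> norm (v * W * v\<star> - p)" by (intro tendsto_intros w(3))
  then have "eventually (%n. norm (v * w n * v\<star> - p) < 1/2) sequentially" using v(2) by (rule order_tendstoD)
  then obtain n where n: "norm (v * w n * v\<star> - p) < 1/2" by (auto simp: eventually_sequentially)
  note as = cpos_self_adjoint[OF is_proj_cpos[OF p(1)]]
  have "cutoff (1/2) p = cfc (%t. (1/2) * t) p"
    unfolding cutoff_def
  proof (rule cfc_cong[OF as])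
    show "max (t - 1/2) 0 = (1/2) * t" if "t \<in> rspec p" for t using rspec_projection[OF p(1) that] by auto
  qed (intro continuous_intros)+
  also have "... = (1/2) *R p" using cfc_scaleR[OF as continuous_on_id, of "1/2"] cfc_id[OF as] by simp
  finally have c: "cutoff (1/2) p = (1/2) *R p" .
  have "cuntz_subequiv B p (cutoff (1/2) p)"
    by (rule dominated_cuntz_subequiv[OF B is_proj_cpos[OF p(1)] p(2) _ _, of _ 2])
      (use cut_props(1)[OF is_proj_cpos[OF p(1)], of "1/2"] cut_mem[OF B is_proj_cpos[OF p(1)] p(2), of "1/2"] in \<open>simp_all add: c\<close>)
  moreover have "v * w n * v\<star> \<in> B" using B v(1) w(1) by (intro cstar_subalgebraD(3,4))
  then have "cuntz_subequiv B (cutoff (1/2) p) (v * w n * v\<star>)"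
    by (intro cut_cuntz_subequiv[OF B is_proj_cpos[OF p(1)] p(2)] cpos_conj' w) (use n in \<open>auto simp: norm_minus_commute\<close>)
  moreover have "cuntz_subequiv B (v * w n * v\<star>) (w n)" by (rule cuntz_subequiv_conj[OF v(1)])
  ultimately have "cuntz_subequiv B p (w n)" using sub_trans[OF B] by blast
  then show thesis by (rule that)
qed

text \<open>The new element is \<open>z\<star> z\<close> with \<open>z z\<star>\<close> between two multiples of \<open>c\<close>: a small multiple of a copy
  of \<open>c\<close> on fresh coordinates is attached to an approximation of \<open>w\<close> inside \<open>c\<close>.\<close>

lemma enlarge_to_class:
  fixes w c :: "'b::unital_cstar_algebra" and S :: "nat => 'b"
  assumes B: "cstar_subalgebra B" and S: "!!i j. (S i)\<star> * S j = (if i = j then 1 else 0)" "!!n x. x \<in> B ==> S n * x \<in> B"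
    and w: "w \<in> B" "cpos w" "!!m. m >= n ==> (S m)\<star> * w = 0" and c: "c \<in> B" "cpos c" and wc: "cuntz_subequiv B w c" and d: "d > 0"
  obtains w' where "w' \<in> B" "cpos w'" "!!m. m >= Suc n ==> (S m)\<star> * w' = 0" "norm (w' - w) <= d"
    "cuntz_subequiv B w' c" "cuntz_subequiv B c w'"
proof -
  let ?Q = "S n * c * (S n)\<star>"
  note BD = cstar_subalgebraD[OF B]
  note ws = cpos_self_adjoint[OF w(2)]
  define e where "e = d / 8"
  have e: "e > 0" using d by (simp add: e_def)
  \<comment> \<open>\<open>k\<close> is \<open>w\<close> divided by \<open>w + e\<close>:
    \<open>k * w * k\<close> is near \<open>w\<close>, and multiplication by \<open>k\<close> makes
    \<open>v\<close> inherit \<open>(S m)\<star> * v = 0\<close> from \<open>w\<close>.\<close>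
  define f where "f t = t * (1 / (\<bar>t\<bar> + e))" for t :: real
  have gc: "continuous_on UNIV (%t. 1 / (\<bar>t\<bar> + e))" using e by (intro continuous_intros) (auto simp: add_nonneg_eq_0_iff)
  have fc: "continuous_on UNIV f" unfolding f_def by (intro continuous_intros gc)
  define k where "k = cfc f w"
  have kB: "k \<in> B" unfolding k_def by (rule cfc_mem[OF B fc _ ws w(1)]) (simp add: f_def)
  have ks: "k\<star> = k" unfolding k_def by (rule cfc_star[OF ws fc])
  have "k = w * cfc (%t. 1 / (\<bar>t\<bar> + e)) w"
    unfolding k_def f_def using cfc_mult[OF ws continuous_on_id gc] cfc_id[OF ws] by simp
  then have Sk: "(S m)\<star> * k = 0" if "m >= n" for m using w(3)[OF that] by (simp flip: mult.assoc)
  have kn: "norm k <= 1" unfolding k_def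
    by (rule cfc_norm_le[OF ws fc]) (use e in \<open>auto simp: f_def abs_mult field_simps\<close>)
  have kwk: "norm (k * w * k - w) <= d / 4"
  proof -
    have "k * w * k = cfc (%t. f t * t * f t) w"
      unfolding k_def using cfc_mult[OF ws continuous_on_mult[OF fc continuous_on_id] fc] cfc_mult[OF ws fc continuous_on_id] cfc_id[OF ws] by simp
    then have "k * w * k - w = cfc (%t. f t * t * f t - t) w"
      using cfc_diff[OF ws continuous_on_mult[OF continuous_on_mult[OF fc continuous_on_id] fc] continuous_on_id] cfc_id[OF ws] by simp
    also have "norm ... <= d / 4"
    proof (rule cfc_norm_le[OF ws])
      show "continuous_on UNIV (%t. f t * t * f t - t)" by (intro continuous_intros fc)
      fix t assume "t \<in> rspec w"
      then have t: "t >= 0" using cpos_rspec[OF w(2)] by blast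
      define r where "r = t / (t + e)"
      have r: "0 <= r" "r <= 1" using t e by (simp_all add: r_def)
      have tr: "t * (1 - r) <= e" using t e by (simp add: r_def field_simps)
      have "f t = r" using t by (simp add: f_def r_def)
      then have "t - f t * t * f t = t * (1 - r) * (1 + r)" by (simp add: algebra_simps)
      moreover have "... <= e * 2" using tr r t e by (intro mult_mono) auto
      moreover have "0 <= t * (1 - r) * (1 + r)" using r t by (intro mult_nonneg_nonneg) auto
      ultimately show "\<bar>f t * t * f t - t\<bar> <= d / 4" by (simp add: e_def)
    qed
    finally show ?thesis .
  qed
  obtain v0 where v0: "v0 \<in> B" "norm (v0 * c * v0\<star> - w) < d / 4" using cuntz_subequivD[OF wc, of "d / 4"] d by auto
  define v where "v = k * v0"
  have vB: "v \<in> B" unfolding v_def by (rule BD(3)[OF kB v0(1)])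
  have Sv: "(S m)\<star> * v = 0" if "m >= n" for m using Sk[OF that] by (simp add: v_def flip: mult.assoc)
  have vw: "norm (v * c * v\<star> - w) <= d / 2"
  proof -
    have E: "v * c * v\<star> - w = k * (v0 * c * v0\<star> - w) * k\<star> + (k * w * k - w)"
      by (simp add: v_def star_mult ks diff_distribs mult.assoc)
    have "norm (k * (v0 * c * v0\<star> - w) * k\<star>) <= 1 * (d / 4)"
      using v0(2) kn by (intro order.trans[OF norm_conj_le] mult_mono) (auto simp: power_le_one)
    then show ?thesis unfolding E using kwk norm_triangle_ineq[of "k * (v0 * c * v0\<star> - w) * k\<star>" "k * w * k - w"] by simp
  qed
  define r where "r = csqrt_el c"
  have r: "r\<star> = r" "r * r = c" "r \<in> B" using csqrt_el[OF c(2)] csqrt_el_mem[OF B c(2,1)] by (simp_all add: r_def)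
  have r': "r * (r * y) = c * y" for y using r(2) by (simp flip: mult.assoc)
  define X where "X = v * c * (S n)\<star> + S n * c * v\<star>"
  define M where "M = norm X + norm ?Q + 1"
  have M: "M > 0" by (simp add: M_def add_nonneg_pos)
  define K where "K = min 1 (d / (2 * M))"
  have K: "K > 0" "K <= 1" "K * M <= d / 2"
    using d M by (auto simp: K_def min_def)
  \<comment> \<open>In \<open>z * z\<star>\<close> the mixed terms vanish since
    \<open>(S n)\<star> * v = 0\<close>; what remains is a positive element below a multiple of
    \<open>c\<close>, plus \<open>K\<^sup>2 *R c\<close>, hence of the class of \<open>c\<close>. In
    \<open>z\<star> * z\<close> they remain, and \<open>K\<close> makes them small.\<close>
  define z where "z = r * v\<star> + K *R (r * (S n)\<star>)"
  have zs: "z\<star> = v * r + K *R (S n * r)" by (simp add: z_def star_add star_mult r)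
  have "r * (S n)\<star> = (S n * r)\<star>" by (simp add: star_mult r)
  then have rSB: "r * (S n)\<star> \<in> B" using BD(4)[OF S(2)[OF r(3)]] by simp
  have zB: "z \<in> B" unfolding z_def by (rule BD(5)[OF BD(3)[OF r(3) BD(4)[OF vB]] BD(7)[OF rSB]])
  have zz: "z\<star> * z = v * c * v\<star> + K *R (X + K *R ?Q)"
    unfolding zs unfolding z_def by (simp add: X_def add_distribs mult.assoc r' scaleR_add_right)
  have vS: "v\<star> * S n = 0" using arg_cong[OF Sv[of n], of star] by (simp add: star_mult)
  then have vS': "v\<star> * (S n * y) = 0" for y by (simp flip: mult.assoc)
  have Svn: "(S n)\<star> * (v * y) = 0" for y using Sv[of n] by (simp flip: mult.assoc)
  have SSn: "(S n)\<star> * (S n * y) = y" for y using S(1)[of n n] by (simp flip: mult.assoc)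
  have zz': "z * z\<star> = r * (v\<star> * v) * r + K\<^sup>2 *R c"
    unfolding zs unfolding z_def by (simp add: add_distribs mult.assoc vS' Svn SSn r power2_eq_square)
  have rr: "cpos (r * y * r)" if "cpos y" for y using cpos_conj'[OF that, of r] r(1) by simp
  have sw: "cuntz_subequiv B (z\<star> * z) (z * z\<star>)" "cuntz_subequiv B (z * z\<star>) (z\<star> * z)"
    using cuntz_star_mult_swap[OF B zB] cuntz_star_mult_swap[OF B BD(4)[OF zB]] by auto
  have mB: "z\<star> * z \<in> B" "z * z\<star> \<in> B" by (rule BD(3)[OF BD(4)[OF zB] zB], rule BD(3)[OF zB BD(4)[OF zB]])
  have 1: "cuntz_subequiv B (z * z\<star>) c"
  proof (rule dominated_cuntz_subequiv[OF B cpos_mult_star mB(2) c(2,1), of "norm (v\<star> * v) + K\<^sup>2"])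
    have "(norm (v\<star> * v) + K\<^sup>2) *R c - z * z\<star> = r * (norm (v\<star> * v) *R 1 - v\<star> * v) * r"
      unfolding zz' by (simp add: diff_distribs scaleR_left_distrib r(2))
    then show "cpos ((norm (v\<star> * v) + K\<^sup>2) *R c - z * z\<star>)" using rr[OF cpos_le_norm[OF cpos_star_mult[of v]]] by simp
  qed
  have 2: "cuntz_subequiv B c (z * z\<star>)"
  proof (rule dominated_cuntz_subequiv[OF B c(2,1) cpos_mult_star mB(2), of "1 / K\<^sup>2"])
    have "(1 / K\<^sup>2) *R (z * z\<star>) - c = (1 / K\<^sup>2) *R (r * (v\<star> * v) * r)"
      unfolding zz' using K(1) by (simp add: scaleR_add_right)
    then show "cpos ((1 / K\<^sup>2) *R (z * z\<star>) - c)" by (simp only:) (intro cpos_scaleR rr cpos_star_mult, simp)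
  qed
  show thesis
  proof (rule that[of "z\<star> * z"])
    show "z\<star> * z \<in> B" by (rule mB(1))
    show "cpos (z\<star> * z)" by simp
    show "(S m)\<star> * (z\<star> * z) = 0" if m: "m >= Suc n" for m
    proof -
      have "(S m)\<star> * z\<star> = (S m)\<star> * v * r + K *R ((S m)\<star> * S n * r)" by (simp add: zs distrib_left mult.assoc)
      also have "... = 0" using Sv[of m] S(1)[of m n] m by simp
      finally show ?thesis by (simp flip: mult.assoc)
    qed
    show "norm (z\<star> * z - w) <= d"
    proof -
      have "norm (X + K *R ?Q) <= norm X + K * norm ?Q"
        using norm_triangle_ineq[of X "K *R ?Q"] K(1) by simp
      also have "... <= M" using mult_right_mono[OF K(2), of "norm ?Q"] by (simp add: M_def)
      finally have "K * norm (X + K *R ?Q) <= d / 2"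
        using K(1,3) by (meson mult_left_mono order.trans less_imp_le)
      then have "norm (K *R (X + K *R ?Q)) <= d / 2" using K(1) by simp
      moreover have E: "z\<star> * z - w = (v * c * v\<star> - w) + K *R (X + K *R ?Q)" unfolding zz by simp
      ultimately show ?thesis unfolding E
        using norm_triangle_ineq[of "v * c * v\<star> - w" "K *R (X + K *R ?Q)"] vw by auto
    qed
    show "cuntz_subequiv B (z\<star> * z) c" "cuntz_subequiv B c (z\<star> * z)" using sub_trans[OF B] sw 1 2 by blast+
  qed
qed

text \<open>Each step passes to an element of the class of \<open>c n\<close>, within half the
  current tolerance. Tolerances at least halve, so the sequence converges, and they are so small
  that the limit still dominates every \<open>c i\<close>. The limit is the upper bound with which a
  supremum in \<open>Cu\<close> is compared.\<close>

lemma increasing_sequence_bound: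
  fixes c :: "nat => 'b::unital_cstar_algebra" and S :: "nat => 'b"
  assumes B: "cstar_subalgebra B" and S: "!!i j. (S i)\<star> * S j = (if i = j then 1 else 0)" "!!n x. x \<in> B ==> S n * x \<in> B"
    and c: "!!n. c n \<in> B" "!!n. cpos (c n)" "!!n. cuntz_subequiv B (c n) (c (Suc n))"
  shows "\<exists>W w. W \<in> B \<and> cpos W \<and> (\<forall>n. cuntz_subequiv B (c n) W) \<and> w \<longlonglongrightarrow> W \<and>
    (\<forall>n. w n \<in> B \<and> cpos (w n) \<and> cuntz_subequiv B (w n) (c n))"
proof -
  note BD = cstar_subalgebraD[OF B]
  note tr = sub_trans[OF B]
  have cmono: "cuntz_subequiv B (c i) (c n)" if "i <= n" for i n
    using that
  proof (induction n rule: dec_induct)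
    case base
    show ?case by (rule cuntz_subequiv_refl[OF B c(2,1)])
  next
    case (step n)
    then show ?case using tr c(3) by blast
  qed
  \<comment> \<open>The second component is the tolerance: \<open>c i\<close> cut at
    \<open>1 / n\<close> lies below \<open>w\<close> cut at the tolerance, hence below every
    positive element of \<open>B\<close> within the tolerance of \<open>w\<close>. The clause on
    \<open>S m\<close> reserves fresh coordinates.\<close>
  define I where "I n y \<longleftrightarrow> fst y \<in> B \<and> cpos (fst y) \<and> (\<forall>m\<ge>n. (S m)\<star> * fst y = 0) \<and> snd y > 0 \<and> cuntz_subequiv B (fst y) (c n) \<and>
    (\<forall>i<n. cuntz_subequiv B (cutoff (1 / real n) (c i)) (cutoff (snd y) (fst y)))" for n and y :: "'b \<times> real"
  define Q where "Q y y' \<longleftrightarrow> norm (fst y' - fst y) <= snd y / 2 \<and> snd y' <= snd y / 2" for y y' :: "'b \<times> real"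
  have "\<exists>y. \<forall>n. I n (y n) \<and> Q (y n) (y (Suc n))"
  proof (rule dependent_nat_choice)
    have "cuntz_subequiv B 0 (c 0)" using c BD(8) by (intro dominated_cuntz_subequiv[OF B, of _ _ 1]) auto
    then show "\<exists>y. I 0 y" using BD(8) by (intro exI[of _ "(0, 1)"]) (simp add: I_def)
    fix y n assume "I n y"
    then obtain w t where y: "y = (w, t)" and w: "w \<in> B" "cpos w" "!!m. m >= n ==> (S m)\<star> * w = 0" "t > 0" "cuntz_subequiv B w (c n)"
      by (cases y) (auto simp: I_def)
    have "t / 2 > 0" using w(4) by simp
    then obtain w' where w': "w' \<in> B" "cpos w'" "!!m. m >= Suc n ==> (S m)\<star> * w' = 0" "norm (w' - w) <= t / 2"
      "cuntz_subequiv B w' (c n)" "cuntz_subequiv B (c n) w'"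
      using enlarge_to_class[OF B S w(1-3) c(1,2) w(5)] by metis
    have "\<exists>d>0. cuntz_subequiv B (cutoff (1 / real (Suc n)) (c i)) (cutoff d w')" if "i <= n" for i
    proof -
      have "cuntz_subequiv B (c i) w'" using tr[OF cmono[OF that] w'(6)] .
      from cuntz_subequiv_cut[OF B this c(2,1) w'(2,1), of "1 / real (Suc n)"] show ?thesis by auto
    qed
    then have "\<forall>i. \<exists>d. i <= n --> d > 0 \<and> cuntz_subequiv B (cutoff (1 / real (Suc n)) (c i)) (cutoff d w')" by blast
    from choice[OF this] obtain d where d: "!!i. i <= n ==> d i > 0 \<and> cuntz_subequiv B (cutoff (1 / real (Suc n)) (c i)) (cutoff (d i) w')" by blast
    define t' where "t' = Min (insert (t / 2) (d ` {..n}))"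
    have t': "t' > 0" "t' <= t / 2" unfolding t'_def using w(4) d by auto
    have "cuntz_subequiv B (cutoff (1 / real (Suc n)) (c i)) (cutoff t' w')" if "i < Suc n" for i
    proof -
      have "t' <= d i" unfolding t'_def using that by (intro Min_le) auto
      then show ?thesis using tr[OF _ cutoff_antimono[OF B w'(2,1) t'(1)]] d[of i] that by auto
    qed
    then have "I (Suc n) (w', t')" unfolding I_def using w' t' tr[OF w'(5) c(3)] by simp
    moreover have "Q y (w', t')" using w'(4) t'(2) by (simp add: Q_def y)
    ultimately show "\<exists>y'. I (Suc n) y' \<and> Q y y'" by blast
  qed
  then obtain y where y: "!!n. I n (y n)" "!!n. Q (y n) (y (Suc n))" by blast
  define w where "w n = fst (y n)" for n
  define t where "t n = snd (y n)" for n
  have w: "w n \<in> B" "cpos (w n)" "t n > 0" "cuntz_subequiv B (w n) (c n)"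
    "i < n ==> cuntz_subequiv B (cutoff (1 / real n) (c i)) (cutoff (t n) (w n))" for n i
    using y(1)[of n] by (simp_all add: I_def w_def t_def)
  have st: "norm (w (Suc n) - w n) <= t n / 2" "t (Suc n) <= t n / 2" for n using y(2)[of n] by (simp_all add: Q_def w_def t_def)
  have tele: "norm (w m - w n) <= t n - t m" if "n <= m" for n m
    using that
  proof (induction m rule: dec_induct)
    case (step m)
    have "w (Suc m) - w n = (w (Suc m) - w m) + (w m - w n)" by simp
    then show ?case using norm_triangle_ineq[of "w (Suc m) - w m" "w m - w n"] st[of m] step.IH by simp
  qed simp
  have t_le: "t n <= t 0 * (1/2) ^ n" for n
  proof (induction n)
    case (Suc n)
    then show ?case using st(2)[of n] by simp
  qed simp
  have "(%n. t 0 * (1/2) ^ n) \<longlonglongrightarrow> t 0 * 0" by (intro tendsto_intros LIMSEQ_realpow_zero) auto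
  then have ev: "eventually (%n. t 0 * (1/2) ^ n < e) sequentially" if "e > 0" for e using that by (intro order_tendstoD) auto
  have "Cauchy w"
  proof (rule metric_CauchyI)
    fix e :: real assume "e > 0"
    then obtain N where N: "t 0 * (1/2) ^ N < e/2" using ev[of "e/2"] by (auto simp: eventually_sequentially)
    have "dist (w m) (w N) < e/2" if "m >= N" for m
      using tele[OF that] w(3)[of m] t_le[of N] N by (simp add: dist_norm)
    then show "\<exists>M. \<forall>m\<ge>M. \<forall>n\<ge>M. dist (w m) (w n) < e" using dist_triangle_half_l by blast
  qed
  then obtain W where W: "w \<longlonglongrightarrow> W" using Cauchy_convergent convergent_def by blast
  have WB: "W \<in> B" using closed_sequentially[OF BD(2) _ W] w(1) by blast
  have Wc: "cpos W" by (rule cpos_closed[OF w(2) W])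
  have Wn: "norm (w n - W) <= t n" for n
  proof (rule tendsto_upperbound)
    show "(%m. norm (w n - w m)) \<longlonglongrightarrow> norm (w n - W)" by (intro tendsto_intros W)
    show "\<forall>\<^sub>F m in sequentially. norm (w n - w m) <= t n"
    proof (rule eventually_sequentiallyI[of n])
      show "norm (w n - w m) <= t n" if "n <= m" for m
        using tele[OF that] w(3)[of m] by (simp add: norm_minus_commute)
    qed
  qed simp
  have "cuntz_subequiv B (c i) W" for i
  proof (rule cuntz_subequiv_limit)
    fix e :: real assume "e > 0"
    then obtain n0 where n0: "1 / real (Suc n0) < e" using nat_approx_posE by blast
    define n where "n = max (Suc n0) (Suc i)"
    have n: "n > 0" "i < n" "1 / real n < e"
    proof -
      have "1 / real n <= 1 / real (Suc n0)" by (intro divide_left_mono) (auto simp: n_def)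
      then show "1 / real n < e" using n0 by auto
    qed (auto simp: n_def)
    have "cuntz_subequiv B (cutoff (t n) (w n)) W" by (rule cut_cuntz_subequiv[OF B w(2,1) Wc WB Wn w(3)])
    then have "cuntz_subequiv B (cutoff (1 / real n) (c i)) W" using tr w(5)[OF n(2)] by blast
    moreover have "norm (cutoff (1 / real n) (c i) - c i) < e"
      using cut_props(2)[OF c(2)[of i], of "1 / real n"] n by (simp add: norm_minus_commute)
    ultimately show "\<exists>a'. cuntz_subequiv B a' W \<and> norm (a' - c i) < e" by blast
  qed
  then show ?thesis using WB Wc W w by blast
qed

section \<open>Cuntz classes in the stabilization\<close>

text \<open>Simplicity and separability guarantee that the chosen \<open>faithful_rep\<close> is
  indeed a faithful representation.\<close>

context
  assumes simple: "simple_cstar TYPE('a::unital_cstar_algebra)" and sep: "separable_space (euclidean :: 'a topology)"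
begin

lemma faithful_rep: "star_hom_on UNIV (faithful_rep :: 'a => nat bop)" "inj (faithful_rep :: 'a => nat bop)"
  using someI_ex[OF faithful_representation_exists[OF simple sep]] unfolding faithful_rep_def by blast+

lemma stabilization_subalgebra: "cstar_subalgebra (stabilization TYPE('a))"
proof -
  note f = star_hom_onD[OF faithful_rep(1)]
  show ?thesis unfolding stabilization_def
  proof (rule min_tensor_subalgebra)
    show "S * S' \<in> range (faithful_rep :: 'a => nat bop)" if "S \<in> range (faithful_rep :: 'a => nat bop)" "S' \<in> range (faithful_rep :: 'a => nat bop)" for S S'
      using that by (auto simp flip: f(2))
    show "S\<star> \<in> range (faithful_rep :: 'a => nat bop)" if "S \<in> range (faithful_rep :: 'a => nat bop)" for S
      using that by (auto simp flip: f(4))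
    show "c *C S \<in> range (faithful_rep :: 'a => nat bop)" if "S \<in> range (faithful_rep :: 'a => nat bop)" for c S
      using that by (auto simp flip: f(3))
  qed (auto intro: compact_operators_mult_left compact_operators_star)
qed

lemma elementary_tensor_mem: "T \<in> compact_operators ==> tensor_bop (faithful_rep (a :: 'a)) T \<in> stabilization TYPE('a)"
  unfolding stabilization_def min_tensor_def
  by (rule subsetD[OF closure_subset]) (auto intro!: span_base)

lemma corner_mem: "corner (a :: 'a) \<in> stabilization TYPE('a)"
  unfolding corner_def by (rule elementary_tensor_mem[OF compact_operators_e11])

lemma corner_hom: "star_hom_on UNIV (corner :: 'a => _)"
  unfolding star_hom_on_def corner_def
  by (simp add: star_hom_onD[OF faithful_rep(1)] tensor_bop_add tensor_bop_mult tensor_bop_scale tensor_bop_star is_projD[OF e11_proj])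

lemma corner_inj: "inj (corner :: 'a => _)"
proof (rule injI)
  fix a b :: 'a
  assume "corner a = corner b"
  then have eq: "bop_apply (corner a) (tensor_ell2 x (ket 0)) = bop_apply (corner b) (tensor_ell2 x (ket 0))" for x by simp
  have "bop_apply e11 (ket 0) = ket 0" by (rule ell2_eqI) (simp add: bop_apply_e11 ket.rep_eq scale_ell2.rep_eq)
  then have "tensor_ell2 (bop_apply (faithful_rep a) x) (ket 0) = tensor_ell2 (bop_apply (faithful_rep b) x) (ket (0 :: nat))" for x
    using eq[of x] by (simp add: corner_def tensor_bop_apply)
  then have "ell2_nth (tensor_ell2 (bop_apply (faithful_rep a) x) (ket (0 :: nat))) (i, 0) = ell2_nth (tensor_ell2 (bop_apply (faithful_rep b) x) (ket (0 :: nat))) (i, 0)" for x i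
    by simp
  then have "ell2_nth (bop_apply (faithful_rep a) x) i = ell2_nth (bop_apply (faithful_rep b) x) i" for x i
    by (simp add: tensor_ell2_nth ket.rep_eq)
  then have "faithful_rep a = faithful_rep b" by (intro bop_eqI ell2_eqI)
  then show "a = b" using faithful_rep(2) by (simp add: inj_eq)
qed

lemma norm_corner: "norm (corner (a :: 'a)) = norm a"
  by (rule star_hom_isometric[OF corner_hom corner_inj])

text \<open>On elementary tensors, compression by \<open>e11\<close> leaves a scalar in the second
  factor, which moves into the first; the range of \<open>corner\<close> is closed because
  \<open>corner\<close> is isometric.\<close>

lemma corner_compress:
  assumes v: "v \<in> stabilization TYPE('a)"
  obtains z :: 'a where "tensor_bop 1 e11 * v * tensor_bop 1 e11 = corner z"
proof -
  note c = star_hom_onD[OF corner_hom]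
  have bl: "bounded_linear (corner :: 'a => _)"
    by (rule bounded_linear_intro[where K = 1]) (simp_all add: c norm_corner)
  have sub: "subspace (range (corner :: 'a => _))"
    using linear_subspace_image[OF bounded_linear.linear[OF bl] subspace_UNIV] .
  have cl: "closed (range (corner :: 'a => _))"
    unfolding closed_sequential_limits
  proof (intro allI impI)
    fix X l assume X: "(\<forall>n. X n \<in> range (corner :: 'a => _)) \<and> X \<longlonglongrightarrow> l"
    then have "\<forall>n. \<exists>z :: 'a. X n = corner z" by blast
    from choice[OF this] obtain z :: "nat => 'a" where z: "!!n. X n = corner (z n)" by blast
    have "dist (z i) (z j) = dist (X i) (X j)" for i j by (simp add: dist_norm z norm_corner flip: c(7))
    moreover have "Cauchy X" using X LIMSEQ_imp_Cauchy by blast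
    ultimately have "Cauchy z" by (simp add: Cauchy_def)
    then obtain z0 where "z \<longlonglongrightarrow> z0" using Cauchy_convergent convergent_def by blast
    from bounded_linear.tendsto[OF bl this] have "X \<longlonglongrightarrow> corner z0" by (simp flip: z)
    then show "l \<in> range (corner :: 'a => _)" using X LIMSEQ_unique by blast
  qed
  have f: "bounded_linear (%v. tensor_bop 1 e11 * v * tensor_bop 1 e11 :: (nat \<times> nat) bop)"
    by (rule bounded_linear_compose[OF bounded_linear_mult_left bounded_linear_mult_right])
  have "tensor_bop 1 e11 * v * tensor_bop 1 e11 \<in> range (corner :: 'a => _)"
  proof (rule closure_span_image[OF f sub cl _ v[unfolded stabilization_def min_tensor_def]])
    fix x assume "x \<in> {tensor_bop S T |S T. S \<in> range (faithful_rep :: 'a => nat bop) \<and> T \<in> (compact_operators :: nat bop set)}"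
    then obtain b :: 'a and T where x: "x = tensor_bop (faithful_rep b) T" by blast
    have "tensor_bop 1 e11 * x * tensor_bop 1 e11 = tensor_bop (faithful_rep b) (e11 * T * e11)"
      by (simp add: x tensor_bop_mult)
    also have "... = corner (ell2_nth (bop_apply T (ket 0)) 0 *C b)"
      unfolding e11_compress by (simp add: corner_def tensor_bop_scale star_hom_onD[OF faithful_rep(1)])
    finally show "tensor_bop 1 e11 * x * tensor_bop 1 e11 \<in> range (corner :: 'a => _)" by simp
  qed
  then show thesis using that by blast
qed

text \<open>A witness in the stabilization, compressed to the corner, is a witness from the algebra,
  and compression does not increase the error.\<close>

lemma corner_cuntz: "cuntz_subequiv (stabilization TYPE('a)) (corner a) (corner b) \<longleftrightarrow> a \<lessapprox> b" for a b :: 'a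
proof
  note c = star_hom_onD[OF corner_hom]
  let ?Q = "tensor_bop 1 e11 :: (nat \<times> nat) bop"
  have Q: "is_proj ?Q" by (simp add: is_proj_def tensor_bop_star tensor_bop_mult is_projD[OF e11_proj])
  have Qc: "?Q * corner x * ?Q = corner x" "?Q * corner x = corner x" "corner x * ?Q = corner x" for x :: 'a
    by (simp_all add: corner_def tensor_bop_mult is_projD[OF e11_proj])
  assume ab: "cuntz_subequiv (stabilization TYPE('a)) (corner a) (corner b)"
  show "a \<lessapprox> b"
  proof (rule cuntz_subequivI)
    fix e :: real assume "e > 0"
    then obtain v where v: "v \<in> stabilization TYPE('a)" "norm (v * corner b * v\<star> - corner a) < e"
      using cuntz_subequivD[OF ab] by blast
    obtain z :: 'a where z: "?Q * v * ?Q = corner z" by (rule corner_compress[OF v(1)])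
    have "corner (z * b * z\<star> - a) = (?Q * v * ?Q) * corner b * (?Q * v * ?Q)\<star> - corner a"
      by (simp add: z c)
    also have "(?Q * v * ?Q) * corner b * (?Q * v * ?Q)\<star> = ?Q * v * (?Q * corner b * ?Q) * v\<star> * ?Q"
      by (simp only: star_mult is_projD(1)[OF Q] mult.assoc)
    also have "?Q * v * (?Q * corner b * ?Q) * v\<star> * ?Q - corner a = ?Q * (v * corner b * v\<star> - corner a) * ?Q\<star>"
      unfolding Qc(1) by (simp add: is_projD(1)[OF Q] diff_distribs mult.assoc Qc)
    finally have "norm (z * b * z\<star> - a) = norm (?Q * (v * corner b * v\<star> - corner a) * ?Q\<star>)"
      by (simp flip: norm_corner)
    also have "... <= (norm ?Q)\<^sup>2 * norm (v * corner b * v\<star> - corner a)" by (rule norm_conj_le)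
    also have "... <= 1 * norm (v * corner b * v\<star> - corner a)"
      using is_proj_norm[OF Q] by (intro mult_right_mono) (auto simp: power_le_one)
    finally show "\<exists>z\<in>UNIV. norm (z * b * z\<star> - a) < e" using v(2) by (intro bexI[of _ z]) auto
  qed
next
  note c = star_hom_onD[OF corner_hom]
  assume ab: "a \<lessapprox> b"
  show "cuntz_subequiv (stabilization TYPE('a)) (corner a) (corner b)"
  proof (rule cuntz_subequivI)
    fix e :: real assume "e > 0"
    then obtain v where v: "norm (v * b * v\<star> - a) < e" using cuntz_subequivD[OF ab] by blast
    have "corner v * corner b * (corner v)\<star> - corner a = corner (v * b * v\<star> - a)" by (simp add: c)
    then show "\<exists>v\<in>stabilization TYPE('a). norm (v * corner b * v\<star> - corner a) < e"
      using v corner_mem[of v] norm_corner by (intro bexI[of _ "corner v"]) auto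
  qed
qed

section \<open>The order on classes and compactness\<close>

lemma cuntz_equiv_iff:
  "(x, y) \<in> cuntz_equiv (stabilization TYPE('a)) \<longleftrightarrow> x \<in> positive_elements (stabilization TYPE('a)) \<and>
    y \<in> positive_elements (stabilization TYPE('a)) \<and> cuntz_subequiv (stabilization TYPE('a)) x y \<and> cuntz_subequiv (stabilization TYPE('a)) y x"
  by (auto simp: cuntz_equiv_def)

lemma pos_stab: "x \<in> positive_elements (stabilization TYPE('a)) \<longleftrightarrow> x \<in> stabilization TYPE('a) \<and> cpos x"
  unfolding positive_elements_sub[OF stabilization_subalgebra] by simp

lemma equiv_cuntz_equiv: "equiv (positive_elements (stabilization TYPE('a))) (cuntz_equiv (stabilization TYPE('a)))"
proof (rule equivI)
  note B = stabilization_subalgebra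
  show "refl_on (positive_elements (stabilization TYPE('a))) (cuntz_equiv (stabilization TYPE('a)))"
    by (rule refl_onI) (use cuntz_subequiv_refl[OF B] in \<open>auto simp: cuntz_equiv_iff pos_stab\<close>)
  show "sym (cuntz_equiv (stabilization TYPE('a)))" by (rule symI) (auto simp: cuntz_equiv_iff)
  show "trans (cuntz_equiv (stabilization TYPE('a)))"
    by (rule transI) (use sub_trans[OF B] in \<open>unfold cuntz_equiv_iff, blast\<close>)
  show "cuntz_equiv (stabilization TYPE('a)) \<subseteq> positive_elements (stabilization TYPE('a)) \<times> positive_elements (stabilization TYPE('a))"
    by (auto simp: cuntz_equiv_def)
qed

lemma corner_pos: "cpos (a :: 'a) ==> corner a \<in> positive_elements (stabilization TYPE('a))"
  using star_hom_cpos[OF corner_hom] corner_mem by (simp add: pos_stab)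

lemma cu_class_eq_iff:
  fixes a b :: 'a
  assumes "cpos a" "cpos b"
  shows "cu_class a = cu_class b \<longleftrightarrow> a \<lessapprox> b \<and> b \<lessapprox> a"
proof -
  have "cu_class a = cu_class b \<longleftrightarrow> (corner a, corner b) \<in> cuntz_equiv (stabilization TYPE('a))"
    unfolding cu_class_def by (rule eq_equiv_class_iff[OF equiv_cuntz_equiv corner_pos[OF assms(1)] corner_pos[OF assms(2)]])
  then show ?thesis using corner_pos[OF assms(1)] corner_pos[OF assms(2)] by (simp add: cuntz_equiv_iff corner_cuntz)
qed

lemma cu_le_class:
  assumes "x \<in> positive_elements (stabilization TYPE('a))" "y \<in> positive_elements (stabilization TYPE('a))"
  shows "cu_le TYPE('a) (cuntz_equiv (stabilization TYPE('a)) `` {x}) (cuntz_equiv (stabilization TYPE('a)) `` {y})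
    \<longleftrightarrow> cuntz_subequiv (stabilization TYPE('a)) x y"
proof
  note tr = sub_trans[OF stabilization_subalgebra]
  assume "cu_le TYPE('a) (cuntz_equiv (stabilization TYPE('a)) `` {x}) (cuntz_equiv (stabilization TYPE('a)) `` {y})"
  then obtain u v where "(x, u) \<in> cuntz_equiv (stabilization TYPE('a))" "(y, v) \<in> cuntz_equiv (stabilization TYPE('a))"
    "cuntz_subequiv (stabilization TYPE('a)) u v" unfolding cu_le_def by blast
  then show "cuntz_subequiv (stabilization TYPE('a)) x y" unfolding cuntz_equiv_iff using tr by blast
next
  assume "cuntz_subequiv (stabilization TYPE('a)) x y"
  then show "cu_le TYPE('a) (cuntz_equiv (stabilization TYPE('a)) `` {x}) (cuntz_equiv (stabilization TYPE('a)) `` {y})"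
    unfolding cu_le_def using equiv_class_self[OF equiv_cuntz_equiv assms(1)] equiv_class_self[OF equiv_cuntz_equiv assms(2)] by blast
qed

text \<open>Isometries with orthogonal ranges, from an encoding of pairs of naturals by naturals,
  placed in the second tensor factor; there left multiplication preserves compactness. They supply
  the fresh coordinates of \<open>enlarge_to_class\<close>.\<close>

lemma shift_isometries:
  obtains S :: "nat => (nat \<times> nat) bop" where "!!i j. (S i)\<star> * S j = (if i = j then 1 else 0)"
    "!!n x. x \<in> stabilization TYPE('a) ==> S n * x \<in> stabilization TYPE('a)"
proof -
  have ck: "cinner (ket m) (ket n) = (if m = n then 1 else 0)" for m n :: nat
    by (simp add: cinner_ket ket.rep_eq)
  have "\<exists>T. \<forall>n. bop_apply T (ket n) = ket (prod_encode (i, n))" for i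
  proof (rule column_operator[of 1])
    fix F :: "nat set" and c :: "nat => complex" assume F: "finite F"
    let ?z = "\<Sum>n\<in>F. scale_ell2 (c n) (ket (prod_encode (i, n)))"
    have left: "cinner (\<Sum>n\<in>F. scale_ell2 (c n) (ket (prod_encode (i, n)))) y = (\<Sum>n\<in>F. cnj (c n) * ell2_nth y (prod_encode (i, n)))" for y
      using F
    proof (induction F rule: finite_induct)
      case empty
      show ?case using cinner_add_left[of 0 0 y] by simp
    qed (simp add: cinner_add_left cinner_scale_left cinner_ket)
    have "ell2_nth ?z (prod_encode (i, m)) = (if m \<in> F then c m else 0)" for m
    proof -
      have "ell2_nth ?z (prod_encode (i, m)) = cnj (cinner ?z (ket (prod_encode (i, m))))"
        by (metis cinner_commute cinner_ket)
      also have "... = (\<Sum>n\<in>F. if n = m then c m else 0)"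
        unfolding left cnj_sum by (intro sum.cong refl) (auto simp: ket.rep_eq)
      finally show ?thesis using F by simp
    qed
    then have "cinner ?z ?z = complex_of_real (\<Sum>n\<in>F. (cmod (c n))\<^sup>2)"
      unfolding left of_real_sum by (intro sum.cong refl) (simp add: complex_norm_square mult.commute del: of_real_power)
    then have "(norm ?z)\<^sup>2 = (\<Sum>n\<in>F. (cmod (c n))\<^sup>2)" unfolding cinner_self of_real_eq_iff .
    then show "(norm ?z)\<^sup>2 <= 1\<^sup>2 * (\<Sum>n\<in>F. (cmod (c n))\<^sup>2)" by simp
  qed simp
  then have "\<forall>i. \<exists>T. \<forall>n. bop_apply T (ket n) = ket (prod_encode (i, n))" by blast
  from choice[OF this] obtain s where s: "!!i n. bop_apply (s i) (ket n) = ket (prod_encode (i, n))" by blast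
  have ss: "(s i)\<star> * s j = (if i = j then 1 else 0)" for i j
  proof (rule bop_entry_eqI)
    fix m n
    have "cinner (ket m) (bop_apply ((s i)\<star> * s j) (ket n)) = cinner (bop_apply (s i) (ket m)) (bop_apply (s j) (ket n))"
      by (simp add: bop_apply_simps cinner_star)
    also have "... = (if i = j \<and> m = n then 1 else 0)" unfolding s ck by simp
    also have "... = cinner (ket m) (bop_apply (if i = j then 1 else 0) (ket n))"
      by (simp add: bop_apply_simps cinner_ket zero_ell2.rep_eq ket.rep_eq)
    finally show "cinner (ket m) (bop_apply ((s i)\<star> * s j) (ket n)) = cinner (ket m) (bop_apply (if i = j then 1 else 0) (ket n))" .
  qed
  have t0: "tensor_bop 1 0 = (0 :: (nat \<times> nat) bop)" using tensor_bop_scale(2)[of 1 0 0] by simp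
  show thesis
  proof (rule that[of "%i. tensor_bop 1 (s i)"])
    show "(tensor_bop 1 (s i))\<star> * tensor_bop 1 (s j) = (if i = j then 1 else 0 :: (nat \<times> nat) bop)" for i j
      by (simp add: tensor_bop_star tensor_bop_mult ss tensor_bop_one t0)
    fix n x assume x: "x \<in> stabilization TYPE('a)"
    show "tensor_bop 1 (s n) * x \<in> stabilization TYPE('a)"
    proof (rule closure_span_image[OF bounded_linear_mult_right _ _ _ x[unfolded stabilization_def min_tensor_def]])
      show "subspace (stabilization TYPE('a))" "closed (stabilization TYPE('a))"
        using cstar_subalgebraD[OF stabilization_subalgebra] by blast+
      fix y assume "y \<in> {tensor_bop S T |S T. S \<in> range (faithful_rep :: 'a => nat bop) \<and> T \<in> (compact_operators :: nat bop set)}"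
      then obtain b :: 'a and T where y: "y = tensor_bop (faithful_rep b) T" "T \<in> compact_operators" by blast
      have "tensor_bop 1 (s n) * y = tensor_bop (faithful_rep b) (s n * T)" by (simp add: y(1) tensor_bop_mult)
      then show "tensor_bop 1 (s n) * y \<in> stabilization TYPE('a)"
        using elementary_tensor_mem[OF compact_operators_mult_left[OF y(2)]] by simp
    qed
  qed
qed

text \<open>If the supremum of the sequence lies above \<open>q\<close>, so does every upper bound,
  in particular \<open>W\<close>. As \<open>W\<close> is a norm limit of elements \<open>w n\<close>
  below \<open>c n\<close>, a projection below \<open>W\<close> is already below one of the
  \<open>c n\<close>.\<close>

lemma projection_compact:
  fixes a q :: 'a
  assumes a: "cpos a" and q: "is_proj q" "q \<lessapprox> a" "a \<lessapprox> q"
  shows "cu_compact TYPE('a) (cu_class a)"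
  unfolding cu_compact_def cu_way_below_def
proof (intro allI impI)
  let ?B = "stabilization TYPE('a)"
  let ?cl = "%x. cuntz_equiv ?B `` {x}"
  note B = stabilization_subalgebra
  note tr = sub_trans[OF B]
  fix s U
  assume "(\<forall>i. s i \<in> Cu TYPE('a) \<and> cu_le TYPE('a) (s i) (s (Suc i))) \<and> cu_is_sup TYPE('a) s U \<and> cu_le TYPE('a) (cu_class a) U"
  then have s: "!!i. s i \<in> Cu TYPE('a)" "!!i. cu_le TYPE('a) (s i) (s (Suc i))" and U: "U \<in> Cu TYPE('a)" "cu_le TYPE('a) (cu_class a) U"
    and least: "!!W. W \<in> Cu TYPE('a) ==> (!!i. cu_le TYPE('a) (s i) W) ==> cu_le TYPE('a) U W"
    unfolding cu_is_sup_def by blast+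
  have "\<forall>i. \<exists>x. x \<in> positive_elements ?B \<and> s i = ?cl x" using s(1) unfolding Cu_def quotient_def by blast
  from choice[OF this] obtain c where c: "!!i. c i \<in> positive_elements ?B" "!!i. s i = ?cl (c i)" by blast
  obtain u where u: "u \<in> positive_elements ?B" "U = ?cl u" using U(1) unfolding Cu_def quotient_def by blast
  have cc: "cuntz_subequiv ?B (c i) (c (Suc i))" for i using s(2)[of i] unfolding c(2) cu_le_class[OF c(1) c(1)] .
  have cq: "cu_class a = ?cl (corner q)"
    using cu_class_eq_iff[OF a is_proj_cpos[OF q(1)]] q(2,3) by (simp add: cu_class_def)
  have qp: "corner q \<in> positive_elements ?B" by (rule corner_pos[OF is_proj_cpos[OF q(1)]])
  have qu: "cuntz_subequiv ?B (corner q) u" using U(2) unfolding cq u(2) cu_le_class[OF qp u(1)] .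
  obtain S :: "nat => (nat \<times> nat) bop" where S: "!!i j. (S i)\<star> * S j = (if i = j then 1 else 0)" "!!n x. x \<in> ?B ==> S n * x \<in> ?B"
    using shift_isometries by metis
  have cB: "c n \<in> ?B" "cpos (c n)" for n using c(1)[of n] by (simp_all add: pos_stab)
  obtain W w where W: "W \<in> ?B" "cpos W" "!!n. cuntz_subequiv ?B (c n) W" "w \<longlonglongrightarrow> W"
    and w: "!!n. w n \<in> ?B" "!!n. cpos (w n)" "!!n. cuntz_subequiv ?B (w n) (c n)"
    using increasing_sequence_bound[where B = ?B and S = S and c = c, OF B S cB cc] by blast
  have Wp: "W \<in> positive_elements ?B" using W(1,2) by (simp add: pos_stab)
  have "cu_le TYPE('a) U (?cl W)"
  proof (rule least)
    show "?cl W \<in> Cu TYPE('a)" unfolding Cu_def by (rule quotientI[OF Wp])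
    show "cu_le TYPE('a) (s i) (?cl W)" for i unfolding c(2) cu_le_class[OF c(1) Wp] by (rule W(3))
  qed
  then have "cuntz_subequiv ?B u W" unfolding u(2) cu_le_class[OF u(1) Wp] .
  then have qW: "cuntz_subequiv ?B (corner q) W" by (rule tr[OF qu])
  note ch = star_hom_onD[OF corner_hom]
  have "is_proj (corner q)" using is_projD[OF q(1)] by (simp add: is_proj_def flip: ch)
  then obtain n where "cuntz_subequiv ?B (corner q) (w n)" by (rule projection_below_limit[OF B _ corner_mem qW w(1,2) W(4)])
  then have "cuntz_subequiv ?B (corner q) (c n)" using tr[OF _ w(3)] by blast
  then show "\<exists>i. cu_le TYPE('a) (cu_class a) (s i)" unfolding cq c(2) cu_le_class[OF qp c(1)] by blast
qed

lemma cuntz_class_set_eq: "cpos a ==> cuntz_class_set a = {b. cuntz_eq a b}" for a :: 'a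
  unfolding cuntz_class_set_def cuntz_eq_def using cu_class_eq_iff by blast

end

theorem corollary1p3:
  fixes a :: "'a::unital_cstar_algebra"
  assumes "simple_cstar TYPE('a)"
    and "separable_space (euclidean :: 'a topology)"
    and "exact_cstar TYPE('a)"
    and "approximately_divisible TYPE('a)"
    and "real_rank_zero TYPE('a)"
    and "a \<in> positive_elements UNIV"
    and "stably_finite TYPE('a) \<longrightarrow> \<not> cu_compact TYPE('a) (cu_class a)"
    and "purely_infinite TYPE('a) \<longrightarrow> cu_class a \<noteq> cu_class (0 :: 'a)"
  shows "\<forall>k\<ge>1. \<forall>x\<in>cuntz_class_set a.
    trivial_group (homotopy_group k (top_of_set (cuntz_class_set a)) x)"
proof (intro allI impI ballI)
  fix k x
  assume k: "(1 :: nat) \<le> k" and x: "x \<in> cuntz_class_set a"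
  note simple = assms(1) and sep = assms(2) and ad = assms(4) and rr0 = assms(5) and a = assms(6)
  note D = cuntz_class_set_eq[OF simple sep a]
  \<comment> \<open>Noncompactness enters in this form: no projection below \<open>a\<close> is
    equivalent to \<open>a\<close>.\<close>
  have nc: "\<not> a \<lessapprox> q" if "stably_finite TYPE('a)" "is_proj q" "q \<lessapprox> a" for q
    using projection_compact[OF simple sep a that(2,3)] assms(7) that(1) by blast
  obtain m where m: "colored_pou (cube k) (cube_boundary k) m" by (rule colored_pou_cube[OF k])
  have ne: "cube k \<noteq> {}" and bd: "cube_boundary k \<subseteq> cube k" by (auto simp: cube_def cube_boundary_def)
  show "trivial_group (homotopy_group k (top_of_set (cuntz_class_set a)) x)"
  proof (rule trivial_homotopy_group[OF x])
    fix f assume "f \<in> cube_loops k (top_of_set (cuntz_class_set a)) x"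
    then have f: "continuous_on (cube k) f" "\<And>s. s \<in> cube k \<Longrightarrow> f s \<in> cuntz_class_set a" "\<And>s. s \<in> cube_boundary k \<Longrightarrow> f s = x"
      by (auto simp: cube_loops_def unit_cube_eq based_cube_map_iff)
    have "class_family a 0 (cube k) (cube_boundary k) f"
      unfolding class_family_def using f D by (simp add: cuntz_eq_def)
    then obtain W where "class_homotopic a 0 (cube k) (cube_boundary k) f (\<lambda>_. W)"
      using class_null_homotopic[OF simple ad rr0 a nc compact_cube ne bd m] by blast
    then obtain H where H: "continuous_on ({0..1 :: real} \<times> cube k) (\<lambda>(t, s). H t s)"
      "\<And>t. t \<in> {0..1} \<Longrightarrow> class_family a 0 (cube k) (cube_boundary k) (H t)" "\<And>s. s \<in> cube k \<Longrightarrow> H 0 s = f s \<and> H 1 s = W"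
      unfolding class_homotopic_def by blast
    show "homotopic_with (based_cube_map k x) (unit_cube k) (top_of_set (cuntz_class_set a)) f (\<lambda>_. x)"
    proof (rule null_homotopic_based[OF k f(3) H(1)])
      show "H t s \<in> cuntz_class_set a" if "t \<in> {0..1}" "s \<in> cube k" for t s
        using class_familyD(6)[OF H(2)[OF that(1)] that(2)] unfolding D by simp
      show "H t s = H t s'" if "t \<in> {0..1}" "s \<in> cube_boundary k" "s' \<in> cube_boundary k" for t s s'
        by (rule class_familyD(2)[OF H(2)[OF that(1)] that(2,3)])
    qed (use H(3) in auto)
  qed
qed

end
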